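(* Let $\alpha,\beta$ be complex numbers with $\mathrm{Re}(\sqrt\alpha)\ge\mathrm{Re}(\sqrt\beta)>0$. Then $$\sum_{n=1}^{\infty}r_2(n)\,I_{0}\big(\pi(\sqrt{n\alpha}-\sqrt{n\beta})\big)K_{0}\big(\pi(\sqrt{n\alpha}+\sqrt{n\beta})\big)$$ $$=\frac{1}{2\pi\sqrt{\alpha\beta}}+\gamma+\log\left(\frac{\sqrt{\alpha}+\sqrt{\beta}}{2}\right)+\frac{1}{2}\log\left(\frac{\pi}{2}\right)-\mathfrak{B}'(0)+\frac{1}{2\pi}\sum_{n=1}^{\infty}r_2(n)\left(\frac{1}{(n+\alpha)^{1/2}(n+\beta)^{1/2}}-\frac{1}{n}\right).$$
   Context: $r_2(n)$ is the number of representations of $n$ as a sum of two squares of integers (different signs and orders counted as distinct). $I_0$ and $K_0$ are the modified Bessel functions of the first and second kind of order $0$. $\gamma$ is Euler's constant. $\mathfrak{B}(s)=\sum_{n\ge0}\frac{(-1)^n}{(2n+1)^s}$ for $\mathrm{Re}(s)>0$ is the Dirichlet beta function, continued analytically to $\mathbb{C}$. Square roots, powers and logarithms are principal values, and $\sqrt{\alpha\beta}$ means $\sqrt\alpha\,\sqrt\beta$. *)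

theory Defs
  imports "HOL-Analysis.Analysis"
begin

definition r2 :: "nat \<Rightarrow> nat" where
  "r2 n = card {(a::int, b::int). a\<^sup>2 + b\<^sup>2 = int n}"

(* The case split is needed because 0 powr 0 = 0, whereas I_0(0) = 1. The function rGamma is the
   entire function 1/Gamma, so the series also covers negative integer orders. *)
definition bessel_I :: "complex \<Rightarrow> complex \<Rightarrow> complex" where
  "bessel_I \<nu> z = (if \<nu> = 0 then 1 else (z / 2) powr \<nu>) *
     (\<Sum>k. (z / 2) ^ (2 * k) * rGamma (\<nu> + of_nat k + 1) / fact k)"

(* For integer orders the quotient is 0/0 and K is its limit in the order; only the value for
   z \<noteq> 0 is meaningful. *)
definition bessel_K :: "complex \<Rightarrow> complex \<Rightarrow> complex" where
  "bessel_K \<nu> z =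
     (let q = (\<lambda>\<mu>. of_real (pi / 2) * (bessel_I (- \<mu>) z - bessel_I \<mu> z) / sin (\<mu> * of_real pi))
      in if \<nu> \<in> \<int> then Lim (at \<nu>) q else q \<nu>)"

(* The analytic continuation: the unique entire function given by the (conditionally convergent)
   Dirichlet series on the half-plane Re s > 0. *)
definition dirichlet_beta :: "complex \<Rightarrow> complex" where
  "dirichlet_beta = (THE f. f holomorphic_on UNIV \<and>
     (\<forall>s. Re s > 0 \<longrightarrow> (\<lambda>n::nat. (-1) ^ n / of_nat (2 * n + 1) powr s) sums f s))"

end

theory Submission
  imports Defs "HOL-Probability.Probability" "HOL-Complex_Analysis.Complex_Analysis"
begin

text \<open>Write a = sqrt \<alpha>, b = sqrt \<beta>. The identity is an average over a circle of the identity with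
\<alpha> = \<beta> = w > 0, namely

  sum r2(n) K0(2 pi sqrt(n w)) = 1/(2 pi w) + (ln w)/2 + C + 1/(2 pi) sum r2(n) (1/(n+w) - 1/n),

continued analytically from positive real a, b to the right half-plane.

The one-parameter identity. Since K0(2 sqrt(A B)) is half of the integral of exp(-A e^x - B e^(-x))
over the real line, the left side is half of the integral of
(\<theta>(e^x)^2 - 1) exp(-pi w e^(-x)), where \<theta>(u)^2 = sum r2(n) exp(-pi n u) is the square of the
Jacobi theta series. The transformation \<theta>(1/u)^2 = u \<theta>(u)^2 (theta3_modular) splits this integral
into 1/(2 pi w), the sum over 1/(n+w) - 1/n, and a remaining integral that depends on w only through
a Frullani integral equal to ln w; this leaves an unknown constant C
(r2_K0_sum_eq_up_to_constant).

The constant. Jacobi's theorem on two squares, in the form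
\<theta>(u)^2 = sum over all integers m of 1 / cosh(pi u m) (theta3_squared_eq_sech_sum), turns the left side
into the integral of (1 / cosh(pi e^x)) / (exp(pi w e^(-x)) - 1). As w tends to 0 this is evaluated
by separating the first terms of 1/(e^y - 1) at y = 0: the integral of the remainder is
-ln(2 pi)/2 (integral_bernoulli_kernel, a form of the Wallis product), one term is again a value of K0
near 0, where K0(x) = -ln(x/2) - \<gamma> + o(1), and the last term produces the derivative at 0 of the
Dirichlet beta function B, which is half of the integral of 1 / cosh(e^x) - exp(-e^x)
(deriv_dirichlet_beta_0). Hence C = \<gamma> + ln(pi/2)/2 - B'(0) (r2_K0_sum_formula).

The average. For positive a, b let w(t) be the squared modulus of
(a+b)/2 - ((a-b)/2) e^(2 pi i t). Over a period, the mean of K0(2 pi sqrt(n w(t))) is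
I0(pi sqrt n (a-b)) K0(pi sqrt n (a+b)), which is the constant term of the addition theorem for K0
(bessel_I_0_mult_K0); the means of 1/w(t) and ln w(t) are 1/(a b) and 2 ln((a+b)/2); and since n + w(t)
is again such a squared modulus, with sqrt(n+a^2) and sqrt(n+b^2) in the places of a and b, the mean
of 1/(n+w(t)) is 1/(sqrt(n+a^2) sqrt(n+b^2)). This gives the theorem for positive a, b
(r2_I0_K0_sum_real).

The continuation. Both sides are holomorphic in a, and by symmetry in b, on the right half-plane,
because the two series converge locally uniformly there: the terms of the first are
O(r2(n) exp(-2 pi \<delta> sqrt n)) when Re a, Re b \<ge> \<delta>, those of the second are O(r2(n) / n^2).
It remains to know that K0, used here through its integral, agrees with the limit in the order
by which K is defined at integer orders (bessel_K_0_eq_K0).\<close>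

section \<open>Integrals over the real line\<close>

text \<open>Dominated convergence for the difference quotients. A bound on the derivative that is uniform in
the parameter controls the quotients by the mean value inequality on a convex neighbourhood.\<close>

lemma has_field_derivative_integral:
  fixes \<phi> \<phi>' :: "complex \<Rightarrow> 'a \<Rightarrow> complex"
  assumes S: "open S" "convex S" "z0 \<in> S"
    and int: "\<And>z. z \<in> S \<Longrightarrow> integrable M (\<phi> z)"
    and der: "\<And>z x. z \<in> S \<Longrightarrow> ((\<lambda>z. \<phi> z x) has_field_derivative \<phi>' z x) (at z)"
    and meas: "\<phi>' z0 \<in> borel_measurable M"
    and G: "integrable M G"
    and bound: "\<And>z x. z \<in> S \<Longrightarrow> norm (\<phi>' z x) \<le> G x"
  shows "((\<lambda>z. integral\<^sup>L M (\<phi> z)) has_field_derivative integral\<^sup>L M (\<phi>' z0)) (at z0)"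
proof -
  have "((\<lambda>z. (integral\<^sup>L M (\<phi> z) - integral\<^sup>L M (\<phi> z0)) / (z - z0)) \<longlongrightarrow> integral\<^sup>L M (\<phi>' z0)) (at z0 within S)"
    unfolding tendsto_at_iff_sequentially
  proof (intro allI impI)
    fix X assume X: "\<forall>i. X i \<in> S - {z0}" "X \<longlonglongrightarrow> z0"
    have "(\<lambda>i. integral\<^sup>L M (\<lambda>x. (\<phi> (X i) x - \<phi> z0 x) / (X i - z0))) \<longlonglongrightarrow> integral\<^sup>L M (\<phi>' z0)"
    proof (rule integral_dominated_convergence[where w = G])
      show "\<phi>' z0 \<in> borel_measurable M" "integrable M G" by fact+
      show "(\<lambda>x. (\<phi> (X i) x - \<phi> z0 x) / (X i - z0)) \<in> borel_measurable M" for i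
        using int[of "X i"] int[of z0] X S by (auto dest!: borel_measurable_integrable)
      show "AE x in M. (\<lambda>i. (\<phi> (X i) x - \<phi> z0 x) / (X i - z0)) \<longlonglongrightarrow> \<phi>' z0 x"
      proof (rule AE_I2)
        fix x
        have "((\<lambda>z. (\<phi> z x - \<phi> z0 x) / (z - z0)) \<longlongrightarrow> \<phi>' z0 x) (at z0 within S)"
          using der[OF S(3), of x] by (auto simp: has_field_derivative_iff intro: tendsto_within_subset)
        then show "(\<lambda>i. (\<phi> (X i) x - \<phi> z0 x) / (X i - z0)) \<longlonglongrightarrow> \<phi>' z0 x"
          using X unfolding tendsto_at_iff_sequentially by (auto simp: o_def)
      qed
      show "AE x in M. norm ((\<phi> (X i) x - \<phi> z0 x) / (X i - z0)) \<le> G x" for i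
      proof (rule AE_I2)
        fix x
        have "norm (\<phi> (X i) x - \<phi> z0 x) \<le> G x * norm (X i - z0)"
        proof (rule field_differentiable_bound[where f' = "\<lambda>z. \<phi>' z x"])
          show "((\<lambda>z. \<phi> z x) has_field_derivative \<phi>' z x) (at z within S)" if "z \<in> S" for z
            using der[OF that] has_field_derivative_at_within by blast
        qed (use S X bound in auto)
        then show "norm ((\<phi> (X i) x - \<phi> z0 x) / (X i - z0)) \<le> G x"
          using X by (auto simp: norm_divide divide_le_eq)
      qed
    qed
    moreover have "(\<lambda>i. integral\<^sup>L M (\<lambda>x. (\<phi> (X i) x - \<phi> z0 x) / (X i - z0)))
        = (\<lambda>z. (integral\<^sup>L M (\<phi> z) - integral\<^sup>L M (\<phi> z0)) / (z - z0)) \<circ> X"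
    proof
      fix i
      have d: "integral\<^sup>L M (\<lambda>x. \<phi> (X i) x - \<phi> z0 x) = integral\<^sup>L M (\<phi> (X i)) - integral\<^sup>L M (\<phi> z0)"
        by (rule Bochner_Integration.integral_diff[OF int int]) (use X S in auto)
      have e: "integral\<^sup>L M (\<lambda>x. (\<phi> (X i) x - \<phi> z0 x) / (X i - z0))
          = integral\<^sup>L M (\<lambda>x. \<phi> (X i) x - \<phi> z0 x) / (X i - z0)"
        by (rule integral_divide_zero)
      show "integral\<^sup>L M (\<lambda>x. (\<phi> (X i) x - \<phi> z0 x) / (X i - z0))
          = ((\<lambda>z. (integral\<^sup>L M (\<phi> z) - integral\<^sup>L M (\<phi> z0)) / (z - z0)) \<circ> X) i"
        unfolding e unfolding d unfolding o_apply by (rule refl)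
    qed
    ultimately show "((\<lambda>z. (integral\<^sup>L M (\<phi> z) - integral\<^sup>L M (\<phi> z0)) / (z - z0)) \<circ> X) \<longlonglongrightarrow> integral\<^sup>L M (\<phi>' z0)"
      by (simp only:)
  qed
  then have "((\<lambda>z. integral\<^sup>L M (\<phi> z)) has_field_derivative integral\<^sup>L M (\<phi>' z0)) (at z0 within S)"
    unfolding has_field_derivative_iff .
  then show ?thesis
    unfolding at_within_open[OF S(3,1)] .
qed

lemma integral_FTC_UNIV:
  fixes F f :: "real \<Rightarrow> 'a::euclidean_space"
  assumes "\<And>x. (F has_vector_derivative f x) (at x)" "\<And>x. isCont f x" "integrable lborel f"
    and "(F \<longlongrightarrow> A) at_bot" "(F \<longlongrightarrow> B) at_top"
  shows "integral\<^sup>L lborel f = B - A"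
proof -
  have "(LBINT x=-\<infinity>..\<infinity>. f x) = B - A"
    by (rule interval_integral_FTC_integrable[where F = F])
      (use assms in \<open>auto simp: ereal_tendsto_simps set_integrable_def\<close>)
  then show ?thesis by (simp add: interval_lebesgue_integral_def set_lebesgue_integral_def)
qed

lemma integrable_exp_minus_abs:
  assumes "d > 0"
  shows "integrable lborel (\<lambda>x::real. exp (- d * \<bar>x\<bar>))"
proof -
  have half: "integrable lborel (\<lambda>x::real. indicator {0..} x * exp (- d * x))"
  proof (rule integrableI_nn_integral_finite[where x = "1 / d"])
    have lim: "((\<lambda>x. - exp (- d * x) / d) \<longlongrightarrow> 0) at_top" using assms by real_asymp
    have "(\<integral>\<^sup>+x. ennreal (exp (- d * x)) * indicator {0..} x \<partial>lborel) = 0 - (- exp (- d * 0) / d)"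
      by (rule nn_integral_FTC_atLeast[OF _ _ _ lim]) (use assms in \<open>auto intro!: derivative_eq_intros\<close>)
    moreover have "ennreal (indicator {0..} x * exp (- d * x)) = ennreal (exp (- d * x)) * indicator {0..} x" for x :: real
      by (auto simp: indicator_def)
    ultimately show "(\<integral>\<^sup>+x. ennreal (indicator {0..} x * exp (- d * x)) \<partial>lborel) = ennreal (1 / d)" by simp
  qed auto
  have "integrable lborel (\<lambda>x::real. indicator {0..} x * exp (- d * x) + indicator {0..} (- x) * exp (- d * (- x)))"
    using lborel_integrable_real_affine[OF half, of "-1" 0] half by (intro Bochner_Integration.integrable_add) auto
  then show ?thesis
    by (rule Bochner_Integration.integrable_bound) (auto simp: indicator_def)
qed

lemma integrable_exp_decay:
  fixes f :: "real \<Rightarrow> 'a::{banach,second_countable_topology}"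
  assumes "f \<in> borel_measurable borel" "d > 0" "\<And>x. norm (f x) \<le> C * exp (- d * \<bar>x\<bar>)"
  shows "integrable lborel f"
proof (rule Bochner_Integration.integrable_bound)
  show "integrable lborel (\<lambda>x. C * exp (- d * \<bar>x\<bar>))"
    using integrable_exp_minus_abs[OF assms(2)] by simp
  show "AE x in lborel. norm (f x) \<le> norm (C * exp (- d * \<bar>x\<bar>))"
    using assms(3) by (intro AE_I2) (metis abs_ge_self order_trans real_norm_def)
qed (use assms in simp)

text \<open>Two-sided series are treated as sequences along an enumeration of the integers, which absolute
convergence permits.\<close>

lemma has_sum_integral_int:
  fixes f :: "int \<Rightarrow> 'a \<Rightarrow> real"
  assumes int: "\<And>i. integrable M (f i)"
    and sm: "(\<lambda>i. \<integral>x. \<bar>f i x\<bar> \<partial>M) summable_on UNIV"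
    and g: "\<And>x. ((\<lambda>i. f i x) has_sum g x) UNIV"
  shows "integrable M g" "((\<lambda>i. integral\<^sup>L M (f i)) has_sum integral\<^sup>L M g) UNIV"
proof -
  let ?e = int_decode
  have sm': "summable (\<lambda>n. \<integral>x. \<bar>f (?e n) x\<bar> \<partial>M)"
    using summable_on_reindex_bij_betw[OF bij_int_decode, of "\<lambda>i. \<integral>x. \<bar>f i x\<bar> \<partial>M"] sm
    by (auto intro: summable_on_imp_summable)
  have pt: "summable (\<lambda>n. \<bar>f (?e n) x\<bar>)" for x
  proof -
    have "(\<lambda>i. \<bar>f i x\<bar>) summable_on UNIV"
      using has_sum_imp_summable[OF g[of x]] summable_on_iff_abs_summable_on_real[of "\<lambda>i. f i x" UNIV] by simp
    then show ?thesis
      using summable_on_reindex_bij_betw[OF bij_int_decode, of "\<lambda>i. \<bar>f i x\<bar>"]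
      by (auto intro: summable_on_imp_summable)
  qed
  have g_eq: "g = (\<lambda>x. \<Sum>n. f (?e n) x)"
  proof
    fix x
    have "((\<lambda>n. f (?e n) x) has_sum g x) UNIV"
      using has_sum_reindex_bij_betw[OF bij_int_decode, of "\<lambda>i. f i x"] g by auto
    then show "g x = (\<Sum>n. f (?e n) x)"
      using has_sum_imp_sums sums_unique by blast
  qed
  show "integrable M g" unfolding g_eq
    by (rule integrable_suminf) (use int pt sm' in auto)
  have "(\<lambda>n. integral\<^sup>L M (f (?e n))) sums integral\<^sup>L M g" unfolding g_eq
    by (rule sums_integral) (use int pt sm' in auto)
  moreover have "summable (\<lambda>n. norm (integral\<^sup>L M (f (?e n))))"
    by (rule summable_comparison_test[OF _ sm']) (auto intro!: exI[of _ 0] integral_abs_bound)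
  ultimately have "((\<lambda>n. integral\<^sup>L M (f (?e n))) has_sum integral\<^sup>L M g) UNIV"
    by (intro norm_summable_imp_has_sum) auto
  then show "((\<lambda>i. integral\<^sup>L M (f i)) has_sum integral\<^sup>L M g) UNIV"
    using has_sum_reindex_bij_betw[OF bij_int_decode, of "\<lambda>i. integral\<^sup>L M (f i)"] by auto
qed

lemma lborel_integrable_of_lebesgue:
  fixes f :: "real \<Rightarrow> 'a::euclidean_space"
  assumes "f absolutely_integrable_on UNIV" "f \<in> borel_measurable borel"
  shows "integrable lborel f" "integral\<^sup>L lborel f = integral UNIV f"
proof -
  show *: "integrable lborel f"
    using assms by (simp add: set_integrable_def integrable_completion)
  show "integral\<^sup>L lborel f = integral UNIV f"
    using has_integral_integral_lborel[OF *] by (simp add: integral_unique)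
qed

text \<open>Euler's integral after the substitution of e^x for the variable. All Mellin-type integrals below are taken in
this form, with respect to Lebesgue measure on the whole line, so that scaling of the argument becomes a
translation and inversion becomes a reflection.\<close>

lemma Gamma_integral_exp:
  fixes s :: complex
  assumes "Re s > 0"
  shows "integrable lborel (\<lambda>x. exp (s * of_real x - of_real (exp x)))"
    and "integral\<^sup>L lborel (\<lambda>x. exp (s * of_real x - of_real (exp x))) = Gamma s"
proof -
  let ?f = "\<lambda>t. complex_of_real t powr (s - 1) / of_real (exp t)"
  have img: "exp ` (UNIV :: real set) = {0<..}" by (auto simp: image_iff intro: exI[of _ "ln x" for x])
      (metis exp_ln)
  have eq: "\<bar>exp x\<bar> *\<^sub>R ?f (exp x) = exp (s * of_real x - of_real (exp x))" for x :: real
  proof -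
    have "complex_of_real (exp x) powr (s - 1) = exp ((s - 1) * of_real x)"
      by (simp add: powr_def Ln_of_real exp_of_real[symmetric] del: of_real_exp)
    then show ?thesis
      by (simp add: scaleR_conv_of_real exp_diff exp_of_real[symmetric] ring_distribs left_diff_distrib)
  qed
  have "(\<lambda>x. \<bar>exp x\<bar> *\<^sub>R ?f (exp x)) absolutely_integrable_on UNIV \<and> integral UNIV (\<lambda>x. \<bar>exp x\<bar> *\<^sub>R ?f (exp x)) = Gamma s
          \<longleftrightarrow> ?f absolutely_integrable_on exp ` UNIV \<and> integral (exp ` UNIV) ?f = Gamma s"
    by (rule has_absolute_integral_change_of_variables_real) (auto intro!: derivative_eq_intros simp: inj_on_def)
  then have *: "(\<lambda>x. exp (s * of_real x - of_real (exp x))) absolutely_integrable_on (UNIV :: real set)"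
       "integral UNIV (\<lambda>x::real. exp (s * of_real x - of_real (exp x))) = Gamma s"
    using absolutely_integrable_Gamma_integral'[OF assms] Gamma_integral_complex'[OF assms]
    unfolding img eq by (auto simp: integral_unique)
  have meas: "(\<lambda>x::real. exp (s * of_real x - of_real (exp x))) \<in> borel_measurable borel"
    by (intro borel_measurable_continuous_onI continuous_intros)
  show "integrable lborel (\<lambda>x. exp (s * of_real x - of_real (exp x)))"
    using lborel_integrable_of_lebesgue(1)[OF *(1) meas] .
  show "integral\<^sup>L lborel (\<lambda>x. exp (s * of_real x - of_real (exp x))) = Gamma s"
    using lborel_integrable_of_lebesgue(2)[OF *(1) meas] *(2) by simp
qed

section \<open>Theta series and sums of hyperbolic secants\<close>

lemma summable_on_abs_iff:
  fixes f :: "'a \<Rightarrow> real"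
  shows "(\<lambda>n. \<bar>f n\<bar>) summable_on A \<longleftrightarrow> f summable_on A"
  using summable_on_iff_abs_summable_on_real[of f A] by simp

lemma summable_on_int_if_nat:
  fixes f :: "int \<Rightarrow> real"
  assumes "summable (\<lambda>n. \<bar>f (int n)\<bar>)" "summable (\<lambda>n. \<bar>f (- int n)\<bar>)"
  shows "f summable_on UNIV"
proof -
  have "f summable_on range int"
    using norm_summable_imp_summable_on[of "\<lambda>n. f (int n)"] assms(1)
    by (subst summable_on_reindex) (auto simp: o_def)
  moreover have "f summable_on range (\<lambda>n. - int n)"
    using norm_summable_imp_summable_on[of "\<lambda>n. f (- int n)"] assms(2)
    by (subst summable_on_reindex) (auto simp: o_def inj_on_def)
  ultimately have "f summable_on (range int \<union> range (\<lambda>n. - int n))"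
    by (rule summable_on_union)
  also have "range int \<union> range (\<lambda>n. - int n) = UNIV"
  proof -
    have "n \<in> range int \<union> range (\<lambda>n. - int n)" for n
      by (cases n rule: int_cases2) auto
    then show ?thesis by blast
  qed
  finally show ?thesis .
qed

lemma summable_on_exp_minus_abs:
  assumes "a > 0"
  shows "(\<lambda>n::int. exp (- a * \<bar>real_of_int n\<bar>)) summable_on UNIV"
proof -
  have "exp (- (a * real n)) = exp (- a) ^ n" for n
    by (metis exp_of_nat_mult mult.commute mult_minus_left)
  moreover have "summable (\<lambda>n. exp (- a) ^ n)"
    using assms by (intro summable_geometric) auto
  ultimately show ?thesis
    by (intro summable_on_int_if_nat) (auto simp: )
qed

lemma summable_on_int_comparison_exp:
  fixes f :: "int \<Rightarrow> real"
  assumes "a > 0" "\<And>n. \<bar>f n\<bar> \<le> C * exp (- a * \<bar>real_of_int n\<bar>)"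
  shows "f summable_on UNIV"
proof -
  have "(\<lambda>n. \<bar>f n\<bar>) summable_on UNIV"
    by (rule summable_on_comparison_test[OF summable_on_cmult_right[OF summable_on_exp_minus_abs[OF assms(1)]]])
       (use assms(2) in auto)
  then show ?thesis by (simp only: summable_on_abs_iff)
qed

lemma summable_on_gaussian:
  assumes "c > 0"
  shows "(\<lambda>n::int. exp (- c * (real_of_int n)\<^sup>2 + d * real_of_int n)) summable_on UNIV"
proof (rule summable_on_int_comparison_exp)
  show "\<bar>exp (- c * (real_of_int n)\<^sup>2 + d * real_of_int n)\<bar>
      \<le> exp ((\<bar>d\<bar> + 1)\<^sup>2 / (4 * c)) * exp (- 1 * \<bar>real_of_int n\<bar>)" for n
  proof -
    define x where "x = \<bar>real_of_int n\<bar>"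
    have "(2 * c * x - (\<bar>d\<bar> + 1))\<^sup>2 \<ge> 0" by simp
    then have "4 * c * ((\<bar>d\<bar> + 1) * x - c * x\<^sup>2) \<le> (\<bar>d\<bar> + 1)\<^sup>2"
      by (simp add: power2_eq_square algebra_simps)
    then have "(\<bar>d\<bar> + 1) * x - c * x\<^sup>2 \<le> (\<bar>d\<bar> + 1)\<^sup>2 / (4 * c)"
      using assms by (simp add: field_simps)
    moreover have "d * real_of_int n \<le> \<bar>d\<bar> * x"
      unfolding x_def by (metis abs_ge_self abs_mult)
    moreover have "x\<^sup>2 = (real_of_int n)\<^sup>2" by (simp add: x_def)
    ultimately have "- c * (real_of_int n)\<^sup>2 + d * real_of_int n \<le> (\<bar>d\<bar> + 1)\<^sup>2 / (4 * c) - x"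
      by (simp add: algebra_simps)
    then show ?thesis by (simp add: exp_add[symmetric] x_def[symmetric])
  qed
qed simp

lemma sech_le: "1 / cosh x \<le> 2 * exp (- \<bar>x\<bar>)" for x :: real
proof -
  have "exp \<bar>x\<bar> \<le> 2 * cosh \<bar>x\<bar>" by (simp add: cosh_def)
  then have "exp \<bar>x\<bar> \<le> 2 * cosh x" by (simp add: cosh_real_abs)
  then show ?thesis by (simp add: field_simps exp_minus)
qed

definition alt_sign :: "int \<Rightarrow> real" where
  "alt_sign n = (if even n then 1 else -1)"

definition theta3 :: "real \<Rightarrow> real" where
  "theta3 c = (\<Sum>\<^sub>\<infinity>n::int. exp (- c * (real_of_int n)\<^sup>2))"

definition theta4 :: "real \<Rightarrow> real" where
  "theta4 c = (\<Sum>\<^sub>\<infinity>n::int. alt_sign n * exp (- c * (real_of_int n)\<^sup>2))"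

definition sech_sum :: "real \<Rightarrow> real" where
  "sech_sum c = (\<Sum>\<^sub>\<infinity>n::int. 1 / cosh (c * real_of_int n))"

definition alt_sech_sum :: "real \<Rightarrow> real" where
  "alt_sech_sum c = (\<Sum>\<^sub>\<infinity>n::int. alt_sign n / cosh (c * real_of_int n))"

lemma abs_alt_sign [simp]: "\<bar>alt_sign n\<bar> = 1"
  by (simp add: alt_sign_def)

lemma alt_sign_mult_self [simp]: "alt_sign n * alt_sign n = 1"
  by (simp add: alt_sign_def)

lemma alt_sign_diff: "alt_sign (k - n) = alt_sign k * alt_sign n"
  by (auto simp: alt_sign_def)

lemma summable_on_alt_sign:
  assumes "(\<lambda>n. \<bar>f n\<bar>) summable_on A"
  shows "(\<lambda>n. alt_sign n * f n) summable_on A"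
  using assms by (subst summable_on_abs_iff[symmetric]) (simp add: abs_mult)

context
  fixes c :: real
  assumes c: "c > 0"
begin

lemma summable_theta3: "(\<lambda>n::int. exp (- c * (real_of_int n)\<^sup>2)) summable_on UNIV"
  using summable_on_gaussian[OF c, of 0] by simp

lemma summable_theta4: "(\<lambda>n::int. alt_sign n * exp (- c * (real_of_int n)\<^sup>2)) summable_on UNIV"
  using summable_theta3 by (intro summable_on_alt_sign) simp

lemma summable_sech_sum: "(\<lambda>n::int. 1 / cosh (c * real_of_int n)) summable_on UNIV"
proof (rule summable_on_int_comparison_exp[OF c])
  show "\<bar>1 / cosh (c * real_of_int n)\<bar> \<le> 2 * exp (- c * \<bar>real_of_int n\<bar>)" for n
    using sech_le[of "c * real_of_int n"] c by (simp add: abs_mult)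
qed

lemma summable_alt_sech_sum: "(\<lambda>n::int. alt_sign n / cosh (c * real_of_int n)) summable_on UNIV"
  using summable_on_alt_sign[of "\<lambda>n. 1 / cosh (c * real_of_int n)" UNIV] summable_sech_sum by simp

text \<open>The terms that appear when a sum of hyperbolic secants is convolved with a theta series: shifting
the Gaussian by k produces the exponential factor.\<close>

definition sech_gauss :: "int \<Rightarrow> int \<Rightarrow> real" where
  "sech_gauss k n = alt_sign n * exp (- c * (real_of_int n)\<^sup>2 + 2 * c * real_of_int k * real_of_int n)
      / cosh (c * real_of_int n)"

lemma summable_sech_gauss: "sech_gauss k summable_on UNIV"
proof -
  have "(\<lambda>n. \<bar>sech_gauss k n\<bar>) summable_on UNIV"
  proof (rule summable_on_comparison_test[OF summable_on_gaussian[OF c, of "2 * c * real_of_int k"]])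
    show "\<bar>sech_gauss k n\<bar> \<le> exp (- c * (real_of_int n)\<^sup>2 + 2 * c * real_of_int k * real_of_int n)" for n
      using cosh_real_ge_1[of "c * real_of_int n"]
      by (simp add: sech_gauss_def abs_mult divide_le_eq mult_le_cancel_left1)
  qed simp
  then show ?thesis by (simp only: summable_on_abs_iff)
qed

text \<open>The terms cancel in pairs under the reflection of n in k + 1/2, which changes the parity of n and
preserves the exponent.\<close>

lemma alternating_gaussian_odd_shift:
  "(\<Sum>\<^sub>\<infinity>n::int. alt_sign n * exp (- c * (real_of_int n)\<^sup>2 + (2 * real_of_int k + 1) * c * real_of_int n)) = 0"
    (is "infsum ?f UNIV = 0")
proof -
  have "infsum ?f UNIV = infsum (\<lambda>n. - ?f n) UNIV"
  proof (rule infsum_reindex_bij_witness[where i = "\<lambda>n. 2 * k + 1 - n" and j = "\<lambda>n. 2 * k + 1 - n"])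
    show "- ?f (2 * k + 1 - n) = ?f n" for n
    proof -
      have "alt_sign (2 * k + 1 - n) = - alt_sign n" by (auto simp: alt_sign_def)
      moreover have "- c * (real_of_int (2 * k + 1 - n))\<^sup>2 + (2 * real_of_int k + 1) * c * real_of_int (2 * k + 1 - n)
          = - c * (real_of_int n)\<^sup>2 + (2 * real_of_int k + 1) * c * real_of_int n"
        by (simp add: power2_eq_square algebra_simps)
      ultimately show ?thesis by simp
    qed
  qed auto
  also have "\<dots> = - infsum ?f UNIV" by (simp add: infsum_uminus)
  finally show ?thesis by simp
qed

text \<open>Adding the terms for k and k + 1 produces the factor 1 + e^(2x) = 2 e^x cosh x with x = c n; the
hyperbolic cosine cancels the denominator and leaves an alternating Gaussian sum that vanishes.\<close>

lemma infsum_sech_gauss_step: "infsum (sech_gauss (k + 1)) UNIV = - infsum (sech_gauss k) UNIV"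
proof -
  have "sech_gauss k n + sech_gauss (k + 1) n
      = 2 * (alt_sign n * exp (- c * (real_of_int n)\<^sup>2 + (2 * real_of_int k + 1) * c * real_of_int n))" for n
  proof -
    define x where "x = c * real_of_int n"
    define E where "E = exp (- c * (real_of_int n)\<^sup>2 + 2 * c * real_of_int k * real_of_int n)"
    have shift: "exp (- c * (real_of_int n)\<^sup>2 + 2 * c * real_of_int (k + 1) * real_of_int n) = E * (exp x * exp x)"
      by (simp add: E_def x_def exp_add[symmetric] algebra_simps)
    have half: "exp (- c * (real_of_int n)\<^sup>2 + (2 * real_of_int k + 1) * c * real_of_int n) = E * exp x"
      by (simp add: E_def x_def exp_add[symmetric] algebra_simps)
    have cosh: "1 + exp x * exp x = 2 * exp x * cosh x"
      by (simp add: cosh_def algebra_simps exp_add[symmetric])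
    have "sech_gauss k n + sech_gauss (k + 1) n = alt_sign n * E * (1 + exp x * exp x) / cosh x"
      unfolding sech_gauss_def x_def[symmetric] E_def[symmetric] shift
      by (simp add: add_divide_distrib distrib_left mult_ac)
    also have "\<dots> = 2 * (alt_sign n * (E * exp x))" unfolding cosh by simp
    finally show ?thesis by (simp only: half)
  qed
  then have "infsum (\<lambda>n. sech_gauss k n + sech_gauss (k + 1) n) UNIV = 0"
    using alternating_gaussian_odd_shift[of k] by (simp add: infsum_cmult_right')
  then show ?thesis
    using infsum_add[OF summable_sech_gauss summable_sech_gauss, of k "k + 1"] by simp
qed

lemma infsum_sech_gauss: "infsum (sech_gauss k) UNIV = alt_sign k * infsum (sech_gauss 0) UNIV"
proof (induction k rule: int_induct[where k = 0])
  case (step1 i)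
  then show ?case using infsum_sech_gauss_step[of i] by (auto simp: alt_sign_def)
next
  case (step2 i)
  then show ?case using infsum_sech_gauss_step[of "i - 1"] by (auto simp: alt_sign_def split: if_splits)
qed (simp add: alt_sign_def)

end

lemma summable_on_product:
  fixes f g :: "int \<Rightarrow> real"
  assumes "f summable_on UNIV" "g summable_on UNIV"
  shows "(\<lambda>(n,m). f n * g m) summable_on (UNIV \<times> UNIV)"
proof -
  have f: "(\<lambda>n. \<bar>f n\<bar>) summable_on UNIV" and g: "(\<lambda>n. \<bar>g n\<bar>) summable_on UNIV"
    using assms by (simp_all only: summable_on_abs_iff)
  have "(\<lambda>x. \<bar>f (fst x) * g (snd x)\<bar>) summable_on (UNIV \<times> UNIV)"
  proof (rule summable_on_SigmaI[where g = "\<lambda>n. \<bar>f n\<bar> * infsum (\<lambda>m. \<bar>g m\<bar>) UNIV"])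
    show "((\<lambda>y. \<bar>f (fst (x, y)) * g (snd (x, y))\<bar>) has_sum \<bar>f x\<bar> * infsum (\<lambda>m. \<bar>g m\<bar>) UNIV) UNIV" for x
      using has_sum_cmult_right[OF has_sum_infsum[OF g], of "\<bar>f x\<bar>"] by (simp add: abs_mult)
    show "(\<lambda>n. \<bar>f n\<bar> * infsum (\<lambda>m. \<bar>g m\<bar>) UNIV) summable_on UNIV"
      by (rule summable_on_cmult_left[OF f])
  qed auto
  then show ?thesis by (simp only: summable_on_abs_iff case_prod_unfold)
qed

lemma has_sum_product:
  fixes f g :: "int \<Rightarrow> real"
  assumes "f summable_on UNIV" "g summable_on UNIV"
  shows "((\<lambda>(n,m). f n * g m) has_sum (infsum f UNIV * infsum g UNIV)) (UNIV \<times> UNIV)"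
proof (rule has_sum_SigmaI[where g = "\<lambda>n. f n * infsum g UNIV"])
  show "((\<lambda>y. case (x, y) of (n, m) \<Rightarrow> f n * g m) has_sum f x * infsum g UNIV) UNIV" for x
    using has_sum_cmult_right[OF has_sum_infsum[OF assms(2)], of "f x"] by simp
  show "((\<lambda>n. f n * infsum g UNIV) has_sum infsum f UNIV * infsum g UNIV) UNIV"
    by (rule has_sum_cmult_left[OF has_sum_infsum[OF assms(1)]])
qed (rule summable_on_product[OF assms])

lemma has_sum_convolution:
  fixes f g :: "int \<Rightarrow> real"
  assumes "f summable_on UNIV" "g summable_on UNIV"
  shows "((\<lambda>k. \<Sum>\<^sub>\<infinity>n. f n * g (k - n)) has_sum (infsum f UNIV * infsum g UNIV)) UNIV"
proof -
  have *: "((\<lambda>(k,n). f n * g (k - n)) has_sum (infsum f UNIV * infsum g UNIV)) (UNIV \<times> UNIV)"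
    using has_sum_product[OF assms]
    by (subst has_sum_reindex_bij_witness[where j = "\<lambda>(k,n). (n, k - n)" and i = "\<lambda>(n,m). (n + m, n)"
          and h = "\<lambda>(n,m). f n * g m" and T = "UNIV \<times> UNIV"]) auto
  show ?thesis
  proof (rule has_sum_SigmaD[OF *])
    fix k :: int
    have "(\<lambda>n. f n * g (k - n)) summable_on UNIV"
      using summable_on_SigmaD1[OF has_sum_imp_summable[OF *], of k] by simp
    then show "((\<lambda>y. case (k, y) of (k, n) \<Rightarrow> f n * g (k - n)) has_sum (\<Sum>\<^sub>\<infinity>n. f n * g (k - n))) UNIV"
      by simp
  qed
qed

context
  fixes c :: real
  assumes c: "c > 0"
begin

lemma gauss_shift_split:
  "exp (- c * (real_of_int (k - n))\<^sup>2)
     = exp (- c * (real_of_int k)\<^sup>2) * exp (- c * (real_of_int n)\<^sup>2 + 2 * c * real_of_int k * real_of_int n)"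
  by (simp add: exp_add[symmetric] power2_eq_square algebra_simps)

text \<open>The inner sums of the convolution are all equal up to the sign (-1)^k, which the alternating sign of
theta4 removes, so the product factors again.\<close>

lemma sech_sum_mult_theta4: "sech_sum c * theta4 c = infsum (sech_gauss c 0) UNIV * theta3 c"
proof -
  have "(\<Sum>\<^sub>\<infinity>n. 1 / cosh (c * real_of_int n) * (alt_sign (k - n) * exp (- c * (real_of_int (k - n))\<^sup>2)))
      = infsum (sech_gauss c 0) UNIV * exp (- c * (real_of_int k)\<^sup>2)" for k
  proof -
    have "(\<Sum>\<^sub>\<infinity>n. 1 / cosh (c * real_of_int n) * (alt_sign (k - n) * exp (- c * (real_of_int (k - n))\<^sup>2)))
      = (\<Sum>\<^sub>\<infinity>n. (alt_sign k * exp (- c * (real_of_int k)\<^sup>2)) * sech_gauss c k n)"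
      by (intro infsum_cong) (simp only: gauss_shift_split alt_sign_diff sech_gauss_def[OF c] mult_ac divide_inverse mult_1)
    also have "\<dots> = (alt_sign k * exp (- c * (real_of_int k)\<^sup>2)) * (alt_sign k * infsum (sech_gauss c 0) UNIV)"
      by (simp add: infsum_cmult_right' infsum_sech_gauss[OF c, of k])
    also have "\<dots> = (alt_sign k * alt_sign k) * infsum (sech_gauss c 0) UNIV * exp (- c * (real_of_int k)\<^sup>2)"
      by (simp only: mult_ac)
    finally show ?thesis by simp
  qed
  then have "((\<lambda>k. infsum (sech_gauss c 0) UNIV * exp (- c * (real_of_int k)\<^sup>2)) has_sum sech_sum c * theta4 c) UNIV"
    using has_sum_convolution[OF summable_sech_sum[OF c] summable_theta4[OF c]]
    by (simp add: sech_sum_def theta4_def)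
  moreover have "((\<lambda>k. infsum (sech_gauss c 0) UNIV * exp (- c * (real_of_int k)\<^sup>2))
      has_sum infsum (sech_gauss c 0) UNIV * theta3 c) UNIV"
    unfolding theta3_def by (rule has_sum_cmult_right[OF has_sum_infsum[OF summable_theta3[OF c]]])
  ultimately show ?thesis by (rule has_sum_unique)
qed

lemma alt_sech_sum_mult_theta3: "alt_sech_sum c * theta3 c = infsum (sech_gauss c 0) UNIV * theta4 c"
proof -
  have "(\<Sum>\<^sub>\<infinity>n. alt_sign n / cosh (c * real_of_int n) * exp (- c * (real_of_int (k - n))\<^sup>2))
      = infsum (sech_gauss c 0) UNIV * (alt_sign k * exp (- c * (real_of_int k)\<^sup>2))" for k
  proof -
    have "(\<Sum>\<^sub>\<infinity>n. alt_sign n / cosh (c * real_of_int n) * exp (- c * (real_of_int (k - n))\<^sup>2))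
      = (\<Sum>\<^sub>\<infinity>n. exp (- c * (real_of_int k)\<^sup>2) * sech_gauss c k n)"
      by (intro infsum_cong) (simp only: gauss_shift_split alt_sign_diff sech_gauss_def[OF c] mult_ac divide_inverse mult_1)
    also have "\<dots> = exp (- c * (real_of_int k)\<^sup>2) * (alt_sign k * infsum (sech_gauss c 0) UNIV)"
      by (simp add: infsum_cmult_right' infsum_sech_gauss[OF c, of k])
    finally show ?thesis by simp
  qed
  then have "((\<lambda>k. infsum (sech_gauss c 0) UNIV * (alt_sign k * exp (- c * (real_of_int k)\<^sup>2)))
      has_sum alt_sech_sum c * theta3 c) UNIV"
    using has_sum_convolution[OF summable_alt_sech_sum[OF c] summable_theta3[OF c]]
    by (simp add: alt_sech_sum_def theta3_def)
  moreover have "((\<lambda>k. infsum (sech_gauss c 0) UNIV * (alt_sign k * exp (- c * (real_of_int k)\<^sup>2)))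
      has_sum infsum (sech_gauss c 0) UNIV * theta4 c) UNIV"
    unfolding theta4_def by (rule has_sum_cmult_right[OF has_sum_infsum[OF summable_theta4[OF c]]])
  ultimately show ?thesis by (rule has_sum_unique)
qed

lemma sech_sum_double: "sech_sum c + alt_sech_sum c = 2 * sech_sum (2 * c)"
proof -
  have "((\<lambda>n. 1 / cosh (c * real_of_int n) + alt_sign n / cosh (c * real_of_int n))
      has_sum (sech_sum c + alt_sech_sum c)) UNIV"
    unfolding sech_sum_def alt_sech_sum_def
    by (intro has_sum_add has_sum_infsum summable_sech_sum summable_alt_sech_sum c)
  then have "((\<lambda>n. 2 / cosh (c * real_of_int n)) has_sum (sech_sum c + alt_sech_sum c)) (range (\<lambda>n. 2 * n))"
    by (rule iffD1[OF has_sum_cong_neutral, rotated 3]) (auto simp: alt_sign_def elim!: evenE)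
  then have "((\<lambda>n. 2 / cosh (2 * c * real_of_int n)) has_sum (sech_sum c + alt_sech_sum c)) UNIV"
    by (subst (asm) has_sum_reindex) (auto simp: inj_on_def o_def mult_ac)
  moreover have "((\<lambda>n. 2 * (1 / cosh (2 * c * real_of_int n))) has_sum 2 * sech_sum (2 * c)) UNIV"
    unfolding sech_sum_def by (intro has_sum_cmult_right has_sum_infsum summable_sech_sum) (use c in simp)
  ultimately show ?thesis by (simp add: has_sum_unique)
qed

text \<open>In the double series of theta3^2 + theta4^2 only the pairs (n, m) with n + m even survive; these are
(a + b, a - b), and n^2 + m^2 = 2 a^2 + 2 b^2.\<close>

lemma theta_squares_double: "(theta3 c)\<^sup>2 + (theta4 c)\<^sup>2 = 2 * (theta3 (2 * c))\<^sup>2"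
proof -
  define e where "e n = exp (- c * (real_of_int n)\<^sup>2)" for n
  define e2 where "e2 n = exp (- (2 * c) * (real_of_int n)\<^sup>2)" for n
  have "((\<lambda>x. (case x of (n,m) \<Rightarrow> e n * e m) + (case x of (n,m) \<Rightarrow> (alt_sign n * e n) * (alt_sign m * e m)))
      has_sum (theta3 c * theta3 c + theta4 c * theta4 c)) (UNIV \<times> UNIV)"
    unfolding theta3_def theta4_def e_def
    by (intro has_sum_add has_sum_product summable_theta3 summable_theta4 c)
  then have "((\<lambda>(n,m). 2 * (e n * e m)) has_sum (theta3 c * theta3 c + theta4 c * theta4 c))
      ((\<lambda>(a,b). (a + b, a - b)) ` (UNIV \<times> UNIV))"
  proof (rule iffD1[OF has_sum_cong_neutral, rotated 3])
    fix x :: "int \<times> int"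
    assume x: "x \<in> UNIV \<times> UNIV - (\<lambda>(a,b). (a + b, a - b)) ` (UNIV \<times> UNIV)"
    obtain n m where nm: "x = (n, m)" by force
    have "odd (n + m)"
    proof
      assume "even (n + m)"
      then obtain a where a: "n + m = 2 * a" by (elim evenE)
      have "x = (\<lambda>(a,b). (a + b, a - b)) (a, n - a)" using nm a by simp
      with x show False by blast
    qed
    then show "(case x of (n,m) \<Rightarrow> e n * e m) + (case x of (n,m) \<Rightarrow> (alt_sign n * e n) * (alt_sign m * e m)) = 0"
      using nm by (auto simp: alt_sign_def)
  qed (auto simp: alt_sign_def)
  then have "((\<lambda>x. 2 * (case x of (a,b) \<Rightarrow> e2 a * e2 b)) has_sum (theta3 c * theta3 c + theta4 c * theta4 c)) (UNIV \<times> UNIV)"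
  proof (subst (asm) has_sum_reindex)
    show "inj_on (\<lambda>(a,b). (a + b, a - b)) (UNIV \<times> UNIV :: (int \<times> int) set)"
      by (auto simp: inj_on_def)
    have "e (a + b) * e (a - b) = e2 a * e2 b" for a b
      by (simp add: e_def e2_def exp_add[symmetric] power2_eq_square algebra_simps)
    then have *: "(\<lambda>(n,m). 2 * (e n * e m)) \<circ> (\<lambda>(a,b). (a + b, a - b)) = (\<lambda>x. 2 * (case x of (a,b) \<Rightarrow> e2 a * e2 b))"
      by (auto simp: fun_eq_iff)
    assume "((\<lambda>(n,m). 2 * (e n * e m)) \<circ> (\<lambda>(a,b). (a + b, a - b)) has_sum (theta3 c * theta3 c + theta4 c * theta4 c)) (UNIV \<times> UNIV)"
    then show ?thesis unfolding * .
  qed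
  moreover have "((\<lambda>x. 2 * (case x of (a,b) \<Rightarrow> e2 a * e2 b)) has_sum 2 * (theta3 (2 * c) * theta3 (2 * c))) (UNIV \<times> UNIV)"
    unfolding e2_def theta3_def
    by (intro has_sum_cmult_right has_sum_product summable_theta3) (use c in auto)
  ultimately show ?thesis by (simp add: has_sum_unique power2_eq_square)
qed

lemma theta3_ge_1: "theta3 c \<ge> 1"
proof -
  have "(\<Sum>n\<in>{0::int}. exp (- c * (real_of_int n)\<^sup>2)) \<le> theta3 c"
    unfolding theta3_def by (intro finite_sum_le_infsum summable_theta3 c) auto
  then show ?thesis by simp
qed

end

text \<open>Eliminating the auxiliary sum from the two product formulas gives
sech_sum theta4^2 = alt_sech_sum theta3^2; the duplication formulas express theta4^2 and
alt_sech_sum by values at c and 2 c, which leaves a relation between the ratios at c and 2 c.\<close>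

lemma sech_sum_theta3_ratio_double:
  assumes c: "c > 0"
  shows "sech_sum c / (theta3 c)\<^sup>2 = sech_sum (2 * c) / (theta3 (2 * c))\<^sup>2"
proof -
  have "sech_sum c * (theta4 c)\<^sup>2 = infsum (sech_gauss c 0) UNIV * theta4 c * theta3 c"
    using sech_sum_mult_theta4[OF c] by (simp add: power2_eq_square)
  also have "\<dots> = alt_sech_sum c * (theta3 c)\<^sup>2"
    using alt_sech_sum_mult_theta3[OF c] by (simp add: power2_eq_square)
  finally have "sech_sum c * (theta4 c)\<^sup>2 = alt_sech_sum c * (theta3 c)\<^sup>2" .
  moreover have "(theta4 c)\<^sup>2 = 2 * (theta3 (2 * c))\<^sup>2 - (theta3 c)\<^sup>2"
    using theta_squares_double[OF c] by simp
  moreover have "alt_sech_sum c = 2 * sech_sum (2 * c) - sech_sum c"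
    using sech_sum_double[OF c] by simp
  ultimately have "sech_sum c * (2 * (theta3 (2 * c))\<^sup>2 - (theta3 c)\<^sup>2) = (2 * sech_sum (2 * c) - sech_sum c) * (theta3 c)\<^sup>2"
    by simp
  then have "sech_sum c * (theta3 (2 * c))\<^sup>2 = sech_sum (2 * c) * (theta3 c)\<^sup>2"
    by (simp add: algebra_simps)
  moreover have "theta3 c \<noteq> 0" "theta3 (2 * c) \<noteq> 0"
    using theta3_ge_1[OF c] theta3_ge_1[of "2 * c"] c by auto
  ultimately show ?thesis by (simp add: field_simps)
qed

text \<open>For c \<ge> 1 the terms other than the one at 0 sum to at most exp(1 - c) times the convergent sum of
2 exp(-|n|).\<close>

lemma int_sum_tendsto_1:
  fixes F :: "real \<Rightarrow> int \<Rightarrow> real"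
  assumes "\<And>c. c > 0 \<Longrightarrow> F c summable_on UNIV" "\<And>c. F c 0 = 1"
    and "\<And>c n. c > 0 \<Longrightarrow> 0 \<le> F c n \<and> F c n \<le> 2 * exp (- c * \<bar>real_of_int n\<bar>)"
  shows "((\<lambda>c. infsum (F c) UNIV) \<longlongrightarrow> 1) at_top"
proof (rule tendsto_sandwich[of "\<lambda>_. 1" _ _ "\<lambda>c. 1 + exp (1 - c) * infsum (\<lambda>n::int. 2 * exp (- 1 * \<bar>real_of_int n\<bar>)) UNIV"])
  show "\<forall>\<^sub>F c in at_top. 1 \<le> infsum (F c) UNIV"
  proof (rule eventually_mono[OF eventually_gt_at_top[of 0]])
    fix c :: real assume c: "c > 0"
    have "(\<Sum>n\<in>{0::int}. F c n) \<le> infsum (F c) UNIV"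
      using assms(1,3)[OF c] by (intro finite_sum_le_infsum) auto
    then show "1 \<le> infsum (F c) UNIV" using assms(2) by simp
  qed
  let ?K = "infsum (\<lambda>n::int. 2 * exp (- 1 * \<bar>real_of_int n\<bar>)) UNIV"
  have K: "(\<lambda>n::int. 2 * exp (- 1 * \<bar>real_of_int n\<bar>)) summable_on UNIV"
    using summable_on_cmult_right[OF summable_on_exp_minus_abs[of 1], of 2] by simp
  show "\<forall>\<^sub>F c in at_top. infsum (F c) UNIV \<le> 1 + exp (1 - c) * ?K"
  proof (rule eventually_mono[OF eventually_ge_at_top[of 1]])
    fix c :: real assume c: "c \<ge> 1"
    have *: "((\<lambda>n::int. (if n = 0 then 1 else 0) + exp (1 - c) * (2 * exp (- 1 * \<bar>real_of_int n\<bar>)))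
        has_sum 1 + exp (1 - c) * ?K) UNIV"
    proof (intro has_sum_add has_sum_cmult_right has_sum_infsum K)
      show "((\<lambda>n::int. if n = 0 then 1 else 0) has_sum (1::real)) UNIV"
        by (rule has_sum_finite_neutralI[where B = "{0}"]) auto
    qed
    have "infsum (F c) UNIV \<le> infsum (\<lambda>n::int. (if n = 0 then 1 else 0) + exp (1 - c) * (2 * exp (- 1 * \<bar>real_of_int n\<bar>))) UNIV"
    proof (rule infsum_mono)
      show "F c summable_on UNIV" using assms(1) c by simp
      show "(\<lambda>n::int. (if n = 0 then 1 else 0) + exp (1 - c) * (2 * exp (- 1 * \<bar>real_of_int n\<bar>))) summable_on UNIV"
        using * by (rule has_sum_imp_summable)
      fix n :: int
      show "F c n \<le> (if n = 0 then 1 else 0) + exp (1 - c) * (2 * exp (- 1 * \<bar>real_of_int n\<bar>))"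
      proof (cases "n = 0")
        case False
        then have "\<bar>real_of_int n\<bar> \<ge> 1" by linarith
        then have "(c - 1) * \<bar>real_of_int n\<bar> \<ge> c - 1" using c by (simp add: mult_le_cancel_left1)
        then have "- c * \<bar>real_of_int n\<bar> \<le> (1 - c) + (- 1 * \<bar>real_of_int n\<bar>)" by (simp add: algebra_simps)
        then have "exp (- c * \<bar>real_of_int n\<bar>) \<le> exp (1 - c) * exp (- 1 * \<bar>real_of_int n\<bar>)"
          by (simp only: exp_add[symmetric] exp_le_cancel_iff)
        then show ?thesis using False assms(3)[of c n] c by simp
      qed (simp add: assms(2))
    qed
    also have "\<dots> = 1 + exp (1 - c) * ?K" using * by (rule infsumI)
    finally show "infsum (F c) UNIV \<le> 1 + exp (1 - c) * ?K" .
  qed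
  have "((\<lambda>c::real. exp (1 - c)) \<longlongrightarrow> 0) at_top" by real_asymp
  then have "((\<lambda>c. 1 + exp (1 - c) * ?K) \<longlongrightarrow> 1 + 0 * ?K) at_top" by (intro tendsto_intros)
  then show "((\<lambda>c. 1 + exp (1 - c) * ?K) \<longlongrightarrow> 1) at_top" by simp
qed simp

lemma abs_le_square_int: "\<bar>real_of_int n\<bar> \<le> (real_of_int n)\<^sup>2"
proof (cases "n = 0")
  case False
  then have "\<bar>real_of_int n\<bar> \<ge> 1" by linarith
  then have "\<bar>real_of_int n\<bar> * 1 \<le> \<bar>real_of_int n\<bar> * \<bar>real_of_int n\<bar>" by (intro mult_left_mono) auto
  then show ?thesis by (simp add: power2_eq_square)
qed simp

text \<open>Jacobi's theorem on sums of two squares in analytic form; expanding the secants in geometric series and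
comparing coefficients would give r2(n) as a divisor sum. The ratio of the two sides is
invariant under doubling of c and tends to 1 as c grows.\<close>

theorem theta3_squared_eq_sech_sum:
  assumes c: "c > 0"
  shows "(theta3 c)\<^sup>2 = sech_sum c"
proof -
  have lim3: "(theta3 \<longlongrightarrow> 1) at_top"
    unfolding theta3_def
  proof (rule int_sum_tendsto_1)
    fix c :: real and n :: int
    assume "c > 0"
    then have "c * \<bar>real_of_int n\<bar> \<le> c * (real_of_int n)\<^sup>2"
      using abs_le_square_int by simp
    then have "exp (- c * (real_of_int n)\<^sup>2) \<le> 1 * exp (- c * \<bar>real_of_int n\<bar>)" by simp
    also have "\<dots> \<le> 2 * exp (- c * \<bar>real_of_int n\<bar>)" by (intro mult_right_mono) auto
    finally show "0 \<le> exp (- c * (real_of_int n)\<^sup>2) \<and> exp (- c * (real_of_int n)\<^sup>2) \<le> 2 * exp (- c * \<bar>real_of_int n\<bar>)"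
      by simp
  qed (use summable_theta3 in auto)
  have limA: "(sech_sum \<longlongrightarrow> 1) at_top"
    unfolding sech_sum_def
  proof (rule int_sum_tendsto_1)
    fix c :: real and n :: int
    assume "c > 0"
    then show "0 \<le> 1 / cosh (c * real_of_int n) \<and> 1 / cosh (c * real_of_int n) \<le> 2 * exp (- c * \<bar>real_of_int n\<bar>)"
      using sech_le[of "c * real_of_int n"] by (simp add: abs_mult)
  qed (auto intro: summable_sech_sum)
  define \<rho> where "\<rho> c = sech_sum c / (theta3 c)\<^sup>2" for c
  have "\<rho> c = \<rho> (2 ^ k * c)" for k
  proof (induction k)
    case (Suc k)
    then show ?case using sech_sum_theta3_ratio_double[of "2 ^ k * c"] c by (simp add: \<rho>_def mult_ac)
  qed simp
  moreover have "(\<rho> \<longlongrightarrow> 1 / 1\<^sup>2) at_top"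
    unfolding \<rho>_def by (intro tendsto_intros lim3 limA) auto
  then have "(\<lambda>k. \<rho> (2 ^ k * c)) \<longlonglongrightarrow> 1 / 1\<^sup>2"
  proof (rule filterlim_compose)
    show "filterlim (\<lambda>k. 2 ^ k * c) at_top sequentially"
      using c by real_asymp
  qed
  ultimately have "\<rho> c = 1" by (simp add: LIMSEQ_const_iff)
  moreover have "theta3 c \<noteq> 0" using theta3_ge_1[OF c] by simp
  ultimately show ?thesis by (simp add: \<rho>_def)
qed

section \<open>The modular transformation of the theta series\<close>

text \<open>The Fourier transform of a Gaussian, rescaled from the characteristic function of the normal
distribution.\<close>

lemma gaussian_cos_integral:
  fixes u k :: real
  assumes u: "u > 0"
  shows "integrable lborel (\<lambda>x. exp (- pi * u * x\<^sup>2) * cos (2 * pi * k * x))"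
    and "integral\<^sup>L lborel (\<lambda>x. exp (- pi * u * x\<^sup>2) * cos (2 * pi * k * x)) = exp (- pi * k\<^sup>2 / u) / sqrt u"
proof -
  define c where "c = sqrt (2 * pi * u)"
  define t where "t = 2 * pi * k / c"
  have c: "c > 0" "c\<^sup>2 = 2 * pi * u" using u by (simp_all add: c_def)
  have int: "integrable lborel (\<lambda>x. std_normal_density x *\<^sub>R iexp (t * x))"
    by (rule Bochner_Integration.integrable_bound[OF integrable_normal_density[of 1 0]]) auto
  have "(\<integral>x. std_normal_density x *\<^sub>R iexp (t * x) \<partial>lborel) = complex_of_real (exp (- (t\<^sup>2) / 2))"
    using fun_cong[OF char_std_normal_distribution, of t] unfolding char_def
    by (subst (asm) integral_density) auto
  then have "Re (\<integral>x. std_normal_density x *\<^sub>R iexp (t * x) \<partial>lborel) = exp (- (t\<^sup>2) / 2)"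
    by (simp only: Re_complex_of_real)
  then have val: "(\<integral>x. std_normal_density x * cos (t * x) \<partial>lborel) = exp (- (t\<^sup>2) / 2)"
    using integral_Re[OF int] by (simp add: Re_exp)
  have int': "integrable lborel (\<lambda>x. std_normal_density x * cos (t * x))"
    using integrable_Re[OF int] by (simp add: Re_exp)
  have eq: "std_normal_density (0 + c * x) * cos (t * (0 + c * x))
      = exp (- pi * u * x\<^sup>2) * cos (2 * pi * k * x) / sqrt (2 * pi)" for x
    using c by (simp add: std_normal_density_def t_def power_mult_distrib field_simps)
  show "integrable lborel (\<lambda>x. exp (- pi * u * x\<^sup>2) * cos (2 * pi * k * x))"
    using Bochner_Integration.integrable_mult_left[of "sqrt (2 * pi)", OF lborel_integrable_real_affine[OF int', of c 0]] c
    unfolding eq by simp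
  let ?I = "\<integral>x. exp (- pi * u * x\<^sup>2) * cos (2 * pi * k * x) \<partial>lborel"
  have "exp (- (t\<^sup>2) / 2) = c * (?I / sqrt (2 * pi))"
    using lborel_integral_real_affine[of c "\<lambda>x. std_normal_density x * cos (t * x)" 0] c
    unfolding eq val by simp
  also have "\<dots> = sqrt u * ?I"
    by (simp add: c_def real_sqrt_mult)
  finally have "sqrt u * ?I = exp (- (t\<^sup>2) / 2)" ..
  moreover have "- (t\<^sup>2) / 2 = - pi * k\<^sup>2 / u"
    using c u by (simp add: t_def power_divide power_mult_distrib field_simps power2_eq_square)
  ultimately have "sqrt u * ?I = exp (- pi * k\<^sup>2 / u)" by (simp only:)
  then show "?I = exp (- pi * k\<^sup>2 / u) / sqrt u"
    using u by (simp add: eq_divide_eq mult.commute)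
qed

text \<open>The Poisson kernel of the unit disc at radius r and angle 2 pi x. It is used as a positive summation
kernel in the proof of Poisson summation for the Gaussian.\<close>

definition poisson_kernel :: "real \<Rightarrow> real \<Rightarrow> real" where
  "poisson_kernel r x = (1 - r\<^sup>2) / (1 - 2 * r * cos (2 * pi * x) + r\<^sup>2)"

context
  fixes r :: real
  assumes r: "0 \<le> r" "r < 1"
begin

lemma poisson_denominator: "1 - 2 * r * cos (2 * pi * x) + r\<^sup>2 = (1 - r)\<^sup>2 + 4 * r * (sin (pi * x))\<^sup>2"
proof -
  have cos: "cos (2 * pi * x) = 1 - 2 * (sin (pi * x))\<^sup>2"
    using cos_double_sin[of "pi * x"] by (simp only: mult.assoc)
  show ?thesis unfolding cos by (simp add: power2_eq_square algebra_simps)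
qed

lemma poisson_denominator_pos: "1 - 2 * r * cos (2 * pi * x) + r\<^sup>2 > 0"
  using r by (simp add: poisson_denominator add_pos_nonneg)

lemma poisson_kernel_nonneg: "poisson_kernel r x \<ge> 0"
  using poisson_denominator_pos[of x] r power_le_one[of r 2] by (simp add: poisson_kernel_def)

text \<open>The real part of a geometric series, doubled.\<close>

lemma poisson_kernel_sums:
  "(\<lambda>k. 2 * r ^ Suc k * cos (2 * pi * real (Suc k) * x)) sums (poisson_kernel r x - 1)"
proof -
  define z where "z = complex_of_real r * cis (2 * pi * x)"
  have z: "norm z < 1" using r by (simp add: z_def norm_mult)
  have "(\<lambda>k. z * z ^ k) sums (z * (1 / (1 - z)))"
    by (intro sums_mult geometric_sums z)
  then have "(\<lambda>k. Re (z ^ Suc k)) sums Re (z / (1 - z))"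
    by (intro sums_Re) (simp add: mult.commute)
  moreover have "Re (z ^ Suc k) = r ^ Suc k * cos (2 * pi * real (Suc k) * x)" for k
  proof -
    have "z ^ Suc k = of_real (r ^ Suc k) * cis (real (Suc k) * (2 * pi * x))"
      by (simp only: z_def power_mult_distrib Complex.DeMoivre of_real_power)
    then have "Re (z ^ Suc k) = r ^ Suc k * cos (real (Suc k) * (2 * pi * x))"
      by (simp del: power_Suc of_nat_Suc of_real_power)
    moreover have "real (Suc k) * (2 * pi * x) = 2 * pi * real (Suc k) * x" by simp
    ultimately show ?thesis by (simp only:)
  qed
  ultimately have "(\<lambda>k. 2 * (r ^ Suc k * cos (2 * pi * real (Suc k) * x))) sums (2 * Re (z / (1 - z)))"
    by (intro sums_mult) (simp only:)
  moreover have "2 * Re (z / (1 - z)) = poisson_kernel r x - 1"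
  proof -
    have den: "(1 - r * cos (2 * pi * x))\<^sup>2 + (r * sin (2 * pi * x))\<^sup>2 = 1 - 2 * r * cos (2 * pi * x) + r\<^sup>2"
      using sin_cos_squared_add[of "2 * pi * x"] by algebra
    have num: "r * cos (2 * pi * x) * (1 - r * cos (2 * pi * x)) - r * sin (2 * pi * x) * (r * sin (2 * pi * x)) = r * cos (2 * pi * x) - r\<^sup>2"
      using sin_cos_squared_add[of "2 * pi * x"] by algebra
    have "Re (z / (1 - z)) = (r * cos (2 * pi * x) - r\<^sup>2) / (1 - 2 * r * cos (2 * pi * x) + r\<^sup>2)"
      unfolding Re_divide using den num by (simp add: z_def)
    then show ?thesis
      using poisson_denominator_pos[of x] unfolding poisson_kernel_def by (simp add: field_simps)
  qed
  ultimately show ?thesis by (simp add: mult_ac)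
qed

lemma integral_poisson_kernel:
  fixes \<phi> :: "real \<Rightarrow> real"
  assumes \<phi>: "integrable lborel \<phi>"
  shows "integrable lborel (\<lambda>x. \<phi> x * poisson_kernel r x)"
    and "integral\<^sup>L lborel (\<lambda>x. \<phi> x * poisson_kernel r x) = integral\<^sup>L lborel \<phi>
           + (\<Sum>k. 2 * r ^ Suc k * integral\<^sup>L lborel (\<lambda>x. \<phi> x * cos (2 * pi * real (Suc k) * x)))"
proof -
  let ?f = "\<lambda>k x. \<phi> x * (2 * r ^ Suc k * cos (2 * pi * real (Suc k) * x))"
  have [measurable]: "\<phi> \<in> borel_measurable borel" using \<phi> by auto
  have int: "integrable lborel (?f k)" for k
  proof (rule Bochner_Integration.integrable_bound)
    show "integrable lborel (\<lambda>x. 2 * r ^ Suc k * \<phi> x)" using \<phi> by simp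
    show "AE x in lborel. norm (?f k x) \<le> norm (2 * r ^ Suc k * \<phi> x)"
      using r by (intro AE_I2) (auto simp: abs_mult mult_le_cancel_left1 mult_left_le mult_ac intro!: mult_left_mono mult_left_le)
  qed simp
  have pt: "summable (\<lambda>k. norm (?f k x))" for x
  proof (rule summable_comparison_test[of _ "\<lambda>k. \<bar>\<phi> x\<bar> * (2 * r ^ Suc k)"])
    show "summable (\<lambda>k. \<bar>\<phi> x\<bar> * (2 * r ^ Suc k))"
      using r by (intro summable_mult) (auto intro!: summable_mult summable_geometric)
    show "\<exists>N. \<forall>n\<ge>N. norm (norm (?f n x)) \<le> \<bar>\<phi> x\<bar> * (2 * r ^ Suc n)"
      using r by (intro exI[of _ 0]) (auto simp: abs_mult mult_le_cancel_left1 mult_left_le intro!: mult_left_mono)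
  qed
  have sm: "summable (\<lambda>k. \<integral>x. norm (?f k x) \<partial>lborel)"
  proof (rule summable_comparison_test[of _ "\<lambda>k. 2 * r ^ Suc k * (\<integral>x. \<bar>\<phi> x\<bar> \<partial>lborel)"])
    show "summable (\<lambda>k. 2 * r ^ Suc k * (\<integral>x. \<bar>\<phi> x\<bar> \<partial>lborel))"
      using r by (intro summable_mult2) (auto intro!: summable_mult summable_geometric)
    have "norm (\<integral>x. norm (?f k x) \<partial>lborel) \<le> 2 * r ^ Suc k * (\<integral>x. \<bar>\<phi> x\<bar> \<partial>lborel)" for k
    proof -
      have "(\<integral>x. norm (?f k x) \<partial>lborel) \<le> (\<integral>x. 2 * r ^ Suc k * \<bar>\<phi> x\<bar> \<partial>lborel)"
      proof (rule integral_mono)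
        show "integrable lborel (\<lambda>x. norm (?f k x))" by (rule integrable_norm[OF int])
        show "integrable lborel (\<lambda>x. 2 * r ^ Suc k * \<bar>\<phi> x\<bar>)" using \<phi> by simp
        show "norm (?f k x) \<le> 2 * r ^ Suc k * \<bar>\<phi> x\<bar>" for x
          using r by (auto simp: abs_mult mult_le_cancel_left1 mult_left_le mult_ac intro!: mult_left_mono mult_left_le)
      qed
      then show ?thesis using \<phi> by simp
    qed
    then show "\<exists>N. \<forall>n\<ge>N. norm (\<integral>x. norm (?f n x) \<partial>lborel) \<le> 2 * r ^ Suc n * (\<integral>x. \<bar>\<phi> x\<bar> \<partial>lborel)"
      by blast
  qed
  have sum_eq: "(\<Sum>k. ?f k x) = \<phi> x * (poisson_kernel r x - 1)" for x
    using sums_mult[OF poisson_kernel_sums[of x], of "\<phi> x"] by (simp add: sums_iff)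
  have i1: "integrable lborel (\<lambda>x. \<phi> x * (poisson_kernel r x - 1))"
    using integrable_suminf[OF int _ sm] pt unfolding sum_eq by simp
  have v1: "integral\<^sup>L lborel (\<lambda>x. \<phi> x * (poisson_kernel r x - 1)) = (\<Sum>k. integral\<^sup>L lborel (?f k))"
    using integral_suminf[OF int _ sm] pt unfolding sum_eq by simp
  have v2: "integral\<^sup>L lborel (?f k) = 2 * r ^ Suc k * integral\<^sup>L lborel (\<lambda>x. \<phi> x * cos (2 * pi * real (Suc k) * x))" for k
    by (subst integral_mult_right_zero[symmetric]) (simp add: mult_ac)
  have eq: "\<phi> x * poisson_kernel r x = \<phi> x + \<phi> x * (poisson_kernel r x - 1)" for x by (simp add: algebra_simps)
  show "integrable lborel (\<lambda>x. \<phi> x * poisson_kernel r x)"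
    unfolding eq by (intro Bochner_Integration.integrable_add \<phi> i1)
  show "integral\<^sup>L lborel (\<lambda>x. \<phi> x * poisson_kernel r x) = integral\<^sup>L lborel \<phi>
           + (\<Sum>k. 2 * r ^ Suc k * integral\<^sup>L lborel (\<lambda>x. \<phi> x * cos (2 * pi * real (Suc k) * x)))"
    unfolding eq by (subst Bochner_Integration.integral_add[OF \<phi> i1]) (simp only: v1 v2)
qed

lemma integral_poisson_kernel_period:
  "integrable lborel (\<lambda>x. indicator {x. \<lfloor>x + 1 / 2\<rfloor> = n} x * poisson_kernel r x)"
  "integral\<^sup>L lborel (\<lambda>x. indicator {x. \<lfloor>x + 1 / 2\<rfloor> = n} x * poisson_kernel r x) = 1"
proof -
  let ?A = "{real_of_int n - 1 / 2 .. real_of_int n + 1 / 2}"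
  have A: "integrable lborel (indicator ?A :: real \<Rightarrow> real)" by simp
  have ae: "AE x in lborel. indicator {x. \<lfloor>x + 1 / 2\<rfloor> = n} x * poisson_kernel r x = indicator ?A x * poisson_kernel r x"
    using AE_lborel_singleton[of "real_of_int n + 1 / 2"]
    by eventually_elim (auto simp: indicator_def floor_eq_iff)
  have [measurable]: "poisson_kernel r \<in> borel_measurable borel"
    unfolding poisson_kernel_def by measurable
  have cos0: "integral\<^sup>L lborel (\<lambda>x. indicator ?A x * cos (2 * pi * real (Suc k) * x)) = 0" for k
  proof -
    let ?w = "2 * pi * real (Suc k)"
    have "integral\<^sup>L lborel (\<lambda>x. indicator ?A x *\<^sub>R cos (?w * x))
        = sin (?w * (real_of_int n + 1 / 2)) / ?w - sin (?w * (real_of_int n - 1 / 2)) / ?w"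
      by (rule integral_FTC_atLeastAtMost)
        (auto intro!: derivative_eq_intros continuous_intros simp: has_real_derivative_iff_has_vector_derivative[symmetric] simp del: of_nat_Suc)
    also have "sin (?w * (real_of_int n + 1 / 2)) = sin (?w * (real_of_int n - 1 / 2) + 2 * real (Suc k) * pi)"
      by (simp add: algebra_simps)
    also have "\<dots> = sin (?w * (real_of_int n - 1 / 2))"
      unfolding sin_add sin_2npi cos_2npi by simp
    finally show ?thesis by simp
  qed
  have 1: "integrable lborel (\<lambda>x. indicator ?A x * poisson_kernel r x)"
    and 2: "integral\<^sup>L lborel (\<lambda>x. indicator ?A x * poisson_kernel r x) = 1"
    using integral_poisson_kernel[OF A] by (simp_all only: cos0, simp_all)
  show "integrable lborel (\<lambda>x. indicator {x. \<lfloor>x + 1 / 2\<rfloor> = n} x * poisson_kernel r x)"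
    using integrable_cong_AE[OF _ _ ae] 1 by simp
  show "integral\<^sup>L lborel (\<lambda>x. indicator {x. \<lfloor>x + 1 / 2\<rfloor> = n} x * poisson_kernel r x) = 1"
    using integral_cong_AE[OF _ _ ae] 2 by simp
qed

text \<open>A step function that is constant between consecutive half-integers is integrated against a kernel with
mean 1 over each period; the floor of x + 1/2 is the integer nearest to x.\<close>

lemma integral_step_poisson_kernel:
  fixes a :: "int \<Rightarrow> real"
  assumes a: "a summable_on UNIV" "\<And>n. a n \<ge> 0"
  shows "integrable lborel (\<lambda>x. a \<lfloor>x + 1 / 2\<rfloor> * poisson_kernel r x)"
    and "integral\<^sup>L lborel (\<lambda>x. a \<lfloor>x + 1 / 2\<rfloor> * poisson_kernel r x) = infsum a UNIV"
proof -
  let ?f = "\<lambda>n x. a n * (indicator {x. \<lfloor>x + 1 / 2\<rfloor> = n} x * poisson_kernel r x)"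
  have int: "integrable lborel (?f n)" for n using integral_poisson_kernel_period(1)[of n] by simp
  have "\<bar>?f n x\<bar> = ?f n x" for n x using a(2)[of n] poisson_kernel_nonneg[of x] by simp
  then have nrm: "(\<integral>x. \<bar>?f n x\<bar> \<partial>lborel) = a n" for n
    using integral_poisson_kernel_period(2)[of n] by (simp only: integral_mult_right_zero mult_1_right)
  have pt: "((\<lambda>n. ?f n x) has_sum a \<lfloor>x + 1 / 2\<rfloor> * poisson_kernel r x) UNIV" for x
    by (rule has_sum_finite_neutralI[where B = "{\<lfloor>x + 1 / 2\<rfloor>}"]) auto
  have sm: "(\<lambda>n. \<integral>x. \<bar>?f n x\<bar> \<partial>lborel) summable_on UNIV" unfolding nrm by fact
  show "integrable lborel (\<lambda>x. a \<lfloor>x + 1 / 2\<rfloor> * poisson_kernel r x)"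
    by (rule has_sum_integral_int(1)[OF int sm pt])
  have "((\<lambda>n. integral\<^sup>L lborel (?f n)) has_sum integral\<^sup>L lborel (\<lambda>x. a \<lfloor>x + 1 / 2\<rfloor> * poisson_kernel r x)) UNIV"
    by (rule has_sum_integral_int(2)[OF int sm pt])
  then have "(a has_sum integral\<^sup>L lborel (\<lambda>x. a \<lfloor>x + 1 / 2\<rfloor> * poisson_kernel r x)) UNIV"
    using integral_poisson_kernel_period(2) by simp
  then show "integral\<^sup>L lborel (\<lambda>x. a \<lfloor>x + 1 / 2\<rfloor> * poisson_kernel r x) = infsum a UNIV"
    by (simp add: infsumI)
qed

end

text \<open>A weak form of Jordan's inequality; any positive constant would do for the kernel bound.\<close>

lemma abs_sin_ge_quarter:
  fixes y :: real
  assumes "\<bar>y\<bar> \<le> pi / 2"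
  shows "\<bar>sin y\<bar> \<ge> \<bar>y\<bar> / 4"
proof -
  have *: "sin y \<ge> y / 4" if y: "0 \<le> y" "y \<le> pi / 2" for y :: real
  proof (cases "y \<le> pi / 3")
    case True
    show ?thesis
    proof (cases "y = 0")
      case False
      then have "0 < y" using y by simp
      then obtain \<xi> where \<xi>: "0 < \<xi>" "\<xi> < y" "sin y - sin 0 = (y - 0) * cos \<xi>"
        using MVT2[of 0 y sin cos] by (auto intro!: derivative_eq_intros)
      have "cos (pi / 3) \<le> cos \<xi>"
        using \<xi> True by (intro cos_monotone_0_pi_le) auto
      then have "y * (1 / 4) \<le> y * cos \<xi>" using y by (intro mult_left_mono) (auto simp: cos_60)
      then show ?thesis using \<xi> by simp
    qed simp
  next
    case False
    have "sin (pi / 3) \<le> sin y"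
      using False y by (intro sin_monotone_2pi_le) auto
    moreover have "1 / 2 \<le> sin (pi / 3)" by (simp add: sin_60)
    moreover have "y \<le> 2" using y pi_less_4 by linarith
    ultimately show ?thesis by linarith
  qed
  show ?thesis
  proof (cases "y \<ge> 0")
    case True
    then show ?thesis using *[of y] assms by auto
  next
    case False
    then show ?thesis using *[of "- y"] assms by auto
  qed
qed

text \<open>As r tends to 1 the kernel concentrates at the integers; multiplied by the distance to the nearest
integer it stays bounded, which gives a dominating function in the limit.\<close>

lemma poisson_kernel_bound:
  fixes x :: real
  assumes r: "1 / 2 \<le> r" "r < 1" and d: "\<bar>x - real_of_int n\<bar> \<le> 1 / 2"
  shows "\<bar>x - real_of_int n\<bar> * poisson_kernel r x \<le> 2"
proof (cases "x = real_of_int n")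
  case False
  define d where "d = x - real_of_int n"
  have d0: "\<bar>d\<bar> > 0" "\<bar>d\<bar> \<le> 1 / 2" using False assms by (auto simp: d_def)
  have x: "pi * x = pi * d + pi * real_of_int n" by (simp add: d_def algebra_simps)
  have "\<bar>sin (pi * x)\<bar> = \<bar>sin (pi * d)\<bar>"
    unfolding x sin_add by (simp add: sin_integer_2pi cos_int_times_real abs_mult sin_zero_iff_int2 mult.commute)
  moreover have "\<bar>sin (pi * d)\<bar> \<ge> \<bar>pi * d\<bar> / 4"
    using d0 by (intro abs_sin_ge_quarter) (simp add: abs_mult)
  moreover have "\<bar>pi * d\<bar> \<ge> 2 * \<bar>d\<bar>" using pi_gt3 by (simp add: abs_mult mult_right_mono)
  ultimately have "\<bar>d\<bar> / 2 \<le> \<bar>sin (pi * x)\<bar>" by linarith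
  then have "(\<bar>d\<bar> / 2)\<^sup>2 \<le> \<bar>sin (pi * x)\<bar>\<^sup>2" by (intro power_mono) auto
  then have "2 * (d\<^sup>2 / 4) \<le> 4 * r * (sin (pi * x))\<^sup>2"
    using r mult_mono[of 2 "4 * r" "d\<^sup>2 / 4" "(sin (pi * x))\<^sup>2"] by (simp add: power_divide)
  moreover have "(1 - r)\<^sup>2 + d\<^sup>2 / 4 \<ge> (1 - r) * \<bar>d\<bar>"
  proof -
    have "((1 - r) - \<bar>d\<bar> / 2)\<^sup>2 \<ge> 0" by simp
    then show ?thesis by (simp add: power2_eq_square algebra_simps)
  qed
  moreover have "d\<^sup>2 \<ge> 0" by simp
  ultimately have den: "(1 - r) * \<bar>d\<bar> \<le> 1 - 2 * r * cos (2 * pi * x) + r\<^sup>2"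
    using poisson_denominator[of r x] r by linarith
  have pos: "(1 - r) * \<bar>d\<bar> > 0" using r d0 by simp
  have "poisson_kernel r x \<le> (1 - r\<^sup>2) / ((1 - r) * \<bar>d\<bar>)"
    unfolding poisson_kernel_def using den pos r power_le_one[of r 2] by (intro divide_left_mono) auto
  also have "\<dots> = (1 + r) / \<bar>d\<bar>" using r d0 by (simp add: power2_eq_square field_simps)
  finally have "\<bar>d\<bar> * poisson_kernel r x \<le> 1 + r" using d0 by (simp add: field_simps)
  then show ?thesis using r by (simp add: d_def)
qed simp

lemma sums_even_int:
  fixes f :: "int \<Rightarrow> real"
  assumes f: "f summable_on UNIV" and even: "\<And>n. f (- n) = f n"
  shows "(\<lambda>n. 2 * f (int (Suc n))) sums (infsum f UNIV - f 0)"
proof -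
  let ?P = "range (\<lambda>n. int (Suc n))" and ?N = "range (\<lambda>n. - int (Suc n))"
  have sub: "f summable_on A" for A using summable_on_subset_banach[OF f] by auto
  have U: "(UNIV :: int set) = {0} \<union> (?P \<union> ?N)"
  proof -
    have "n \<in> {0} \<union> (?P \<union> ?N)" for n :: int
    proof (cases n rule: int_cases3)
      case (pos m) then show ?thesis by (cases m) auto
    next
      case (neg m) then show ?thesis by (cases m) auto
    qed simp
    then show ?thesis by blast
  qed
  have "((\<lambda>n. f (int (Suc n))) has_sum infsum f ?P) UNIV"
    using has_sum_infsum[OF sub[of ?P]] by (subst (asm) has_sum_reindex) (auto simp: inj_on_def o_def)
  then have P: "(\<lambda>n. f (int (Suc n))) sums infsum f ?P" by (rule has_sum_imp_sums)
  have "((\<lambda>n. f (- int (Suc n))) has_sum infsum f ?N) UNIV"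
    using has_sum_infsum[OF sub[of ?N]] by (subst (asm) has_sum_reindex) (auto simp: inj_on_def o_def)
  then have N: "(\<lambda>n. f (int (Suc n))) sums infsum f ?N" unfolding even by (rule has_sum_imp_sums)
  have "infsum f UNIV = f 0 + infsum f (?P \<union> ?N)"
    by (subst U, subst infsum_Un_disjoint) (auto intro: sub)
  also have "infsum f (?P \<union> ?N) = infsum f ?P + infsum f ?N"
    by (intro infsum_Un_disjoint sub) auto
  finally have "infsum f UNIV - f 0 = infsum f ?P + infsum f ?N" by simp
  then show ?thesis using sums_add[OF P N] by simp
qed

lemma theta3_sums: "c > 0 \<Longrightarrow> (\<lambda>n. 2 * exp (- c * (real (Suc n))\<^sup>2)) sums (theta3 c - 1)"
  using sums_even_int[OF summable_theta3, of c] by (simp add: theta3_def del: of_nat_Suc)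

text \<open>Poisson summation for a Gaussian. Its integral against the Poisson kernel of radius r is computed in two
ways: expanding the kernel in cosines gives the Fourier side, weighted by r^k, and replacing the Gaussian
by its values at the nearest integers gives the sum over the integers. The error of the
replacement is at most a constant times the distance to the nearest integer, so it vanishes in
the limit as r tends to 1 by dominated convergence.\<close>

theorem theta3_modular:
  fixes u :: real
  assumes u: "u > 0"
  shows "theta3 (pi * u) = theta3 (pi / u) / sqrt u"
proof -
  define \<phi> where "\<phi> x = exp (- pi * u * x\<^sup>2)" for x :: real
  \<comment> \<open>radii increasing to 1, starting at 1/2 so that the kernel bound applies to all of them\<close>
  define r where "r j = 1 - 1 / (real j + 2)" for j :: nat
  have r: "1 / 2 \<le> r j" "r j < 1" "0 \<le> r j" for j by (auto simp: r_def field_simps)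
  have r_lim: "r \<longlonglongrightarrow> 1" unfolding r_def by real_asymp
  have \<phi>_fun: "\<phi> = (\<lambda>x. exp (- pi * u * x\<^sup>2))" by (simp add: fun_eq_iff \<phi>_def)
  have int\<phi>: "integrable lborel \<phi>" and val\<phi>: "integral\<^sup>L lborel \<phi> = 1 / sqrt u"
    using gaussian_cos_integral[OF u, of 0] by (simp_all add: \<phi>_fun)
  define c where "c k = exp (- pi * (real (Suc k))\<^sup>2 / u) / sqrt u" for k
  have "(\<lambda>k. 2 * exp (- (pi / u) * (real (Suc k))\<^sup>2) / sqrt u) sums ((theta3 (pi / u) - 1) / sqrt u)"
    using u by (intro sums_divide theta3_sums) simp
  then have c_sums: "(\<lambda>k. 2 * c k) sums ((theta3 (pi / u) - 1) / sqrt u)"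
    by (simp add: c_def del: of_nat_Suc)
  have I1: "integrable lborel (\<lambda>x. \<phi> x * poisson_kernel (r j) x)"
     "integral\<^sup>L lborel (\<lambda>x. \<phi> x * poisson_kernel (r j) x) = 1 / sqrt u + (\<Sum>k. 2 * r j ^ Suc k * c k)" for j
  proof -
    have "integral\<^sup>L lborel (\<lambda>x. \<phi> x * cos (2 * pi * real (Suc k) * x)) = c k" for k
      unfolding \<phi>_def c_def by (rule gaussian_cos_integral(2)[OF u])
    then show "integrable lborel (\<lambda>x. \<phi> x * poisson_kernel (r j) x)"
     "integral\<^sup>L lborel (\<lambda>x. \<phi> x * poisson_kernel (r j) x) = 1 / sqrt u + (\<Sum>k. 2 * r j ^ Suc k * c k)"
      using integral_poisson_kernel[OF r(3,2)[of j] int\<phi>] by (simp_all only: val\<phi>)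
  qed
  have "(\<lambda>j. \<Sum>k. 2 * r j ^ Suc k * c k) \<longlonglongrightarrow> (\<Sum>k. 2 * c k)"
  proof (rule conjunct2[OF conjunct2[OF tannerys_theorem[where M = "\<lambda>k. 2 * c k"]]])
    show "(\<lambda>j. 2 * r j ^ Suc k * c k) \<longlonglongrightarrow> 2 * c k" for k
      using tendsto_mult[OF tendsto_mult[OF tendsto_const[of 2] tendsto_power[OF r_lim, of "Suc k"]] tendsto_const[of "c k"]] by simp
    show "\<forall>\<^sub>F (k, j) in at_top \<times>\<^sub>F sequentially. norm (2 * r j ^ Suc k * c k) \<le> 2 * c k"
    proof (rule always_eventually, safe)
      fix k j
      have "r j ^ Suc k \<le> 1" using r[of j] by (intro power_le_one) auto
      then have "r j ^ Suc k * c k \<le> 1 * c k" using u by (intro mult_right_mono) (auto simp: c_def)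
      then show "norm (2 * r j ^ Suc k * c k) \<le> 2 * c k" using r[of j] u by (simp add: c_def abs_mult)
    qed
    show "summable (\<lambda>k. 2 * c k)" using c_sums by (rule sums_summable)
  qed simp
  then have "(\<lambda>j. integral\<^sup>L lborel (\<lambda>x. \<phi> x * poisson_kernel (r j) x)) \<longlonglongrightarrow> 1 / sqrt u + (theta3 (pi / u) - 1) / sqrt u"
    unfolding I1(2) using c_sums by (intro tendsto_intros) (simp add: sums_iff)
  then have lim1: "(\<lambda>j. integral\<^sup>L lborel (\<lambda>x. \<phi> x * poisson_kernel (r j) x)) \<longlonglongrightarrow> theta3 (pi / u) / sqrt u"
    by (simp add: add_divide_distrib[symmetric])
  have I2: "integrable lborel (\<lambda>x. \<phi> \<lfloor>x + 1 / 2\<rfloor> * poisson_kernel (r j) x)"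
     "integral\<^sup>L lborel (\<lambda>x. \<phi> \<lfloor>x + 1 / 2\<rfloor> * poisson_kernel (r j) x) = theta3 (pi * u)" for j
  proof -
    have "(\<lambda>n::int. \<phi> n) summable_on UNIV" using summable_theta3[of "pi * u"] u by (simp add: \<phi>_def)
    then show "integrable lborel (\<lambda>x. \<phi> \<lfloor>x + 1 / 2\<rfloor> * poisson_kernel (r j) x)"
     "integral\<^sup>L lborel (\<lambda>x. \<phi> \<lfloor>x + 1 / 2\<rfloor> * poisson_kernel (r j) x) = theta3 (pi * u)"
      using integral_step_poisson_kernel[OF r(3,2)[of j], of "\<lambda>n. \<phi> n"]
      by (simp_all add: \<phi>_def theta3_def)
  qed
  \<comment> \<open>a bound for the derivative of the Gaussian on a unit interval around x, up to the factor exp(-|x|)\<close>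
  define C where "C = 2 * pi * u * exp (1 / (pi * u)) * exp (1 / 2)"
  have C: "C > 0" using u by (simp add: C_def)
  have diff: "\<bar>\<phi> x - \<phi> (real_of_int \<lfloor>x + 1 / 2\<rfloor>)\<bar> \<le> C * exp (- \<bar>x\<bar>) * \<bar>x - real_of_int \<lfloor>x + 1 / 2\<rfloor>\<bar>" for x
  proof -
    have n: "x - 1 / 2 \<le> real_of_int \<lfloor>x + 1 / 2\<rfloor>" "real_of_int \<lfloor>x + 1 / 2\<rfloor> \<le> x + 1 / 2" by linarith+
    have "norm (\<phi> x - \<phi> (real_of_int \<lfloor>x + 1 / 2\<rfloor>)) \<le> (C * exp (- \<bar>x\<bar>)) * norm (x - real_of_int \<lfloor>x + 1 / 2\<rfloor>)"
    proof (rule field_differentiable_bound[where S = "{x - 1 / 2 .. x + 1 / 2}" and f' = "\<lambda>\<xi>. - 2 * pi * u * \<xi> * \<phi> \<xi>"])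
      show "(\<phi> has_field_derivative - 2 * pi * u * \<xi> * \<phi> \<xi>) (at \<xi> within {x - 1 / 2 .. x + 1 / 2})" for \<xi>
        unfolding \<phi>_def by (auto intro!: derivative_eq_intros simp: power2_eq_square)
      fix \<xi> assume \<xi>: "\<xi> \<in> {x - 1 / 2 .. x + 1 / 2}"
      have "\<bar>\<xi>\<bar> \<le> exp \<bar>\<xi>\<bar>" using exp_ge_add_one_self[of "\<bar>\<xi>\<bar>"] by linarith
      then have "\<bar>\<xi>\<bar> * \<phi> \<xi> \<le> exp \<bar>\<xi>\<bar> * \<phi> \<xi>" by (intro mult_right_mono) (auto simp: \<phi>_def)
      also have "\<dots> = exp (\<bar>\<xi>\<bar> - pi * u * \<xi>\<^sup>2)" by (simp add: \<phi>_def exp_add[symmetric])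
      also have "\<dots> \<le> exp (1 / (pi * u) - \<bar>\<xi>\<bar>)"
      proof -
        have "(pi * u * \<bar>\<xi>\<bar> - 1)\<^sup>2 \<ge> 0" by simp
        then have "2 * (pi * u) * \<bar>\<xi>\<bar> - (pi * u) * (pi * u * \<xi>\<^sup>2) \<le> 1"
          by (simp add: power2_eq_square algebra_simps)
        then have "2 * \<bar>\<xi>\<bar> - pi * u * \<xi>\<^sup>2 \<le> 1 / (pi * u)"
          using u by (simp add: field_simps)
        then show ?thesis by simp
      qed
      also have "\<dots> \<le> exp (1 / (pi * u) + 1 / 2 - \<bar>x\<bar>)" using \<xi> by auto
      also have "\<dots> = exp (1 / (pi * u)) * exp (1 / 2) * exp (- \<bar>x\<bar>)" by (simp add: exp_add[symmetric] exp_diff[symmetric])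
      finally have "2 * pi * u * (\<bar>\<xi>\<bar> * \<phi> \<xi>) \<le> 2 * pi * u * (exp (1 / (pi * u)) * exp (1 / 2) * exp (- \<bar>x\<bar>))"
        using u by (intro mult_left_mono) auto
      then show "norm (- 2 * pi * u * \<xi> * \<phi> \<xi>) \<le> C * exp (- \<bar>x\<bar>)"
        using u by (simp add: C_def abs_mult mult_ac \<phi>_def)
    qed (use n in auto)
    then show ?thesis by simp
  qed
  have "(\<lambda>j. integral\<^sup>L lborel (\<lambda>x. \<phi> x * poisson_kernel (r j) x - \<phi> \<lfloor>x + 1 / 2\<rfloor> * poisson_kernel (r j) x))
      \<longlonglongrightarrow> integral\<^sup>L lborel (\<lambda>x::real. 0::real)"
  proof (rule integral_dominated_convergence[where w = "\<lambda>x. 2 * C * exp (- 1 * \<bar>x\<bar>)"])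
    show "integrable lborel (\<lambda>x::real. 2 * C * exp (- 1 * \<bar>x\<bar>))"
      using integrable_exp_minus_abs[of 1] by simp
    show "(\<lambda>x. \<phi> x * poisson_kernel (r j) x - \<phi> \<lfloor>x + 1 / 2\<rfloor> * poisson_kernel (r j) x) \<in> borel_measurable lborel" for j
      using Bochner_Integration.integrable_diff[OF I1(1)[of j] I2(1)[of j]] by auto
    show "AE x in lborel. norm (\<phi> x * poisson_kernel (r j) x - \<phi> \<lfloor>x + 1 / 2\<rfloor> * poisson_kernel (r j) x)
        \<le> 2 * C * exp (- 1 * \<bar>x\<bar>)" for j
    proof (rule AE_I2)
      fix x :: real
      have "norm (\<phi> x * poisson_kernel (r j) x - \<phi> \<lfloor>x + 1 / 2\<rfloor> * poisson_kernel (r j) x)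
          = \<bar>\<phi> x - \<phi> \<lfloor>x + 1 / 2\<rfloor>\<bar> * poisson_kernel (r j) x"
        using poisson_kernel_nonneg[OF r(3,2), of j x] by (simp add: left_diff_distrib[symmetric] abs_mult)
      also have "\<dots> \<le> (C * exp (- \<bar>x\<bar>) * \<bar>x - real_of_int \<lfloor>x + 1 / 2\<rfloor>\<bar>) * poisson_kernel (r j) x"
        using diff[of x] poisson_kernel_nonneg[OF r(3,2), of j x] by (rule mult_right_mono)
      also have "\<dots> = C * exp (- \<bar>x\<bar>) * (\<bar>x - real_of_int \<lfloor>x + 1 / 2\<rfloor>\<bar> * poisson_kernel (r j) x)" by simp
      also have "\<dots> \<le> C * exp (- \<bar>x\<bar>) * 2"
      proof (rule mult_left_mono)
        have "\<bar>x - real_of_int \<lfloor>x + 1 / 2\<rfloor>\<bar> \<le> 1 / 2" by linarith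
        then show "\<bar>x - real_of_int \<lfloor>x + 1 / 2\<rfloor>\<bar> * poisson_kernel (r j) x \<le> 2"
          by (intro poisson_kernel_bound r)
      qed (use C in simp)
      finally show "norm (\<phi> x * poisson_kernel (r j) x - \<phi> \<lfloor>x + 1 / 2\<rfloor> * poisson_kernel (r j) x)
        \<le> 2 * C * exp (- 1 * \<bar>x\<bar>)" by simp
    qed
    show "AE x in lborel. (\<lambda>j. \<phi> x * poisson_kernel (r j) x - \<phi> \<lfloor>x + 1 / 2\<rfloor> * poisson_kernel (r j) x) \<longlonglongrightarrow> 0"
    proof (rule AE_I2)
      fix x :: real
      show "(\<lambda>j. \<phi> x * poisson_kernel (r j) x - \<phi> \<lfloor>x + 1 / 2\<rfloor> * poisson_kernel (r j) x) \<longlonglongrightarrow> 0"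
      \<comment> \<open>at an integer the two values of the Gaussian coincide; elsewhere the kernel tends to 0\<close>
      proof (cases "cos (2 * pi * x) = 1")
        case True
        then obtain m :: int where "2 * pi * x = of_int m * 2 * pi" using cos_one_2pi_int by auto
        then have "x = of_int m" by simp
        then have "\<lfloor>x + 1 / 2\<rfloor> = m" by linarith
        then have "\<phi> \<lfloor>x + 1 / 2\<rfloor> = \<phi> x" using \<open>x = of_int m\<close> by simp
        then show ?thesis by simp
      next
        case False
        have "(\<lambda>j. poisson_kernel (r j) x) \<longlonglongrightarrow> (1 - 1\<^sup>2) / (1 - 2 * 1 * cos (2 * pi * x) + 1\<^sup>2)"
          unfolding poisson_kernel_def using False by (intro tendsto_intros r_lim) auto
        then have "(\<lambda>j. poisson_kernel (r j) x) \<longlonglongrightarrow> 0" by simp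
        then have "(\<lambda>j. \<phi> x * poisson_kernel (r j) x - \<phi> \<lfloor>x + 1 / 2\<rfloor> * poisson_kernel (r j) x) \<longlonglongrightarrow> \<phi> x * 0 - \<phi> \<lfloor>x + 1 / 2\<rfloor> * 0"
          by (intro tendsto_intros)
        then show ?thesis by simp
      qed
    qed
  qed simp
  then have "(\<lambda>j. integral\<^sup>L lborel (\<lambda>x. \<phi> x * poisson_kernel (r j) x) - theta3 (pi * u)) \<longlonglongrightarrow> 0"
    using Bochner_Integration.integral_diff[OF I1(1) I2(1)] by (simp add: I2(2))
  then have "(\<lambda>j. integral\<^sup>L lborel (\<lambda>x. \<phi> x * poisson_kernel (r j) x)) \<longlonglongrightarrow> theta3 (pi * u)"
    by (simp add: LIM_zero_iff)
  then show ?thesis using lim1 by (rule LIMSEQ_unique)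
qed

section \<open>The integral representation of the Bessel function K\<close>

text \<open>From x^k \<le> k^k e^x, which follows from x / k \<le> e^(x / k).\<close>

lemma power_mult_exp_bound:
  fixes t s :: real
  assumes "t \<ge> 0" "s > 0"
  shows "t ^ k \<le> (real k / s) ^ k * exp (s * t)"
proof (cases "k = 0")
  case False
  have "s * t / real k \<le> exp (s * t / real k)"
    using exp_ge_add_one_self[of "s * t / real k"] by linarith
  then have "t \<le> (real k / s) * exp (s * t / real k)"
    using False assms by (simp add: field_simps)
  then have "t ^ k \<le> ((real k / s) * exp (s * t / real k)) ^ k"
    using assms by (intro power_mono) auto
  also have "\<dots> = (real k / s) ^ k * exp (s * t)"
    using False by (simp add: power_mult_distrib power_divide exp_of_nat_mult[symmetric])
  finally show ?thesis .
qed (use assms in simp)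

lemma cosh_ge_half_abs: "cosh x \<ge> \<bar>x\<bar> / 2" for x :: real
proof -
  have "exp \<bar>x\<bar> \<le> 2 * cosh \<bar>x\<bar>" by (simp add: cosh_def)
  then have "exp \<bar>x\<bar> \<le> 2 * cosh x" by (simp add: cosh_real_abs)
  then show ?thesis using exp_ge_add_one_self[of "\<bar>x\<bar>"] by linarith
qed

lemma integrable_cosh_power_exp:
  assumes "\<delta> > 0"
  shows "integrable lborel (\<lambda>x::real. cosh x ^ k * exp (- \<delta> * cosh x))"
proof (rule integrable_exp_decay)
  show "norm (cosh x ^ k * exp (- \<delta> * cosh x)) \<le> (real k / (\<delta> / 2)) ^ k * exp (- (\<delta> / 4) * \<bar>x\<bar>)" for x :: real
  proof -
    have "cosh x ^ k * exp (- \<delta> * cosh x) \<le> ((real k / (\<delta> / 2)) ^ k * exp (\<delta> / 2 * cosh x)) * exp (- \<delta> * cosh x)"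
      using assms by (intro mult_right_mono power_mult_exp_bound) auto
    also have "\<dots> = (real k / (\<delta> / 2)) ^ k * exp (- (\<delta> / 2) * cosh x)"
      by (simp add: exp_add[symmetric] mult.assoc)
    also have "\<dots> \<le> (real k / (\<delta> / 2)) ^ k * exp (- (\<delta> / 4) * \<bar>x\<bar>)"
    proof (rule mult_left_mono)
      have "\<delta> / 2 * (\<bar>x\<bar> / 2) \<le> \<delta> / 2 * cosh x"
        using assms cosh_ge_half_abs[of x] by (intro mult_left_mono) auto
      then show "exp (- (\<delta> / 2) * cosh x) \<le> exp (- (\<delta> / 4) * \<bar>x\<bar>)" by simp
    qed (use assms in simp)
    finally show ?thesis by simp
  qed
  show "(\<lambda>x::real. cosh x ^ k * exp (- \<delta> * cosh x)) \<in> borel_measurable borel"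
    by (intro borel_measurable_continuous_onI continuous_intros)
qed (use assms in auto)

lemma of_real_cosh: "complex_of_real (cosh x) = cosh (of_real x)"
  by (simp add: cosh_def scaleR_conv_of_real exp_of_real[symmetric] del: exp_of_real)

lemma of_real_sinh: "complex_of_real (sinh x) = sinh (of_real x)"
  by (simp add: sinh_def scaleR_conv_of_real exp_of_real[symmetric] del: exp_of_real)

text \<open>The k-th derivative, up to sign, of the classical integral for the modified Bessel function of the second
kind of order 0, which is half of the integral of exp(-z cosh x) over the whole line. For k = 1 it is the
function of order 1.\<close>

definition K_cosh :: "nat \<Rightarrow> complex \<Rightarrow> complex" where
  "K_cosh k z = 1 / 2 * (\<integral>x. of_real (cosh x ^ k) * exp (- z * of_real (cosh x)) \<partial>lborel)"

lemma norm_K_cosh_integrand: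
  "norm (complex_of_real (cosh x ^ k) * exp (- z * of_real (cosh x))) = cosh x ^ k * exp (- Re z * cosh x)"
  by (simp add: norm_mult norm_power)

lemma integrable_K_cosh:
  assumes "Re z > 0"
  shows "integrable lborel (\<lambda>x. complex_of_real (cosh x ^ k) * exp (- z * of_real (cosh x)))"
proof (rule Bochner_Integration.integrable_bound[OF integrable_cosh_power_exp[OF assms, of k]])
  show "(\<lambda>x. complex_of_real (cosh x ^ k) * exp (- z * of_real (cosh x))) \<in> borel_measurable lborel"
    by (simp, intro borel_measurable_continuous_onI continuous_intros)
qed (auto simp: norm_mult norm_power)

lemma K_cosh_deriv:
  assumes "Re z > 0"
  shows "(K_cosh k has_field_derivative - K_cosh (Suc k) z) (at z)"
proof -
  define \<delta> where "\<delta> = Re z / 2"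
  have \<delta>: "\<delta> > 0" "Re z > \<delta>" using assms by (auto simp: \<delta>_def)
  let ?\<phi> = "\<lambda>z x. complex_of_real (cosh x ^ k) * exp (- z * of_real (cosh x))"
  let ?\<phi>' = "\<lambda>z x. - (complex_of_real (cosh x ^ Suc k) * exp (- z * of_real (cosh x)))"
  have "((\<lambda>z. integral\<^sup>L lborel (?\<phi> z)) has_field_derivative integral\<^sup>L lborel (?\<phi>' z)) (at z)"
  proof (rule has_field_derivative_integral[where S = "{z. Re z > \<delta>}" and G = "\<lambda>x. cosh x ^ Suc k * exp (- \<delta> * cosh x)"])
    show "?\<phi>' z \<in> borel_measurable lborel"
      using borel_measurable_integrable[OF integrable_K_cosh[OF assms, of "Suc k"]] by measurable
    show "integrable lborel (\<lambda>x::real. cosh x ^ Suc k * exp (- \<delta> * cosh x))"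
      by (rule integrable_cosh_power_exp[OF \<delta>(1)])
    show "((\<lambda>z. ?\<phi> z x) has_field_derivative ?\<phi>' w x) (at w)" for w x
      by (auto intro!: derivative_eq_intros)
    fix w x assume "w \<in> {z. Re z > \<delta>}"
    then have "exp (- Re w * cosh x) \<le> exp (- \<delta> * cosh x)" by simp
    then show "norm (?\<phi>' w x) \<le> cosh x ^ Suc k * exp (- \<delta> * cosh x)"
      unfolding norm_minus_cancel norm_K_cosh_integrand by (intro mult_left_mono) auto
  next
    fix w assume "w \<in> {z. Re z > \<delta>}"
    then show "integrable lborel (?\<phi> w)" using \<delta> by (intro integrable_K_cosh) auto
  qed (use \<delta> in \<open>auto simp: open_halfspace_Re_gt convex_halfspace_Re_gt\<close>)
  then have "((\<lambda>z. 1 / 2 * integral\<^sup>L lborel (?\<phi> z)) has_field_derivative 1 / 2 * integral\<^sup>L lborel (?\<phi>' z)) (at z)"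
    by (rule DERIV_cmult)
  then show ?thesis
    unfolding K_cosh_def[abs_def] by simp
qed

lemma tendsto_exp_cosh:
  fixes z :: complex
  assumes "Re z > 0"
  shows "((\<lambda>x. of_real (sinh x) * exp (- z * of_real (cosh x))) \<longlongrightarrow> 0) at_bot"
    and "((\<lambda>x. of_real (sinh x) * exp (- z * of_real (cosh x))) \<longlongrightarrow> 0) at_top"
proof -
  have b: "norm (of_real (sinh x) * exp (- z * of_real (cosh x))) \<le> (1 / (Re z / 2)) * exp (- (Re z / 4) * \<bar>x\<bar>)" for x
  proof -
    have "norm (of_real (sinh x) * exp (- z * of_real (cosh x))) = \<bar>sinh x\<bar> * exp (- Re z * cosh x)"
      by (simp add: norm_mult)
    also have "\<bar>sinh x\<bar> \<le> cosh x" by (simp add: sinh_def cosh_def abs_le_iff)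
    then have "\<bar>sinh x\<bar> * exp (- Re z * cosh x) \<le> cosh x * exp (- Re z * cosh x)" by (intro mult_right_mono) auto
    also have "\<dots> \<le> ((real 1 / (Re z / 2)) ^ 1 * exp (Re z / 2 * cosh x)) * exp (- Re z * cosh x)"
      using assms power_mult_exp_bound[of "cosh x" "Re z / 2" 1] by (intro mult_right_mono) auto
    also have "\<dots> = (1 / (Re z / 2)) * exp (- (Re z / 2) * cosh x)"
      by (simp add: exp_add[symmetric] mult.assoc)
    also have "\<dots> \<le> (1 / (Re z / 2)) * exp (- (Re z / 4) * \<bar>x\<bar>)"
    proof (rule mult_left_mono)
      have "Re z / 2 * (\<bar>x\<bar> / 2) \<le> Re z / 2 * cosh x"
        using assms cosh_ge_half_abs[of x] by (intro mult_left_mono) auto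
      then show "exp (- (Re z / 2) * cosh x) \<le> exp (- (Re z / 4) * \<bar>x\<bar>)" by simp
    qed (use assms in simp)
    finally show ?thesis .
  qed
  have t: "((\<lambda>x::real. (1 / (Re z / 2)) * exp (- (Re z / 4) * \<bar>x\<bar>)) \<longlongrightarrow> 0) at_top"
    "((\<lambda>x::real. (1 / (Re z / 2)) * exp (- (Re z / 4) * \<bar>x\<bar>)) \<longlongrightarrow> 0) at_bot"
    using assms by real_asymp+
  show "((\<lambda>x. of_real (sinh x) * exp (- z * of_real (cosh x))) \<longlongrightarrow> 0) at_bot"
    by (rule Lim_null_comparison[OF _ t(2)]) (use b in auto)
  show "((\<lambda>x. of_real (sinh x) * exp (- z * of_real (cosh x))) \<longlongrightarrow> 0) at_top"
    by (rule Lim_null_comparison[OF _ t(1)]) (use b in auto)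
qed

text \<open>Bessel's equation of order 0. The integrand of the difference of the two sides is, up to a constant factor, the derivative of
sinh x exp(-z cosh x), which vanishes at both ends.\<close>

lemma K_cosh_bessel_equation:
  assumes z: "Re z > 0"
  shows "z * K_cosh 2 z = K_cosh 1 z + z * K_cosh 0 z"
proof -
  let ?e = "\<lambda>x. exp (- z * complex_of_real (cosh x))"
  let ?f = "\<lambda>x. of_real (cosh x ^ 1) * ?e x - z * (of_real (cosh x ^ 2) * ?e x) + z * (of_real (cosh x ^ 0) * ?e x)"
  have int: "integrable lborel ?f"
    by (intro Bochner_Integration.integrable_add Bochner_Integration.integrable_diff integrable_mult_right integrable_K_cosh z)
  have "integral\<^sup>L lborel ?f = 0 - 0"
  proof (rule integral_FTC_UNIV[OF _ _ int tendsto_exp_cosh[OF z]])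
    show "((\<lambda>x. of_real (sinh x) * ?e x) has_vector_derivative ?f x) (at x)" for x
    proof -
      have "((\<lambda>w. sinh w * exp (- z * cosh w)) has_field_derivative
          cosh (of_real x) * exp (- z * cosh (of_real x)) + sinh (of_real x) * (- z * sinh (of_real x) * exp (- z * cosh (of_real x)))) (at (of_real x))"
        by (auto intro!: derivative_eq_intros)
      from has_vector_derivative_real_field[OF this]
      have "((\<lambda>x. of_real (sinh x) * ?e x) has_vector_derivative
          of_real (cosh x) * ?e x + of_real (sinh x) * (- z * of_real (sinh x) * ?e x)) (at x)"
        by (simp only: of_real_cosh of_real_sinh)
      also have "of_real (cosh x) * ?e x + of_real (sinh x) * (- z * of_real (sinh x) * ?e x)
          = of_real (cosh x) * ?e x - z * (of_real (sinh x ^ 2) * ?e x)"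
        by (simp add: power2_eq_square)
      also have "\<dots> = ?f x" by (simp add: sinh_square_eq algebra_simps)
      finally show ?thesis .
    qed
    show "isCont ?f x" for x by (intro continuous_intros)
  qed
  moreover have "integral\<^sup>L lborel ?f = integral\<^sup>L lborel (\<lambda>x. of_real (cosh x ^ 1) * ?e x)
      - z * integral\<^sup>L lborel (\<lambda>x. of_real (cosh x ^ 2) * ?e x) + z * integral\<^sup>L lborel (\<lambda>x. of_real (cosh x ^ 0) * ?e x)"
    using integrable_K_cosh[OF z, of 0] integrable_K_cosh[OF z, of 1] integrable_K_cosh[OF z, of 2]
    by (subst Bochner_Integration.integral_add Bochner_Integration.integral_diff;
        (intro Bochner_Integration.integrable_diff integrable_mult_right)?; simp)+
  ultimately show ?thesis unfolding K_cosh_def by (simp add: algebra_simps)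
qed

abbreviation K0 :: "complex \<Rightarrow> complex" where "K0 \<equiv> K_cosh 0"

lemma K0_eq: "K0 z = 1 / 2 * (\<integral>x. exp (- z * of_real (cosh x)) \<partial>lborel)"
  by (simp add: K_cosh_def)

lemma holomorphic_K0: "K0 holomorphic_on {z. Re z > 0}"
  using K_cosh_deriv by (auto simp: holomorphic_on_open open_halfspace_Re_gt)

text \<open>In the integral, cosh x \<ge> 1 allows the factor exp(\<delta> - Re z) to be taken out.\<close>

lemma K0_bound:
  assumes "\<delta> > 0"
  obtains C where "C \<ge> 0" "\<And>z. Re z \<ge> \<delta> \<Longrightarrow> norm (K0 z) \<le> C * exp (- Re z)"
proof -
  let ?C = "1 / 2 * exp \<delta> * (\<integral>x. exp (- \<delta> * cosh x) \<partial>lborel)"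
  have nn: "(\<integral>x. exp (- \<delta> * cosh x) \<partial>lborel) \<ge> 0" by simp
  show ?thesis
  proof (rule that[of ?C])
    show "?C \<ge> 0" using nn by simp
    fix z assume z: "Re z \<ge> \<delta>"
    have "norm (\<integral>x. exp (- z * complex_of_real (cosh x)) \<partial>lborel) \<le> (\<integral>x. exp (\<delta> - Re z) * exp (- \<delta> * cosh x) \<partial>lborel)"
    proof (rule Bochner_Integration.integral_norm_bound_integral)
      show "integrable lborel (\<lambda>x. exp (- z * complex_of_real (cosh x)))"
        using integrable_K_cosh[of z 0] z assms by simp
      show "integrable lborel (\<lambda>x::real. exp (\<delta> - Re z) * exp (- \<delta> * cosh x))"
        using integrable_cosh_power_exp[OF assms, of 0] by simp
      show "norm (exp (- z * complex_of_real (cosh x))) \<le> exp (\<delta> - Re z) * exp (- \<delta> * cosh x)" for x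
      proof -
        have "(Re z - \<delta>) * 1 \<le> (Re z - \<delta>) * cosh x"
          using z cosh_real_ge_1[of x] by (intro mult_left_mono) auto
        then show ?thesis by (simp add: exp_add[symmetric] algebra_simps)
      qed
    qed
    then have "norm (K0 z) \<le> 1 / 2 * (exp (\<delta> - Re z) * (\<integral>x. exp (- \<delta> * cosh x) \<partial>lborel))"
      unfolding K0_eq by (simp add: norm_mult)
    also have "\<dots> = ?C * exp (- Re z)" by (simp add: exp_diff exp_minus field_simps)
    finally show "norm (K0 z) \<le> ?C * exp (- Re z)" .
  qed
qed

lemma K0_of_real: "K0 (of_real x) = of_real (1 / 2 * (\<integral>t. exp (- x * cosh t) \<partial>lborel))"
proof -
  have "exp (- of_real x * complex_of_real (cosh t)) = of_real (exp (- x * cosh t))" for t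
    by (simp only: exp_of_real[symmetric] of_real_mult of_real_minus)
  then show ?thesis unfolding K0_eq by simp
qed

text \<open>The substitution of x + ln (sqrt (B / A)) for x makes the exponent symmetric.\<close>

lemma K0_two_sided_integral:
  fixes A B :: real
  assumes "A > 0" "B > 0"
  shows "integrable lborel (\<lambda>x. exp (- A * exp x - B * exp (- x)))"
    and "K0 (of_real (2 * sqrt (A * B))) = of_real (1 / 2 * (\<integral>x. exp (- A * exp x - B * exp (- x)) \<partial>lborel))"
proof -
  define s where "s = ln (B / A) / 2"
  have "(exp s)\<^sup>2 = B / A"
    using assms by (simp add: s_def power2_eq_square exp_add[symmetric])
  moreover from this have "(exp (- s))\<^sup>2 = A / B"
    by (simp add: exp_minus power_inverse)
  ultimately have "(exp s)\<^sup>2 = B / A" "(exp (- s))\<^sup>2 = A / B" by auto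
  then have es: "exp s = sqrt (B / A)" "exp (- s) = sqrt (A / B)"
    using real_sqrt_unique[of "exp s"] real_sqrt_unique[of "exp (- s)"] by auto
  have A: "A * sqrt (B / A) = sqrt (A * B)"
    using assms by (simp add: real_sqrt_divide real_sqrt_mult field_simps)
  have B: "B * sqrt (A / B) = sqrt (A * B)"
    using assms by (simp add: real_sqrt_divide real_sqrt_mult field_simps)
  have eq: "exp (- A * exp (s + 1 * x) - B * exp (- (s + 1 * x))) = exp (- (2 * sqrt (A * B)) * cosh x)" for x
  proof -
    have "A * exp (s + x) = sqrt (A * B) * exp x" unfolding exp_add es using A by simp
    moreover have "B * exp (- (s + x)) = sqrt (A * B) * exp (- x)"
      using B unfolding minus_add_distrib exp_add es by simp
    ultimately show ?thesis by (simp add: cosh_def algebra_simps)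
  qed
  have pos: "2 * sqrt (A * B) > 0" using assms by simp
  show "integrable lborel (\<lambda>x. exp (- A * exp x - B * exp (- x)))"
    using integrable_cosh_power_exp[OF pos, of 0] lborel_integrable_real_affine_iff[of 1 "\<lambda>x. exp (- A * exp x - B * exp (- x))" s]
    unfolding eq by simp
  show "K0 (of_real (2 * sqrt (A * B))) = of_real (1 / 2 * (\<integral>x. exp (- A * exp x - B * exp (- x)) \<partial>lborel))"
    using lborel_integral_real_affine[of 1 "\<lambda>x. exp (- A * exp x - B * exp (- x))" s]
    unfolding K0_of_real eq by simp
qed

lemma norm_sinh_le_cosh_Re: "norm (sinh w) \<le> cosh (Re w)" for w :: complex
proof -
  have "norm (sinh w) = norm (exp w - exp (- w)) / 2" by (simp add: sinh_def scaleR_conv_of_real norm_mult)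
  also have "\<dots> \<le> (norm (exp w) + norm (exp (- w))) / 2" by (intro divide_right_mono norm_triangle_ineq4) auto
  also have "\<dots> = cosh (Re w)" by (simp add: cosh_def)
  finally show ?thesis .
qed

lemma Re_cosh: "Re (cosh w) = cosh (Re w) * cos (Im w)" for w :: complex
  by (simp add: cosh_def scaleR_conv_of_real Re_exp algebra_simps)

lemma cosh_add_bounds:
  fixes x t :: real
  assumes "\<bar>x\<bar> \<le> 1"
  shows "cosh (t + x) \<le> exp 1 * cosh t" "exp (- 1) * cosh t \<le> cosh (t + x)"
proof -
  have *: "cosh (t + x) \<le> exp 1 * cosh t" if "\<bar>x\<bar> \<le> 1" for x t :: real
  proof -
    have "exp (t + x) \<le> exp (t + 1)" "exp (- (t + x)) \<le> exp (1 - t)" using that by auto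
    then have "cosh (t + x) \<le> (exp (t + 1) + exp (1 - t)) / 2" by (simp add: cosh_def del: exp_le_cancel_iff)
    also have "\<dots> = exp 1 * cosh t" by (simp add: cosh_def exp_add exp_diff exp_minus field_simps)
    finally show ?thesis .
  qed
  show "cosh (t + x) \<le> exp 1 * cosh t" by (rule *[OF assms])
  have "cosh (t + x + - x) \<le> exp 1 * cosh (t + x)" by (rule *) (use assms in simp)
  then show "exp (- 1) * cosh t \<le> cosh (t + x)" by (simp add: exp_minus field_simps)
qed

text \<open>The path of integration is moved from the real line to the parallel line at height \<phi>. The integral is a
holomorphic function of the shift z, with derivative the integral of a total derivative in t, hence 0; so it
is constant on a rectangle that contains both 0 and i \<phi>.\<close>

lemma K0_rotated_integral:
  fixes \<rho> \<phi> :: real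
  assumes \<rho>: "\<rho> > 0" and \<phi>: "\<bar>\<phi>\<bar> < pi / 2"
  shows "(\<integral>t. exp (- of_real \<rho> * cosh (of_real t + \<i> * of_real \<phi>)) \<partial>lborel) = 2 * K0 (of_real \<rho>)"
proof -
  \<comment> \<open>strictly between |\<phi>| and pi/2: the rectangle of half-height \<psi> contains i \<phi>, and cos is bounded below by cos \<psi> > 0 on it\<close>
  define \<psi> where "\<psi> = (\<bar>\<phi>\<bar> + pi / 2) / 2"
  have \<psi>: "\<bar>\<phi>\<bar> < \<psi>" "\<psi> < pi / 2" "0 < \<psi>" using \<phi> by (auto simp: \<psi>_def)
  define S where "S = {z::complex. \<bar>Re z\<bar> < 1} \<inter> {z. \<bar>Im z\<bar> < \<psi>}"
  have S_eq: "S = {z. Re z < 1} \<inter> {z. Re z > - 1} \<inter> {z. Im z < \<psi>} \<inter> {z. Im z > - \<psi>}"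
    by (auto simp: S_def abs_less_iff)
  have S: "open S" "convex S"
    unfolding S_eq by (intro open_Int convex_Int open_halfspace_Re_lt open_halfspace_Re_gt open_halfspace_Im_lt open_halfspace_Im_gt
        convex_halfspace_Re_lt convex_halfspace_Re_gt convex_halfspace_Im_lt convex_halfspace_Im_gt)+
  let ?f = "\<lambda>z t. exp (- of_real \<rho> * cosh (of_real t + z)) :: complex"
  let ?f' = "\<lambda>z t. - of_real \<rho> * sinh (of_real t + z) * exp (- of_real \<rho> * cosh (of_real t + z)) :: complex"
  define \<delta> where "\<delta> = \<rho> * exp (- 1) * cos \<psi>"
  have cos\<psi>: "cos \<psi> > 0" using \<psi> by (intro cos_gt_zero_pi) auto
  have \<delta>: "\<delta> > 0" using \<rho> cos\<psi> by (simp add: \<delta>_def)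
  have nf: "norm (?f z t) \<le> exp (- \<delta> * cosh t)" if "z \<in> S" for z t
  proof -
    have "cos \<psi> \<le> cos (Im z)"
      using that \<psi> cos_monotone_0_pi_le[of "\<bar>Im z\<bar>" \<psi>] by (simp add: S_def cos_abs_real)
    then have "(exp (- 1) * cosh t) * cos \<psi> \<le> cosh (t + Re z) * cos (Im z)"
      using that cosh_add_bounds(2)[of "Re z" t] cos\<psi> by (intro mult_mono) (auto simp: S_def)
    then have "\<rho> * ((exp (- 1) * cosh t) * cos \<psi>) \<le> \<rho> * (cosh (t + Re z) * cos (Im z))"
      using \<rho> by (intro mult_left_mono) auto
    then show ?thesis by (simp add: Re_cosh \<delta>_def mult_ac)
  qed
  have nf': "norm (?f' z t) \<le> \<rho> * exp 1 * (cosh t ^ 1 * exp (- \<delta> * cosh t))" if "z \<in> S" for z t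
  proof -
    have "norm (sinh (of_real t + z)) \<le> cosh (t + Re z)" using norm_sinh_le_cosh_Re[of "of_real t + z"] by simp
    also have "\<dots> \<le> exp 1 * cosh t" using that by (intro cosh_add_bounds) (auto simp: S_def)
    finally have "norm (sinh (of_real t + z)) * norm (?f z t) \<le> (exp 1 * cosh t) * exp (- \<delta> * cosh t)"
      using nf[OF that] by (intro mult_mono) auto
    then have "\<rho> * (norm (sinh (of_real t + z)) * norm (?f z t)) \<le> \<rho> * ((exp 1 * cosh t) * exp (- \<delta> * cosh t))"
      using \<rho> by (intro mult_left_mono) auto
    then show ?thesis using \<rho> by (simp add: norm_mult mult_ac)
  qed
  have cont: "continuous_on UNIV (?f z)" "continuous_on UNIV (?f' z)" for z
    unfolding cosh_def sinh_def by (intro continuous_intros)+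
  have int: "integrable lborel (?f z)" if "z \<in> S" for z
    by (rule Bochner_Integration.integrable_bound[OF integrable_cosh_power_exp[OF \<delta>, of 0]])
      (use nf[OF that] cont in \<open>auto intro: borel_measurable_continuous_onI\<close>)
  have G: "integrable lborel (\<lambda>t. \<rho> * exp 1 * (cosh t ^ 1 * exp (- \<delta> * cosh t)))"
    by (intro integrable_mult_right integrable_cosh_power_exp \<delta>)
  have int': "integrable lborel (?f' z)" if "z \<in> S" for z
  proof (rule Bochner_Integration.integrable_bound[OF G])
    show "?f' z \<in> borel_measurable lborel"
      using borel_measurable_continuous_onI[OF cont(2)[of z]] by simp
    show "AE t in lborel. norm (?f' z t) \<le> norm (\<rho> * exp 1 * (cosh t ^ 1 * exp (- \<delta> * cosh t)))"
      using nf'[OF that] by (intro AE_I2) (metis abs_ge_self order_trans real_norm_def)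
  qed
  have lim: "(?f z \<longlongrightarrow> 0) at_bot" "(?f z \<longlongrightarrow> 0) at_top" if "z \<in> S" for z
  proof -
    have b: "norm (?f z t) \<le> exp (- (\<delta> / 2) * \<bar>t\<bar>)" for t
    proof -
      have "\<delta> * (\<bar>t\<bar> / 2) \<le> \<delta> * cosh t" using \<delta> cosh_ge_half_abs[of t] by (intro mult_left_mono) auto
      then have "exp (- \<delta> * cosh t) \<le> exp (- (\<delta> / 2) * \<bar>t\<bar>)" by simp
      with nf[OF that, of t] show ?thesis by linarith
    qed
    have t: "((\<lambda>x::real. exp (- (\<delta> / 2) * \<bar>x\<bar>)) \<longlongrightarrow> 0) at_top" "((\<lambda>x::real. exp (- (\<delta> / 2) * \<bar>x\<bar>)) \<longlongrightarrow> 0) at_bot"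
      using \<delta> by real_asymp+
    show "(?f z \<longlongrightarrow> 0) at_bot" by (rule Lim_null_comparison[OF _ t(2)]) (use b in auto)
    show "(?f z \<longlongrightarrow> 0) at_top" by (rule Lim_null_comparison[OF _ t(1)]) (use b in auto)
  qed
  have der: "((\<lambda>z. ?f z t) has_field_derivative ?f' z t) (at z)" for z t
    by (auto intro!: derivative_eq_intros)
  have zero: "integral\<^sup>L lborel (?f' z) = 0" if "z \<in> S" for z
  proof -
    have "integral\<^sup>L lborel (?f' z) = 0 - 0"
    proof (rule integral_FTC_UNIV[OF _ _ int'[OF that] lim[OF that]])
      fix t
      have "((\<lambda>w. exp (- of_real \<rho> * cosh (w + z))) has_field_derivative ?f' z t) (at (of_real t))"
        by (auto intro!: derivative_eq_intros)
      from has_vector_derivative_real_field[OF this]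
      show "(?f z has_vector_derivative ?f' z t) (at t)" by simp
      show "isCont (?f' z) t" using cont(2)[of z] by (simp add: continuous_on_eq_continuous_at)
    qed
    then show ?thesis by simp
  qed
  have "((\<lambda>z. integral\<^sup>L lborel (?f z)) has_field_derivative 0) (at z within S)" if "z \<in> S" for z
  proof -
    have "((\<lambda>z. integral\<^sup>L lborel (?f z)) has_field_derivative integral\<^sup>L lborel (?f' z)) (at z)"
    proof (rule has_field_derivative_integral[OF S that int der _ G nf'])
      show "?f' z \<in> borel_measurable lborel"
        using borel_measurable_continuous_onI[OF cont(2)[of z]] by simp
    qed
    then show ?thesis using zero[OF that] has_field_derivative_at_within by metis
  qed
  from has_field_derivative_zero_constant[OF S(2) this]
  obtain c where c: "\<And>z. z \<in> S \<Longrightarrow> integral\<^sup>L lborel (?f z) = c" by blast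
  have "0 \<in> S" "\<i> * of_real \<phi> \<in> S" using \<psi> by (auto simp: S_def)
  then have "integral\<^sup>L lborel (?f (\<i> * of_real \<phi>)) = integral\<^sup>L lborel (?f 0)" using c by (simp only:)
  also have "?f 0 = (\<lambda>t. exp (- of_real \<rho> * of_real (cosh t)))"
    by (simp add: of_real_cosh)
  finally show ?thesis by (simp add: K0_eq)
qed

section \<open>Euler's constant and the Bessel function K near the origin\<close>

text \<open>The identity theorem, with agreement on a short interval of real numbers.\<close>

lemma eq_on_right_half_plane:
  fixes f g :: "complex \<Rightarrow> complex"
  assumes f: "f holomorphic_on {z. Re z > 0}" and g: "g holomorphic_on {z. Re z > 0}"
    and "\<epsilon> > 0" and eq: "\<And>x. 0 < x \<Longrightarrow> x < \<epsilon> \<Longrightarrow> f (of_real x) = g (of_real x)"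
    and w: "Re w > 0"
  shows "f w = g w"
proof -
  let ?U = "complex_of_real ` {0<..<\<epsilon>}" and ?\<xi> = "complex_of_real (\<epsilon> / 2)"
  have "(\<lambda>z. f z - g z) w = 0"
  proof (rule analytic_continuation[where f = "\<lambda>z. f z - g z" and S = "{z. Re z > 0}" and U = ?U and \<xi> = ?\<xi>])
    show "(\<lambda>z. f z - g z) holomorphic_on {z. Re z > 0}" by (intro holomorphic_intros f g)
    show "connected {z. Re z > 0}" by (intro convex_connected convex_halfspace_Re_gt)
    show "?\<xi> islimpt ?U" unfolding islimpt_approachable
    proof (intro allI impI)
      fix e :: real assume e: "e > 0"
      define d where "d = min e \<epsilon> / 4"
      have d: "d > 0" "d < e" "d < \<epsilon> / 2" using e assms(3) by (auto simp: d_def)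
      have "complex_of_real (\<epsilon> / 2 + d) \<in> ?U" using d assms(3) by (intro imageI) auto
      moreover have "complex_of_real (\<epsilon> / 2 + d) \<noteq> ?\<xi>" using d by (simp only: of_real_eq_iff)
      moreover have "dist (complex_of_real (\<epsilon> / 2 + d)) ?\<xi> < e" using d by (simp add: dist_norm)
      ultimately show "\<exists>x'\<in>?U. x' \<noteq> ?\<xi> \<and> dist x' ?\<xi> < e" by blast
    qed
  qed (use assms in \<open>auto simp: open_halfspace_Re_gt\<close>)
  then show ?thesis by simp
qed

lemma exp_half_line:
  assumes d: "d > 0"
  shows "integrable lborel (\<lambda>x::real. indicator {..<0} x * exp (d * x))"
    and "(\<integral>x. indicator {..<0} (x::real) * exp (d * x) \<partial>lborel) = 1 / d"
proof -
  let ?f = "\<lambda>x::real. indicator {0..} x * exp (- d * x)"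
  have lim: "((\<lambda>x. - exp (- d * x) / d) \<longlongrightarrow> 0) at_top" using d by real_asymp
  have "(\<integral>\<^sup>+x. ennreal (exp (- d * x)) * indicator {0..} x \<partial>lborel) = 0 - (- exp (- d * 0) / d)"
    by (rule nn_integral_FTC_atLeast[OF _ _ _ lim]) (use d in \<open>auto intro!: derivative_eq_intros\<close>)
  moreover have "ennreal (?f x) = ennreal (exp (- d * x)) * indicator {0..} x" for x :: real
    by (auto simp: indicator_def)
  ultimately have nn: "(\<integral>\<^sup>+x. ennreal (?f x) \<partial>lborel) = ennreal (1 / d)" by simp
  have i: "integrable lborel ?f"
    by (rule integrableI_nn_integral_finite[OF _ _ nn]) auto
  have v: "integral\<^sup>L lborel ?f = 1 / d"
    using nn d by (subst integral_eq_nn_integral) auto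
  have i': "integrable lborel (\<lambda>x. ?f (0 + (-1) * x))" by (rule lborel_integrable_real_affine[OF i]) simp
  have v': "integral\<^sup>L lborel (\<lambda>x. ?f (0 + (-1) * x)) = 1 / d"
    using lborel_integral_real_affine[of "-1" ?f 0] v by simp
  have ae: "AE x in lborel. ?f (0 + (-1) * x) = indicator {..<0} x * exp (d * x)"
    using AE_lborel_singleton[of "0::real"] by eventually_elim (auto simp: indicator_def)
  show "integrable lborel (\<lambda>x::real. indicator {..<0} x * exp (d * x))"
    using integrable_cong_AE[OF _ _ ae] i' by simp
  show "(\<integral>x. indicator {..<0} (x::real) * exp (d * x) \<partial>lborel) = 1 / d"
    using integral_cong_AE[OF _ _ ae] v' by simp
qed

text \<open>Gamma(s) - 1/s is the difference quotient of Gamma at 1, and Gamma'(1) = -\<gamma>. A sequence of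
arguments tending to 0 is enough for dominated convergence below.\<close>

lemma Gamma_minus_inverse_tendsto:
  "(\<lambda>j. Gamma (1 / (real j + 2)) - (real j + 2)) \<longlonglongrightarrow> - euler_mascheroni"
proof -
  have "(Gamma has_field_derivative Gamma 1 * Digamma 1) (at (1::real))"
    by (rule has_field_derivative_Gamma) auto
  then have "((\<lambda>h::real. (Gamma (1 + h) - Gamma 1) / h) \<longlongrightarrow> - euler_mascheroni) (at 0)"
    by (simp add: DERIV_def)
  moreover have "filterlim (\<lambda>j. 1 / (real j + 2)) (at 0) sequentially"
    unfolding filterlim_at by (auto intro!: always_eventually) real_asymp
  ultimately have "(\<lambda>j. (Gamma (1 + 1 / (real j + 2)) - Gamma 1) / (1 / (real j + 2))) \<longlonglongrightarrow> - euler_mascheroni"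
    by (rule filterlim_compose)
  moreover have "(Gamma (1 + 1 / (real j + 2)) - Gamma 1) / (1 / (real j + 2)) = Gamma (1 / (real j + 2)) - (real j + 2)" for j
  proof -
    have "1 / (real j + 2) \<notin> \<int>\<^sub>\<le>\<^sub>0" by (auto dest: nonpos_Ints_nonpos)
    then show ?thesis
      using Gamma_plus1[of "1 / (real j + 2)"] by (simp add: add.commute field_simps)
  qed
  ultimately show ?thesis by simp
qed

text \<open>With a factor e^(s t) the two terms can be integrated separately, to Gamma(s) and 1/s; let s tend
to 0.\<close>

lemma integral_exp_exp_minus_step:
  "integrable lborel (\<lambda>t::real. exp (- exp t) - indicator {..<0} t)"
  "(\<integral>t. exp (- exp (t::real)) - indicator {..<0} t \<partial>lborel) = - euler_mascheroni"
proof -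
  let ?g = "\<lambda>t::real. exp (- exp t) - indicator {..<0} t"
  \<comment> \<open>exponential decay at both ends leaves room for the factor e^(s t)\<close>
  have b: "\<bar>?g t\<bar> \<le> exp (- \<bar>t\<bar>)" for t
  proof (cases "t < 0")
    case True
    then show ?thesis using exp_ge_add_one_self[of "- exp t"] by (simp add: abs_if)
  next
    case False
    have "- exp t \<le> - t" using exp_ge_add_one_self[of t] by linarith
    then show ?thesis using False by simp
  qed
  have int_s: "integrable lborel (\<lambda>t. exp (s * t) * ?g t)" if "0 \<le> s" "s \<le> 1 / 2" for s
  proof (rule integrable_exp_decay[where d = "1 / 2" and C = 1])
    fix t :: real
    have "s * t \<le> \<bar>t\<bar> / 2"
    proof -
      have "s * t \<le> s * \<bar>t\<bar>" using that by (intro mult_left_mono) auto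
      also have "\<dots> \<le> 1 / 2 * \<bar>t\<bar>" using that by (intro mult_right_mono) auto
      finally show ?thesis by simp
    qed
    then have "exp (s * t) * \<bar>?g t\<bar> \<le> exp (\<bar>t\<bar> / 2) * exp (- \<bar>t\<bar>)"
      using b[of t] by (intro mult_mono) auto
    also have "\<dots> = exp (- (1 / 2) * \<bar>t\<bar>)" by (simp add: exp_add[symmetric])
    finally show "norm (exp (s * t) * ?g t) \<le> 1 * exp (- (1 / 2) * \<bar>t\<bar>)" by (simp add: abs_mult)
  qed auto
  show "integrable lborel ?g" using int_s[of 0] by simp
  define s where "s j = 1 / (real j + 2)" for j
  have s: "0 < s j" "s j \<le> 1 / 2" for j by (auto simp: s_def field_simps)
  have "s \<longlonglongrightarrow> 0" unfolding s_def by real_asymp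
  have val: "(\<integral>t. exp (s j * t) * ?g t \<partial>lborel) = Gamma (s j) - 1 / s j" for j
  proof -
    have G: "integrable lborel (\<lambda>t. exp (s j * t - exp t))" "(\<integral>t. exp (s j * t - exp t) \<partial>lborel) = Gamma (s j)"
    proof -
      have eq: "exp (complex_of_real (s j) * of_real t - of_real (exp t)) = of_real (exp (s j * t - exp t))" for t
        by (simp only: exp_of_real[symmetric] of_real_mult of_real_diff)
      have "Re (complex_of_real (s j)) > 0" using s by simp
      from Gamma_integral_exp[OF this, unfolded eq]
      show "integrable lborel (\<lambda>t. exp (s j * t - exp t))" "(\<integral>t. exp (s j * t - exp t) \<partial>lborel) = Gamma (s j)"
        by (simp_all add: complex_of_real_integrable_eq Gamma_complex_of_real)
    qed
    have "exp (s j * t) * ?g t = exp (s j * t - exp t) - indicator {..<0} t * exp (s j * t)" for t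
      by (simp add: exp_diff exp_minus field_simps)
    then show ?thesis using G exp_half_line[OF s(1)[of j]] by simp
  qed
  have "(\<lambda>j. \<integral>t. exp (s j * t) * ?g t \<partial>lborel) \<longlonglongrightarrow> integral\<^sup>L lborel ?g"
  proof (rule integral_dominated_convergence[where w = "\<lambda>t. exp (- (1 / 2) * \<bar>t\<bar>)"])
    show "integrable lborel (\<lambda>t::real. exp (- (1 / 2) * \<bar>t\<bar>))" by (rule integrable_exp_minus_abs) simp
    show "AE t in lborel. (\<lambda>j. exp (s j * t) * ?g t) \<longlonglongrightarrow> ?g t"
    proof (rule AE_I2)
      fix t
      have "(\<lambda>j. exp (s j * t) * ?g t) \<longlonglongrightarrow> exp (0 * t) * ?g t"
        by (intro tendsto_intros \<open>s \<longlonglongrightarrow> 0\<close>)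
      then show "(\<lambda>j. exp (s j * t) * ?g t) \<longlonglongrightarrow> ?g t" by simp
    qed
    show "AE t in lborel. norm (exp (s j * t) * ?g t) \<le> exp (- (1 / 2) * \<bar>t\<bar>)" for j
    proof (rule AE_I2)
      fix t :: real
      have "s j * t \<le> \<bar>t\<bar> / 2"
      proof -
        have "s j * t \<le> s j * \<bar>t\<bar>" using s[of j] by (intro mult_left_mono) auto
        also have "\<dots> \<le> 1 / 2 * \<bar>t\<bar>" using s[of j] by (intro mult_right_mono) auto
        finally show ?thesis by simp
      qed
      then have "exp (s j * t) * \<bar>?g t\<bar> \<le> exp (\<bar>t\<bar> / 2) * exp (- \<bar>t\<bar>)"
        using b[of t] by (intro mult_mono) auto
      also have "\<dots> = exp (- (1 / 2) * \<bar>t\<bar>)" by (simp add: exp_add[symmetric])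
      finally show "norm (exp (s j * t) * ?g t) \<le> exp (- (1 / 2) * \<bar>t\<bar>)" by (simp add: abs_mult)
    qed
  qed auto
  moreover have "(\<lambda>j. \<integral>t. exp (s j * t) * ?g t \<partial>lborel) \<longlonglongrightarrow> - euler_mascheroni"
    unfolding val using Gamma_minus_inverse_tendsto by (simp add: s_def)
  ultimately show "integral\<^sup>L lborel ?g = - euler_mascheroni" by (rule LIMSEQ_unique)
qed

lemma integral_exp_scaled_minus_step:
  fixes a :: real
  assumes a: "a > 0"
  shows "integrable lborel (\<lambda>t::real. exp (- a * exp t) - indicator {..<0} t)"
    and "(\<integral>t. exp (- a * exp (t::real)) - indicator {..<0} t \<partial>lborel) = - euler_mascheroni - ln a"
proof -
  define c where "c = ln a"
  have c: "exp c = a" using a by (simp add: c_def)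
  let ?g = "\<lambda>t::real. exp (- exp t) - indicator {..<0} t"
  let ?h = "\<lambda>t::real. indicator {..<c} t - indicator {..<0} t :: real"
  have h: "integrable lborel ?h \<and> integral\<^sup>L lborel ?h = c"
  proof (cases "c \<ge> 0")
    case True
    have "?h = indicator {0..<c}" using True by (auto simp: fun_eq_iff indicator_def)
    then show ?thesis using True by simp
  next
    case False
    have "?h = (\<lambda>t. - indicator {c..<0} t)" using False by (auto simp: fun_eq_iff indicator_def)
    then show ?thesis using False by simp
  qed
  have eq: "exp (- a * exp t) - indicator {..<0} t = ?g (c + 1 * t) - ?h (c + 1 * t)" for t
    by (auto simp: exp_add c indicator_def)
  have g: "integrable lborel (\<lambda>t. ?g (c + 1 * t))" "integral\<^sup>L lborel (\<lambda>t. ?g (c + 1 * t)) = - euler_mascheroni"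
    using lborel_integrable_real_affine[OF integral_exp_exp_minus_step(1), of 1 c]
      lborel_integral_real_affine[of 1 ?g c] integral_exp_exp_minus_step(2) by auto
  have h': "integrable lborel (\<lambda>t. ?h (c + 1 * t))" "integral\<^sup>L lborel (\<lambda>t. ?h (c + 1 * t)) = c"
    using lborel_integrable_real_affine[OF conjunct1[OF h], of 1 c]
      lborel_integral_real_affine[of 1 ?h c] conjunct2[OF h] by auto
  show "integrable lborel (\<lambda>t::real. exp (- a * exp t) - indicator {..<0} t)"
    unfolding eq by (rule Bochner_Integration.integrable_diff[OF g(1) h'(1)])
  show "(\<integral>t. exp (- a * exp (t::real)) - indicator {..<0} t \<partial>lborel) = - euler_mascheroni - ln a"
    unfolding eq Bochner_Integration.integral_diff[OF g(1) h'(1)] g(2) h'(2) by (simp add: c_def)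
qed

text \<open>Frullani's integral for the exponential function. Both terms are compared with the same step function.\<close>

lemma frullani_exp_exp:
  fixes a b :: real
  assumes "a > 0" "b > 0"
  shows "integrable lborel (\<lambda>t. exp (- a * exp t) - exp (- b * exp t))"
    and "(\<integral>t. exp (- a * exp t) - exp (- b * exp t) \<partial>lborel) = ln b - ln a"
  using Bochner_Integration.integrable_diff[OF integral_exp_scaled_minus_step(1)[OF assms(1)] integral_exp_scaled_minus_step(1)[OF assms(2)]]
    Bochner_Integration.integral_diff[OF integral_exp_scaled_minus_step(1)[OF assms(1)] integral_exp_scaled_minus_step(1)[OF assms(2)]]
    integral_exp_scaled_minus_step(2)[OF assms(1)] integral_exp_scaled_minus_step(2)[OF assms(2)]
  by simp_all

text \<open>With a = x/2 the integrand of 2 K0(x) is E(t) E(-t) with E(t) = exp(-a e^t). Comparing it with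
E(t) + E(-t) - 1 leaves the error (1 - E(t)) (1 - E(-t)), which is at most a e^(-|t|); the sum
E(t) + E(-t) - 1 integrates to -2 \<gamma> - 2 ln a after the step function is split between the two
halves of the line.\<close>

lemma K0_log_asymptotic:
  fixes x :: real
  assumes x: "x > 0"
  shows "norm (K0 (of_real x) + of_real (ln (x / 2) + euler_mascheroni)) \<le> x / 2"
proof -
  define a where "a = x / 2"
  have a: "a > 0" using x by (simp add: a_def)
  let ?E = "\<lambda>t. exp (- a * exp t)" and ?E' = "\<lambda>t. exp (- a * exp (- t))"
  let ?g = "\<lambda>t::real. ?E t - indicator {..<0} t"
  have g: "integrable lborel ?g" "integral\<^sup>L lborel ?g = - euler_mascheroni - ln a"
    using integral_exp_scaled_minus_step[OF a] by auto
  have g': "integrable lborel (\<lambda>t. ?g (0 + (-1) * t))" "integral\<^sup>L lborel (\<lambda>t. ?g (0 + (-1) * t)) = - euler_mascheroni - ln a"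
    using lborel_integrable_real_affine[OF g(1), of "-1" 0] lborel_integral_real_affine[of "-1" ?g 0] g(2) by auto
  have E: "integrable lborel (\<lambda>t. ?E t * ?E' t)"
    using K0_two_sided_integral(1)[OF a a] by (simp add: exp_add[symmetric])
  have k: "K0 (of_real x) = of_real (1 / 2 * (\<integral>t. ?E t * ?E' t \<partial>lborel))"
  proof -
    have "2 * sqrt (a * a) = x" using a by (simp add: a_def[symmetric]) (simp add: a_def)
    then show ?thesis
      using K0_two_sided_integral(2)[OF a a] by (simp add: exp_add[symmetric])
  qed
  let ?R = "\<lambda>t. ?E t * ?E' t - ?g t - ?g (0 + (-1) * t)"
  have R: "integrable lborel ?R" 
    by (rule Bochner_Integration.integrable_diff[OF Bochner_Integration.integrable_diff[OF E g(1)] g'(1)])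
  have bR: "AE t in lborel. norm (?R t) \<le> a * exp (- 1 * \<bar>t\<bar>)"
    using AE_lborel_singleton[of "0::real"]
  proof eventually_elim
    case (elim t)
    then have "?R t = (1 - ?E t) * (1 - ?E' t)"
      by (auto simp: indicator_def algebra_simps)
    moreover have "0 \<le> 1 - ?E t" "0 \<le> 1 - ?E' t" "1 - ?E t \<le> 1" "1 - ?E' t \<le> 1" using a by auto
    moreover have "1 - ?E t \<le> a * exp t" "1 - ?E' t \<le> a * exp (- t)"
      using exp_ge_add_one_self[of "- a * exp t"] exp_ge_add_one_self[of "- a * exp (- t)"] by auto
    ultimately show ?case
    proof (cases "t > 0")
      case True
      have "(1 - ?E t) * (1 - ?E' t) \<le> 1 * (a * exp (- t))"
        by (rule mult_mono) (fact | simp)+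
      then show ?thesis using True \<open>?R t = (1 - ?E t) * (1 - ?E' t)\<close> \<open>0 \<le> 1 - ?E t\<close> \<open>0 \<le> 1 - ?E' t\<close> by simp
    next
      case False
      have "(1 - ?E t) * (1 - ?E' t) \<le> (a * exp t) * 1"
        by (rule mult_mono) (fact | use a in simp)+
      then show ?thesis using False \<open>?R t = (1 - ?E t) * (1 - ?E' t)\<close> \<open>0 \<le> 1 - ?E t\<close> \<open>0 \<le> 1 - ?E' t\<close> by simp
    qed
  qed
  have two: "(\<integral>t. exp (- 1 * \<bar>(t::real)\<bar>) \<partial>lborel) = 2"
  proof -
    let ?f = "\<lambda>x::real. indicator {..<0} x * exp (1 * x)"
    have f: "integrable lborel ?f" "integral\<^sup>L lborel ?f = 1" using exp_half_line[of 1] by auto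
    have f': "integrable lborel (\<lambda>x. ?f (0 + (-1) * x))" "integral\<^sup>L lborel (\<lambda>x. ?f (0 + (-1) * x)) = 1"
      using lborel_integrable_real_affine[OF f(1), of "-1" 0] lborel_integral_real_affine[of "-1" ?f 0] f(2) by auto
    have "AE x in lborel. exp (- 1 * \<bar>x\<bar>) = ?f x + ?f (0 + (-1) * x)"
      using AE_lborel_singleton[of "0::real"] by eventually_elim (auto simp: indicator_def)
    then have "(\<integral>t. exp (- 1 * \<bar>(t::real)\<bar>) \<partial>lborel) = (\<integral>x. ?f x + ?f (0 + (-1) * x) \<partial>lborel)"
      by (intro integral_cong_AE) auto
    also have "\<dots> = 2" using Bochner_Integration.integral_add[OF f(1) f'(1)] f(2) f'(2) by linarith
    finally show ?thesis .
  qed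
  have "norm (integral\<^sup>L lborel ?R) \<le> (\<integral>t. a * exp (- 1 * \<bar>t\<bar>) \<partial>lborel)"
  proof (rule order_trans[OF integral_norm_bound integral_mono_AE[OF integrable_norm[OF R] _ bR]])
    show "integrable lborel (\<lambda>t. a * exp (- 1 * \<bar>t\<bar>))" using integrable_exp_minus_abs[of 1] by simp
  qed
  then have bound: "\<bar>integral\<^sup>L lborel ?R\<bar> \<le> 2 * a" using two by simp
  define J where "J = (\<integral>t. ?E t * ?E' t \<partial>lborel)"
  have val: "integral\<^sup>L lborel ?R = J + 2 * (euler_mascheroni + ln a)"
    unfolding Bochner_Integration.integral_diff[OF Bochner_Integration.integrable_diff[OF E g(1)] g'(1)]
      Bochner_Integration.integral_diff[OF E g(1)] g(2) g'(2) J_def by simp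
  have "1 / 2 * J + (ln a + euler_mascheroni) = (J + 2 * (euler_mascheroni + ln a)) / 2" by simp
  then have "\<bar>1 / 2 * J + (ln a + euler_mascheroni)\<bar> \<le> a" using bound unfolding val by simp
  then show ?thesis
    unfolding k J_def[symmetric] of_real_add[symmetric] norm_of_real by (simp add: a_def[symmetric])
qed

lemma K0_plus_log_tendsto: "((\<lambda>x. K0 (of_real x) + of_real (ln (x / 2))) \<longlongrightarrow> - euler_mascheroni) (at_right 0)"
proof -
  have "((\<lambda>x. K0 (of_real x) + of_real (ln (x / 2)) - (- euler_mascheroni)) \<longlongrightarrow> 0) (at_right 0)"
  proof (rule Lim_null_comparison)
    show "\<forall>\<^sub>F x in at_right 0. norm (K0 (of_real x) + of_real (ln (x / 2)) - (- euler_mascheroni)) \<le> x / 2"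
      using K0_log_asymptotic by (auto simp: eventually_at_filter algebra_simps intro!: always_eventually)
    show "((\<lambda>x::real. x / 2) \<longlongrightarrow> 0) (at_right 0)" by (auto intro!: tendsto_eq_intros)
  qed
  then show ?thesis by (simp only: LIM_zero_iff)
qed

lemma one_minus_tanh_squared: "1 - (tanh t)\<^sup>2 = 1 / (cosh t)\<^sup>2" for t :: real
proof -
  have "cosh t \<noteq> 0" using cosh_real_pos[of t] by simp
  then show ?thesis by (simp add: tanh_def power_divide sinh_square_eq field_simps)
qed

text \<open>Integrating the derivative of tanh t exp(-x cosh t) trades the factor x cosh t, which has
no integrable bound as x tends to 0, for 1 / cosh(t)^2 and x / cosh t, which have one; the integral of 1 / cosh(t)^2 is 2.\<close>

lemma K1_asymptotic:
  "((\<lambda>x. of_real x * K_cosh 1 (of_real x)) \<longlongrightarrow> 1) (at_right 0)"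
proof -
  have sech_int: "integrable lborel (\<lambda>t::real. 1 / cosh t)"
  proof (rule integrable_exp_decay[where d = 1 and C = 2])
    show "norm (1 / cosh t) \<le> 2 * exp (- 1 * \<bar>t\<bar>)" for t :: real
      using sech_le[of t] cosh_real_pos[of t] by simp
    show "(\<lambda>t::real. 1 / cosh t) \<in> borel_measurable borel"
      by (intro borel_measurable_continuous_onI continuous_intros) auto
  qed simp
  have sech2: "1 / (cosh t)\<^sup>2 \<le> 1 / cosh t" for t :: real
    using cosh_real_ge_1[of t] by (simp add: power2_eq_square field_simps)
  have sech2_int: "integrable lborel (\<lambda>t::real. 1 / (cosh t)\<^sup>2)"
    by (rule Bochner_Integration.integrable_bound[OF sech_int])
      (use sech2 in \<open>auto intro!: borel_measurable_continuous_onI continuous_intros\<close>)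
  have tanh_lim: "(tanh \<longlongrightarrow> (-1::real)) at_bot" "(tanh \<longlongrightarrow> (1::real)) at_top"
    by (rule tanh_real_at_bot tanh_real_at_top)+
  have "(\<integral>t. 1 / (cosh (t::real))\<^sup>2 \<partial>lborel) = 1 - (-1)"
    by (rule integral_FTC_UNIV[OF _ _ sech2_int tanh_lim])
      (auto intro!: derivative_eq_intros continuous_intros
        simp: has_real_derivative_iff_has_vector_derivative[symmetric] one_minus_tanh_squared[symmetric])
  then have sech2_val: "(\<integral>t. 1 / (cosh (t::real))\<^sup>2 \<partial>lborel) = 2" by simp
  have id: "of_real x * K_cosh 1 (of_real x) = of_real (1 / 2 * ((\<integral>t. 1 / (cosh t)\<^sup>2 * exp (- x * cosh t) \<partial>lborel)
      + x * (\<integral>t. 1 / cosh t * exp (- x * cosh t) \<partial>lborel)))" if x: "x > 0" for x :: real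
  proof -
    let ?e = "\<lambda>t. exp (- x * cosh t)"
    have i1: "integrable lborel (\<lambda>t. 1 / (cosh t)\<^sup>2 * ?e t)"
      by (rule Bochner_Integration.integrable_bound[OF sech2_int])
        (use x in \<open>auto intro!: borel_measurable_continuous_onI continuous_intros simp: abs_mult divide_right_mono\<close>)
    have i2: "integrable lborel (\<lambda>t. 1 / cosh t * ?e t)"
      by (rule Bochner_Integration.integrable_bound[OF sech_int])
        (use x in \<open>auto intro!: borel_measurable_continuous_onI continuous_intros simp: abs_mult divide_right_mono\<close>)
    have i3: "integrable lborel (\<lambda>t. cosh t * ?e t)" using integrable_cosh_power_exp[OF x, of 1] by simp
    let ?f = "\<lambda>t. x * (cosh t * ?e t) - 1 / (cosh t)\<^sup>2 * ?e t - x * (1 / cosh t * ?e t)"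
    have i: "integrable lborel ?f" using i1 i2 i3 by (intro Bochner_Integration.integrable_diff integrable_mult_right)
    have b: "norm (- tanh t * ?e t) \<le> exp (- (x / 2) * \<bar>t\<bar>)" for t
    proof -
      have "x * (\<bar>t\<bar> / 2) \<le> x * cosh t" using x cosh_ge_half_abs[of t] by (intro mult_left_mono) auto
      then have "?e t \<le> exp (- (x / 2) * \<bar>t\<bar>)" by simp
      moreover have "\<bar>tanh t\<bar> \<le> 1" using tanh_real_abs[of t] tanh_real_lt_1[of "\<bar>t\<bar>"] by linarith
      ultimately have "\<bar>tanh t\<bar> * ?e t \<le> 1 * exp (- (x / 2) * \<bar>t\<bar>)" by (intro mult_mono) auto
      then show ?thesis by (simp add: abs_mult)
    qed
    have t: "((\<lambda>t::real. exp (- (x / 2) * \<bar>t\<bar>)) \<longlongrightarrow> 0) at_top" "((\<lambda>t::real. exp (- (x / 2) * \<bar>t\<bar>)) \<longlongrightarrow> 0) at_bot"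
      using x by real_asymp+
    have "integral\<^sup>L lborel ?f = 0 - 0"
    proof (rule integral_FTC_UNIV[OF _ _ i])
      show "((\<lambda>t. - tanh t * ?e t) \<longlongrightarrow> 0) at_bot" by (rule Lim_null_comparison[OF _ t(2)]) (use b in auto)
      show "((\<lambda>t. - tanh t * ?e t) \<longlongrightarrow> 0) at_top" by (rule Lim_null_comparison[OF _ t(1)]) (use b in auto)
      fix t :: real
      have "((\<lambda>t. - tanh t * ?e t) has_real_derivative - (1 - (tanh t)\<^sup>2) * ?e t + - tanh t * (- x * sinh t * ?e t)) (at t)"
        by (auto intro!: derivative_eq_intros simp: algebra_simps)
      moreover have "- (1 - (tanh t)\<^sup>2) * ?e t + - tanh t * (- x * sinh t * ?e t) = ?f t"
      proof -
        have c: "cosh t \<noteq> 0" using cosh_real_pos[of t] by simp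
        have ts: "tanh t * sinh t = cosh t - 1 / cosh t"
          using c sinh_square_eq[of t] by (simp add: tanh_def field_simps power2_eq_square)
        have "- (1 - (tanh t)\<^sup>2) * ?e t + - tanh t * (- x * sinh t * ?e t) = - (1 - (tanh t)\<^sup>2) * ?e t + x * (tanh t * sinh t) * ?e t"
          by simp
        also have "\<dots> = ?f t" unfolding one_minus_tanh_squared ts by (simp add: algebra_simps)
        finally show ?thesis .
      qed
      ultimately show "((\<lambda>t. - tanh t * ?e t) has_vector_derivative ?f t) (at t)"
        by (simp add: has_real_derivative_iff_has_vector_derivative[symmetric])
      show "isCont ?f t" by (intro continuous_intros) auto
    qed
    then have "x * (\<integral>t. cosh t * ?e t \<partial>lborel) = (\<integral>t. 1 / (cosh t)\<^sup>2 * ?e t \<partial>lborel) + x * (\<integral>t. 1 / cosh t * ?e t \<partial>lborel)"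
      using i1 i2 i3 Bochner_Integration.integral_diff[OF Bochner_Integration.integrable_diff[OF integrable_mult_right[OF i3, of x] i1] integrable_mult_right[OF i2, of x]]
        Bochner_Integration.integral_diff[OF integrable_mult_right[OF i3, of x] i1] by (simp only: integral_mult_right_zero)
    moreover have "K_cosh 1 (of_real x) = of_real (1 / 2 * (\<integral>t. cosh t * ?e t \<partial>lborel))"
    proof -
      have eq: "complex_of_real (cosh t ^ 1) * exp (- of_real x * complex_of_real (cosh t)) = of_real (cosh t * ?e t)" for t
        by (simp only: exp_of_real[symmetric] of_real_mult of_real_minus power_one_right)
      show ?thesis unfolding K_cosh_def eq integral_complex_of_real by simp
    qed
    ultimately show ?thesis by (simp only: of_real_mult[symmetric]) (simp add: mult_ac)
  qed
  have lim1: "((\<lambda>x. \<integral>t. 1 / (cosh t)\<^sup>2 * exp (- x * cosh t) \<partial>lborel) \<longlongrightarrow> (\<integral>t. 1 / (cosh (t::real))\<^sup>2 \<partial>lborel)) (at_right 0)"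
    unfolding tendsto_at_iff_sequentially
  proof (intro allI impI)
    fix X :: "nat \<Rightarrow> real" assume X: "\<forall>i. X i \<in> {0<..} - {0}" "X \<longlonglongrightarrow> 0"
    show "((\<lambda>x. \<integral>t. 1 / (cosh t)\<^sup>2 * exp (- x * cosh t) \<partial>lborel) \<circ> X) \<longlonglongrightarrow> (\<integral>t. 1 / (cosh (t::real))\<^sup>2 \<partial>lborel)"
      unfolding o_def
    proof (rule integral_dominated_convergence[OF _ _ sech2_int])
      show "AE t in lborel. (\<lambda>i. 1 / (cosh t)\<^sup>2 * exp (- X i * cosh t)) \<longlonglongrightarrow> 1 / (cosh t)\<^sup>2"
      proof (rule AE_I2)
        fix t :: real
        have "(\<lambda>i. 1 / (cosh t)\<^sup>2 * exp (- X i * cosh t)) \<longlonglongrightarrow> 1 / (cosh t)\<^sup>2 * exp (- 0 * cosh t)"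
          by (intro tendsto_intros X)
        then show "(\<lambda>i. 1 / (cosh t)\<^sup>2 * exp (- X i * cosh t)) \<longlonglongrightarrow> 1 / (cosh t)\<^sup>2" by simp
      qed
      show "AE t in lborel. norm (1 / (cosh t)\<^sup>2 * exp (- X i * cosh t)) \<le> 1 / (cosh t)\<^sup>2" for i
        using X(1) by (intro AE_I2) (auto simp: abs_mult divide_right_mono less_imp_le)
    qed (auto intro!: borel_measurable_continuous_onI continuous_intros)
  qed
  have lim2: "((\<lambda>x::real. x * (\<integral>t. 1 / cosh t * exp (- x * cosh t) \<partial>lborel)) \<longlongrightarrow> 0) (at_right 0)"
  proof (rule Lim_null_comparison[where g = "\<lambda>x. x * (\<integral>t. 1 / cosh (t::real) \<partial>lborel)"])
    show "((\<lambda>x::real. x * (\<integral>t. 1 / cosh (t::real) \<partial>lborel)) \<longlongrightarrow> 0) (at_right 0)"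
      by (rule tendsto_mult_left_zero) (auto intro!: tendsto_eq_intros)
    show "\<forall>\<^sub>F x in at_right 0. norm (x * (\<integral>t. 1 / cosh t * exp (- x * cosh t) \<partial>lborel)) \<le> x * (\<integral>t. 1 / cosh (t::real) \<partial>lborel)"
      unfolding eventually_at_filter
    proof (intro always_eventually allI impI)
      fix x :: real assume x: "x \<in> {0<..}"
      have "(\<integral>t. 1 / cosh t * exp (- x * cosh t) \<partial>lborel) \<le> (\<integral>t. 1 / cosh (t::real) \<partial>lborel)"
        using x by (intro integral_mono' sech_int) (auto simp: divide_right_mono)
      moreover have "(\<integral>t. 1 / cosh t * exp (- x * cosh t) \<partial>lborel) \<ge> 0" by (intro integral_nonneg_AE AE_I2) auto
      ultimately show "norm (x * (\<integral>t. 1 / cosh t * exp (- x * cosh t) \<partial>lborel)) \<le> x * (\<integral>t. 1 / cosh (t::real) \<partial>lborel)"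
        using x by (auto simp: abs_mult mult_left_mono)
    qed
  qed
  have "((\<lambda>x. complex_of_real (1 / 2 * ((\<integral>t. 1 / (cosh t)\<^sup>2 * exp (- x * cosh t) \<partial>lborel)
      + x * (\<integral>t. 1 / cosh t * exp (- x * cosh t) \<partial>lborel)))) \<longlongrightarrow> of_real (1 / 2 * (2 + 0))) (at_right 0)"
    by (intro tendsto_intros lim1[unfolded sech2_val] lim2)
  then have "((\<lambda>x. complex_of_real (1 / 2 * ((\<integral>t. 1 / (cosh t)\<^sup>2 * exp (- x * cosh t) \<partial>lborel)
      + x * (\<integral>t. 1 / cosh t * exp (- x * cosh t) \<partial>lborel)))) \<longlongrightarrow> 1) (at_right 0)"
    by (simp only: mult_1 add_0_right) simp
  then show ?thesis
  proof (rule Lim_transform_eventually)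
    show "\<forall>\<^sub>F x in at_right 0. complex_of_real (1 / 2 * ((\<integral>t. 1 / (cosh t)\<^sup>2 * exp (- x * cosh t) \<partial>lborel)
      + x * (\<integral>t. 1 / cosh t * exp (- x * cosh t) \<partial>lborel))) = of_real x * K_cosh 1 (of_real x)"
      unfolding eventually_at_filter
    proof (intro always_eventually allI impI)
      fix x :: real assume "x \<in> {0<..}"
      then have "x > 0" by simp
      then show "complex_of_real (1 / 2 * ((\<integral>t. 1 / (cosh t)\<^sup>2 * exp (- x * cosh t) \<partial>lborel)
        + x * (\<integral>t. 1 / cosh t * exp (- x * cosh t) \<partial>lborel))) = of_real x * K_cosh 1 (of_real x)"
        by (rule id[symmetric])
    qed
  qed
qed

section \<open>The Bessel function K of order zero as a limit in the order\<close>

text \<open>The entire factor of bessel_I, with y = (z/2)^2 and as a function of the order \<mu>.\<close>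

definition I_series :: "complex \<Rightarrow> complex \<Rightarrow> complex" where
  "I_series y \<mu> = (\<Sum>k. y ^ k * rGamma (\<mu> + of_nat k + 1) / fact k)"

lemma bessel_I_eq:
  assumes "z \<noteq> 0"
  shows "bessel_I \<mu> z = exp (\<mu> * Ln (z / 2)) * I_series ((z / 2)\<^sup>2) \<mu>"
  using assms by (simp add: bessel_I_def I_series_def powr_def power_mult)

text \<open>The coefficients of I0 in powers of z^2/4.\<close>

definition I0_coeff :: "nat \<Rightarrow> complex" where "I0_coeff k = 1 / (fact k)\<^sup>2"
text \<open>The values Digamma(k + 1) come from differentiating 1/Gamma with respect to the order.\<close>

definition K0_coeff :: "nat \<Rightarrow> complex" where "K0_coeff k = Digamma (of_nat (Suc k)) / (fact k)\<^sup>2"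

text \<open>1/Gamma(\<mu> + k + 1) is obtained from 1/Gamma(\<mu> + 1) by k divisions by factors of modulus at least 1/2.
The growth 2^k is harmless against the k! in the series.\<close>

lemma rGamma_shift_bound:
  "\<exists>M. \<forall>\<mu> k. norm \<mu> \<le> 1 / 2 \<longrightarrow> norm (rGamma (\<mu> + of_nat k + 1) :: complex) \<le> M * 2 ^ k"
proof -
  have "compact ((\<lambda>\<mu>. rGamma (\<mu> + 1) :: complex) ` cball 0 (1 / 2))"
    by (intro compact_continuous_image holomorphic_on_imp_continuous_on holomorphic_intros) auto
  then have "bounded ((\<lambda>\<mu>. rGamma (\<mu> + 1) :: complex) ` cball 0 (1 / 2))"
    by (rule compact_imp_bounded)
  then obtain M where M': "\<forall>x\<in>(\<lambda>\<mu>. rGamma (\<mu> + 1) :: complex) ` cball 0 (1 / 2). norm x \<le> M"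
    unfolding bounded_iff by (elim exE)
  have M: "norm (rGamma (\<mu> + 1) :: complex) \<le> M" if "\<mu> \<in> cball 0 (1 / 2)" for \<mu>
    using M' that by (rule bspec[OF _ imageI])
  show ?thesis
  proof (intro exI[of _ M] allI impI)
    fix \<mu> :: complex and k :: nat assume \<mu>: "norm \<mu> \<le> 1 / 2"
    show "norm (rGamma (\<mu> + of_nat k + 1)) \<le> M * 2 ^ k"
    proof (induction k)
      case 0
      then show ?case using M[of \<mu>] \<mu> by simp
    next
      case (Suc k)
      let ?w = "\<mu> + of_nat k + 1"
      have "real k + 1 = norm (of_nat k + 1 :: complex)" by (metis norm_of_nat of_nat_1 of_nat_add)
      also have "\<dots> \<le> norm ?w + norm \<mu>"
        using norm_triangle_ineq4[of ?w \<mu>] by (simp add: algebra_simps)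
      finally have w: "1 / 2 \<le> norm ?w" using \<mu> by simp
      have "norm ?w * norm (rGamma (?w + 1)) \<le> M * 2 ^ k"
        using Suc rGamma_plus1[of ?w] by (metis norm_mult)
      moreover have "1 / 2 * norm (rGamma (?w + 1)) \<le> norm ?w * norm (rGamma (?w + 1))"
        using w by (intro mult_right_mono) auto
      ultimately show ?case by (simp add: algebra_simps)
    qed
  qed
qed

lemma I_series_deriv:
  "I_series y 0 = (\<Sum>k. I0_coeff k * y ^ k)" "summable (\<lambda>k. I0_coeff k * y ^ k)"
  "summable (\<lambda>k. K0_coeff k * y ^ k)"
  "(I_series y has_field_derivative - (\<Sum>k. K0_coeff k * y ^ k)) (at 0)"
proof -
  obtain M where M: "\<And>\<mu> k. norm \<mu> \<le> 1 / 2 \<Longrightarrow> norm (rGamma (\<mu> + of_nat k + 1) :: complex) \<le> M * 2 ^ k"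
    using rGamma_shift_bound by blast
  define h where "h k = M * ((2 * norm y) ^ k /\<^sub>R fact k)" for k
  have h: "summable h"
    unfolding h_def by (intro summable_mult summable_exp_generic)
  let ?f = "\<lambda>k \<mu>. y ^ k * rGamma (\<mu> + of_nat k + 1) / fact k"
  let ?f' = "\<lambda>k \<mu>. y ^ k * (- rGamma (\<mu> + of_nat k + 1) * Digamma (\<mu> + of_nat k + 1)) / fact k"
  obtain g g' where g: "\<And>\<mu>. \<mu> \<in> ball 0 (1 / 2) \<Longrightarrow>
      ((\<lambda>k. ?f k \<mu>) sums g \<mu>) \<and> ((\<lambda>k. ?f' k \<mu>) sums g' \<mu>) \<and> (g has_field_derivative g' \<mu>) (at \<mu>)"
  proof (rule series_and_derivative_comparison[OF open_ball h, of 0 "1 / 2" ?f ?f'])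
    fix k and \<mu> :: complex assume \<mu>: "\<mu> \<in> ball 0 (1 / 2)"
    have "\<bar>Re \<mu>\<bar> < 1 / 2" using abs_Re_le_cmod[of \<mu>] \<mu> by simp
    then have "\<mu> + of_nat k + 1 \<notin> \<int>\<^sub>\<le>\<^sub>0" by (auto elim!: nonpos_Ints_cases simp: complex_eq_iff)
    then show "(?f k has_field_derivative ?f' k \<mu>) (at \<mu>)"
      by (auto intro!: derivative_eq_intros)
  next
    show "\<forall>\<^sub>F n in sequentially. \<forall>x\<in>ball 0 (1 / 2). norm (?f n x) \<le> h n"
    proof (intro always_eventually allI ballI)
      fix n and \<mu> :: complex assume "\<mu> \<in> ball 0 (1 / 2)"
      then have "norm y ^ n * norm (rGamma (\<mu> + of_nat n + 1)) \<le> norm y ^ n * (M * 2 ^ n)"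
        by (intro mult_left_mono M) auto
      then show "norm (?f n \<mu>) \<le> h n"
        by (simp add: h_def norm_mult norm_divide norm_power power_mult_distrib field_simps)
    qed
  qed blast
  have rG: "rGamma (of_nat k + 1 :: complex) = 1 / fact k" for k
    using Gamma_fact[of k, where 'a = complex] by (simp add: rGamma_inverse_Gamma add.commute inverse_eq_divide)
  have rG': "rGamma (1 + of_nat k :: complex) = 1 / fact k" for k
    using rG[of k] by (simp only: add.commute)
  have f0: "?f k 0 = I0_coeff k * y ^ k" for k
    by (simp add: rG I0_coeff_def power2_eq_square)
  have f'0: "?f' k 0 = - (K0_coeff k * y ^ k)" for k
    by (simp add: rG rG' K0_coeff_def power2_eq_square add.commute)
  have s0: "(\<lambda>k. I0_coeff k * y ^ k) sums g 0" and s0': "(\<lambda>k. - (K0_coeff k * y ^ k)) sums g' 0"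
    using g[of 0] unfolding f0 f'0 by auto
  show "summable (\<lambda>k. I0_coeff k * y ^ k)" using s0 by (rule sums_summable)
  show "summable (\<lambda>k. K0_coeff k * y ^ k)" using sums_minus[OF s0'] by (auto intro: sums_summable)
  have ge: "g \<mu> = I_series y \<mu>" if "\<mu> \<in> ball 0 (1 / 2)" for \<mu>
    using g[OF that] by (simp add: I_series_def sums_iff)
  show "I_series y 0 = (\<Sum>k. I0_coeff k * y ^ k)" using s0 ge[of 0] by (simp add: sums_iff)
  have "g' 0 = - (\<Sum>k. K0_coeff k * y ^ k)"
    using sums_minus[OF s0'] by (simp add: sums_iff minus_equation_iff)
  moreover have "(I_series y has_field_derivative g' 0) (at 0)"
    by (rule has_field_derivative_transform_within_open[of g _ _ "ball 0 (1 / 2)"]) (use g[of 0] ge in auto)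
  ultimately show "(I_series y has_field_derivative - (\<Sum>k. K0_coeff k * y ^ k)) (at 0)" by simp
qed

text \<open>The logarithmic expansion of K0 at the origin.\<close>

definition K0_series :: "complex \<Rightarrow> complex" where
  "K0_series z = - Ln (z / 2) * (\<Sum>k. I0_coeff k * (z\<^sup>2 / 4) ^ k) + (\<Sum>k. K0_coeff k * (z\<^sup>2 / 4) ^ k)"

text \<open>The defining quotient is 0/0 at order 0, so its limit is the ratio of the derivatives in the order:
that of I(-\<mu>) - I(\<mu>) is -2 times the derivative of I at \<mu> = 0, and that of sin(\<mu> pi) is pi.\<close>

lemma bessel_K_0_eq_series:
  assumes z: "z \<noteq> 0"
  shows "bessel_K 0 z = K0_series z"
proof -
  let ?y = "(z / 2)\<^sup>2"
  let ?J = "\<lambda>\<mu>. exp (\<mu> * Ln (z / 2)) * I_series ?y \<mu>"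
  define E where "E = (\<Sum>k. I0_coeff k * ?y ^ k)"
  define P where "P = (\<Sum>k. K0_coeff k * ?y ^ k)"
  have dJ: "(?J has_field_derivative Ln (z / 2) * E - P) (at 0)"
    using I_series_deriv(4)[of ?y] I_series_deriv(1)[of ?y]
    by (auto intro!: derivative_eq_intros simp: E_def P_def)
  have dJ': "((\<lambda>\<mu>. ?J (- \<mu>)) has_field_derivative - (Ln (z / 2) * E - P)) (at 0)"
  proof -
    have "(?J has_field_derivative Ln (z / 2) * E - P) (at (- 0))" using dJ by (simp only: minus_zero)
    from DERIV_chain2[OF this DERIV_minus[OF DERIV_ident]] show ?thesis by (simp only: mult_minus_right mult_1_right)
  qed
  have "((\<lambda>\<mu>. ?J (- \<mu>) - ?J \<mu>) has_field_derivative - (Ln (z / 2) * E - P) - (Ln (z / 2) * E - P)) (at 0)"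
    by (rule DERIV_diff[OF dJ' dJ])
  then have n: "((\<lambda>\<mu>. (?J (- \<mu>) - ?J \<mu>) / \<mu>) \<longlongrightarrow> - (Ln (z / 2) * E - P) - (Ln (z / 2) * E - P)) (at 0)"
    by (simp add: DERIV_def)
  have "((\<lambda>\<mu>::complex. sin (\<mu> * of_real pi)) has_field_derivative of_real pi) (at 0)"
    by (auto intro!: derivative_eq_intros)
  then have d: "((\<lambda>\<mu>::complex. sin (\<mu> * of_real pi) / \<mu>) \<longlongrightarrow> of_real pi) (at 0)"
    by (simp add: DERIV_def)
  have "((\<lambda>\<mu>. of_real (pi / 2) * (((?J (- \<mu>) - ?J \<mu>) / \<mu>) / (sin (\<mu> * of_real pi) / \<mu>)))
      \<longlongrightarrow> of_real (pi / 2) * ((- (Ln (z / 2) * E - P) - (Ln (z / 2) * E - P)) / of_real pi)) (at 0)"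
    by (intro tendsto_intros n d) auto
  also have "of_real (pi / 2) * ((- (Ln (z / 2) * E - P) - (Ln (z / 2) * E - P)) / complex_of_real pi) = - Ln (z / 2) * E + P"
    by (simp add: field_simps)
  finally have "((\<lambda>\<mu>. of_real (pi / 2) * (bessel_I (- \<mu>) z - bessel_I \<mu> z) / sin (\<mu> * of_real pi)) \<longlongrightarrow> - Ln (z / 2) * E + P) (at 0)"
    by (rule Lim_transform_eventually) (auto simp: eventually_at_filter bessel_I_eq[OF z] intro!: always_eventually)
  then have "bessel_K 0 z = - Ln (z / 2) * E + P"
    unfolding bessel_K_def Let_def by (simp add: tendsto_Lim)
  then show ?thesis by (simp add: K0_series_def E_def P_def power_divide)
qed

text \<open>As functions of y = z^2/4: the two power series of K0_series, and their derivatives in y.\<close>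

definition "I0_power_series y = (\<Sum>k. I0_coeff k * y ^ k)"
definition "K0_regular_series y = (\<Sum>k. K0_coeff k * y ^ k)"
definition "I0_power_series_deriv y = (\<Sum>k. diffs I0_coeff k * y ^ k)"
definition "K0_regular_series_deriv y = (\<Sum>k. diffs K0_coeff k * y ^ k)"

lemma has_derivative_I0_power_series: "(I0_power_series has_field_derivative I0_power_series_deriv y) (at y)"
  unfolding I0_power_series_def[abs_def] I0_power_series_deriv_def by (rule termdiffs_strong_converges_everywhere[OF I_series_deriv(2)])

lemma has_derivative_K0_regular_series: "(K0_regular_series has_field_derivative K0_regular_series_deriv y) (at y)"
  unfolding K0_regular_series_def[abs_def] K0_regular_series_deriv_def by (rule termdiffs_strong_converges_everywhere[OF I_series_deriv(3)])

text \<open>The operator D(y D) multiplies the coefficient of y^(n+1) by (n+1)^2 and shifts it to y^n. It turns the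
recursions for the coefficients into the differential equations of the two series.\<close>

lemma euler_operator_power_series:
  fixes c :: "nat \<Rightarrow> complex"
  assumes c: "\<And>y. summable (\<lambda>n. c n * y ^ n)"
    and d: "\<And>n. (of_nat (Suc n))\<^sup>2 * c (Suc n) = d n"
  shows "((\<lambda>y. y * (\<Sum>n. diffs c n * y ^ n)) has_field_derivative (\<Sum>n. d n * y ^ n)) (at y)"
proof -
  have sd: "summable (\<lambda>n. diffs c n * y ^ n)" for y
    by (rule termdiff_converges_all[OF c])
  then have s: "(\<lambda>n. (of_nat n * c n) * y ^ n) sums (y * (\<Sum>n. diffs c n * y ^ n))" for y
  proof -
    have "(\<lambda>n. y * (of_nat n * c n * y ^ (n - Suc 0))) = (\<lambda>n. (of_nat n * c n) * y ^ n)"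
    proof
      fix n show "y * (of_nat n * c n * y ^ (n - Suc 0)) = (of_nat n * c n) * y ^ n"
        by (cases n) (simp_all add: mult_ac)
    qed
    then show ?thesis
      using sums_mult[OF diffs_equiv[OF sd[of y]], of y] by (simp only:)
  qed
  have eq: "y * (\<Sum>n. diffs c n * y ^ n) = (\<Sum>n. (of_nat n * c n) * y ^ n)" for y
    using s[of y] by (simp add: sums_iff)
  have "((\<lambda>y. \<Sum>n. (of_nat n * c n) * y ^ n) has_field_derivative (\<Sum>n. diffs (\<lambda>n. of_nat n * c n) n * y ^ n)) (at y)"
    by (rule termdiffs_strong_converges_everywhere[OF sums_summable[OF s]])
  moreover have "diffs (\<lambda>n. of_nat n * c n) n = d n" for n
    using d[of n] by (simp add: diffs_def power2_eq_square mult_ac)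
  ultimately show ?thesis unfolding eq by simp
qed

lemma euler_derivative_I0_power_series: "((\<lambda>y. y * I0_power_series_deriv y) has_field_derivative I0_power_series y) (at y)"
  unfolding I0_power_series_deriv_def I0_power_series_def
proof (rule euler_operator_power_series[OF I_series_deriv(2)])
  show "(of_nat (Suc n))\<^sup>2 * I0_coeff (Suc n) = I0_coeff n" for n
    by (simp add: I0_coeff_def power_mult_distrib del: of_nat_Suc)
qed

lemma euler_derivative_K0_regular_series: "((\<lambda>y. y * K0_regular_series_deriv y) has_field_derivative K0_regular_series y + I0_power_series_deriv y) (at y)"
proof -
  have "((\<lambda>y. y * K0_regular_series_deriv y) has_field_derivative (\<Sum>n. (K0_coeff n + diffs I0_coeff n) * y ^ n)) (at y)"
    unfolding K0_regular_series_deriv_def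
  proof (rule euler_operator_power_series[OF I_series_deriv(3)])
    fix n
    have "Digamma (of_nat (Suc (Suc n)) :: complex) = Digamma (of_nat (Suc n)) + 1 / of_nat (Suc n)"
      using Digamma_plus1[of "of_nat (Suc n) :: complex"] by (simp add: add.commute del: of_nat_Suc) (simp add: add_ac)
    then show "(of_nat (Suc n))\<^sup>2 * K0_coeff (Suc n) = K0_coeff n + diffs I0_coeff n"
    proof -
      define w f D where "w = (of_nat (Suc n) :: complex)" and "f = (fact n :: complex)" and "D = Digamma w"
      have nz: "w \<noteq> 0" "f \<noteq> 0" by (simp_all add: w_def f_def del: of_nat_Suc)
      have k1: "K0_coeff (Suc n) = (D + 1 / w) / (w * f)\<^sup>2"
        using \<open>Digamma (of_nat (Suc (Suc n))) = _\<close> by (simp only: K0_coeff_def w_def f_def D_def fact_Suc)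
      have k2: "I0_coeff (Suc n) = 1 / (w * f)\<^sup>2" by (simp only: I0_coeff_def w_def f_def fact_Suc)
      have k3: "K0_coeff n = D / f\<^sup>2" by (simp only: K0_coeff_def w_def f_def D_def)
      have "w\<^sup>2 * K0_coeff (Suc n) = K0_coeff n + w * I0_coeff (Suc n)"
        unfolding k1 k2 k3 using nz by (simp add: field_simps power2_eq_square)
      then show ?thesis by (simp only: diffs_def w_def)
    qed
  qed
  also have "(\<Sum>n. (K0_coeff n + diffs I0_coeff n) * y ^ n) = K0_regular_series y + I0_power_series_deriv y"
    unfolding K0_regular_series_def I0_power_series_deriv_def distrib_right
    by (rule suminf_add[symmetric]) (auto intro: I_series_deriv termdiff_converges_all)
  finally show ?thesis .
qed

lemma K0_series_eq: "K0_series z = - Ln (z / 2) * I0_power_series (z\<^sup>2 / 4) + K0_regular_series (z\<^sup>2 / 4)"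
  by (simp add: K0_series_def I0_power_series_def K0_regular_series_def)

text \<open>z times the derivative of K0_series. The pair of K0_series and this function satisfies the first order
system d' = u/z, u' = z d, which is Bessel's equation of order 0.\<close>

definition K0_series_euler_deriv :: "complex \<Rightarrow> complex" where
  "K0_series_euler_deriv z = - I0_power_series (z\<^sup>2 / 4) + 2 * (- Ln (z / 2) * (z\<^sup>2 / 4 * I0_power_series_deriv (z\<^sup>2 / 4)) + z\<^sup>2 / 4 * K0_regular_series_deriv (z\<^sup>2 / 4))"

lemma Re_pos_not_nonpos_Reals: "Re z > 0 \<Longrightarrow> z \<notin> \<real>\<^sub>\<le>\<^sub>0"
  by (auto simp: complex_nonpos_Reals_iff)

lemma deriv_K0_series:
  assumes z: "Re z > 0"
  shows "(K0_series has_field_derivative K0_series_euler_deriv z / z) (at z)"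
    and "(K0_series_euler_deriv has_field_derivative z * K0_series z) (at z)"
proof -
  have z0: "z \<noteq> 0" using z by auto
  have ln: "((\<lambda>z. Ln (z / 2)) has_field_derivative 1 / z) (at z)"
    using z z0 by (auto intro!: derivative_eq_intros Re_pos_not_nonpos_Reals simp: field_simps)
  have sq: "((\<lambda>z. z\<^sup>2 / 4) has_field_derivative z / 2) (at z)"
    by (auto intro!: derivative_eq_intros)
  note E = DERIV_chain2[OF has_derivative_I0_power_series sq] and P = DERIV_chain2[OF has_derivative_K0_regular_series sq]
    and dE = DERIV_chain2[OF euler_derivative_I0_power_series sq] and dP = DERIV_chain2[OF euler_derivative_K0_regular_series sq]
  have "((\<lambda>z. - Ln (z / 2) * I0_power_series (z\<^sup>2 / 4) + K0_regular_series (z\<^sup>2 / 4)) has_field_derivative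
     (- (1 / z)) * I0_power_series (z\<^sup>2 / 4) + (I0_power_series_deriv (z\<^sup>2 / 4) * (z / 2)) * (- Ln (z / 2)) + K0_regular_series_deriv (z\<^sup>2 / 4) * (z / 2)) (at z)"
    by (intro DERIV_add DERIV_mult DERIV_minus ln E P)
  moreover have "(- (1 / z)) * I0_power_series (z\<^sup>2 / 4) + (I0_power_series_deriv (z\<^sup>2 / 4) * (z / 2)) * (- Ln (z / 2)) + K0_regular_series_deriv (z\<^sup>2 / 4) * (z / 2) = K0_series_euler_deriv z / z"
    using z0 by (simp add: K0_series_euler_deriv_def field_simps power2_eq_square)
  ultimately show "(K0_series has_field_derivative K0_series_euler_deriv z / z) (at z)"
    unfolding K0_series_eq[abs_def] by simp
  have "(K0_series_euler_deriv has_field_derivative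
     - (I0_power_series_deriv (z\<^sup>2 / 4) * (z / 2)) + 2 * ((- (1 / z)) * (z\<^sup>2 / 4 * I0_power_series_deriv (z\<^sup>2 / 4)) + (I0_power_series (z\<^sup>2 / 4) * (z / 2)) * (- Ln (z / 2))
       + (K0_regular_series (z\<^sup>2 / 4) + I0_power_series_deriv (z\<^sup>2 / 4)) * (z / 2))) (at z)"
    unfolding K0_series_euler_deriv_def[abs_def]
    by (intro DERIV_add DERIV_cmult DERIV_mult DERIV_minus ln E dE dP)
  moreover have "- (I0_power_series_deriv (z\<^sup>2 / 4) * (z / 2)) + 2 * ((- (1 / z)) * (z\<^sup>2 / 4 * I0_power_series_deriv (z\<^sup>2 / 4)) + (I0_power_series (z\<^sup>2 / 4) * (z / 2)) * (- Ln (z / 2))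
       + (K0_regular_series (z\<^sup>2 / 4) + I0_power_series_deriv (z\<^sup>2 / 4)) * (z / 2)) = z * K0_series z"
    using z0 by (simp add: K0_series_eq field_simps power2_eq_square)
  ultimately show "(K0_series_euler_deriv has_field_derivative z * K0_series z) (at z)" by simp
qed

lemma I0_K0_power_series_at_0:
  "I0_power_series 0 = 1" "K0_regular_series 0 = - euler_mascheroni"
  unfolding I0_power_series_def K0_regular_series_def powser_zero by (simp_all add: I0_coeff_def K0_coeff_def)

lemma x_ln_tendsto_0: "((\<lambda>x::real. complex_of_real (ln (x / 2)) * complex_of_real (x\<^sup>2)) \<longlongrightarrow> 0) (at_right 0)"
proof -
  have "((\<lambda>x::real. ln (x / 2) * x\<^sup>2) \<longlongrightarrow> 0) (at_right 0)" by real_asymp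
  then have "((\<lambda>x::real. complex_of_real (ln (x / 2) * x\<^sup>2)) \<longlongrightarrow> of_real 0) (at_right 0)"
    by (rule tendsto_of_real)
  then show ?thesis by simp
qed

text \<open>Both functions are -ln(x/2) - \<gamma> + o(1) at 0, and z times their derivatives tend to -1. The logarithm in
the series multiplies I0, whose deviation from 1 is of order x^2, and x^2 ln x vanishes at 0.\<close>

lemma K0_minus_series_tendsto:
  "((\<lambda>x. K0 (of_real x) - K0_series (of_real x)) \<longlongrightarrow> 0) (at_right 0)"
  "((\<lambda>x. - of_real x * K_cosh 1 (of_real x) - K0_series_euler_deriv (of_real x)) \<longlongrightarrow> 0) (at_right 0)"
proof -
  let ?y = "\<lambda>x::real. (complex_of_real x)\<^sup>2 / 4"
  have cont: "isCont I0_power_series 0" "isCont K0_regular_series 0" "isCont I0_power_series_deriv 0" "isCont K0_regular_series_deriv 0"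
  proof -
    show "isCont I0_power_series 0" "isCont K0_regular_series 0" using has_derivative_I0_power_series has_derivative_K0_regular_series DERIV_isCont by blast+
    show "isCont I0_power_series_deriv 0" unfolding I0_power_series_deriv_def[abs_def]
      by (rule DERIV_isCont[OF termdiffs_strong_converges_everywhere]) (rule termdiff_converges_all[OF I_series_deriv(2)])
    show "isCont K0_regular_series_deriv 0" unfolding K0_regular_series_deriv_def[abs_def]
      by (rule DERIV_isCont[OF termdiffs_strong_converges_everywhere]) (rule termdiff_converges_all[OF I_series_deriv(3)])
  qed
  have y: "(?y \<longlongrightarrow> 0) (at_right 0)" by (auto intro!: tendsto_eq_intros)
  note lim = isCont_tendsto_compose[OF cont(1) y] isCont_tendsto_compose[OF cont(2) y]
    isCont_tendsto_compose[OF cont(3) y] isCont_tendsto_compose[OF cont(4) y]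
  \<comment> \<open>the quotient (I0 - 1)/y, continuous at 0\<close>
  obtain g where g: "\<And>y. I0_power_series y - I0_power_series 0 = g y * (y - 0)" "isCont g 0"
    using has_derivative_I0_power_series[of 0] by (auto simp: CARAT_DERIV)
  note limg = isCont_tendsto_compose[OF g(2) y]
  have "((\<lambda>x. (K0 (of_real x) + of_real (ln (x / 2))) - K0_regular_series (?y x)
      + (of_real (ln (x / 2)) * of_real (x\<^sup>2)) * (g (?y x) / 4)) \<longlongrightarrow> - euler_mascheroni - K0_regular_series 0 + 0 * (g 0 / 4)) (at_right 0)"
    by (intro tendsto_intros K0_plus_log_tendsto x_ln_tendsto_0 lim limg) auto
  then have "((\<lambda>x. (K0 (of_real x) + of_real (ln (x / 2))) - K0_regular_series (?y x)
      + (of_real (ln (x / 2)) * of_real (x\<^sup>2)) * (g (?y x) / 4)) \<longlongrightarrow> 0) (at_right 0)"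
    by (simp add: I0_K0_power_series_at_0)
  then show "((\<lambda>x. K0 (of_real x) - K0_series (of_real x)) \<longlongrightarrow> 0) (at_right 0)"
  proof (rule Lim_transform_eventually)
    show "\<forall>\<^sub>F x in at_right 0. (K0 (of_real x) + of_real (ln (x / 2))) - K0_regular_series (?y x)
      + (of_real (ln (x / 2)) * of_real (x\<^sup>2)) * (g (?y x) / 4) = K0 (of_real x) - K0_series (of_real x)"
      unfolding eventually_at_filter
    proof (intro always_eventually allI impI)
      fix x :: real assume "x \<in> {0<..}"
      then have "Ln (complex_of_real x / 2) = of_real (ln (x / 2))" using Ln_of_real[of "x / 2"] by simp
      moreover have "I0_power_series (?y x) = 1 + g (?y x) * ?y x" using g(1)[of "?y x"] by (simp only: I0_K0_power_series_at_0 diff_0_right diff_eq_eq add.commute)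
      ultimately show "(K0 (of_real x) + of_real (ln (x / 2))) - K0_regular_series (?y x)
        + (of_real (ln (x / 2)) * of_real (x\<^sup>2)) * (g (?y x) / 4) = K0 (of_real x) - K0_series (of_real x)"
        by (simp add: K0_series_eq algebra_simps)
    qed
  qed
  have "((\<lambda>x. - (of_real x * K_cosh 1 (of_real x)) + I0_power_series (?y x) - 2 * (- ((of_real (ln (x / 2)) * of_real (x\<^sup>2)) * (I0_power_series_deriv (?y x) / 4)) + ?y x * K0_regular_series_deriv (?y x)))
      \<longlongrightarrow> - 1 + I0_power_series 0 - 2 * (- (0 * (I0_power_series_deriv 0 / 4)) + 0 * K0_regular_series_deriv 0)) (at_right 0)"
    by (intro tendsto_intros K1_asymptotic x_ln_tendsto_0 lim y) auto
  then have "((\<lambda>x. - (of_real x * K_cosh 1 (of_real x)) + I0_power_series (?y x) - 2 * (- ((of_real (ln (x / 2)) * of_real (x\<^sup>2)) * (I0_power_series_deriv (?y x) / 4)) + ?y x * K0_regular_series_deriv (?y x)))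
      \<longlongrightarrow> 0) (at_right 0)"
    by (simp add: I0_K0_power_series_at_0)
  then show "((\<lambda>x. - of_real x * K_cosh 1 (of_real x) - K0_series_euler_deriv (of_real x)) \<longlongrightarrow> 0) (at_right 0)"
  proof (rule Lim_transform_eventually)
    show "\<forall>\<^sub>F x in at_right 0. - (of_real x * K_cosh 1 (of_real x)) + I0_power_series (?y x) - 2 * (- ((of_real (ln (x / 2)) * of_real (x\<^sup>2)) * (I0_power_series_deriv (?y x) / 4)) + ?y x * K0_regular_series_deriv (?y x))
      = - of_real x * K_cosh 1 (of_real x) - K0_series_euler_deriv (of_real x)"
      unfolding eventually_at_filter
    proof (intro always_eventually allI impI)
      fix x :: real assume "x \<in> {0<..}"
      then have "Ln (complex_of_real x / 2) = of_real (ln (x / 2))" using Ln_of_real[of "x / 2"] by simp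
      then show "- (of_real x * K_cosh 1 (of_real x)) + I0_power_series (?y x) - 2 * (- ((of_real (ln (x / 2)) * of_real (x\<^sup>2)) * (I0_power_series_deriv (?y x) / 4)) + ?y x * K0_regular_series_deriv (?y x))
        = - of_real x * K_cosh 1 (of_real x) - K0_series_euler_deriv (of_real x)"
        by (simp add: K0_series_euler_deriv_def algebra_simps)
    qed
  qed
qed

text \<open>Uniqueness for Bessel's equation at its singular point. If M is the maximum of |d| on [0, 1/2], then
|u(x)| \<le> M x by the second equation and |d(x)| \<le> M x \<le> M/2 by the first, so M = 0.\<close>

lemma vanishing_ode_system:
  fixes d u :: "real \<Rightarrow> complex"
  assumes d: "\<And>x. x > 0 \<Longrightarrow> (d has_vector_derivative u x / of_real x) (at x)"
    and u: "\<And>x. x > 0 \<Longrightarrow> (u has_vector_derivative of_real x * d x) (at x)"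
    and lim: "(d \<longlongrightarrow> 0) (at_right 0)" "(u \<longlongrightarrow> 0) (at_right 0)"
    and x: "0 < x" "x < 1 / 2"
  shows "d x = 0"
proof -
  define D where "D x = (if x = 0 then 0 else d x)" for x
  define W where "W x = (if x = 0 then 0 else u x)" for x
  \<comment> \<open>a function with limit 0 at 0 becomes continuous on [0, 1/2] when it is given the value 0 there\<close>
  have cont: "continuous_on {0..1 / 2} F" if "\<And>x. x > 0 \<Longrightarrow> (f has_vector_derivative f' x) (at x)"
      "(f \<longlongrightarrow> 0) (at_right 0)" "F = (\<lambda>x. if x = 0 then 0 else f x)" for F f f' :: "real \<Rightarrow> complex"
    unfolding continuous_on_def
  proof
    fix x :: real assume x: "x \<in> {0..1 / 2}"
    show "(F \<longlongrightarrow> F x) (at x within {0..1 / 2})"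
    proof (cases "x = 0")
      case True
      have "(F \<longlongrightarrow> 0) (at_right 0)"
        by (rule Lim_transform_eventually[OF that(2)]) (auto simp: that(3) eventually_at_filter)
      then have "(F \<longlongrightarrow> 0) (at 0 within {0..1 / 2})"
        by (subst at_within_Icc_at_right) auto
      then show ?thesis using True by (simp add: that(3))
    next
      case False
      then have "x > 0" using x by simp
      then have "(f \<longlongrightarrow> f x) (at x)"
        using has_vector_derivative_continuous[OF that(1)[OF \<open>x > 0\<close>]] by (simp add: isCont_def)
      then have "(F \<longlongrightarrow> f x) (at x)"
      proof (rule Lim_transform_eventually)
        show "\<forall>\<^sub>F y in at x. f y = F y"
        proof (rule eventually_mono)
          show "\<forall>\<^sub>F y in at x. y \<in> {0<..}"
            using \<open>x > 0\<close> by (intro eventually_at_in_open') auto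
        qed (auto simp: that(3))
      qed
      then show ?thesis using False by (auto simp: that(3) intro: tendsto_within_subset)
    qed
  qed
  have contD: "continuous_on {0..1 / 2} D"
    by (rule cont[OF d lim(1)]) (simp_all add: D_def fun_eq_iff)
  have contW: "continuous_on {0..1 / 2} W"
    by (rule cont[OF u lim(2)]) (simp_all add: W_def fun_eq_iff)
  have "\<exists>x\<in>{0..1 / 2}. \<forall>y\<in>{0..1 / 2}. norm (D y) \<le> norm (D x)"
    by (rule continuous_attains_sup) (use contD in \<open>auto intro: continuous_on_norm\<close>)
  then obtain x0 where x0: "x0 \<in> {0..1 / 2}" "\<And>x. x \<in> {0..1 / 2} \<Longrightarrow> norm (D x) \<le> norm (D x0)" by blast
  define M where "M = norm (D x0)"
  have M: "norm (d x) \<le> M" if "0 < x" "x \<le> 1 / 2" for x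
    using x0(2)[of x] that by (simp add: D_def M_def)
  have M0: "M \<ge> 0" by (simp add: M_def)
  have bu: "norm (u x) \<le> M * x" if x: "0 < x" "x \<le> 1 / 2" for x
  proof -
    have "\<exists>\<xi>\<in>{0<..<x}. norm (W x - W 0) \<le> norm ((x - 0) *\<^sub>R (of_real \<xi> * d \<xi>))"
    proof (rule mvt_general[OF x(1)])
      show "continuous_on {0..x} W" using contW x by (rule_tac continuous_on_subset) auto
      fix \<xi> assume "0 < \<xi>" "\<xi> < x"
      have "(u has_derivative (\<lambda>h. h *\<^sub>R (of_real \<xi> * d \<xi>))) (at \<xi>)"
        using u[OF \<open>0 < \<xi>\<close>] by (simp add: has_vector_derivative_def)
      then show "(W has_derivative (\<lambda>h. h *\<^sub>R (of_real \<xi> * d \<xi>))) (at \<xi>)"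
        by (rule has_derivative_transform_within_open[of _ _ _ _ "{0<..}"]) (use \<open>0 < \<xi>\<close> in \<open>auto simp: W_def\<close>)
    qed
    then obtain \<xi> where \<xi>: "0 < \<xi>" "\<xi> < x" "norm (u x) \<le> x * (\<xi> * norm (d \<xi>))"
      using x by (auto simp: W_def norm_mult)
    note \<xi>(3)
    also have "x * (\<xi> * norm (d \<xi>)) \<le> x * (1 * M)"
      using \<xi> x M[of \<xi>] by (intro mult_left_mono mult_mono) auto
    finally show ?thesis by (simp add: mult.commute)
  qed
  have bd: "norm (d x) \<le> M / 2" if x: "0 < x" "x \<le> 1 / 2" for x
  proof -
    have "\<exists>\<xi>\<in>{0<..<x}. norm (D x - D 0) \<le> norm ((x - 0) *\<^sub>R (u \<xi> / of_real \<xi>))"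
    proof (rule mvt_general[OF x(1)])
      show "continuous_on {0..x} D" using contD x by (rule_tac continuous_on_subset) auto
      fix \<xi> assume "0 < \<xi>" "\<xi> < x"
      have "(d has_derivative (\<lambda>h. h *\<^sub>R (u \<xi> / of_real \<xi>))) (at \<xi>)"
        using d[OF \<open>0 < \<xi>\<close>] by (simp add: has_vector_derivative_def)
      then show "(D has_derivative (\<lambda>h. h *\<^sub>R (u \<xi> / of_real \<xi>))) (at \<xi>)"
        by (rule has_derivative_transform_within_open[of _ _ _ _ "{0<..}"]) (use \<open>0 < \<xi>\<close> in \<open>auto simp: D_def\<close>)
    qed
    then obtain \<xi> where \<xi>: "0 < \<xi>" "\<xi> < x" "norm (d x) \<le> x * (norm (u \<xi>) / \<xi>)"
      using x by (auto simp: D_def norm_divide)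
    have "norm (u \<xi>) / \<xi> \<le> M" using bu[of \<xi>] \<xi> x by (simp add: divide_le_eq)
    then have "x * (norm (u \<xi>) / \<xi>) \<le> 1 / 2 * M"
      using x M0 \<xi> by (intro mult_mono) auto
    with \<xi>(3) show ?thesis by linarith
  qed
  have "M \<le> M / 2"
  proof (cases "x0 = 0")
    case True then show ?thesis by (simp add: M_def D_def)
  next
    case False then show ?thesis using bd[of x0] x0(1) by (simp add: M_def D_def)
  qed
  then have "M = 0" using M0 by simp
  then show ?thesis using M[of x] x by simp
qed

text \<open>The integral and the logarithmic series solve the same differential equation and agree in the limit at 0, so they
agree on an interval of positive reals, and by the identity theorem on the half-plane.\<close>

theorem bessel_K_0_eq_K0:
  assumes z: "Re z > 0"
  shows "bessel_K 0 z = K0 z"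
proof -
  have "K0 z = K0_series z"
  proof (rule eq_on_right_half_plane[OF holomorphic_K0 _ _ _ z])
    show "K0_series holomorphic_on {z. Re z > 0}"
      using deriv_K0_series(1) by (auto simp: holomorphic_on_open open_halfspace_Re_gt)
    show "(1 / 2 :: real) > 0" by simp
    fix x :: real assume x: "0 < x" "x < 1 / 2"
    have "K0 (of_real x) - K0_series (of_real x) = 0"
    proof (rule vanishing_ode_system[OF _ _ K0_minus_series_tendsto x])
      fix x :: real assume x: "x > 0"
      then have x': "Re (of_real x) > 0" "complex_of_real x \<noteq> 0" by auto
      have "((\<lambda>z. K0 z - K0_series z) has_field_derivative - K_cosh (Suc 0) (of_real x) - K0_series_euler_deriv (of_real x) / of_real x) (at (of_real x))"
        by (intro DERIV_diff K_cosh_deriv deriv_K0_series x')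
      then have "((\<lambda>z. K0 z - K0_series z) has_field_derivative (- of_real x * K_cosh 1 (of_real x) - K0_series_euler_deriv (of_real x)) / of_real x) (at (of_real x))"
        by (rule DERIV_cong) (use x' in \<open>simp add: field_simps\<close>)
      from has_vector_derivative_real_field[OF this]
      show "((\<lambda>x. K0 (of_real x) - K0_series (of_real x)) has_vector_derivative (- of_real x * K_cosh 1 (of_real x) - K0_series_euler_deriv (of_real x)) / of_real x) (at x)" .
      have "((\<lambda>z. - z * K_cosh 1 z - K0_series_euler_deriv z) has_field_derivative
          (- 1) * K_cosh 1 (of_real x) + (- K_cosh (Suc 1) (of_real x)) * (- of_real x) - of_real x * K0_series (of_real x)) (at (of_real x))"
        by (intro DERIV_diff DERIV_mult DERIV_minus DERIV_ident K_cosh_deriv deriv_K0_series x')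
      then have "((\<lambda>z. - z * K_cosh 1 z - K0_series_euler_deriv z) has_field_derivative of_real x * (K0 (of_real x) - K0_series (of_real x))) (at (of_real x))"
        by (rule DERIV_cong) (use K_cosh_bessel_equation[OF x'(1)] in \<open>simp add: algebra_simps numeral_2_eq_2\<close>)
      from has_vector_derivative_real_field[OF this]
      show "((\<lambda>x. - of_real x * K_cosh 1 (of_real x) - K0_series_euler_deriv (of_real x)) has_vector_derivative of_real x * (K0 (of_real x) - K0_series (of_real x))) (at x)" .
    qed
    then show "K0 (of_real x) = K0_series (of_real x)" by simp
  qed
  moreover have "z \<noteq> 0" using z by auto
  ultimately show ?thesis using bessel_K_0_eq_series[of z] by simp
qed

section \<open>Averages over the unit circle\<close>

text \<open>Lebesgue measure on a period, as a probability measure on the whole line: averages over the unit circle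
are its expectations, and results on probability spaces and product measures apply.\<close>

definition unit_measure :: "real measure" where
  "unit_measure = density lborel (\<lambda>t. ennreal (indicator {0..1} t))"

lemma sets_unit_measure [simp, measurable_cong]: "sets unit_measure = sets borel"
  by (simp add: unit_measure_def)

lemma space_unit_measure [simp]: "space unit_measure = UNIV"
  by (simp add: unit_measure_def)

lemma prob_space_unit_measure: "prob_space unit_measure"
proof (rule prob_spaceI)
  show "emeasure unit_measure (space unit_measure) = 1"
    by (simp add: unit_measure_def emeasure_density ennreal_indicator)
qed

lemma integral_unit_measure:
  fixes f :: "real \<Rightarrow> 'a::{banach,second_countable_topology}"
  assumes "f \<in> borel_measurable borel"
  shows "integral\<^sup>L unit_measure f = (\<integral>t. indicator {0..1} t *\<^sub>R f t \<partial>lborel)"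
  using assms unfolding unit_measure_def by (subst integral_density) auto

lemma integrable_unit_measure_bounded:
  fixes f :: "real \<Rightarrow> 'a::{banach,second_countable_topology}"
  assumes "f \<in> borel_measurable borel" "\<And>t. norm (f t) \<le> B"
  shows "integrable unit_measure f"
proof -
  interpret prob_space unit_measure by (rule prob_space_unit_measure)
  show ?thesis using assms by (intro integrable_const_bound[of _ B] AE_I2) (auto simp: measurable_cong_sets[OF sets_unit_measure refl])
qed

abbreviation circ :: "real \<Rightarrow> complex" where "circ t \<equiv> cis (2 * pi * t)"

lemma borel_measurable_circ [measurable]: "circ \<in> borel_measurable borel"
  by (intro borel_measurable_continuous_onI continuous_intros)

lemma circ_orthogonal:
  "(\<integral>t. circ t ^ m * cnj (circ t) ^ n \<partial>unit_measure) = (if m = n then 1 else 0)"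
proof -
  interpret prob_space unit_measure by (rule prob_space_unit_measure)
  define w where "w = 2 * pi * (real m - real n)"
  have eq: "circ t ^ m * cnj (circ t) ^ n = cis (w * t)" for t
    unfolding cis_cnj Complex.DeMoivre cis_mult w_def by (simp add: algebra_simps)
  show ?thesis
  proof (cases "m = n")
    case True
    then show ?thesis unfolding eq by (simp add: w_def prob_space[unfolded space_unit_measure])
  next
    case False
    then have w: "w \<noteq> 0" by (simp add: w_def)
    have "(\<integral>t. cis (w * t) \<partial>unit_measure) = (\<integral>t. indicator {0..1} t *\<^sub>R cis (w * t) \<partial>lborel)"
      by (intro integral_unit_measure borel_measurable_continuous_onI continuous_intros)
    also have "\<dots> = cis (w * 1) / (\<i> * of_real w) - cis (w * 0) / (\<i> * of_real w)"
    proof (rule integral_FTC_atLeastAtMost)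
      fix t :: real
      have "((\<lambda>z. exp (\<i> * of_real w * z) / (\<i> * of_real w)) has_field_derivative exp (\<i> * of_real w * of_real t)) (at (of_real t))"
        using w by (auto intro!: derivative_eq_intros)
      from has_vector_derivative_real_field[OF this]
      have "((\<lambda>t. cis (w * t) / (\<i> * of_real w)) has_vector_derivative cis (w * t)) (at t)"
        by (simp add: cis_conv_exp mult_ac)
      then show "((\<lambda>t. cis (w * t) / (\<i> * of_real w)) has_vector_derivative cis (w * t)) (at t within {0..1})"
        by (rule has_vector_derivative_at_within)
    qed (auto intro!: continuous_intros)
    also have "cis (w * 1) = 1"
      unfolding w_def by (simp add: cis_multiple_2pi)
    finally show ?thesis unfolding eq using False by simp
  qed
qed

lemma integral_unit_suminf:
  fixes h :: "nat \<Rightarrow> real \<Rightarrow> 'a::{banach,second_countable_topology}"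
  assumes meas: "\<And>n. h n \<in> borel_measurable borel" and b: "\<And>n t. norm (h n t) \<le> B n" and B: "summable B"
  shows "integrable unit_measure (\<lambda>t. \<Sum>n. h n t)"
    and "(\<integral>t. (\<Sum>n. h n t) \<partial>unit_measure) = (\<Sum>n. integral\<^sup>L unit_measure (h n))"
proof -
  interpret prob_space unit_measure by (rule prob_space_unit_measure)
  have int: "integrable unit_measure (h n)" for n
    by (rule integrable_unit_measure_bounded[OF meas b])
  have pt: "AE t in unit_measure. summable (\<lambda>n. norm (h n t))"
    by (intro AE_I2 summable_comparison_test[OF _ B]) (auto intro!: exI[of _ 0] b)
  have "norm (\<integral>t. norm (h n t) \<partial>unit_measure) \<le> B n" for n
  proof -
    have "(\<integral>t. norm (h n t) \<partial>unit_measure) \<le> (\<integral>t. B n \<partial>unit_measure)"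
      using int[of n] by (intro integral_mono b) auto
    then show ?thesis by (simp add: prob_space[unfolded space_unit_measure])
  qed
  then have sm: "summable (\<lambda>n. \<integral>t. norm (h n t) \<partial>unit_measure)"
    by (intro summable_comparison_test[OF _ B]) (auto intro!: exI[of _ 0])
  show "integrable unit_measure (\<lambda>t. \<Sum>n. h n t)" by (rule integrable_suminf[OF int pt sm])
  show "(\<integral>t. (\<Sum>n. h n t) \<partial>unit_measure) = (\<Sum>n. integral\<^sup>L unit_measure (h n))"
    by (rule integral_suminf[OF int pt sm])
qed

text \<open>Parseval's formula for absolutely convergent series; expanding the product and integrating term by term
leaves the diagonal.\<close>

lemma circle_parseval:
  fixes f g :: "nat \<Rightarrow> complex"
  assumes f: "summable (\<lambda>n. norm (f n))" and g: "summable (\<lambda>n. norm (g n))"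
  shows "integrable unit_measure (\<lambda>t. (\<Sum>n. f n * circ t ^ n) * (\<Sum>n. g n * cnj (circ t) ^ n))"
    and "(\<integral>t. (\<Sum>n. f n * circ t ^ n) * (\<Sum>n. g n * cnj (circ t) ^ n) \<partial>unit_measure) = (\<Sum>n. f n * g n)"
proof -
  let ?G = "\<lambda>t. \<Sum>n. g n * cnj (circ t) ^ n"
  have [measurable]: "(\<lambda>t. cnj (circ t)) \<in> borel_measurable borel"
    by (intro borel_measurable_continuous_onI continuous_intros)
  have Gm [measurable]: "?G \<in> borel_measurable borel" by measurable
  have sg: "summable (\<lambda>n. norm (g n * cnj (circ t) ^ n))" for t using g by (simp add: norm_mult norm_power)
  have sf: "summable (\<lambda>n. norm (f n * circ t ^ n))" for t using f by (simp add: norm_mult norm_power)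
  define K where "K = (\<Sum>n. norm (g n))"
  have Gb: "norm (?G t) \<le> K" for t
    using summable_norm[OF sg[of t]] by (simp add: K_def norm_mult norm_power)
  have coeff: "(\<integral>t. f m * circ t ^ m * ?G t \<partial>unit_measure) = f m * g m" for m
  proof -
    let ?h = "\<lambda>n t. f m * (g n * (circ t ^ m * cnj (circ t) ^ n))"
    have "(\<lambda>t. f m * circ t ^ m * ?G t) = (\<lambda>t. \<Sum>n. ?h n t)"
    proof
      fix t
      have "f m * circ t ^ m * ?G t = (\<Sum>n. f m * circ t ^ m * (g n * cnj (circ t) ^ n))"
        by (rule suminf_mult[symmetric, OF summable_norm_cancel[OF sg]])
      then show "f m * circ t ^ m * ?G t = (\<Sum>n. ?h n t)" by (simp add: mult_ac)
    qed
    moreover have "(\<integral>t. (\<Sum>n. ?h n t) \<partial>unit_measure) = (\<Sum>n. integral\<^sup>L unit_measure (?h n))"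
    proof (rule integral_unit_suminf(2))
      show "?h n \<in> borel_measurable borel" for n by measurable
      show "norm (?h n t) \<le> norm (f m) * norm (g n)" for n t by (simp add: norm_mult norm_power)
      show "summable (\<lambda>n. norm (f m) * norm (g n))" by (intro summable_mult g)
    qed
    moreover have "integral\<^sup>L unit_measure (?h n) = (if n = m then f m * g m else 0)" for n
      by (simp only: integral_mult_right_zero circ_orthogonal) auto
    moreover have "(\<Sum>n. if n = m then f m * g m else 0) = f m * g m"
      using sums_unique[OF sums_single[of m "\<lambda>_. f m * g m"]] by simp
    ultimately show ?thesis by simp
  qed
  let ?F = "\<lambda>n t. f n * circ t ^ n * ?G t"
  have eq: "(\<Sum>n. f n * circ t ^ n) * ?G t = (\<Sum>n. ?F n t)" for t
    by (rule suminf_mult2[OF summable_norm_cancel[OF sf]])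
  have m: "?F n \<in> borel_measurable borel" for n by measurable
  have b: "norm (?F n t) \<le> norm (f n) * K" for n t
    using mult_left_mono[OF Gb[of t] norm_ge_zero[of "f n"]] by (simp add: norm_mult norm_power)
  have B: "summable (\<lambda>n. norm (f n) * K)" by (intro summable_mult2 f)
  show "integrable unit_measure (\<lambda>t. (\<Sum>n. f n * circ t ^ n) * (\<Sum>n. g n * cnj (circ t) ^ n))"
    unfolding eq by (rule integral_unit_suminf(1)[OF m b B])
  show "(\<integral>t. (\<Sum>n. f n * circ t ^ n) * (\<Sum>n. g n * cnj (circ t) ^ n) \<partial>unit_measure) = (\<Sum>n. f n * g n)"
    unfolding eq using integral_unit_suminf(2)[OF m b B] by (simp only: coeff)
qed

lemma bessel_I_0_eq_suminf: "bessel_I 0 z = (\<Sum>k. (z\<^sup>2 / 4) ^ k / (fact k)\<^sup>2)"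
proof -
  have "rGamma (0 + of_nat k + 1 :: complex) = 1 / fact k" for k
    using Gamma_fact[of k, where 'a = complex] by (simp add: rGamma_inverse_Gamma add.commute inverse_eq_divide)
  then show ?thesis
    by (simp add: bessel_I_def power_mult power_divide power2_eq_square mult.assoc)
qed

text \<open>Parseval applied to two exponential series. The factors exp(\<tau>) and exp(-\<tau>) cancel in the
products of coefficients, so the value does not depend on \<tau>.\<close>

lemma bessel_I_0_circle_integral:
  fixes x :: complex and \<tau> :: real
  shows "integrable unit_measure (\<lambda>t. exp (x / 2 * (of_real (exp \<tau>) * circ t + of_real (exp (- \<tau>)) * cnj (circ t))))"
    and "(\<integral>t. exp (x / 2 * (of_real (exp \<tau>) * circ t + of_real (exp (- \<tau>)) * cnj (circ t))) \<partial>unit_measure) = bessel_I 0 x"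
proof -
  define A where "A = x / 2 * of_real (exp \<tau>)"
  define B where "B = x / 2 * of_real (exp (- \<tau>))"
  have AB: "A * B = x\<^sup>2 / 4" 
  proof -
    have "complex_of_real (exp \<tau>) * of_real (exp (- \<tau>)) = 1"
      by (simp only: of_real_mult[symmetric] exp_add[symmetric]) simp
    then show ?thesis by (simp add: A_def B_def power2_eq_square mult_ac)
  qed
  have e: "exp (c * w) = (\<Sum>n. c ^ n / fact n * w ^ n)" for c w :: complex
    using exp_converges[of "c * w"] by (simp add: sums_iff power_mult_distrib scaleR_conv_of_real field_simps)
  have s: "summable (\<lambda>n. norm (c ^ n / fact n :: complex))" for c
    using summable_exp_generic[of "norm c"] by (simp add: norm_divide norm_mult norm_inverse norm_power divide_inverse mult.commute)
  have eq: "exp (x / 2 * (of_real (exp \<tau>) * circ t + of_real (exp (- \<tau>)) * cnj (circ t)))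
      = (\<Sum>n. A ^ n / fact n * circ t ^ n) * (\<Sum>n. B ^ n / fact n * cnj (circ t) ^ n)" for t
    unfolding e[symmetric] exp_add[symmetric] by (simp add: A_def B_def algebra_simps)
  show "integrable unit_measure (\<lambda>t. exp (x / 2 * (of_real (exp \<tau>) * circ t + of_real (exp (- \<tau>)) * cnj (circ t))))"
    unfolding eq by (rule circle_parseval(1)[OF s s])
  have "(\<Sum>n. A ^ n / fact n * (B ^ n / fact n)) = (\<Sum>n. (A * B) ^ n / (fact n)\<^sup>2)"
    by (simp add: power_mult_distrib power2_eq_square)
  then show "(\<integral>t. exp (x / 2 * (of_real (exp \<tau>) * circ t + of_real (exp (- \<tau>)) * cnj (circ t))) \<partial>unit_measure) = bessel_I 0 x"
    unfolding eq circle_parseval(2)[OF s s] bessel_I_0_eq_suminf AB by simp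
qed

text \<open>For \<tau> = 0 the circle integral is the mean of exp(x cos(2 pi t)).\<close>

lemma norm_bessel_I_0_le: "norm (bessel_I 0 x) \<le> exp \<bar>Re x\<bar>"
proof -
  interpret prob_space unit_measure by (rule prob_space_unit_measure)
  let ?f = "\<lambda>t. exp (x / 2 * (of_real (exp 0) * circ t + of_real (exp (- 0)) * cnj (circ t)))"
  have f: "?f t = exp (x * of_real (cos (2 * pi * t)))" for t
    using complex_add_cnj[of "circ t"] by simp
  have b: "norm (?f t) \<le> exp \<bar>Re x\<bar>" for t
  proof -
    have "Re x * cos (2 * pi * t) \<le> \<bar>Re x\<bar> * \<bar>cos (2 * pi * t)\<bar>" by (metis abs_ge_self abs_mult)
    also have "\<dots> \<le> \<bar>Re x\<bar> * 1" by (intro mult_left_mono) auto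
    finally show ?thesis unfolding f by simp
  qed
  have "norm (bessel_I 0 x) \<le> (\<integral>t. norm (?f t) \<partial>unit_measure)"
    unfolding bessel_I_0_circle_integral(2)[of x 0, symmetric] by (rule integral_norm_bound)
  also have "\<dots> \<le> (\<integral>t. exp \<bar>Re x\<bar> \<partial>unit_measure)"
    by (intro integral_mono integrable_norm bessel_I_0_circle_integral(1) b) auto
  also have "\<dots> = exp \<bar>Re x\<bar>" by (simp add: prob_space[unfolded space_unit_measure])
  finally show ?thesis .
qed

lemma bessel_I_0_minus: "bessel_I 0 (- z) = bessel_I 0 z"
  by (simp add: bessel_I_0_eq_suminf)

lemma holomorphic_bessel_I_0: "bessel_I 0 holomorphic_on UNIV"
proof -
  have "summable (\<lambda>k. (1 / (fact k)\<^sup>2) * y ^ k)" for y :: complex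
  proof (rule summable_comparison_test[OF _ summable_exp_generic[of "norm y"]])
    have "norm (1 / (fact n)\<^sup>2 * y ^ n) \<le> norm y ^ n /\<^sub>R fact n" for n
    proof -
      have "(1::real) / (fact n)\<^sup>2 \<le> 1 / fact n"
        using fact_ge_1[of n, where 'a = real] by (simp add: power2_eq_square divide_le_eq)
      then have "norm y ^ n * (1 / (fact n)\<^sup>2) \<le> norm y ^ n * (1 / fact n)"
        by (intro mult_left_mono) auto
      then show ?thesis by (simp add: norm_mult norm_divide norm_power norm_inverse divide_inverse mult_ac)
    qed
    then show "\<exists>N. \<forall>n\<ge>N. norm (1 / (fact n)\<^sup>2 * y ^ n) \<le> norm y ^ n /\<^sub>R fact n" by blast
  qed
  note d = termdiffs_strong_converges_everywhere[OF this]
  have "(\<lambda>y::complex. \<Sum>k. (1 / (fact k)\<^sup>2) * y ^ k) holomorphic_on UNIV"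
    using d by (auto simp: holomorphic_on_def field_differentiable_def intro: has_field_derivative_at_within)
  moreover have "(\<lambda>z::complex. z\<^sup>2 / 4) holomorphic_on UNIV" by (intro holomorphic_intros) auto
  ultimately have "(\<lambda>z::complex. \<Sum>k. (1 / (fact k)\<^sup>2) * (z\<^sup>2 / 4) ^ k) holomorphic_on UNIV"
    using holomorphic_on_compose_gen[of "\<lambda>z. z\<^sup>2 / 4" UNIV _ UNIV, unfolded o_def] by blast
  moreover have "bessel_I 0 = (\<lambda>z. \<Sum>k. (1 / (fact k)\<^sup>2) * (z\<^sup>2 / 4) ^ k)"
    by (simp add: fun_eq_iff bessel_I_0_eq_suminf)
  ultimately show ?thesis by simp
qed

lemma norm_minus_circ:
  fixes X x :: real
  shows "(cmod (of_real X - of_real x * circ t))\<^sup>2 = X\<^sup>2 + x\<^sup>2 - 2 * X * x * cos (2 * pi * t)"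
proof -
  have "(cmod (of_real X - of_real x * circ t))\<^sup>2 = (X - x * cos (2 * pi * t))\<^sup>2 + (x * sin (2 * pi * t))\<^sup>2"
    by (simp add: cmod_power2)
  then show ?thesis using sin_cos_squared_add[of "2 * pi * t"] by algebra
qed

text \<open>The constant term of the addition theorem for K0. The double integral of
exp(-X cosh \<tau> + (x/2) (e^\<tau> v + e^(-\<tau>) / v)), where v runs over the unit circle, is evaluated in
both orders. Integrating over v first gives I0(x) for every \<tau>, and then K0(X). Writing
X - x v = |X - x v| e^(i \<phi>), the exponent is -|X - x v| cosh(\<tau> + i \<phi>), so integrating over \<tau> first
gives K0(|X - x v|) by the shift of the path.\<close>

lemma bessel_I_0_mult_K0:
  fixes X x :: real
  assumes x: "\<bar>x\<bar> < X"
  shows "(\<integral>t. K0 (of_real (cmod (of_real X - of_real x * circ t))) \<partial>unit_measure) = bessel_I 0 (of_real x) * K0 (of_real X)"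
proof -
  interpret U: prob_space unit_measure by (rule prob_space_unit_measure)
  interpret P: pair_sigma_finite lborel unit_measure ..
  let ?f = "\<lambda>\<tau> t. exp (- of_real (X * cosh \<tau>)) * exp (of_real x / 2 * (of_real (exp \<tau>) * circ t + of_real (exp (- \<tau>)) * cnj (circ t)))"
  define \<delta> where "\<delta> = X - \<bar>x\<bar>"
  have \<delta>: "\<delta> > 0" using x by (simp add: \<delta>_def)
  \<comment> \<open>absolute integrability on the product, for the exchange of the two integrals\<close>
  have nrm: "norm (?f \<tau> t) \<le> exp (- \<delta> * cosh \<tau>)" for \<tau> t
  proof -
    have "Re (of_real x / 2 * (of_real (exp \<tau>) * circ t + of_real (exp (- \<tau>)) * cnj (circ t))) = x * cos (2 * pi * t) * cosh \<tau>"
      by (simp add: cosh_def algebra_simps)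
    then have "norm (?f \<tau> t) = exp (- (X * cosh \<tau>) + x * cos (2 * pi * t) * cosh \<tau>)"
      by (simp only: norm_mult norm_exp_eq_Re exp_add) simp
    moreover have "x * cos (2 * pi * t) * cosh \<tau> \<le> \<bar>x\<bar> * cosh \<tau>"
    proof (rule mult_right_mono)
      have "x * cos (2 * pi * t) \<le> \<bar>x\<bar> * \<bar>cos (2 * pi * t)\<bar>" by (metis abs_ge_self abs_mult)
      also have "\<dots> \<le> \<bar>x\<bar> * 1" by (intro mult_left_mono) auto
      finally show "x * cos (2 * pi * t) \<le> \<bar>x\<bar>" by simp
    qed simp
    ultimately show ?thesis by (simp add: \<delta>_def algebra_simps)
  qed
  have meas: "(\<lambda>(\<tau>, t). ?f \<tau> t) \<in> borel_measurable (lborel \<Otimes>\<^sub>M unit_measure)"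
  proof -
    have "(\<lambda>(\<tau>, t). ?f \<tau> t) \<in> borel_measurable borel"
      by (intro borel_measurable_continuous_onI) (auto simp: case_prod_unfold intro!: continuous_intros)
    moreover have S: "sets (lborel \<Otimes>\<^sub>M unit_measure) = sets (borel :: (real \<times> real) measure)"
    proof -
      have "sets (lborel \<Otimes>\<^sub>M unit_measure) = sets ((borel :: real measure) \<Otimes>\<^sub>M (borel :: real measure))"
        by (intro sets_pair_measure_cong) auto
      also have "(borel :: real measure) \<Otimes>\<^sub>M (borel :: real measure) = borel" by (rule borel_prod)
      finally show ?thesis .
    qed
    ultimately show ?thesis by (simp only: measurable_cong_sets[OF S refl])
  qed
  have mf: "?f \<tau> \<in> borel_measurable borel" for \<tau>
    by (intro borel_measurable_continuous_onI continuous_intros)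
  have int: "integrable (lborel \<Otimes>\<^sub>M unit_measure) (\<lambda>(\<tau>, t). ?f \<tau> t)"
  proof (rule P.Fubini_integrable[OF meas])
    have mint: "integrable unit_measure (?f \<tau>)" for \<tau>
      by (rule integrable_unit_measure_bounded[OF mf nrm])
    then show "AE \<tau> in lborel. integrable unit_measure (\<lambda>y. case (\<tau>, y) of (\<tau>, t) \<Rightarrow> ?f \<tau> t)"
      by (intro AE_I2) simp
    show "integrable lborel (\<lambda>\<tau>. \<integral>y. norm (case (\<tau>, y) of (\<tau>, t) \<Rightarrow> ?f \<tau> t) \<partial>unit_measure)"
    proof (rule Bochner_Integration.integrable_bound[OF integrable_cosh_power_exp[OF \<delta>, of 0]])
      show "(\<lambda>\<tau>. \<integral>y. norm (case (\<tau>, y) of (\<tau>, t) \<Rightarrow> ?f \<tau> t) \<partial>unit_measure) \<in> borel_measurable lborel"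
        using meas by measurable
      show "AE \<tau> in lborel. norm (\<integral>y. norm (case (\<tau>, y) of (\<tau>, t) \<Rightarrow> ?f \<tau> t) \<partial>unit_measure) \<le> norm (cosh \<tau> ^ 0 * exp (- \<delta> * cosh \<tau>))"
      proof (rule AE_I2)
        fix \<tau>
        have "(\<integral>y. norm (?f \<tau> y) \<partial>unit_measure) \<le> (\<integral>y. exp (- \<delta> * cosh \<tau>) \<partial>unit_measure)"
          by (intro integral_mono integrable_norm mint nrm) auto
        then show "norm (\<integral>y. norm (case (\<tau>, y) of (\<tau>, t) \<Rightarrow> ?f \<tau> t) \<partial>unit_measure) \<le> norm (cosh \<tau> ^ 0 * exp (- \<delta> * cosh \<tau>))"
          by (simp add: U.prob_space[unfolded space_unit_measure])
      qed
    qed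
  qed
  have swap: "(\<integral>t. (\<integral>\<tau>. ?f \<tau> t \<partial>lborel) \<partial>unit_measure) = (\<integral>\<tau>. (\<integral>t. ?f \<tau> t \<partial>unit_measure) \<partial>lborel)"
    by (rule P.Fubini_integral[OF int])
  have inner1: "(\<integral>t. ?f \<tau> t \<partial>unit_measure) = exp (- of_real X * of_real (cosh \<tau>)) * bessel_I 0 (of_real x)" for \<tau>
    by (simp only: integral_mult_right_zero bessel_I_0_circle_integral(2) of_real_mult mult_minus_left)
  \<comment> \<open>\<phi> is the argument of X - x v, which lies in (-pi/2, pi/2) because |x| < X\<close>
  have inner2: "(\<integral>\<tau>. ?f \<tau> t \<partial>lborel) = 2 * K0 (of_real (cmod (of_real X - of_real x * circ t)))" for t
  proof -
    define p where "p = of_real X - of_real x * circ t"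
    have Rep: "Re p > 0"
    proof -
      have "x * cos (2 * pi * t) \<le> \<bar>x\<bar> * \<bar>cos (2 * pi * t)\<bar>" by (metis abs_ge_self abs_mult)
      also have "\<dots> \<le> \<bar>x\<bar> * 1" by (intro mult_left_mono) auto
      finally show ?thesis using x by (simp add: p_def)
    qed
    then have p0: "p \<noteq> 0" by auto
    define \<phi> where "\<phi> = Arg p"
    have \<phi>: "\<bar>\<phi>\<bar> < pi / 2" unfolding \<phi>_def using Arg_Re_pos[of p] Rep p0 by auto
    have p: "p = of_real (cmod p) * exp (\<i> * of_real \<phi>)" unfolding \<phi>_def by (rule Arg_eq[OF p0])
    then have "cnj p = cnj (of_real (cmod p) * exp (\<i> * of_real \<phi>))" by (rule arg_cong)
    then have cp: "cnj p = of_real (cmod p) * exp (- (\<i> * of_real \<phi>))"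
      by (simp add: exp_cnj)
    have "?f \<tau> t = exp (- of_real (cmod p) * cosh (of_real \<tau> + \<i> * of_real \<phi>))" for \<tau>
    proof -
      have "of_real (cmod p) * cosh (of_real \<tau> + \<i> * of_real \<phi>)
          = (of_real (cmod p) * exp (\<i> * of_real \<phi>) * exp (of_real \<tau>) + of_real (cmod p) * exp (- (\<i> * of_real \<phi>)) * exp (- of_real \<tau>)) / 2"
        by (simp add: cosh_def scaleR_conv_of_real exp_add exp_diff exp_minus field_simps)
      also have "\<dots> = (p * of_real (exp \<tau>) + cnj p * of_real (exp (- \<tau>))) / 2"
        unfolding p[symmetric] cp[symmetric] by (simp add: exp_of_real[symmetric] del: exp_of_real)
      also have "\<dots> = of_real (X * cosh \<tau>) - of_real x / 2 * (of_real (exp \<tau>) * circ t + of_real (exp (- \<tau>)) * cnj (circ t))"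
        by (simp add: p_def cosh_def field_simps)
      finally have E: "of_real (cmod p) * cosh (of_real \<tau> + \<i> * of_real \<phi>)
          = of_real (X * cosh \<tau>) - of_real x / 2 * (of_real (exp \<tau>) * circ t + of_real (exp (- \<tau>)) * cnj (circ t))" .
      show ?thesis unfolding mult_minus_left E by (simp only: exp_add[symmetric] minus_diff_eq) (simp add: add.commute)
    qed
    then show ?thesis
      using K0_rotated_integral[of "cmod p" \<phi>] p0 \<phi> by (simp add: p_def)
  qed
  have "(\<integral>t. K0 (of_real (cmod (of_real X - of_real x * circ t))) \<partial>unit_measure)
     = 1 / 2 * (\<integral>t. 2 * K0 (of_real (cmod (of_real X - of_real x * circ t))) \<partial>unit_measure)"
    by simp
  also have "\<dots> = 1 / 2 * (\<integral>\<tau>. exp (- of_real X * of_real (cosh \<tau>)) * bessel_I 0 (of_real x) \<partial>lborel)"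
    unfolding inner2[symmetric] swap inner1 ..
  also have "\<dots> = bessel_I 0 (of_real x) * K0 (of_real X)"
    unfolding K0_eq by (simp add: mult_ac)
  finally show ?thesis .
qed

text \<open>Parseval for the geometric series of 1/(c - d v) and its conjugate.\<close>

lemma circle_mean_inverse_square:
  fixes c d :: real
  assumes "\<bar>d\<bar> < c"
  shows "integrable unit_measure (\<lambda>t. 1 / (cmod (of_real c - of_real d * circ t))\<^sup>2)"
    and "(\<integral>t. 1 / (cmod (of_real c - of_real d * circ t))\<^sup>2 \<partial>unit_measure) = 1 / (c\<^sup>2 - d\<^sup>2)"
proof -
  define q where "q = complex_of_real (d / c)"
  have c: "c > 0" using assms by simp
  have q: "norm q < 1" using assms c by (simp add: q_def norm_divide divide_less_eq)
  have geo: "1 / (of_real c - of_real d * v) = (\<Sum>n. q ^ n / of_real c * v ^ n)" if "norm v = 1" for v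
  proof -
    have "(\<lambda>n. (q * v) ^ n) sums (1 / (1 - q * v))"
      by (rule geometric_sums) (use q that in \<open>simp add: norm_mult\<close>)
    from sums_divide[OF this, of "of_real c"]
    have "(\<lambda>n. q ^ n / of_real c * v ^ n) sums (1 / (1 - q * v) / of_real c)"
      by (simp add: power_mult_distrib)
    moreover have "of_real c - of_real d * v = of_real c * (1 - q * v)"
      using c by (simp add: q_def field_simps)
    then have "1 / (1 - q * v) / of_real c = 1 / (of_real c - of_real d * v)"
      by (simp add: mult.commute)
    ultimately show ?thesis by (simp add: sums_iff)
  qed
  have s: "summable (\<lambda>n. norm (q ^ n / complex_of_real c))"
    using q by (auto simp: norm_divide norm_power intro!: summable_divide summable_geometric)
  have eq: "(\<Sum>n. q ^ n / of_real c * circ t ^ n) * (\<Sum>n. q ^ n / of_real c * cnj (circ t) ^ n)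
      = complex_of_real (1 / (cmod (of_real c - of_real d * circ t))\<^sup>2)" for t
  proof -
    have "(of_real c - of_real d * circ t) * cnj (of_real c - of_real d * circ t) = of_real ((cmod (of_real c - of_real d * circ t))\<^sup>2)"
      by (simp only: complex_norm_square)
    moreover have "cnj (of_real c - of_real d * circ t) = of_real c - of_real d * cnj (circ t)" by simp
    ultimately show ?thesis by (simp only: geo[symmetric] norm_cis complex_mod_cnj of_real_divide of_real_1) simp
  qed
  have SUM: "(\<Sum>n. q ^ n / of_real c * (q ^ n / of_real c)) = complex_of_real (1 / (c\<^sup>2 - d\<^sup>2))"
  proof -
    have "(\<lambda>n. (q * q) ^ n) sums (1 / (1 - q * q))"
    proof (rule geometric_sums)
      have "norm q * norm q < 1 * 1" using q by (intro mult_strict_mono) auto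
      then show "norm (q * q) < 1" by (simp add: norm_mult)
    qed
    from sums_divide[OF this, of "(of_real c)\<^sup>2"]
    have A: "(\<lambda>n. q ^ n / of_real c * (q ^ n / of_real c)) sums (1 / (1 - q * q) / (of_real c)\<^sup>2)"
      by (simp add: power_mult_distrib power2_eq_square)
    have B: "1 / (1 - q * q) / (of_real c)\<^sup>2 = complex_of_real (1 / (1 - d / c * (d / c)) / c\<^sup>2)"
      by (simp add: q_def)
    have "c\<^sup>2 - d\<^sup>2 = c\<^sup>2 * (1 - d / c * (d / c))"
      using c by (simp add: field_simps power2_eq_square)
    then have C: "1 / (1 - d / c * (d / c)) / c\<^sup>2 = 1 / (c\<^sup>2 - d\<^sup>2)"
      by (simp add: mult.commute)
    show ?thesis by (rule sums_unique[OF A[unfolded B C], symmetric])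
  qed
  show "integrable unit_measure (\<lambda>t. 1 / (cmod (of_real c - of_real d * circ t))\<^sup>2)"
    using circle_parseval(1)[OF s s] unfolding eq complex_of_real_integrable_eq .
  show "(\<integral>t. 1 / (cmod (of_real c - of_real d * circ t))\<^sup>2 \<partial>unit_measure) = 1 / (c\<^sup>2 - d\<^sup>2)"
    using circle_parseval(2)[OF s s] unfolding eq SUM integral_complex_of_real of_real_eq_iff .
qed

text \<open>ln |1 - q v|^2 is twice the real part of Ln(1 - q v), a power series in v without constant term.\<close>

lemma circle_mean_ln:
  fixes c d :: real
  assumes "\<bar>d\<bar> < c"
  shows "integrable unit_measure (\<lambda>t. ln ((cmod (of_real c - of_real d * circ t))\<^sup>2))"
    and "(\<integral>t. ln ((cmod (of_real c - of_real d * circ t))\<^sup>2) \<partial>unit_measure) = 2 * ln c"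
proof -
  interpret prob_space unit_measure by (rule prob_space_unit_measure)
  define q where "q = complex_of_real (d / c)"
  have c: "c > 0" using assms by simp
  have q: "norm q < 1" using assms c by (simp add: q_def norm_divide divide_less_eq)
  define f where "f n = (- 1) ^ Suc n / of_nat n * (- q) ^ n" for n
  have s: "summable (\<lambda>n. norm (f n))"
  proof (rule summable_comparison_test[of _ "\<lambda>n. norm q ^ n"])
    have "norm (f n) \<le> norm q ^ n" for n
    proof (cases "n = 0")
      case False
      then have "norm q ^ n / real n \<le> norm q ^ n / 1" by (intro divide_left_mono) auto
      then show ?thesis by (simp add: f_def norm_mult norm_divide norm_power)
    qed (simp add: f_def)
    then show "\<exists>N. \<forall>n\<ge>N. norm (norm (f n)) \<le> norm q ^ n" by simp
    show "summable (\<lambda>n. norm q ^ n)" using q by (intro summable_geometric) auto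
  qed
  \<comment> \<open>the constant function 1 as the second factor: Parseval then extracts the constant term\<close>
  define g :: "nat \<Rightarrow> complex" where "g n = (if n = 0 then 1 else 0)" for n
  have sg: "summable (\<lambda>n. norm (g n))" by (rule summable_finite[of "{0}"]) (auto simp: g_def)
  have G: "(\<Sum>n. g n * v n) = v 0" for v
    by (subst suminf_finite[of "{0}"]) (auto simp: g_def)
  have F: "(\<Sum>n. f n * circ t ^ n) = Ln (1 - q * circ t)" for t
  proof -
    have "norm (- q * circ t) < 1" using q by (simp add: norm_mult)
    from Ln_series[OF this] have "(\<lambda>n. f n * circ t ^ n) sums Ln (1 + - q * circ t)"
      by (simp only: f_def power_mult_distrib mult.assoc)
    then show ?thesis by (simp add: sums_iff)
  qed
  have fg: "(\<Sum>n. f n * g n) = 0"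
    using G[of f] by (simp add: mult.commute f_def)
  have i: "integrable unit_measure (\<lambda>t. Ln (1 - q * circ t))" "(\<integral>t. Ln (1 - q * circ t) \<partial>unit_measure) = 0"
    using circle_parseval[OF s sg] unfolding F G fg by simp_all
  have eq: "ln ((cmod (of_real c - of_real d * circ t))\<^sup>2) = 2 * ln c + 2 * Re (Ln (1 - q * circ t))" for t
  proof -
    have "norm (q * circ t) < 1" using q by (simp add: norm_mult)
    then have nz: "1 - q * circ t \<noteq> 0" by auto
    have "of_real c - of_real d * circ t = of_real c * (1 - q * circ t)" using c by (simp add: q_def field_simps)
    then have "cmod (of_real c - of_real d * circ t) = c * cmod (1 - q * circ t)" using c by (simp add: norm_mult)
    then show ?thesis using nz c by (simp add: ln_realpow power_mult_distrib ln_mult)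
  qed
  have i': "integrable unit_measure (\<lambda>t. 2 * Re (Ln (1 - q * circ t)))" using i(1) by simp
  show "integrable unit_measure (\<lambda>t. ln ((cmod (of_real c - of_real d * circ t))\<^sup>2))"
    unfolding eq using i' by (intro Bochner_Integration.integrable_add) auto
  show "(\<integral>t. ln ((cmod (of_real c - of_real d * circ t))\<^sup>2) \<partial>unit_measure) = 2 * ln c"
    unfolding eq using i i' by (subst Bochner_Integration.integral_add) (auto simp: prob_space[unfolded space_unit_measure])
qed

section \<open>The derivative of the Dirichlet beta function at zero\<close>

text \<open>The functions P(tanh t) / cosh t are closed under differentiation and decay like e^(-|t|). This is the family
in which the Mellin transform of 1 / (2 cosh t) can be integrated by parts any number of times.\<close>

definition tanh_sech :: "real poly \<Rightarrow> real \<Rightarrow> real" where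
  "tanh_sech P t = poly P (tanh t) / cosh t"

definition tanh_sech_deriv :: "real poly \<Rightarrow> real poly" where
  "tanh_sech_deriv P = [:0, -1:] * P + [:1, 0, -1:] * pderiv P"

lemma tanh_sech_has_derivative:
  "(tanh_sech P has_real_derivative tanh_sech (tanh_sech_deriv P) t) (at t)"
proof -
  have c: "cosh t \<noteq> 0" using cosh_real_pos[of t] by simp
  have "((\<lambda>t. poly P (tanh t) / cosh t) has_real_derivative
      (poly (pderiv P) (tanh t) * (1 - (tanh t)\<^sup>2) * cosh t - poly P (tanh t) * sinh t) / (cosh t * cosh t)) (at t)"
    using c by (auto intro!: derivative_eq_intros DERIV_chain2[OF poly_DERIV])
  moreover have "(poly (pderiv P) (tanh t) * (1 - (tanh t)\<^sup>2) * cosh t - poly P (tanh t) * sinh t) / (cosh t * cosh t)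
      = tanh_sech (tanh_sech_deriv P) t"
  proof -
    have s: "sinh t = tanh t * cosh t" using c by (simp add: tanh_def)
    show ?thesis unfolding s tanh_sech_def tanh_sech_deriv_def
      using c by (simp add: field_simps power2_eq_square)
  qed
  ultimately show ?thesis by (simp add: tanh_sech_def[abs_def])
qed

lemma tanh_sech_bound: "\<exists>C\<ge>0. \<forall>t. \<bar>tanh_sech P t\<bar> \<le> C * exp (- \<bar>t\<bar>)"
proof -
  have "compact ((\<lambda>x. poly P x) ` {-1..1})"
    by (intro compact_continuous_image continuous_intros) auto
  then have "bounded ((\<lambda>x. poly P x) ` {-1..1})" by (rule compact_imp_bounded)
  then obtain B where B: "\<forall>x\<in>(\<lambda>x. poly P x) ` {-1..1}. norm x \<le> B"
    unfolding bounded_iff by (elim exE)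
  have B': "\<bar>poly P (tanh t)\<bar> \<le> B" for t
  proof -
    have "tanh t \<in> {-1..1}" using tanh_real_bounds[of t] by auto
    then show ?thesis using bspec[OF B imageI] by simp
  qed
  have B0: "B \<ge> 0" using B'[of 0] by linarith
  show ?thesis
  proof (intro exI[of _ "2 * B"] conjI allI)
    fix t :: real
    have "\<bar>poly P (tanh t)\<bar> * (1 / cosh t) \<le> B * (2 * exp (- \<bar>t\<bar>))"
      using B' B0 sech_le by (intro mult_mono) auto
    then show "\<bar>tanh_sech P t\<bar> \<le> 2 * B * exp (- \<bar>t\<bar>)"
      by (simp add: tanh_sech_def abs_divide mult_ac)
  qed (use B0 in simp)
qed

lemma continuous_tanh_sech: "continuous_on UNIV (tanh_sech P)"
  using tanh_sech_has_derivative DERIV_isCont by (blast intro: continuous_at_imp_continuous_on)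

lemma integrable_exp_mult_exp_minus_exp:
  fixes s :: real
  assumes "s > 0"
  shows "integrable lborel (\<lambda>x. exp (s * x) * exp (- exp x))"
proof -
  have "Re (complex_of_real s) > 0" using assms by simp
  from integrable_norm[OF Gamma_integral_exp(1)[OF this]]
  show ?thesis unfolding norm_exp_eq_Re by (simp add: exp_add[symmetric])
qed

text \<open>The Mellin transform divided by Gamma(s), in exponential coordinates.\<close>

definition mellin_sech :: "real poly \<Rightarrow> complex \<Rightarrow> complex" where
  "mellin_sech P s = rGamma s * (\<integral>x. exp (s * of_real x) * of_real (tanh_sech P (exp x)) \<partial>lborel)"

lemma continuous_tanh_sech_exp: "continuous_on UNIV (\<lambda>x. tanh_sech P (exp x))"
  by (rule continuous_on_compose2[OF continuous_tanh_sech]) (auto intro: continuous_intros)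

lemma mellin_sech_integrable:
  assumes "Re s > 0"
  shows "integrable lborel (\<lambda>x. exp (s * of_real x) * of_real (tanh_sech P (exp x)))"
proof -
  obtain C where C: "C \<ge> 0" "\<And>t. \<bar>tanh_sech P t\<bar> \<le> C * exp (- \<bar>t\<bar>)" using tanh_sech_bound by blast
  show ?thesis
  proof (rule Bochner_Integration.integrable_bound)
    show "integrable lborel (\<lambda>x. C * (exp (Re s * x) * exp (- exp x)))"
      by (intro integrable_mult_right integrable_exp_mult_exp_minus_exp assms)
    show "(\<lambda>x. exp (s * of_real x) * of_real (tanh_sech P (exp x))) \<in> borel_measurable lborel"
      by (simp only: measurable_lborel2, intro borel_measurable_continuous_onI continuous_intros continuous_tanh_sech_exp)
    show "AE x in lborel. norm (exp (s * of_real x) * of_real (tanh_sech P (exp x))) \<le> norm (C * (exp (Re s * x) * exp (- exp x)))"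
    proof (rule AE_I2)
      fix x
      have "exp (Re s * x) * \<bar>tanh_sech P (exp x)\<bar> \<le> exp (Re s * x) * (C * exp (- exp x))"
        using C(2)[of "exp x"] by (intro mult_left_mono) auto
      then show "norm (exp (s * of_real x) * of_real (tanh_sech P (exp x))) \<le> norm (C * (exp (Re s * x) * exp (- exp x)))"
        using C by (simp add: norm_mult abs_mult mult_ac)
    qed
  qed
qed

lemma mellin_sech_holomorphic: "mellin_sech P holomorphic_on {s. Re s > 0}"
proof -
  obtain C where C: "C \<ge> 0" "\<And>t. \<bar>tanh_sech P t\<bar> \<le> C * exp (- \<bar>t\<bar>)" using tanh_sech_bound by blast
  let ?\<phi> = "\<lambda>s x. exp (s * of_real x) * of_real (tanh_sech P (exp x))"
  let ?\<phi>' = "\<lambda>s x. of_real x * exp (s * of_real x) * complex_of_real (tanh_sech P (exp x))"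
  have "((\<lambda>s. integral\<^sup>L lborel (?\<phi> s)) has_field_derivative integral\<^sup>L lborel (?\<phi>' s0)) (at s0)" if s0: "Re s0 > 0" for s0
  proof -
    define a b where "a = Re s0 / 2" and "b = 2 * Re s0"
    define \<eta> where "\<eta> = a / 2"
    have ab: "0 < a" "a < Re s0" "Re s0 < b" "0 < \<eta>" "0 < a - \<eta>" "0 < b + \<eta>" using s0 by (auto simp: a_def b_def \<eta>_def)
    define S where "S = {s::complex. Re s > a} \<inter> {s. Re s < b}"
    let ?G = "\<lambda>x. C / \<eta> * (exp ((a - \<eta>) * x) * exp (- exp x) + exp ((b + \<eta>) * x) * exp (- exp x))"
    show ?thesis
    proof (rule has_field_derivative_integral[where S = S and G = ?G])
      show "open S" "convex S" unfolding S_def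
        by (intro open_Int convex_Int open_halfspace_Re_gt open_halfspace_Re_lt convex_halfspace_Re_gt convex_halfspace_Re_lt)+
      show "s0 \<in> S" using ab by (simp add: S_def)
      show "integrable lborel (?\<phi> s)" if "s \<in> S" for s
        using that ab by (intro mellin_sech_integrable) (auto simp: S_def)
      show "((\<lambda>s. ?\<phi> s x) has_field_derivative ?\<phi>' s x) (at s)" for s x
        by (auto intro!: derivative_eq_intros)
      show "?\<phi>' s0 \<in> borel_measurable lborel"
        by (simp only: measurable_lborel2, intro borel_measurable_continuous_onI continuous_intros continuous_tanh_sech_exp)
      show "integrable lborel ?G"
        using ab by (intro integrable_mult_right Bochner_Integration.integrable_add integrable_exp_mult_exp_minus_exp)
      fix s x assume "s \<in> S"
      then have s: "a \<le> Re s" "Re s \<le> b" by (auto simp: S_def)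
      have x: "\<bar>x\<bar> * exp (Re s * x) \<le> (exp ((a - \<eta>) * x) + exp ((b + \<eta>) * x)) / \<eta>"
      proof (cases "x \<ge> 0")
        case True
        have "\<eta> * x \<le> exp (\<eta> * x)" using exp_ge_add_one_self[of "\<eta> * x"] by linarith
        moreover have "exp (Re s * x) \<le> exp (b * x)" using True s by (simp add: mult_right_mono)
        ultimately have "(\<eta> * x) * exp (Re s * x) \<le> exp (\<eta> * x) * exp (b * x)"
          using True ab by (intro mult_mono) auto
        also have "\<dots> = exp ((b + \<eta>) * x)" by (simp add: exp_add[symmetric] algebra_simps)
        also have "\<dots> \<le> exp ((a - \<eta>) * x) + exp ((b + \<eta>) * x)" by simp
        finally show ?thesis using True ab by (simp add: field_simps)
      next
        case False
        have "\<eta> * (- x) \<le> exp (\<eta> * (- x))" using exp_ge_add_one_self[of "\<eta> * (- x)"] by linarith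
        moreover have "exp (Re s * x) \<le> exp (a * x)" using False s by (simp add: mult_right_mono_neg)
        ultimately have "(\<eta> * (- x)) * exp (Re s * x) \<le> exp (\<eta> * (- x)) * exp (a * x)"
          using False ab by (intro mult_mono) auto
        also have "\<dots> = exp ((a - \<eta>) * x)" by (simp add: exp_add[symmetric] algebra_simps)
        also have "\<dots> \<le> exp ((a - \<eta>) * x) + exp ((b + \<eta>) * x)" by simp
        finally show ?thesis using False ab by (simp add: field_simps)
      qed
      have "(\<bar>x\<bar> * exp (Re s * x)) * \<bar>tanh_sech P (exp x)\<bar> \<le> ((exp ((a - \<eta>) * x) + exp ((b + \<eta>) * x)) / \<eta>) * (C * exp (- exp x))"
        using C(2)[of "exp x"] ab by (intro mult_mono x) auto
      also have "\<dots> = ?G x" by (simp add: algebra_simps add_divide_distrib)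
      finally show "norm (?\<phi>' s x) \<le> ?G x" by (simp add: norm_mult)
    qed
  qed
  then have "(\<lambda>s. integral\<^sup>L lborel (?\<phi> s)) holomorphic_on {s. Re s > 0}"
    by (auto simp: holomorphic_on_open open_halfspace_Re_gt)
  then show ?thesis unfolding mellin_sech_def[abs_def] by (intro holomorphic_intros)
qed

text \<open>Integration by parts moves s to s + 1 and differentiates the integrand; the factor s that appears is
absorbed by 1/Gamma(s) = s / Gamma(s + 1).\<close>

lemma mellin_sech_shift:
  assumes s: "Re s > 0"
  shows "mellin_sech P s = - mellin_sech (tanh_sech_deriv P) (s + 1)"
proof -
  obtain C where C: "C \<ge> 0" "\<And>t. \<bar>tanh_sech P t\<bar> \<le> C * exp (- \<bar>t\<bar>)" using tanh_sech_bound by blast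
  let ?F = "\<lambda>x. exp (s * of_real x) * complex_of_real (tanh_sech P (exp x))"
  let ?f1 = "\<lambda>x. exp (s * of_real x) * complex_of_real (tanh_sech P (exp x))"
  let ?f2 = "\<lambda>x. exp ((s + 1) * of_real x) * complex_of_real (tanh_sech (tanh_sech_deriv P) (exp x))"
  have i1: "integrable lborel ?f1" by (rule mellin_sech_integrable[OF s])
  have i2: "integrable lborel ?f2" by (rule mellin_sech_integrable) (use s in simp)
  have i: "integrable lborel (\<lambda>x. s * ?f1 x + ?f2 x)"
    by (intro Bochner_Integration.integrable_add integrable_mult_right i1 i2)
  have b: "norm (?F x) \<le> C * (exp (Re s * x) * exp (- exp x))" for x
  proof -
    have "exp (Re s * x) * \<bar>tanh_sech P (exp x)\<bar> \<le> exp (Re s * x) * (C * exp (- exp x))"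
      using C(2)[of "exp x"] by (intro mult_left_mono) auto
    then show ?thesis by (simp add: norm_mult mult_ac)
  qed
  have t: "((\<lambda>x::real. C * (exp (Re s * x) * exp (- exp x))) \<longlongrightarrow> 0) at_bot"
    "((\<lambda>x::real. C * (exp (Re s * x) * exp (- exp x))) \<longlongrightarrow> 0) at_top"
  proof -
    have "((\<lambda>x::real. exp (Re s * x) * exp (- exp x)) \<longlongrightarrow> 0) at_bot" using s by real_asymp
    then show "((\<lambda>x::real. C * (exp (Re s * x) * exp (- exp x))) \<longlongrightarrow> 0) at_bot" by (rule tendsto_mult_right_zero)
    have "((\<lambda>x::real. exp (Re s * x) * exp (- exp x)) \<longlongrightarrow> 0) at_top" using s by real_asymp
    then show "((\<lambda>x::real. C * (exp (Re s * x) * exp (- exp x))) \<longlongrightarrow> 0) at_top" by (rule tendsto_mult_right_zero)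
  qed
  have "(\<integral>x. s * ?f1 x + ?f2 x \<partial>lborel) = 0 - 0"
  proof (rule integral_FTC_UNIV[OF _ _ i])
    show "(?F \<longlongrightarrow> 0) at_bot" by (rule Lim_null_comparison[OF _ t(1)]) (use b in auto)
    show "(?F \<longlongrightarrow> 0) at_top" by (rule Lim_null_comparison[OF _ t(2)]) (use b in auto)
    fix x :: real
    have "((\<lambda>x. tanh_sech P (exp x)) has_real_derivative tanh_sech (tanh_sech_deriv P) (exp x) * exp x) (at x)"
      by (rule DERIV_chain2[OF tanh_sech_has_derivative]) (auto intro!: derivative_eq_intros)
    then have d1: "((\<lambda>x. complex_of_real (tanh_sech P (exp x))) has_vector_derivative of_real (tanh_sech (tanh_sech_deriv P) (exp x) * exp x)) (at x)"
      by (intro has_vector_derivative_of_real) (simp add: has_real_derivative_iff_has_vector_derivative)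
    have "((\<lambda>z. exp (s * z)) has_field_derivative s * exp (s * of_real x)) (at (of_real x))"
      by (auto intro!: derivative_eq_intros)
    from has_vector_derivative_real_field[OF this]
    have d2: "((\<lambda>x. exp (s * of_real x)) has_vector_derivative s * exp (s * of_real x)) (at x)" .
    have e: "exp ((s + 1) * of_real x) = exp (s * of_real x) * of_real (exp x)"
      by (simp add: distrib_right exp_add exp_of_real)
    show "(?F has_vector_derivative s * ?f1 x + ?f2 x) (at x)"
      using has_vector_derivative_mult[OF d2 d1] unfolding e by (simp add: algebra_simps)
    have "continuous_on UNIV (\<lambda>x. s * ?f1 x + ?f2 x)"
      by (intro continuous_intros continuous_tanh_sech_exp)
    then show "isCont (\<lambda>x. s * ?f1 x + ?f2 x) x" by (simp add: continuous_on_eq_continuous_at)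
  qed
  then have "s * integral\<^sup>L lborel ?f1 + integral\<^sup>L lborel ?f2 = 0"
    unfolding Bochner_Integration.integral_add[OF integrable_mult_right[OF i1, of s] i2] integral_mult_right_zero by simp
  then have "s * integral\<^sup>L lborel ?f1 = - integral\<^sup>L lborel ?f2" by (simp add: eq_neg_iff_add_eq_0)
  then have "rGamma (s + 1) * (s * integral\<^sup>L lborel ?f1) = - (rGamma (s + 1) * integral\<^sup>L lborel ?f2)" by simp
  then show ?thesis
    unfolding mellin_sech_def rGamma_plus1[of s, symmetric] by (simp only: mult_ac)
qed

lemma mellin_sech_shift_iterated:
  "Re s > 0 \<Longrightarrow> mellin_sech P s = (-1) ^ k * mellin_sech ((tanh_sech_deriv ^^ k) P) (s + of_nat k)"
proof (induction k)
  case (Suc k)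
  then show ?case
    using mellin_sech_shift[of "s + of_nat k" "(tanh_sech_deriv ^^ k) P"] by (simp add: add_ac)
qed simp

text \<open>The continuation to all s: integrate by parts until the transform converges. Every number of steps for
which it converges gives the same value (mellin_sech_ext_eq).\<close>

definition mellin_sech_ext :: "real poly \<Rightarrow> complex \<Rightarrow> complex" where
  "mellin_sech_ext P s = (let k = nat (\<lceil>\<bar>Re s\<bar>\<rceil> + 1) in (-1) ^ k * mellin_sech ((tanh_sech_deriv ^^ k) P) (s + of_nat k))"

lemma mellin_sech_ext_eq:
  assumes "Re s + real k > 0"
  shows "mellin_sech_ext P s = (-1) ^ k * mellin_sech ((tanh_sech_deriv ^^ k) P) (s + of_nat k)"
proof -
  have *: "(-1) ^ j * mellin_sech ((tanh_sech_deriv ^^ j) P) (s + of_nat j) = (-1) ^ l * mellin_sech ((tanh_sech_deriv ^^ l) P) (s + of_nat l)"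
    if "Re s + real j > 0" "j \<le> l" for j l
  proof -
    define m where "m = l - j"
    have l: "l = m + j" using that by (simp add: m_def)
    have "mellin_sech ((tanh_sech_deriv ^^ j) P) (s + of_nat j)
        = (-1) ^ m * mellin_sech ((tanh_sech_deriv ^^ m) ((tanh_sech_deriv ^^ j) P)) (s + of_nat j + of_nat m)"
      using that by (intro mellin_sech_shift_iterated) simp
    moreover have "(tanh_sech_deriv ^^ l) P = (tanh_sech_deriv ^^ m) ((tanh_sech_deriv ^^ j) P)"
      by (simp only: l funpow_add o_apply)
    moreover have "s + of_nat l = s + of_nat j + of_nat m" by (simp add: l add_ac)
    moreover have "(-1) ^ l = ((-1) ^ j * (-1) ^ m :: complex)" by (simp add: l power_add)
    ultimately show ?thesis by (simp only: mult.assoc)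
  qed
  define k0 where "k0 = nat (\<lceil>\<bar>Re s\<bar>\<rceil> + 1)"
  have "real k0 = of_int (\<lceil>\<bar>Re s\<bar>\<rceil> + 1)" unfolding k0_def by (rule of_nat_nat) (simp add: le_ceiling_iff)
  then have "real k0 = of_int \<lceil>\<bar>Re s\<bar>\<rceil> + 1" by simp
  then have k0: "Re s + real k0 > 0" using le_of_int_ceiling[of "\<bar>Re s\<bar>"] by linarith
  have eq0: "mellin_sech_ext P s = (-1) ^ k0 * mellin_sech ((tanh_sech_deriv ^^ k0) P) (s + of_nat k0)"
    by (simp only: mellin_sech_ext_def k0_def Let_def)
  show ?thesis
  proof (cases "k \<le> k0")
    case True
    show ?thesis by (rule trans[OF eq0 *[OF assms True, symmetric]])
  next
    case False
    then have "k0 \<le> k" by simp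
    show ?thesis by (rule trans[OF eq0 *[OF k0 \<open>k0 \<le> k\<close>]])
  qed
qed

lemma mellin_sech_ext_holomorphic: "mellin_sech_ext P holomorphic_on UNIV"
proof -
  have "\<exists>f'. (mellin_sech_ext P has_field_derivative f') (at s)" for s
  proof -
    obtain k :: nat where "- Re s < real k" using reals_Archimedean2 by blast
    then have k: "Re s + real k > 0" by linarith
    have op: "open {s. Re s > - real k}" by (rule open_halfspace_Re_gt)
    have "(\<lambda>s. (-1) ^ k * mellin_sech ((tanh_sech_deriv ^^ k) P) (s + of_nat k)) holomorphic_on {s. Re s > - real k}"
      by (intro holomorphic_intros holomorphic_on_compose_gen[OF _ mellin_sech_holomorphic, unfolded o_def]) auto
    then have "mellin_sech_ext P holomorphic_on {s. Re s > - real k}"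
      by (rule holomorphic_transform) (subst mellin_sech_ext_eq[of _ k], auto)
    then show ?thesis using k by (auto simp: holomorphic_on_open[OF op])
  qed
  then show ?thesis by (auto simp: holomorphic_on_open)
qed

definition half_sech_poly :: "real poly" where "half_sech_poly = [:1 / 2:]"

lemma tanh_sech_half: "tanh_sech half_sech_poly t = 1 / (2 * cosh t)"
  by (simp add: tanh_sech_def half_sech_poly_def)

lemma Gamma_integral_scaled:
  fixes s :: complex and c :: real
  assumes s: "Re s > 0" and c: "c > 0"
  shows "integrable lborel (\<lambda>x. exp (s * of_real x) * of_real (exp (- c * exp x)))"
    and "rGamma s * (\<integral>x. exp (s * of_real x) * of_real (exp (- c * exp x)) \<partial>lborel) = 1 / of_real c powr s"
proof -
  let ?f = "\<lambda>x. exp (s * of_real x - of_real (exp x))"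
  have eq: "exp (s * of_real x) * of_real (exp (- c * exp x)) = ?f (ln c + 1 * x) / of_real c powr s" for x
  proof -
    have "of_real c powr s = exp (s * of_real (ln c))" using c by (simp add: powr_def Ln_of_real)
    moreover have "?f (ln c + 1 * x) = exp (s * of_real (ln c)) * (exp (s * of_real x) * of_real (exp (- c * exp x)))"
    proof -
      have "complex_of_real (exp (- c * exp x)) = exp (- of_real (c * exp x))"
        by (simp only: exp_of_real[symmetric] of_real_minus mult_minus_left)
      moreover have "exp (ln c + 1 * x) = c * exp x" using c by (simp add: exp_add)
      moreover have "exp (s * of_real (ln c)) * (exp (s * of_real x) * exp (- of_real (c * exp x)))
          = exp (s * of_real (ln c + 1 * x) - of_real (c * exp x))"
        by (simp only: exp_add[symmetric]) (simp add: algebra_simps)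
      ultimately show ?thesis by (simp only:)
    qed
    ultimately show ?thesis by simp
  qed
  have i: "integrable lborel (\<lambda>x. ?f (ln c + 1 * x))"
    by (rule lborel_integrable_real_affine[OF Gamma_integral_exp(1)[OF s]]) simp
  show "integrable lborel (\<lambda>x. exp (s * of_real x) * of_real (exp (- c * exp x)))"
    unfolding eq using i by (rule integrable_divide_zero)
  have "Gamma s \<noteq> 0" using s by (auto simp: Gamma_eq_zero_iff elim!: nonpos_Ints_cases)
  moreover have "(\<integral>x. ?f (ln c + 1 * x) \<partial>lborel) = Gamma s"
    using lborel_integral_real_affine[of 1 ?f "ln c"] Gamma_integral_exp(2)[OF s] by simp
  ultimately show "rGamma s * (\<integral>x. exp (s * of_real x) * of_real (exp (- c * exp x)) \<partial>lborel) = 1 / of_real c powr s"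
    unfolding eq by (simp add: rGamma_inverse_Gamma)
qed

lemma alternating_geometric_sech:
  fixes t :: real
  shows "(\<Sum>n<N. (-1) ^ n * exp (- real (2 * n + 1) * t)) = (1 - (- exp (- 2 * t)) ^ N) / (2 * cosh t)"
proof -
  define q where "q = - exp (- 2 * t)"
  have q: "q \<noteq> 1" unfolding q_def using exp_gt_zero[of "- 2 * t"] by linarith
  have "(-1) ^ n * exp (- real (2 * n + 1) * t) = exp (- t) * q ^ n" for n
    by (simp add: q_def power_minus[of "exp _"] exp_of_nat_mult[symmetric] exp_add[symmetric] algebra_simps)
  then have "(\<Sum>n<N. (-1) ^ n * exp (- real (2 * n + 1) * t)) = exp (- t) * ((1 - q ^ N) / (1 - q))"
    using q by (simp add: sum_distrib_left[symmetric] sum_gp_strict)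
  also have "\<dots> = (1 - q ^ N) / (exp t * (1 - q))" by (simp add: exp_minus divide_simps)
  also have "exp t * (1 - q) = 2 * cosh t" by (simp add: q_def cosh_def algebra_simps exp_add[symmetric])
  finally show ?thesis by (simp add: q_def)
qed

text \<open>1 / (2 cosh t) is the sum of the alternating series of exp(-(2n+1) t), whose terms have the Mellin transforms
Gamma(s) / (2n+1)^s. The partial sums are finite geometric sums, bounded by twice the limit, which gives
conditional convergence of the Dirichlet series on the whole half-plane Re s > 0.\<close>

lemma dirichlet_beta_series_sums:
  assumes s: "Re s > 0"
  shows "(\<lambda>n::nat. (-1) ^ n / of_nat (2 * n + 1) powr s) sums mellin_sech half_sech_poly s"
proof -
  let ?h = "\<lambda>N x. exp (s * of_real x) * of_real (\<Sum>n<N. (-1) ^ n * exp (- real (2 * n + 1) * exp x))"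
  have part: "(\<Sum>n<N. (-1) ^ n / of_nat (2 * n + 1) powr s) = rGamma s * integral\<^sup>L lborel (?h N)" for N
  proof -
    let ?g = "\<lambda>n x. exp (s * of_real x) * of_real (exp (- real (2 * n + 1) * exp x))"
    have g: "integrable lborel (?g n)" "rGamma s * integral\<^sup>L lborel (?g n) = 1 / of_real (real (2 * n + 1)) powr s" for n
      using Gamma_integral_scaled[OF s, of "real (2 * n + 1)"] by auto
    have "?h N = (\<lambda>x. \<Sum>n<N. (-1) ^ n * ?g n x)"
      by (auto simp: fun_eq_iff sum_distrib_left mult_ac)
    then have "integral\<^sup>L lborel (?h N) = (\<Sum>n<N. (-1) ^ n * integral\<^sup>L lborel (?g n))"
      using g(1) by (simp only: Bochner_Integration.integral_sum integrable_mult_right integral_mult_right_zero)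
    then have "rGamma s * integral\<^sup>L lborel (?h N) = (\<Sum>n<N. (-1) ^ n * (rGamma s * integral\<^sup>L lborel (?g n)))"
      by (simp add: sum_distrib_left mult_ac)
    also have "\<dots> = (\<Sum>n<N. (-1) ^ n / of_nat (2 * n + 1) powr s)"
      unfolding g(2) by simp
    finally show ?thesis ..
  qed
  have "(\<lambda>N. integral\<^sup>L lborel (?h N)) \<longlonglongrightarrow> (\<integral>x. exp (s * of_real x) * of_real (tanh_sech half_sech_poly (exp x)) \<partial>lborel)"
  proof (rule integral_dominated_convergence)
    show "integrable lborel (\<lambda>x. 2 * norm (exp (s * of_real x) * complex_of_real (tanh_sech half_sech_poly (exp x))))"
      by (intro integrable_mult_right integrable_norm mellin_sech_integrable s)
    show "(\<lambda>x. exp (s * of_real x) * complex_of_real (tanh_sech half_sech_poly (exp x))) \<in> borel_measurable lborel"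
      using mellin_sech_integrable[OF s] by (rule borel_measurable_integrable)
    show "?h N \<in> borel_measurable lborel" for N
      by (simp only: measurable_lborel2, intro borel_measurable_continuous_onI continuous_intros)
    show "AE x in lborel. (\<lambda>N. ?h N x) \<longlonglongrightarrow> exp (s * of_real x) * of_real (tanh_sech half_sech_poly (exp x))"
    proof (rule AE_I2)
      fix x :: real
      have "(\<lambda>N. (- exp (- 2 * exp x)) ^ N) \<longlonglongrightarrow> 0" by (intro LIMSEQ_power_zero) simp
      then have "(\<lambda>N. (1 - (- exp (- 2 * exp x)) ^ N) / (2 * cosh (exp x))) \<longlonglongrightarrow> (1 - 0) / (2 * cosh (exp x))"
        by (intro tendsto_intros) auto
      then have "(\<lambda>N. (1 - (- exp (- 2 * exp x)) ^ N) / (2 * cosh (exp x))) \<longlonglongrightarrow> 1 / (2 * cosh (exp x))"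
        by (simp only: diff_0_right)
      then show "(\<lambda>N. ?h N x) \<longlonglongrightarrow> exp (s * of_real x) * of_real (tanh_sech half_sech_poly (exp x))"
        unfolding alternating_geometric_sech tanh_sech_half by (intro tendsto_mult tendsto_const tendsto_of_real)
    qed
    show "AE x in lborel. norm (?h N x) \<le> 2 * norm (exp (s * of_real x) * complex_of_real (tanh_sech half_sech_poly (exp x)))" for N
    proof (rule AE_I2)
      fix x :: real
      have "\<bar>(- exp (- 2 * exp x)) ^ N\<bar> \<le> 1" by (simp add: power_abs power_le_one)
      then have "\<bar>1 - (- exp (- 2 * exp x)) ^ N\<bar> \<le> 2" by linarith
      then have "\<bar>1 - (- exp (- 2 * exp x)) ^ N\<bar> / (2 * cosh (exp x)) \<le> 2 / (2 * cosh (exp x))"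
        by (intro divide_right_mono) auto
      then have "\<bar>(1 - (- exp (- 2 * exp x)) ^ N) / (2 * cosh (exp x))\<bar> \<le> 2 * \<bar>1 / (2 * cosh (exp x))\<bar>"
        by (simp add: abs_divide)
      then have "norm (exp (s * of_real x)) * \<bar>(1 - (- exp (- 2 * exp x)) ^ N) / (2 * cosh (exp x))\<bar>
          \<le> norm (exp (s * of_real x)) * (2 * \<bar>1 / (2 * cosh (exp x))\<bar>)"
        by (rule mult_left_mono) simp
      then show "norm (?h N x) \<le> 2 * norm (exp (s * of_real x) * complex_of_real (tanh_sech half_sech_poly (exp x)))"
        unfolding alternating_geometric_sech tanh_sech_half norm_mult norm_of_real by (simp only: mult_ac)
    qed
  qed
  then have "(\<lambda>N. rGamma s * integral\<^sup>L lborel (?h N)) \<longlonglongrightarrow> mellin_sech half_sech_poly s"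
    unfolding mellin_sech_def by (intro tendsto_intros)
  then show ?thesis unfolding sums_def part .
qed

text \<open>The continued Mellin transform is entire and has the required sums, and the identity theorem makes it the only such
function.\<close>

theorem dirichlet_beta_eq: "dirichlet_beta = mellin_sech_ext half_sech_poly"
  unfolding dirichlet_beta_def
proof (rule the_equality)
  have ext: "mellin_sech_ext half_sech_poly s = mellin_sech half_sech_poly s" if "Re s > 0" for s
    using mellin_sech_ext_eq[of s 0] that by simp
  then show *: "mellin_sech_ext half_sech_poly holomorphic_on UNIV \<and>
     (\<forall>s. Re s > 0 \<longrightarrow> (\<lambda>n::nat. (-1) ^ n / of_nat (2 * n + 1) powr s) sums mellin_sech_ext half_sech_poly s)"
    using mellin_sech_ext_holomorphic dirichlet_beta_series_sums by simp
  fix f assume f: "f holomorphic_on UNIV \<and> (\<forall>s. Re s > 0 \<longrightarrow> (\<lambda>n::nat. (-1) ^ n / of_nat (2 * n + 1) powr s) sums f s)"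
  have eq: "f s = mellin_sech_ext half_sech_poly s" if "Re s > 0" for s
    using f * that sums_unique2 by blast
  have "f w - mellin_sech_ext half_sech_poly w = 0" for w
  proof (rule analytic_continuation_open[where s = "{s. Re s > 0}" and s' = UNIV and f = "\<lambda>w. f w - mellin_sech_ext half_sech_poly w" and g = "\<lambda>_. 0"])
    show "open {s. 0 < Re s}" by (rule open_halfspace_Re_gt)
    show "{s. 0 < Re s} \<noteq> {}" by (auto intro!: exI[of _ 1])
  qed (use f mellin_sech_ext_holomorphic eq in \<open>auto intro!: holomorphic_intros\<close>)
  then show "f = mellin_sech_ext half_sech_poly" by (auto simp: fun_eq_iff)
qed

lemma sech_minus_exp_bound:
  fixes t :: real
  assumes "t > 0"
  shows "\<bar>1 / cosh t - exp (- t)\<bar> \<le> 2 * t * exp (- t)"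
proof -
  have c: "cosh t > 0" by (rule cosh_real_pos)
  have e: "exp t * exp (- t) = 1" by (simp add: exp_add[symmetric])
  have "1 / cosh t - exp (- t) = exp (- t) * (exp t - cosh t) / cosh t"
    using c e by (simp add: field_simps)
  also have "exp t - cosh t = sinh t" by (simp add: cosh_def sinh_def field_simps)
  finally have eq: "1 / cosh t - exp (- t) = exp (- t) * (sinh t / cosh t)" by simp
  have "sinh t / cosh t \<le> 2 * t"
  proof -
    have "sinh t = exp t * (1 - exp (- 2 * t)) / 2" by (simp add: sinh_def algebra_simps exp_add[symmetric])
    moreover have "1 - exp (- 2 * t) \<le> 2 * t" using exp_ge_add_one_self[of "- 2 * t"] by linarith
    then have "exp t * (1 - exp (- 2 * t)) \<le> exp t * (2 * t)" by (rule mult_left_mono) simp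
    ultimately have "sinh t \<le> exp t * (2 * t) / 2" by linarith
    also have "exp t \<le> 2 * cosh t" by (simp add: cosh_def)
    then have "exp t * (2 * t) / 2 \<le> 2 * cosh t * (2 * t) / 2" using assms by (intro divide_right_mono mult_right_mono) auto
    finally show ?thesis using c by (simp add: divide_le_eq mult_ac)
  qed
  then have "exp (- t) * (sinh t / cosh t) \<le> exp (- t) * (2 * t)" by (intro mult_left_mono) auto
  moreover have "0 \<le> exp (- t) * (sinh t / cosh t)" using assms c by simp
  ultimately show ?thesis unfolding eq by (simp only: abs_of_nonneg mult_ac)
qed

lemma integrable_sech_minus_exp: "integrable lborel (\<lambda>x::real. 1 / cosh (exp x) - exp (- exp x))"
proof (rule Bochner_Integration.integrable_bound)
  show "integrable lborel (\<lambda>x::real. 2 * (exp (1 * x) * exp (- exp x)))"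
    using integrable_exp_mult_exp_minus_exp[of 1] by simp
  show "(\<lambda>x::real. 1 / cosh (exp x) - exp (- exp x)) \<in> borel_measurable lborel"
    by (simp only: measurable_lborel2, intro borel_measurable_continuous_onI continuous_intros) auto
  show "AE x in lborel. norm (1 / cosh (exp (x::real)) - exp (- exp x)) \<le> norm (2 * (exp (1 * x) * exp (- exp x)))"
    using sech_minus_exp_bound by (intro AE_I2) (auto simp: mult_ac)
qed

text \<open>For small s > 0, 2 B(s) - 1 is 1/Gamma(s) times the integral of e^(s x) (1 / cosh(e^x) - exp(-e^x)), since the
exponential contributes exactly 1. As 1/Gamma(s) = s / Gamma(s + 1), dividing by s and letting s tend to 0 gives
B(0) = 1/2 and the derivative.\<close>

theorem deriv_dirichlet_beta_0:
  "deriv dirichlet_beta 0 = of_real (1 / 2 * (\<integral>x. 1 / cosh (exp x) - exp (- exp x) \<partial>lborel))"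
proof -
  let ?d = "\<lambda>x. 1 / cosh (exp x) - exp (- exp x) :: real"
  define L where "L = integral\<^sup>L lborel ?d"
  have hol: "dirichlet_beta holomorphic_on UNIV" unfolding dirichlet_beta_eq by (rule mellin_sech_ext_holomorphic)
  define s where "s j = 1 / (real j + 2)" for j
  have s: "0 < s j" "s j \<le> 1" for j by (auto simp: s_def field_simps)
  have s_lim: "s \<longlonglongrightarrow> 0" unfolding s_def by real_asymp
  define I where "I j = (\<integral>x. exp (s j * x) * ?d x \<partial>lborel)" for j
  have bound: "norm (exp (s j * x) * ?d x) \<le> 2 * (exp (1 * x) * exp (- exp x)) + 2 * (exp (2 * x) * exp (- exp x))" for j x
  proof -
    have "exp (s j * x) \<le> 1 + exp x"
    proof (cases "x \<ge> 0")
      case True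
      then have "s j * x \<le> 1 * x" using s by (intro mult_right_mono) auto
      then show ?thesis by (simp add: add_increasing)
    next
      case False
      then have "s j * x \<le> 0" using s(1)[of j] by (simp add: mult_nonneg_nonpos less_imp_le)
      then show ?thesis by (simp add: add_increasing2)
    qed
    then have "exp (s j * x) * \<bar>?d x\<bar> \<le> (1 + exp x) * (2 * exp x * exp (- exp x))"
      using sech_minus_exp_bound[of "exp x"] by (intro mult_mono) auto
    also have "\<dots> = 2 * (exp (1 * x) * exp (- exp x)) + 2 * (exp (2 * x) * exp (- exp x))"
    proof -
      have "exp (2 * x) = exp x * exp x" by (simp add: exp_add[symmetric])
      then show ?thesis by (simp add: algebra_simps)
    qed
    finally show ?thesis by (simp add: abs_mult)
  qed
  have I_lim: "I \<longlonglongrightarrow> L" unfolding I_def L_def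
  proof (rule integral_dominated_convergence)
    show "integrable lborel (\<lambda>x. 2 * (exp (1 * x) * exp (- exp x)) + 2 * (exp (2 * x) * exp (- exp x)) :: real)"
      by (intro Bochner_Integration.integrable_add integrable_mult_right integrable_exp_mult_exp_minus_exp) auto
    show "AE x in lborel. (\<lambda>j. exp (s j * x) * ?d x) \<longlonglongrightarrow> ?d x"
    proof (rule AE_I2)
      fix x
      have "(\<lambda>j. exp (s j * x) * ?d x) \<longlonglongrightarrow> exp (0 * x) * ?d x" by (intro tendsto_intros s_lim)
      then show "(\<lambda>j. exp (s j * x) * ?d x) \<longlonglongrightarrow> ?d x" by simp
    qed
    show "AE x in lborel. norm (exp (s j * x) * ?d x) \<le> 2 * (exp (1 * x) * exp (- exp x)) + 2 * (exp (2 * x) * exp (- exp x))" for j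
      using bound by (intro AE_I2)
    show "(\<lambda>x. exp (s j * x) * ?d x) \<in> borel_measurable lborel" for j
      by (simp only: measurable_lborel2, intro borel_measurable_continuous_onI continuous_intros) auto
    show "?d \<in> borel_measurable lborel"
      by (simp only: measurable_lborel2, intro borel_measurable_continuous_onI continuous_intros) auto
  qed
  \<comment> \<open>the constant 1 is written as the same kind of transform of exp(-e^x)\<close>
  have key: "(2 * dirichlet_beta (of_real (s j)) - 1) / of_real (s j) = rGamma (of_real (s j) + 1) * of_real (I j)" for j
  proof -
    let ?s = "complex_of_real (s j)"
    have Re: "Re ?s > 0" using s by simp
    have "dirichlet_beta ?s = mellin_sech half_sech_poly ?s"
      unfolding dirichlet_beta_eq using mellin_sech_ext_eq[of ?s 0] Re by simp
    then have b: "2 * dirichlet_beta ?s = rGamma ?s * (\<integral>x. 2 * (exp (?s * of_real x) * of_real (tanh_sech half_sech_poly (exp x))) \<partial>lborel)"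
      by (simp add: mellin_sech_def)
    have one: "1 = rGamma ?s * (\<integral>x. exp (?s * of_real x) * of_real (exp (- 1 * exp x)) \<partial>lborel)"
      using Gamma_integral_scaled(2)[OF Re, of 1] by simp
    have "2 * dirichlet_beta ?s - 1 = rGamma ?s * ((\<integral>x. 2 * (exp (?s * of_real x) * of_real (tanh_sech half_sech_poly (exp x))) \<partial>lborel)
        - (\<integral>x. exp (?s * of_real x) * of_real (exp (- 1 * exp x)) \<partial>lborel))"
      unfolding right_diff_distrib b[symmetric] one[symmetric] ..
    also have "(\<integral>x. 2 * (exp (?s * of_real x) * of_real (tanh_sech half_sech_poly (exp x))) \<partial>lborel)
        - (\<integral>x. exp (?s * of_real x) * of_real (exp (- 1 * exp x)) \<partial>lborel)
        = (\<integral>x. 2 * (exp (?s * of_real x) * of_real (tanh_sech half_sech_poly (exp x))) - exp (?s * of_real x) * of_real (exp (- 1 * exp x)) \<partial>lborel)"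
      by (intro Bochner_Integration.integral_diff[symmetric] integrable_mult_right mellin_sech_integrable Gamma_integral_scaled Re) simp
    also have "\<dots> = (\<integral>x. complex_of_real (exp (s j * x) * ?d x) \<partial>lborel)"
    proof (intro Bochner_Integration.integral_cong refl)
      fix x :: real
      have "exp (?s * of_real x) = of_real (exp (s j * x))" by (simp only: exp_of_real[symmetric] of_real_mult)
      then show "2 * (exp (?s * of_real x) * of_real (tanh_sech half_sech_poly (exp x))) - exp (?s * of_real x) * of_real (exp (- 1 * exp x))
        = complex_of_real (exp (s j * x) * ?d x)"
        unfolding tanh_sech_half by (simp add: algebra_simps)
    qed
    also have "\<dots> = of_real (I j)" by (simp only: integral_complex_of_real I_def)
    also have "rGamma ?s = ?s * rGamma (?s + 1)" by (rule rGamma_plus1[symmetric])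
    finally show ?thesis using s(1)[of j] by simp
  qed
  have zlim: "(\<lambda>j. complex_of_real (s j)) \<longlonglongrightarrow> 0" using tendsto_of_real[OF s_lim] by simp
  have rG: "(\<lambda>j. rGamma (complex_of_real (s j) + 1)) \<longlonglongrightarrow> rGamma (0 + 1)"
  proof (rule isCont_tendsto_compose[where g = rGamma])
    show "isCont rGamma (0 + 1 :: complex)"
      using holomorphic_on_imp_continuous_on[OF holomorphic_rGamma[of UNIV]] by (simp add: continuous_on_eq_continuous_at)
  qed (intro tendsto_intros zlim)
  have q: "(\<lambda>j. (2 * dirichlet_beta (of_real (s j)) - 1) / of_real (s j)) \<longlonglongrightarrow> of_real L"
    unfolding key using tendsto_mult[OF rG tendsto_of_real[OF I_lim]] by simp
  have "(\<lambda>j. (2 * dirichlet_beta (of_real (s j)) - 1) / of_real (s j) * of_real (s j)) \<longlonglongrightarrow> of_real L * 0"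
    by (intro tendsto_mult q zlim)
  moreover have "(2 * dirichlet_beta (of_real (s j)) - 1) / of_real (s j) * of_real (s j) = 2 * dirichlet_beta (of_real (s j)) - 1" for j
    using s(1)[of j] by simp
  ultimately have l1: "(\<lambda>j. 2 * dirichlet_beta (of_real (s j)) - 1) \<longlonglongrightarrow> 0" by simp
  have "isCont dirichlet_beta 0"
    using holomorphic_on_imp_continuous_on[OF hol] by (simp add: continuous_on_eq_continuous_at)
  then have "(\<lambda>j. dirichlet_beta (of_real (s j))) \<longlonglongrightarrow> dirichlet_beta 0"
    by (rule isCont_tendsto_compose[OF _ zlim])
  then have "(\<lambda>j. 2 * dirichlet_beta (of_real (s j)) - 1) \<longlonglongrightarrow> 2 * dirichlet_beta 0 - 1"
    by (intro tendsto_intros)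
  with l1 have b0: "2 * dirichlet_beta 0 = 1"
    using LIMSEQ_unique by fastforce
  have "(dirichlet_beta has_field_derivative deriv dirichlet_beta 0) (at 0)"
    using hol by (simp add: holomorphic_derivI)
  then have "((\<lambda>h. (dirichlet_beta h - dirichlet_beta 0) / h) \<longlongrightarrow> deriv dirichlet_beta 0) (at 0)"
    by (simp add: DERIV_def)
  moreover have "filterlim (\<lambda>j. complex_of_real (s j)) (at 0) sequentially"
    using zlim s(1) by (auto simp: filterlim_at less_imp_neq[symmetric] intro!: always_eventually)
  ultimately have "(\<lambda>j. (dirichlet_beta (of_real (s j)) - dirichlet_beta 0) / of_real (s j)) \<longlonglongrightarrow> deriv dirichlet_beta 0"
    by (rule filterlim_compose)
  then have "(\<lambda>j. 2 * ((dirichlet_beta (of_real (s j)) - dirichlet_beta 0) / of_real (s j))) \<longlonglongrightarrow> 2 * deriv dirichlet_beta 0"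
    by (intro tendsto_intros)
  also have "(\<lambda>j. 2 * ((dirichlet_beta (of_real (s j)) - dirichlet_beta 0) / of_real (s j))) = (\<lambda>j. (2 * dirichlet_beta (of_real (s j)) - 1) / of_real (s j))"
    unfolding b0[symmetric] by (simp add: diff_divide_distrib right_diff_distrib)
  finally have "2 * deriv dirichlet_beta 0 = of_real L"
    by (rule LIMSEQ_unique[OF _ q])
  then have "deriv dirichlet_beta 0 = of_real L / 2" by (simp only: eq_divide_eq_numeral1 mult.commute) simp
  then have "deriv dirichlet_beta 0 = of_real (1 / 2 * L)" by simp
  then show ?thesis unfolding L_def .
qed

section \<open>An exponential integral evaluated by the Wallis product\<close>

lemma integral_exp_exp_minus:
  fixes a :: real
  assumes a: "a > 0"
  shows "integrable lborel (\<lambda>x. exp x * exp (- a * exp x))"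
    and "(\<integral>x. exp x * exp (- a * exp x) \<partial>lborel) = 1 / a"
proof -
  have "norm (exp x * exp (- a * exp x)) \<le> (1 + (2 / a)\<^sup>2) * exp (- 1 * \<bar>x\<bar>)" for x
  proof (cases "x \<le> 0")
    case True
    have "exp x * exp (- a * exp x) \<le> exp x * 1" using a by (intro mult_left_mono) auto
    also have "\<dots> \<le> (1 + (2 / a)\<^sup>2) * exp (- 1 * \<bar>x\<bar>)" using True by simp
    finally show ?thesis by simp
  next
    case False
    have "exp x ^ 2 \<le> (real 2 / a) ^ 2 * exp (a * exp x)" by (rule power_mult_exp_bound) (use a in auto)
    then have "exp x ^ 2 * exp (- a * exp x) \<le> (2 / a)\<^sup>2 * exp (a * exp x) * exp (- a * exp x)"
      by (intro mult_right_mono) auto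
    then have "exp x ^ 2 * exp (- a * exp x) \<le> (2 / a)\<^sup>2" by (simp add: mult.assoc exp_add[symmetric])
    then have A: "(exp x ^ 2 * exp (- a * exp x)) * exp (- x) \<le> (2 / a)\<^sup>2 * exp (- x)" by (rule mult_right_mono) simp
    have B: "exp x ^ 2 * exp (- a * exp x) * exp (- x) = exp x * exp (- a * exp x)"
      by (simp add: power2_eq_square exp_minus field_simps)
    have C: "(2 / a)\<^sup>2 * exp (- x) \<le> (1 + (2 / a)\<^sup>2) * exp (- x)" by (intro mult_right_mono) auto
    from order_trans[OF A[unfolded B] C] show ?thesis using False by simp
  qed
  then show i: "integrable lborel (\<lambda>x. exp x * exp (- a * exp x))"
    by (intro integrable_exp_decay[where d = 1]) auto
  have "(\<integral>x. exp x * exp (- a * exp x) \<partial>lborel) = 0 - (- 1 / a)"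
  proof (rule integral_FTC_UNIV[OF _ _ i])
    show "((\<lambda>x. - exp (- a * exp x) / a) has_vector_derivative exp x * exp (- a * exp x)) (at x)" for x
      using a by (auto intro!: derivative_eq_intros simp: has_real_derivative_iff_has_vector_derivative[symmetric])
    show "isCont (\<lambda>x. exp x * exp (- a * exp x)) x" for x by (intro continuous_intros)
    have "((\<lambda>x. exp (- a * exp x)) \<longlongrightarrow> 1) at_bot" using a by real_asymp
    then show "((\<lambda>x. - exp (- a * exp x) / a) \<longlongrightarrow> - 1 / a) at_bot" using a by (intro tendsto_intros) auto
    show "((\<lambda>x. - exp (- a * exp x) / a) \<longlongrightarrow> 0) at_top" using a by real_asymp
  qed
  then show "(\<integral>x. exp x * exp (- a * exp x) \<partial>lborel) = 1 / a" by simp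
qed

text \<open>The remainder of 1/(e^y - 1) after its pole 1/y and its constant term -1/2, where the constant is replaced by
-e^(-y)/2 so that the remainder decays at infinity.\<close>

definition bernoulli_kernel :: "real \<Rightarrow> real" where
  "bernoulli_kernel y = 1 / (exp y - 1) - 1 / y + exp (- y) / 2"

text \<open>The first bound controls the function near 0 and the second near infinity; together they make it
integrable in exponential coordinates.\<close>

lemma bernoulli_kernel_bounds:
  fixes y :: real
  assumes y: "y > 0"
  shows "\<bar>bernoulli_kernel y\<bar> \<le> y" "\<bar>bernoulli_kernel y\<bar> \<le> 2 / y"
proof -
  have e1: "exp y - 1 \<ge> y" using exp_ge_add_one_self[of y] by linarith
  have em: "exp (- y) \<le> 1 / y"
  proof -
    have "y * exp (- y) \<le> exp y * exp (- y)" using e1 by (intro mult_right_mono) auto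
    then show ?thesis using y by (simp add: exp_add[symmetric] field_simps)
  qed
  have le0: "1 / (exp y - 1) \<le> 1 / y" using e1 y by (intro divide_left_mono) auto
  have pos: "1 / (exp y - 1) \<ge> 0" using e1 y by simp
  show "\<bar>bernoulli_kernel y\<bar> \<le> 2 / y"
  proof -
    have "2 / y = 1 / y + 1 / y" by simp
    then show ?thesis
      unfolding bernoulli_kernel_def using le0 pos em exp_gt_zero[of "- y"] by (intro abs_leI) linarith+
  qed
  \<comment> \<open>the derivative of 2 y - (2 - y) (e^y - 1) is 1 - (1 - y) e^y, which is nonnegative\<close>
  have lower: "1 / (exp y - 1) - 1 / y \<ge> - (1 / 2)"
  proof -
    let ?f = "\<lambda>y::real. 2 * y - (2 - y) * (exp y - 1)"
    have "?f 0 \<le> ?f y"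
    proof (rule DERIV_nonneg_imp_nondecreasing[where f = ?f])
      show "0 \<le> y" using y by simp
      fix t :: real assume "0 \<le> t" "t \<le> y"
      have "(1 - t) * exp t \<le> exp (- t) * exp t"
        using exp_ge_add_one_self[of "- t"] by (intro mult_right_mono) auto
      then have "2 - ((- 1) * (exp t - 1) + (2 - t) * exp t) \<ge> 0"
        by (simp add: exp_add[symmetric] algebra_simps)
      moreover have "(?f has_real_derivative 2 - ((- 1) * (exp t - 1) + (2 - t) * exp t)) (at t)"
        by (auto intro!: derivative_eq_intros)
      ultimately show "\<exists>y. (?f has_real_derivative y) (at t) \<and> 0 \<le> y" by blast
    qed
    then have "(2 - y) * (exp y - 1) \<le> 2 * y" by simp
    then show ?thesis using e1 y by (simp add: field_simps)
  qed
  \<comment> \<open>from e^y - 1 \<ge> y + y^2/2 and (1/y - 1/2 + y/4) (y + y^2/2) = 1 + y^3/8\<close>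
  have upper: "1 / (exp y - 1) - 1 / y \<le> - (1 / 2) + y / 4"
  proof -
    have "exp y - 1 \<ge> y + y\<^sup>2 / 2" using exp_lower_Taylor_quadratic[of y] y by simp
    then have "1 / (exp y - 1) \<le> 1 / (y + y\<^sup>2 / 2)" using y by (intro divide_left_mono) (auto intro!: mult_pos_pos add_pos_nonneg)
    also have "\<dots> \<le> 1 / y - 1 / 2 + y / 4"
    proof -
      have "1 \<le> (1 / y - 1 / 2 + y / 4) * (y + y\<^sup>2 / 2)"
      proof -
        have "(1 / y - 1 / 2 + y / 4) * (y + y\<^sup>2 / 2) = 1 + y ^ 3 / 8" using y by (simp add: field_simps power2_eq_square power3_eq_cube)
        then show ?thesis using y by simp
      qed
      moreover have "y + y\<^sup>2 / 2 > 0" using y by (intro add_pos_nonneg) auto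
      ultimately show ?thesis by (simp add: divide_le_eq)
    qed
    finally show ?thesis by simp
  qed
  have "exp (- y) \<ge> 1 - y" using exp_ge_add_one_self[of "- y"] by simp
  moreover have "exp (- y) \<le> 1" using y by simp
  ultimately show "\<bar>bernoulli_kernel y\<bar> \<le> y" unfolding bernoulli_kernel_def using lower upper y by (intro abs_leI) linarith+
qed

lemma integrable_bernoulli_kernel_exp: "integrable lborel (\<lambda>x. bernoulli_kernel (exp x))"
proof (rule integrable_exp_decay[where d = 1 and C = 2])
  show "(\<lambda>x. bernoulli_kernel (exp x)) \<in> borel_measurable borel" unfolding bernoulli_kernel_def by measurable
  show "norm (bernoulli_kernel (exp x)) \<le> 2 * exp (- 1 * \<bar>x\<bar>)" for x
  proof (cases "x \<ge> 0")
    case True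
    then show ?thesis using bernoulli_kernel_bounds(2)[of "exp x"] by (simp add: exp_minus divide_inverse)
  next
    case False
    have "\<bar>bernoulli_kernel (exp x)\<bar> \<le> 1 * exp x" using bernoulli_kernel_bounds(1)[of "exp x"] by simp
    also have "\<dots> \<le> 2 * exp x" by (intro mult_right_mono) auto
    finally show ?thesis using False by simp
  qed
qed simp

lemma wallis_alternating_ln:
  "(\<Sum>k<2 * n. (-1) ^ k * (ln (real (k + 2)) - ln (real (k + 1)))) = ln (\<Prod>k=1..n. (4 * real k ^ 2) / (4 * real k ^ 2 - 1))"
proof (induction n)
  case (Suc n)
  have pos: "(\<Prod>k=1..n. (4 * real k ^ 2) / (4 * real k ^ 2 - 1)) > 0"
  proof (rule prod_pos)
    fix k assume "k \<in> {1..n}"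
    then have "real k ^ 2 \<ge> 1" by simp
    then show "(4 * real k ^ 2) / (4 * real k ^ 2 - 1) > 0" by (intro divide_pos_pos) linarith+
  qed
  let ?m = "real (Suc n)"
  have m: "?m \<ge> 1" by simp
  then have m2: "?m ^ 2 \<ge> 1" by (simp add: one_le_power)
  have f: "(4 * ?m ^ 2) / (4 * ?m ^ 2 - 1) = ((2 * ?m) * (2 * ?m)) / ((2 * ?m - 1) * (2 * ?m + 1))"
    by (simp add: power2_eq_square algebra_simps)
  have lnf: "ln ((4 * ?m ^ 2) / (4 * ?m ^ 2 - 1)) = (ln (2 * ?m) - ln (2 * ?m - 1)) - (ln (2 * ?m + 1) - ln (2 * ?m))"
    unfolding f using m by (subst ln_div, simp, simp, subst ln_mult, simp, simp, subst ln_mult) auto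
  have "(\<Sum>k<2 * Suc n. (-1) ^ k * (ln (real (k + 2)) - ln (real (k + 1))))
     = (\<Sum>k<2 * n. (-1) ^ k * (ln (real (k + 2)) - ln (real (k + 1)))) + (ln (2 * ?m) - ln (2 * ?m - 1)) - (ln (2 * ?m + 1) - ln (2 * ?m))"
    by (simp add: algebra_simps)
  also have "\<dots> = ln (\<Prod>k=1..n. (4 * real k ^ 2) / (4 * real k ^ 2 - 1)) + ln ((4 * ?m ^ 2) / (4 * ?m ^ 2 - 1))"
    unfolding Suc.IH lnf by simp
  also have "\<dots> = ln ((\<Prod>k=1..n. (4 * real k ^ 2) / (4 * real k ^ 2 - 1)) * ((4 * ?m ^ 2) / (4 * ?m ^ 2 - 1)))"
    using pos m2 by (intro ln_mult_pos[symmetric] divide_pos_pos) linarith+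
  finally show ?case by (simp add: prod.nat_ivl_Suc' mult.commute)
qed simp

text \<open>Twice the integrand is the alternating sum of exp(-(k+1) y) - exp(-(k+2) y) with y = e^x. Frullani's integral turns
this into the alternating sum of ln((k+2)/(k+1)), which is the logarithm of the Wallis product.\<close>

lemma integral_fermi_minus_exp:
  "integrable lborel (\<lambda>x. 1 / (exp (exp x) + 1) - exp (- exp x) / 2 :: real)"
  "(\<integral>x. 1 / (exp (exp x) + 1) - exp (- exp x) / 2 \<partial>lborel) = ln (pi / 2) / 2"
proof -
  let ?F = "\<lambda>x::real. 1 / (exp (exp x) + 1) - exp (- exp x) / 2"
  let ?f = "\<lambda>k x. exp (- real (k + 1) * exp x) - exp (- real (k + 2) * exp x)"
  let ?S = "\<lambda>N x. \<Sum>k<N. (-1) ^ k * ?f k x"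
  have f: "integrable lborel (?f k)" "integral\<^sup>L lborel (?f k) = ln (real (k + 2)) - ln (real (k + 1))" for k
    using frullani_exp_exp[of "real (k + 1)" "real (k + 2)"] by auto
  have S_eq: "?S N x = exp (- exp x) * (1 - exp (- exp x)) * (1 - (- exp (- exp x)) ^ N) / (1 + exp (- exp x))" for N x
  proof -
    define q where "q = exp (- exp x)"
    have q: "q > 0" by (simp add: q_def)
    have fk: "(-1) ^ k * ?f k x = q * (1 - q) * (- q) ^ k" for k
    proof -
      have "exp (- real (k + 1) * exp x) = q ^ (k + 1)" "exp (- real (k + 2) * exp x) = q ^ (k + 2)"
        unfolding q_def exp_of_nat_mult[symmetric] by (simp_all only: mult_minus_left mult_minus_right)
      then show ?thesis by (simp add: power_minus[of q] algebra_simps)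
    qed
    have "?S N x = q * (1 - q) * ((1 - (- q) ^ N) / (1 - (- q)))"
      unfolding fk using q by (simp add: sum_distrib_left[symmetric] sum_gp_strict)
    then show ?thesis by (simp add: q_def)
  qed
  have F_eq: "2 * ?F x = exp (- exp x) * (1 - exp (- exp x)) / (1 + exp (- exp x))" for x
  proof -
    define q where "q = exp (exp x)"
    have q: "q > 0" "q + 1 \<noteq> 0" using exp_gt_zero[of "exp x"] unfolding q_def by linarith+
    have "2 * (1 / (q + 1) - inverse q / 2) = inverse q * (1 - inverse q) / (1 + inverse q)"
    proof -
      have "1 + inverse q = (q + 1) / q" "1 - inverse q = (q - 1) / q" using q by (simp_all add: field_simps)
      then have "inverse q * (1 - inverse q) / (1 + inverse q) = (q - 1) / (q * (q + 1))"
        using q by (simp add: inverse_eq_divide)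
      moreover have "2 * (1 / (q + 1) - inverse q / 2) = (q - 1) / (q * (q + 1))"
        using q by (simp add: divide_simps inverse_eq_divide) (simp add: algebra_simps)
      ultimately show ?thesis by simp
    qed
    then show ?thesis by (simp add: q_def exp_minus)
  qed
  have bound: "norm (?S N x) \<le> 2 * (exp x * exp (- 1 * exp x))" for N x
  proof -
    define q where "q = exp (- exp x)"
    have q: "0 < q" "q < 1" by (simp_all add: q_def)
    have "1 - q \<le> exp x" using exp_ge_add_one_self[of "- exp x"] by (simp add: q_def)
    have "\<bar>(- q) ^ N\<bar> \<le> 1" using q by (simp add: power_abs power_le_one)
    then have "\<bar>1 - (- q) ^ N\<bar> \<le> 2" by linarith
    then have "\<bar>1 - (- q) ^ N\<bar> / (1 + q) \<le> 2 / 1" using q by (intro frac_le) auto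
    then have "(q * (1 - q)) * (\<bar>1 - (- q) ^ N\<bar> / (1 + q)) \<le> (q * exp x) * (2 / 1)"
      using q \<open>1 - q \<le> exp x\<close> by (intro mult_mono) auto
    then show ?thesis unfolding S_eq q_def[symmetric] using q by (simp add: abs_mult q_def mult_ac)
  qed
  have dom: "integrable lborel (\<lambda>x::real. 2 * (exp x * exp (- 1 * exp x)))"
    by (intro integrable_mult_right integral_exp_exp_minus) simp
  have lim: "(\<lambda>N. ?S N x) \<longlonglongrightarrow> 2 * ?F x" for x
  proof -
    have "(\<lambda>N. (- exp (- exp x)) ^ N) \<longlonglongrightarrow> 0" by (intro LIMSEQ_power_zero) simp
    then have "(\<lambda>N. exp (- exp x) * (1 - exp (- exp x)) * (1 - (- exp (- exp x)) ^ N) / (1 + exp (- exp x)))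
       \<longlonglongrightarrow> exp (- exp x) * (1 - exp (- exp x)) * (1 - 0) / (1 + exp (- exp x))"
    proof (intro tendsto_intros)
      show "1 + exp (- exp x) \<noteq> 0" using exp_gt_zero[of "- exp x"] by linarith
    qed simp
    then show ?thesis unfolding S_eq F_eq by (simp only: diff_0_right mult_1_right)
  qed
  have Fm: "(\<lambda>x. 2 * ?F x) \<in> borel_measurable lborel" by measurable
  have Sm: "?S N \<in> borel_measurable lborel" for N by measurable
  have int2: "integrable lborel (\<lambda>x. 2 * ?F x)"
    by (rule integrable_dominated_convergence[OF Fm Sm dom]) (use lim bound in \<open>auto intro!: AE_I2\<close>)
  have half: "(\<lambda>x. (1 / 2) * (2 * ?F x)) = ?F" by (rule ext) simp
  show "integrable lborel ?F"
    using integrable_mult_right[OF int2, of "1 / 2"] unfolding half .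
  have "(\<lambda>N. integral\<^sup>L lborel (?S N)) \<longlonglongrightarrow> (\<integral>x. 2 * ?F x \<partial>lborel)"
    by (rule integral_dominated_convergence[OF Fm Sm dom]) (use lim bound in \<open>auto intro!: AE_I2\<close>)
  moreover have "integral\<^sup>L lborel (?S N) = (\<Sum>k<N. (-1) ^ k * (ln (real (k + 2)) - ln (real (k + 1))))" for N
    using f by (simp only: Bochner_Integration.integral_sum integrable_mult_right integral_mult_right_zero)
  ultimately have "(\<lambda>N. \<Sum>k<N. (-1) ^ k * (ln (real (k + 2)) - ln (real (k + 1)))) \<longlonglongrightarrow> 2 * integral\<^sup>L lborel ?F"
    by (simp only: integral_mult_right_zero)
  then have "(\<lambda>n. \<Sum>k<2 * n. (-1) ^ k * (ln (real (k + 2)) - ln (real (k + 1)))) \<longlonglongrightarrow> 2 * integral\<^sup>L lborel ?F"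
    by (rule filterlim_compose) (auto intro!: filterlim_subseq simp: strict_mono_def)
  then have "(\<lambda>n. ln (\<Prod>k=1..n. (4 * real k ^ 2) / (4 * real k ^ 2 - 1))) \<longlonglongrightarrow> 2 * integral\<^sup>L lborel ?F"
    unfolding wallis_alternating_ln .
  moreover have "(\<lambda>n. ln (\<Prod>k=1..n. (4 * real k ^ 2) / (4 * real k ^ 2 - 1))) \<longlonglongrightarrow> ln (pi / 2)"
    by (intro tendsto_ln wallis) simp
  ultimately have "2 * integral\<^sup>L lborel ?F = ln (pi / 2)" by (rule LIMSEQ_unique)
  then show "integral\<^sup>L lborel ?F = ln (pi / 2) / 2" by simp
qed

text \<open>The identity 1/(e^y - 1) - 2/(e^(2y) - 1) = 1/(e^y + 1) relates the kernel at y and 2 y to the integrand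
above. Since doubling y is a translation in x, the integral I satisfies I - 2 I = ln(pi/2)/2 + ln 2.\<close>

theorem integral_bernoulli_kernel: "(\<integral>x. bernoulli_kernel (exp x) \<partial>lborel) = - ln (2 * pi) / 2"
proof -
  let ?c = "\<integral>x. bernoulli_kernel (exp x) \<partial>lborel"
  let ?F = "\<lambda>x::real. 1 / (exp (exp x) + 1) - exp (- exp x) / 2"
  let ?E = "\<lambda>x::real. exp (- 1 * exp x) - exp (- 2 * exp x)"
  have i2: "integrable lborel (\<lambda>x. bernoulli_kernel (exp (ln 2 + 1 * x)))" by (rule lborel_integrable_real_affine[OF integrable_bernoulli_kernel_exp]) simp
  have v2: "(\<integral>x. bernoulli_kernel (exp (ln 2 + 1 * x)) \<partial>lborel) = ?c"
    using lborel_integral_real_affine[of 1 "\<lambda>x. bernoulli_kernel (exp x)" "ln 2"] by simp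
  have eq: "bernoulli_kernel (exp x) - 2 * bernoulli_kernel (exp (ln 2 + 1 * x)) = ?F x + ?E x" for x
  proof -
    define t where "t = exp x"
    have t: "t > 0" by (simp add: t_def)
    define q where "q = exp t"
    have q: "q > 1" using t by (simp add: q_def)
    have e2: "exp (ln 2 + 1 * x) = 2 * t" by (simp add: exp_add t_def)
    have q2: "exp (2 * t) = q * q" by (simp add: q_def exp_add[symmetric])
    have qi: "exp (- t) = inverse q" "exp (- (2 * t)) = inverse (q * q)" by (simp_all add: exp_minus q_def exp_add[symmetric])
    have f: "1 / (q - 1) - 2 * (1 / (q * q - 1)) = 1 / (q + 1)"
    proof -
      have "q * q - 1 = (q - 1) * (q + 1)" by (simp add: algebra_simps)
      moreover have "q - 1 \<noteq> 0" "q + 1 \<noteq> 0" using q by auto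
      ultimately show ?thesis by (simp add: divide_simps)
    qed
    have "bernoulli_kernel t - 2 * bernoulli_kernel (2 * t) = (1 / (q - 1) - 2 * (1 / (q * q - 1))) + (exp (- t) / 2 - exp (- (2 * t)))"
      unfolding bernoulli_kernel_def q2 q_def[symmetric] by (simp add: algebra_simps)
    also have "\<dots> = (1 / (q + 1) - exp (- t) / 2) + (exp (- 1 * t) - exp (- 2 * t))"
      unfolding f by simp
    finally show ?thesis unfolding e2 t_def[symmetric] q_def .
  qed
  have "?c - 2 * ?c = (\<integral>x. bernoulli_kernel (exp x) - 2 * bernoulli_kernel (exp (ln 2 + 1 * x)) \<partial>lborel)"
    using Bochner_Integration.integral_diff[OF integrable_bernoulli_kernel_exp integrable_mult_right[OF i2, of 2]] by (simp only: v2 integral_mult_right_zero)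
  also have "\<dots> = (\<integral>x. ?F x + ?E x \<partial>lborel)" by (simp only: eq)
  also have "\<dots> = ln (pi / 2) / 2 + (ln 2 - ln 1)"
    using Bochner_Integration.integral_add[OF integral_fermi_minus_exp(1) frullani_exp_exp(1)[of 1 2]]
      integral_fermi_minus_exp(2) frullani_exp_exp(2)[of 1 2] by simp
  finally have "- ?c = ln (pi / 2) / 2 + ln 2" by simp
  moreover have "ln (pi / 2) = ln pi - ln 2" "ln (2 * pi) = ln 2 + ln pi" by (simp_all add: ln_div ln_mult)
  ultimately show ?thesis by linarith
qed

section \<open>The one-parameter formula up to a constant\<close>

lemma r2_fibre_finite: "finite {(a::int, b::int). a\<^sup>2 + b\<^sup>2 = int n}"
proof (rule finite_subset)
  show "{(a::int, b::int). a\<^sup>2 + b\<^sup>2 = int n} \<subseteq> {- int n..int n} \<times> {- int n..int n}"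
  proof safe
    fix a b :: int assume ab: "a\<^sup>2 + b\<^sup>2 = int n"
    have sq: "\<bar>c\<bar> \<le> c\<^sup>2" for c :: int
    proof (cases "c = 0")
      case False
      then have "\<bar>c\<bar> * 1 \<le> \<bar>c\<bar> * \<bar>c\<bar>" by (intro mult_left_mono) auto
      then show ?thesis by (simp add: power2_eq_square)
    qed simp
    have "\<bar>a\<bar> \<le> int n" "\<bar>b\<bar> \<le> int n"
      using sq[of a] sq[of b] ab zero_le_power2[of a] zero_le_power2[of b] by linarith+
    then show "a \<in> {- int n..int n}" "b \<in> {- int n..int n}" by auto
  qed
qed simp

text \<open>Projecting to the first coordinate is at most two-to-one, and that coordinate has absolute value at most sqrt n.\<close>

lemma r2_bound:
  assumes "n \<ge> 1"
  shows "real (r2 n) \<le> 6 * sqrt (real n)"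
proof -
  define m where "m = \<lfloor>sqrt (real n)\<rfloor>"
  have m: "m \<ge> 0" "real_of_int m \<le> sqrt (real n)" by (auto simp: m_def)
  \<comment> \<open>a solution is determined by a and the sign of b\<close>
  have "inj_on (\<lambda>(a, b). (a, b \<ge> (0::int))) {(a::int, b::int). a\<^sup>2 + b\<^sup>2 = int n}"
  proof (rule inj_onI, clarsimp)
    fix a b b' :: int
    assume ab: "a\<^sup>2 + b\<^sup>2 = int n" and ab': "a\<^sup>2 + b'\<^sup>2 = int n" and s: "(0 \<le> b) = (0 \<le> b')"
    have "b\<^sup>2 = b'\<^sup>2" using ab ab' by linarith
    then have "b = b' \<or> b = - b'" by (simp add: power2_eq_iff)
    then show "b = b'" using s by auto
  qed
  moreover have "(\<lambda>(a, b). (a, b \<ge> (0::int))) ` {(a::int, b::int). a\<^sup>2 + b\<^sup>2 = int n} \<subseteq> {- m..m} \<times> UNIV"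
  proof clarsimp
    fix a b :: int assume ab: "a\<^sup>2 + b\<^sup>2 = int n"
    have "real_of_int (a\<^sup>2) \<le> real_of_int (int n)" using ab zero_le_power2[of b] by (subst of_int_le_iff) linarith
    then have "(real_of_int \<bar>a\<bar>)\<^sup>2 \<le> real n" by simp
    then have "real_of_int \<bar>a\<bar> \<le> sqrt (real n)" by (rule real_le_rsqrt)
    then have "\<bar>a\<bar> \<le> m" by (simp add: m_def le_floor_iff)
    then show "- m \<le> a \<and> a \<le> m" by auto
  qed
  ultimately have "r2 n \<le> card ({- m..m} \<times> (UNIV :: bool set))"
    unfolding r2_def by (intro card_inj_on_le[where f = "\<lambda>(a, b). (a, b \<ge> (0::int))"]) auto
  also have "\<dots> = nat (2 * m + 1) * 2" by (simp add: card_cartesian_product)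
  finally have "real (r2 n) \<le> real (nat (2 * m + 1) * 2)" by (rule of_nat_mono)
  also have "\<dots> = 2 * (2 * real_of_int m + 1)" using m by simp
  also have "\<dots> \<le> 2 * (2 * sqrt (real n) + sqrt (real n))"
    using m real_sqrt_ge_1_iff[of "real n"] assms by (simp del: real_sqrt_ge_1_iff)
  finally show ?thesis by simp
qed

lemma r2_0: "r2 0 = 1"
proof -
  have "{(a::int, b::int). a\<^sup>2 + b\<^sup>2 = int 0} = {(0, 0)}" by (auto simp: sum_power2_eq_zero_iff)
  then show ?thesis by (simp add: r2_def)
qed

text \<open>The exponential of sqrt n beats every power of n.\<close>

lemma summable_r2_exp_sqrt:
  assumes a: "a > 0"
  shows "summable (\<lambda>n. real (r2 (Suc n)) * exp (- a * sqrt (real (Suc n))))"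
proof (rule summable_comparison_test)
  define C where "C = 6 * (real 5 / a) ^ 5"
  have "norm (real (r2 (Suc n)) * exp (- a * sqrt (real (Suc n)))) \<le> C * (1 / real (Suc n) ^ 2)" for n
  proof -
    define t where "t = sqrt (real (Suc n))"
    have t: "t > 0" "t ^ 4 = real (Suc n) ^ 2"
    proof -
      show "t > 0" by (simp add: t_def)
      have "t ^ 4 = (t ^ 2) ^ 2" by (simp add: power_mult[symmetric])
      then show "t ^ 4 = real (Suc n) ^ 2" by (simp add: t_def)
    qed
    have "t ^ 5 \<le> (real 5 / a) ^ 5 * exp (a * t)" by (rule power_mult_exp_bound) (use a t in auto)
    then have "t ^ 5 * exp (- a * t) \<le> (real 5 / a) ^ 5 * exp (a * t) * exp (- a * t)" by (rule mult_right_mono) simp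
    also have "\<dots> = (real 5 / a) ^ 5" by (simp add: mult.assoc exp_add[symmetric])
    finally have "t * t ^ 4 * exp (- a * t) \<le> (real 5 / a) ^ 5" by (simp add: eval_nat_numeral mult.assoc)
    then have b: "t * exp (- a * t) \<le> (real 5 / a) ^ 5 / real (Suc n) ^ 2"
      using t by (simp add: pos_le_divide_eq mult_ac)
    have "real (r2 (Suc n)) * exp (- a * t) \<le> (6 * t) * exp (- a * t)"
      unfolding t_def by (intro mult_right_mono r2_bound) auto
    also have "\<dots> \<le> 6 * ((real 5 / a) ^ 5 / real (Suc n) ^ 2)" using b by simp
    finally show ?thesis by (simp add: t_def C_def)
  qed
  then show "\<exists>N. \<forall>n\<ge>N. norm (real (r2 (Suc n)) * exp (- a * sqrt (real (Suc n)))) \<le> C * (1 / real (Suc n) ^ 2)" by blast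
  have "summable (\<lambda>n. 1 / real (Suc n) ^ 2)"
    using inverse_power_summable[of 2, where 'a = real] by (subst summable_Suc_iff) (simp add: inverse_eq_divide)
  then show "summable (\<lambda>n. C * (1 / real (Suc n) ^ 2))" by (rule summable_mult)
qed

lemma summable_r2_inverse_square: "summable (\<lambda>n. real (r2 (Suc n)) / (real (Suc n))\<^sup>2)"
proof (rule summable_comparison_test)
  have "norm (real (r2 (Suc n)) / (real (Suc n))\<^sup>2) \<le> 6 * real (Suc n) powr (- (3 / 2))" for n
  proof -
    have "real (r2 (Suc n)) / (real (Suc n))\<^sup>2 \<le> 6 * sqrt (real (Suc n)) / (real (Suc n))\<^sup>2"
      by (intro divide_right_mono r2_bound) auto
    also have "sqrt (real (Suc n)) / (real (Suc n))\<^sup>2 = real (Suc n) powr (1 / 2 - 2)"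
      by (simp only: powr_half_sqrt[symmetric] of_nat_0_le_iff powr_diff powr_numeral of_nat_0_less_iff zero_less_Suc)
    then have "6 * sqrt (real (Suc n)) / (real (Suc n))\<^sup>2 = 6 * real (Suc n) powr (- (3 / 2))" by simp
    finally show ?thesis by simp
  qed
  then show "\<exists>N. \<forall>n\<ge>N. norm (real (r2 (Suc n)) / (real (Suc n))\<^sup>2) \<le> 6 * real (Suc n) powr (- (3 / 2))" by blast
  have "summable (\<lambda>n. real n powr (- (3 / 2)))" by (simp add: summable_real_powr_iff)
  then have "summable (\<lambda>n. real (Suc n) powr (- (3 / 2)))" by (subst summable_Suc_iff)
  then show "summable (\<lambda>n. 6 * real (Suc n) powr (- (3 / 2)))" by (rule summable_mult)
qed

text \<open>The double series of the square of theta3 is grouped along the fibres of (a, b) \<mapsto> a^2 + b^2.\<close>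

lemma r2_generating_function:
  assumes c: "c > 0"
  shows "(\<lambda>n. real (r2 n) * exp (- c * real n)) sums (theta3 c)\<^sup>2"
proof -
  let ?R = "\<lambda>n. {(a::int, b::int). a\<^sup>2 + b\<^sup>2 = int n}"
  let ?e = "\<lambda>(a::int, b::int). exp (- c * (real_of_int a)\<^sup>2) * exp (- c * (real_of_int b)\<^sup>2)"
  have "(?e has_sum theta3 c * theta3 c) (UNIV \<times> UNIV)"
    unfolding theta3_def by (intro has_sum_product summable_theta3 c)
  then have "((\<lambda>(n, x). ?e x) has_sum theta3 c * theta3 c) (Sigma UNIV ?R)"
  proof (subst has_sum_reindex_bij_witness[where j = snd and i = "\<lambda>(a, b). (nat (a\<^sup>2 + b\<^sup>2), (a, b))" and T = "UNIV \<times> UNIV" and h = ?e])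
  qed auto
  then have "((\<lambda>n. real (r2 n) * exp (- c * real n)) has_sum theta3 c * theta3 c) UNIV"
  proof (rule has_sum_SigmaD)
    fix n :: nat
    have v: "?e x = exp (- c * real n)" if "x \<in> ?R n" for x
    proof -
      obtain a b where x: "x = (a, b)" by (cases x)
      then have ab: "a\<^sup>2 + b\<^sup>2 = int n" using that by simp
      have "(real_of_int a)\<^sup>2 + (real_of_int b)\<^sup>2 = real n"
        using arg_cong[OF ab, of real_of_int] by simp
      then have "- c * (real_of_int a)\<^sup>2 + - c * (real_of_int b)\<^sup>2 = - c * real n"
        by (simp only: distrib_left[symmetric])
      then show ?thesis unfolding x by (simp only: prod.case exp_add[symmetric])
    qed
    have "((\<lambda>x. ?e x) has_sum (\<Sum>x\<in>?R n. ?e x)) (?R n)" by (rule has_sum_finite[OF r2_fibre_finite])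
    also have "(\<Sum>x\<in>?R n. ?e x) = real (r2 n) * exp (- c * real n)"
      using v by (simp add: r2_def)
    finally show "((\<lambda>y. case (n, y) of (n, x) \<Rightarrow> ?e x) has_sum real (r2 n) * exp (- c * real n)) (?R n)" by simp
  qed
  then show ?thesis by (simp add: power2_eq_square has_sum_imp_sums)
qed

lemma integral_sums_nonneg:
  fixes f :: "nat \<Rightarrow> 'a \<Rightarrow> real"
  assumes int: "\<And>n. integrable M (f n)" and nn: "\<And>n x. f n x \<ge> 0"
    and s: "\<And>x. (\<lambda>n. f n x) sums g x" and sm: "summable (\<lambda>n. integral\<^sup>L M (f n))"
  shows "integrable M g" "(\<lambda>n. integral\<^sup>L M (f n)) sums integral\<^sup>L M g"
proof -
  have g: "g = (\<lambda>x. \<Sum>n. f n x)" using s by (auto simp: sums_iff)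
  have ae: "AE x in M. summable (\<lambda>n. norm (f n x))" using s nn by (auto simp: sums_iff)
  have sm': "summable (\<lambda>n. \<integral>x. norm (f n x) \<partial>M)" using sm nn by simp
  show "integrable M g" unfolding g by (rule integrable_suminf[OF int ae sm'])
  show "(\<lambda>n. integral\<^sup>L M (f n)) sums integral\<^sup>L M g" unfolding g by (rule sums_integral[OF int ae sm'])
qed

lemma integral_sums_nonneg_integrable:
  fixes f :: "nat \<Rightarrow> 'a \<Rightarrow> real"
  assumes int: "\<And>n. integrable M (f n)" and nn: "\<And>n x. f n x \<ge> 0"
    and s: "\<And>x. (\<lambda>n. f n x) sums g x" and g: "integrable M g"
  shows "(\<lambda>n. integral\<^sup>L M (f n)) sums integral\<^sup>L M g"
proof (rule integral_sums_nonneg(2)[OF int nn s])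
  show "summable (\<lambda>n. integral\<^sup>L M (f n))"
  proof (rule bounded_imp_summable)
    show "integral\<^sup>L M (f n) \<ge> 0" for n using nn by simp
    show "(\<Sum>k\<le>n. integral\<^sup>L M (f k)) \<le> integral\<^sup>L M g" for n
    proof -
      have "(\<Sum>k\<le>n. integral\<^sup>L M (f k)) = (\<integral>x. (\<Sum>k\<le>n. f k x) \<partial>M)" using int by simp
      also have "\<dots> \<le> integral\<^sup>L M g"
      proof (rule integral_mono)
        show "(\<Sum>k\<le>n. f k x) \<le> g x" for x
          using s[of x] sum_le_suminf[of "\<lambda>n. f n x" "{..n}"] nn by (simp add: sums_iff)
      qed (use int g in auto)
      finally show ?thesis .
    qed
  qed
qed

text \<open>K0 on the positive reals as a real function, so that the integrals and inequalities for positive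
parameters can be stated over the reals.\<close>

definition K0_real :: "real \<Rightarrow> real" where
  "K0_real x = 1 / 2 * (\<integral>t. exp (- x * cosh t) \<partial>lborel)"

lemma K0_eq_K0_real: "K0 (of_real x) = of_real (K0_real x)"
  by (simp only: K0_of_real K0_real_def)

lemma K0_real_nonneg: "K0_real x \<ge> 0"
  by (simp add: K0_real_def)

lemma K0_real_two_sided:
  assumes "A > 0" "B > 0"
  shows "K0_real (2 * sqrt (A * B)) = 1 / 2 * (\<integral>x. exp (- A * exp x - B * exp (- x)) \<partial>lborel)"
  using K0_two_sided_integral(2)[OF assms] unfolding K0_eq_K0_real of_real_eq_iff .

lemma summable_r2_K0_real:
  assumes w: "w > 0"
  shows "summable (\<lambda>n. real (r2 (Suc n)) * K0_real (2 * pi * sqrt (real (Suc n) * w)))"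
proof -
  define \<delta> where "\<delta> = 2 * pi * sqrt w"
  have \<delta>: "\<delta> > 0" using w by (simp add: \<delta>_def)
  obtain C where C: "C \<ge> 0" "\<And>z. Re z \<ge> \<delta> \<Longrightarrow> norm (K0 z) \<le> C * exp (- Re z)" using K0_bound[OF \<delta>] by blast
  have b: "norm (real (r2 (Suc n)) * K0_real (2 * pi * sqrt (real (Suc n) * w))) \<le> C * (real (r2 (Suc n)) * exp (- \<delta> * sqrt (real (Suc n))))" for n
  proof -
    have e: "2 * pi * sqrt (real (Suc n) * w) = \<delta> * sqrt (real (Suc n))" by (simp add: \<delta>_def real_sqrt_mult)
    have "\<delta> * 1 \<le> \<delta> * sqrt (real (Suc n))" using \<delta> by (intro mult_left_mono) auto
    then have "norm (K0 (of_real (\<delta> * sqrt (real (Suc n))))) \<le> C * exp (- Re (of_real (\<delta> * sqrt (real (Suc n)))))"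
      by (intro C(2)) simp
    then have "K0_real (\<delta> * sqrt (real (Suc n))) \<le> C * exp (- \<delta> * sqrt (real (Suc n)))"
      unfolding K0_eq_K0_real by (simp del: of_nat_Suc)
    then have "real (r2 (Suc n)) * K0_real (\<delta> * sqrt (real (Suc n))) \<le> real (r2 (Suc n)) * (C * exp (- \<delta> * sqrt (real (Suc n))))"
      by (intro mult_left_mono) auto
    then show ?thesis unfolding e using K0_real_nonneg by (simp add: mult_ac)
  qed
  show ?thesis
    by (rule summable_comparison_test[OF _ summable_mult[OF summable_r2_exp_sqrt[OF \<delta>], of C]]) (use b in blast)
qed

text \<open>The generating function of r2 without the term at n = 0, in the normalisation for which the modular
transformation is u \<mapsto> 1/u.\<close>

definition theta_sq_tail :: "real \<Rightarrow> real" where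
  "theta_sq_tail u = (theta3 (pi * u))\<^sup>2 - 1"

lemma theta_sq_tail_r2_sums:
  assumes u: "u > 0"
  shows "(\<lambda>n. real (r2 (Suc n)) * exp (- pi * real (Suc n) * u)) sums theta_sq_tail u"
proof -
  have "(\<lambda>n. real (r2 n) * exp (- (pi * u) * real n)) sums (theta3 (pi * u))\<^sup>2"
    by (rule r2_generating_function) (use u in simp)
  from sums_Suc_iff[THEN iffD2, of "\<lambda>n. real (r2 n) * exp (- (pi * u) * real n)"] this
  have "(\<lambda>n. real (r2 (Suc n)) * exp (- (pi * u) * real (Suc n))) sums (theta_sq_tail u)"
    unfolding sums_Suc_iff theta_sq_tail_def by (simp add: r2_0)
  then show ?thesis by (simp add: mult_ac)
qed

text \<open>The two-squares theorem, with the term at 0 removed and the terms at m and -m combined.\<close>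

lemma theta_sq_tail_sech_sums:
  assumes u: "u > 0"
  shows "(\<lambda>m. 2 / cosh (pi * u * real (Suc m))) sums theta_sq_tail u"
proof -
  have "(\<lambda>m. 2 * (1 / cosh (pi * u * real_of_int (int (Suc m))))) sums (sech_sum (pi * u) - 1 / cosh (pi * u * real_of_int 0))"
    unfolding sech_sum_def by (rule sums_even_int[OF summable_sech_sum]) (use u in auto)
  then show ?thesis
    using theta3_squared_eq_sech_sum[of "pi * u"] u by (simp add: theta_sq_tail_def)
qed

lemma theta_sq_tail_modular:
  "1 + theta_sq_tail (exp (- x)) = exp x * (1 + theta_sq_tail (exp x))"
proof -
  have "theta3 (pi * exp (- x)) = theta3 (pi / exp (- x)) / sqrt (exp (- x))"
    by (rule theta3_modular) simp
  then have "(theta3 (pi * exp (- x)))\<^sup>2 = (theta3 (pi * exp x))\<^sup>2 * exp x"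
    by (simp only: power_divide exp_minus divide_inverse inverse_inverse_eq power_mult_distrib power_inverse
      real_sqrt_inverse) (simp only: real_sqrt_pow2 exp_ge_zero)
  then show ?thesis by (simp add: theta_sq_tail_def)
qed

definition r2_K0_sum :: "real \<Rightarrow> real" where
  "r2_K0_sum w = (\<Sum>n. real (r2 (Suc n)) * K0_real (2 * pi * sqrt (real (Suc n) * w)))"

lemma r2_K0_sum_integral:
  assumes w: "w > 0"
  shows "integrable lborel (\<lambda>x. theta_sq_tail (exp x) * exp (- pi * w * exp (- x)))"
    and "r2_K0_sum w = 1 / 2 * (\<integral>x. theta_sq_tail (exp x) * exp (- pi * w * exp (- x)) \<partial>lborel)"
proof -
  let ?f = "\<lambda>n x. real (r2 (Suc n)) * exp (- (pi * real (Suc n)) * exp x - (pi * w) * exp (- x))"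
  have pos: "pi * real (Suc n) > 0" "pi * w > 0" for n using w by auto
  have int: "integrable lborel (?f n)" for n
    by (intro integrable_mult_right K0_two_sided_integral pos)
  have val: "integral\<^sup>L lborel (?f n) = 2 * (real (r2 (Suc n)) * K0_real (2 * pi * sqrt (real (Suc n) * w)))" for n
  proof -
    have "sqrt (pi * real (Suc n) * (pi * w)) = pi * sqrt (real (Suc n) * w)"
      using real_sqrt_mult[of "pi * pi" "real (Suc n) * w"] by (simp add: mult_ac)
    then show ?thesis
      using K0_real_two_sided[OF pos(1)[of n] pos(2)] by (simp del: of_nat_Suc add: mult_ac)
  qed
  have s: "(\<lambda>n. ?f n x) sums (theta_sq_tail (exp x) * exp (- pi * w * exp (- x)))" for x
  proof -
    have "?f n x = real (r2 (Suc n)) * exp (- pi * real (Suc n) * exp x) * exp (- pi * w * exp (- x))" for n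
      by (simp only: mult.assoc exp_add[symmetric] diff_conv_add_uminus mult_minus_left)
    then show ?thesis
      using sums_mult2[OF theta_sq_tail_r2_sums[of "exp x"], of "exp (- pi * w * exp (- x))"] by (simp only: exp_gt_zero)
  qed
  have sm: "summable (\<lambda>n. integral\<^sup>L lborel (?f n))"
    unfolding val by (intro summable_mult summable_r2_K0_real w)
  show "integrable lborel (\<lambda>x. theta_sq_tail (exp x) * exp (- pi * w * exp (- x)))"
    by (rule integral_sums_nonneg(1)[OF int _ s sm]) simp
  have "(\<lambda>n. integral\<^sup>L lborel (?f n)) sums (\<integral>x. theta_sq_tail (exp x) * exp (- pi * w * exp (- x)) \<partial>lborel)"
    by (rule integral_sums_nonneg(2)[OF int _ s sm]) simp
  then have "(\<integral>x. theta_sq_tail (exp x) * exp (- pi * w * exp (- x)) \<partial>lborel) = 2 * r2_K0_sum w"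
    unfolding val r2_K0_sum_def using suminf_mult[OF summable_r2_K0_real[OF w], of 2] by (simp add: sums_iff)
  then show "r2_K0_sum w = 1 / 2 * (\<integral>x. theta_sq_tail (exp x) * exp (- pi * w * exp (- x)) \<partial>lborel)" by simp
qed

definition shift_sum :: "real \<Rightarrow> real" where
  "shift_sum w = (\<Sum>n. real (r2 (Suc n)) * (1 / (real (Suc n) + w) - 1 / real (Suc n)))"

lemma shift_term_bound:
  assumes w: "w > 0"
  shows "\<bar>real (r2 (Suc n)) * (1 / (real (Suc n) + w) - 1 / real (Suc n))\<bar> \<le> w * (real (r2 (Suc n)) / (real (Suc n))\<^sup>2)"
proof -
  let ?n = "real (Suc n)"
  have n: "?n > 0" by simp
  have "1 / (?n + w) - 1 / ?n = - (w / (?n * (?n + w)))" using w n by (simp add: field_simps del: of_nat_Suc)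
  then have "\<bar>1 / (?n + w) - 1 / ?n\<bar> = w / (?n * (?n + w))" using w n by (simp add: abs_divide abs_mult)
  also have "\<dots> \<le> w / (?n * ?n)" using w n by (intro divide_left_mono mult_left_mono mult_pos_pos) auto
  finally have "real (r2 (Suc n)) * \<bar>1 / (?n + w) - 1 / ?n\<bar> \<le> real (r2 (Suc n)) * (w / (?n * ?n))"
    by (rule mult_left_mono) simp
  then show ?thesis by (simp add: abs_mult power2_eq_square mult_ac)
qed

lemma summable_shift_terms:
  assumes w: "w > 0"
  shows "summable (\<lambda>n. real (r2 (Suc n)) * (1 / (real (Suc n) + w) - 1 / real (Suc n)))"
  by (rule summable_comparison_test[OF _ summable_mult[OF summable_r2_inverse_square, of w]])
    (use shift_term_bound[OF w] in \<open>auto simp del: of_nat_Suc\<close>)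

lemma abs_shift_sum_le:
  assumes w: "w > 0"
  shows "\<bar>shift_sum w\<bar> \<le> w * (\<Sum>n. real (r2 (Suc n)) / (real (Suc n))\<^sup>2)"
proof -
  have "\<bar>shift_sum w\<bar> \<le> (\<Sum>n. w * (real (r2 (Suc n)) / (real (Suc n))\<^sup>2))"
    unfolding shift_sum_def real_norm_def[symmetric]
    by (rule norm_suminf_le) (use shift_term_bound[OF w] summable_mult[OF summable_r2_inverse_square, of w] in auto)
  then show ?thesis by (simp only: suminf_mult[OF summable_r2_inverse_square])
qed

text \<open>The terms are the integrals of e^x (exp(-pi n e^x) - exp(-pi (n+w) e^x)), which are nonnegative.\<close>

lemma shift_sum_integral:
  assumes w: "w > 0"
  shows "integrable lborel (\<lambda>x. exp x * theta_sq_tail (exp x) * (1 - exp (- pi * w * exp x)))"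
    and "(\<integral>x. exp x * theta_sq_tail (exp x) * (1 - exp (- pi * w * exp x)) \<partial>lborel) = - shift_sum w / pi"
proof -
  let ?f = "\<lambda>n x. real (r2 (Suc n)) * (exp x * exp (- (pi * real (Suc n)) * exp x) - exp x * exp (- (pi * (real (Suc n) + w)) * exp x))"
  have pos: "pi * real (Suc n) > 0" "pi * (real (Suc n) + w) > 0" for n using w by (auto intro!: mult_pos_pos)
  have int: "integrable lborel (?f n)" for n
    by (intro integrable_mult_right Bochner_Integration.integrable_diff integral_exp_exp_minus pos)
  have val: "integral\<^sup>L lborel (?f n) = - (real (r2 (Suc n)) * (1 / (real (Suc n) + w) - 1 / real (Suc n))) / pi" for n
  proof -
    have "integral\<^sup>L lborel (?f n) = real (r2 (Suc n)) * (1 / (pi * real (Suc n)) - 1 / (pi * (real (Suc n) + w)))"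
      using Bochner_Integration.integral_diff[OF integral_exp_exp_minus(1)[OF pos(1)] integral_exp_exp_minus(1)[OF pos(2)], of n n]
        integral_exp_exp_minus(2)[OF pos(1), of n] integral_exp_exp_minus(2)[OF pos(2), of n]
      by (simp only: integral_mult_right_zero)
    also have "\<dots> = - (real (r2 (Suc n)) * (1 / (real (Suc n) + w) - 1 / real (Suc n))) / pi"
      by (simp only: divide_inverse inverse_mult_distrib) algebra
    finally show ?thesis .
  qed
  have eq: "?f n x = real (r2 (Suc n)) * exp (- pi * real (Suc n) * exp x) * (exp x * (1 - exp (- pi * w * exp x)))" for n x
  proof -
    have "exp (- (pi * (real (Suc n) + w)) * exp x) = exp (- pi * real (Suc n) * exp x) * exp (- pi * w * exp x)"
      by (simp only: exp_add[symmetric]) (simp add: algebra_simps)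
    then show ?thesis by (simp add: algebra_simps del: of_nat_Suc)
  qed
  have nn: "?f n x \<ge> 0" for n x
    unfolding eq using w by (intro mult_nonneg_nonneg) auto
  have s: "(\<lambda>n. ?f n x) sums (exp x * theta_sq_tail (exp x) * (1 - exp (- pi * w * exp x)))" for x
    unfolding eq using sums_mult2[OF theta_sq_tail_r2_sums[of "exp x"], of "exp x * (1 - exp (- pi * w * exp x))"] by (simp add: mult_ac)
  have sm: "summable (\<lambda>n. integral\<^sup>L lborel (?f n))"
    unfolding val by (intro summable_divide summable_minus summable_shift_terms w)
  show "integrable lborel (\<lambda>x. exp x * theta_sq_tail (exp x) * (1 - exp (- pi * w * exp x)))"
    by (rule integral_sums_nonneg(1)[OF int nn s sm])
  have "(\<lambda>n. integral\<^sup>L lborel (?f n)) sums (\<integral>x. exp x * theta_sq_tail (exp x) * (1 - exp (- pi * w * exp x)) \<partial>lborel)"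
    by (rule integral_sums_nonneg(2)[OF int nn s sm])
  moreover have "(\<lambda>n. integral\<^sup>L lborel (?f n)) sums (- shift_sum w / pi)"
    unfolding val shift_sum_def by (intro sums_divide sums_minus summable_sums summable_shift_terms w)
  ultimately show "(\<integral>x. exp x * theta_sq_tail (exp x) * (1 - exp (- pi * w * exp x)) \<partial>lborel) = - shift_sum w / pi"
    by (rule sums_unique2)
qed

text \<open>After the reflection of x, the modular transformation replaces theta_sq_tail at e^(-x) by
e^x + e^x theta_sq_tail(e^x) - 1. The first summand integrates to 1/(pi w). In the rest, the factor
exp(-pi w e^x) is written as 1 - (1 - exp(-pi w e^x)) on the theta part, and the second piece is the
shifted sum.\<close>

lemma r2_K0_sum_shift_form:
  assumes w: "w > 0"
  shows "integrable lborel (\<lambda>x. exp x * theta_sq_tail (exp x) - exp (- pi * w * exp x))"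
    and "r2_K0_sum w = 1 / (2 * pi * w) + 1 / 2 * (\<integral>x. exp x * theta_sq_tail (exp x) - exp (- pi * w * exp x) \<partial>lborel)
           + shift_sum w / (2 * pi)"
proof -
  let ?E = "\<lambda>x. exp (- pi * w * exp x)" and ?A = "\<lambda>x. exp x * theta_sq_tail (exp x)"
  let ?h = "\<lambda>x. theta_sq_tail (exp x) * exp (- pi * w * exp (- x))"
  have ih: "integrable lborel (\<lambda>x. ?h (0 + (-1) * x))"
    by (rule lborel_integrable_real_affine[OF r2_K0_sum_integral(1)[OF w]]) simp
  have vh: "integral\<^sup>L lborel (\<lambda>x. ?h (0 + (-1) * x)) = 2 * r2_K0_sum w"
    using lborel_integral_real_affine[of "-1" ?h 0] r2_K0_sum_integral(2)[OF w] by simp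
  have eq: "?h (0 + (-1) * x) = (exp x + ?A x - 1) * ?E x" for x
  proof -
    have "theta_sq_tail (exp (- x)) = exp x + ?A x - 1"
      using theta_sq_tail_modular[of x] by (simp add: algebra_simps)
    then show ?thesis by simp
  qed
  have i1: "integrable lborel (\<lambda>x. exp x * exp (- (pi * w) * exp x))" "(\<integral>x. exp x * exp (- (pi * w) * exp x) \<partial>lborel) = 1 / (pi * w)"
    using integral_exp_exp_minus[of "pi * w"] w by auto
  note i2 = shift_sum_integral[OF w]
  have dec: "?A x - ?E x = ?h (0 + (-1) * x) - exp x * exp (- (pi * w) * exp x) + ?A x * (1 - ?E x)" for x
    unfolding eq by (simp add: algebra_simps)
  have i12: "integrable lborel (\<lambda>x. ?h (0 + (-1) * x) - exp x * exp (- (pi * w) * exp x))"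
    by (rule Bochner_Integration.integrable_diff[OF ih i1(1)])
  show "integrable lborel (\<lambda>x. ?A x - ?E x)"
    unfolding dec by (rule Bochner_Integration.integrable_add[OF i12 i2(1)])
  have "(\<integral>x. ?A x - ?E x \<partial>lborel) = 2 * r2_K0_sum w - 1 / (pi * w) + (- shift_sum w / pi)"
    unfolding dec Bochner_Integration.integral_add[OF i12 i2(1)] Bochner_Integration.integral_diff[OF ih i1(1)] vh i1(2) i2(2) ..
  moreover have "1 / (2 * pi * w) = (1 / (pi * w)) / 2" "shift_sum w / (2 * pi) = (shift_sum w / pi) / 2" by simp_all
  moreover have "- shift_sum w / pi = - (shift_sum w / pi)" by simp
  ultimately show "r2_K0_sum w = 1 / (2 * pi * w) + 1 / 2 * (\<integral>x. ?A x - ?E x \<partial>lborel) + shift_sum w / (2 * pi)"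
    by linarith
qed

text \<open>The remaining integral depends on w only through exp(-pi w e^x), so its values at w and at 1 differ by a
Frullani integral.\<close>

lemma r2_K0_sum_eq_up_to_constant:
  "\<exists>c. \<forall>w>0. r2_K0_sum w = 1 / (2 * pi * w) + ln w / 2 + c + shift_sum w / (2 * pi)"
proof -
  let ?D = "\<lambda>w x. exp x * theta_sq_tail (exp x) - exp (- pi * w * exp x)"
  have "integral\<^sup>L lborel (?D w) = integral\<^sup>L lborel (?D 1) + ln w" if w: "w > 0" for w
  proof -
    have "integral\<^sup>L lborel (?D w) - integral\<^sup>L lborel (?D 1) = (\<integral>x. ?D w x - ?D 1 x \<partial>lborel)"
      by (rule Bochner_Integration.integral_diff[symmetric, OF r2_K0_sum_shift_form(1)[OF w] r2_K0_sum_shift_form(1)[OF zero_less_one]])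
    also have "\<dots> = (\<integral>x. exp (- pi * exp x) - exp (- (pi * w) * exp x) \<partial>lborel)" by simp
    also have "\<dots> = ln (pi * w) - ln pi" using w by (intro frullani_exp_exp) auto
    also have "\<dots> = ln w" using w by (simp add: ln_mult)
    finally show ?thesis by simp
  qed
  then have "r2_K0_sum w = 1 / (2 * pi * w) + ln w / 2 + integral\<^sup>L lborel (?D 1) / 2 + shift_sum w / (2 * pi)" if "w > 0" for w
    using r2_K0_sum_shift_form(2)[OF that] that by (simp add: add_divide_distrib)
  then show ?thesis by blast
qed

text \<open>The theta series is expanded in hyperbolic secants instead of exponentials, the m-th term is translated by
ln m, which moves m from the secant to the other exponential, and the geometric series over m is summed.\<close>

lemma r2_K0_sum_sech_form:
  assumes w: "w > 0"
  shows "integrable lborel (\<lambda>x. 1 / cosh (pi * exp x) * (1 / (exp (pi * w * exp (- x)) - 1)))"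
    and "r2_K0_sum w = (\<integral>x. 1 / cosh (pi * exp x) * (1 / (exp (pi * w * exp (- x)) - 1)) \<partial>lborel)"
proof -
  let ?E = "\<lambda>x. exp (- pi * w * exp (- x))"
  let ?f = "\<lambda>m x. 1 / cosh (pi * exp x * real (Suc m)) * ?E x"
  let ?g = "\<lambda>m x. 1 / cosh (pi * exp x) * exp (- pi * w * exp (- x)) ^ Suc m"
  have s: "(\<lambda>m. ?f m x) sums (1 / 2 * (theta_sq_tail (exp x) * ?E x))" for x
    using sums_mult[OF sums_mult2[OF theta_sq_tail_sech_sums[of "exp x"], of "?E x"], of "1 / 2"] by (simp del: of_nat_Suc)
  have tot: "integrable lborel (\<lambda>x. 1 / 2 * (theta_sq_tail (exp x) * ?E x))"
    by (intro integrable_mult_right r2_K0_sum_integral w)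
  have fm: "?f m \<in> borel_measurable borel" for m
    by (intro borel_measurable_continuous_onI continuous_intros) auto
  have nn: "?f m x \<ge> 0" for m x by simp
  have int: "integrable lborel (?f m)" for m
  proof (rule Bochner_Integration.integrable_bound[OF tot])
    show "AE x in lborel. norm (?f m x) \<le> norm (1 / 2 * (theta_sq_tail (exp x) * ?E x))"
    proof (rule AE_I2)
      fix x
      have "?f m x \<le> (\<Sum>m. ?f m x)"
        using sum_le_suminf[of "\<lambda>m. ?f m x" "{m}"] s[of x] nn by (auto simp: sums_iff)
      also have "\<dots> = 1 / 2 * (theta_sq_tail (exp x) * ?E x)" using s[of x] by (simp add: sums_iff)
      finally show "norm (?f m x) \<le> norm (1 / 2 * (theta_sq_tail (exp x) * ?E x))"
        using nn[of x m] by (simp only: real_norm_def abs_of_nonneg)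
    qed
  qed (use fm in simp)
  have sums_f: "(\<lambda>m. integral\<^sup>L lborel (?f m)) sums r2_K0_sum w"
    using integral_sums_nonneg_integrable[OF int nn s tot] by (simp only: r2_K0_sum_integral(2)[OF w] integral_mult_right_zero)
  have shift: "?f m (- ln (real (Suc m)) + 1 * x) = ?g m x" for m x
  proof -
    have "exp (- ln (real (Suc m)) + 1 * x) = exp x / real (Suc m)"
      by (simp add: exp_diff exp_add exp_minus divide_inverse mult.commute del: of_nat_Suc)
    moreover have "exp (- (- ln (real (Suc m)) + 1 * x)) = real (Suc m) * exp (- x)"
      by (simp add: exp_diff exp_minus divide_inverse del: of_nat_Suc)
    moreover have "exp (- pi * w * (real (Suc m) * exp (- x))) = exp (- pi * w * exp (- x)) ^ Suc m"
      unfolding exp_of_nat_mult[symmetric] by (simp add: mult_ac del: of_nat_Suc)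
    ultimately show ?thesis by (simp del: of_nat_Suc power_Suc)
  qed
  have gint: "integrable lborel (?g m)" for m
    using lborel_integrable_real_affine[OF int[of m], of 1 "- ln (real (Suc m))"] unfolding shift by simp
  have gval: "integral\<^sup>L lborel (?g m) = integral\<^sup>L lborel (?f m)" for m
    using lborel_integral_real_affine[of 1 "?f m" "- ln (real (Suc m))"] unfolding shift by simp
  have gs: "(\<lambda>m. ?g m x) sums (1 / cosh (pi * exp x) * (1 / (exp (pi * w * exp (- x)) - 1)))" for x
  proof -
    define q where "q = exp (- pi * w * exp (- x))"
    have q: "0 < q" "q < 1" using w by (auto simp: q_def)
    have "(\<lambda>m. q * q ^ m) sums (q * (1 / (1 - q)))" using q by (intro sums_mult geometric_sums) auto
    moreover have "q * (1 / (1 - q)) = 1 / (inverse q - 1)" using q by (simp add: field_simps)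
    moreover have "inverse q = exp (pi * w * exp (- x))" by (simp add: q_def exp_minus[symmetric])
    ultimately have "(\<lambda>m. q ^ Suc m) sums (1 / (exp (pi * w * exp (- x)) - 1))" by simp
    then show ?thesis unfolding q_def by (rule sums_mult)
  qed
  have gn: "?g m x \<ge> 0" for m x by simp
  have sm: "summable (\<lambda>m. integral\<^sup>L lborel (?g m))" unfolding gval using sums_f by (rule sums_summable)
  show "integrable lborel (\<lambda>x. 1 / cosh (pi * exp x) * (1 / (exp (pi * w * exp (- x)) - 1)))"
    by (rule integral_sums_nonneg(1)[OF gint gn gs sm])
  have "(\<lambda>m. integral\<^sup>L lborel (?g m)) sums (\<integral>x. 1 / cosh (pi * exp x) * (1 / (exp (pi * w * exp (- x)) - 1)) \<partial>lborel)"
    by (rule integral_sums_nonneg(2)[OF gint gn gs sm])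
  then show "r2_K0_sum w = (\<integral>x. 1 / cosh (pi * exp x) * (1 / (exp (pi * w * exp (- x)) - 1)) \<partial>lborel)"
    unfolding gval using sums_f by (rule sums_unique2[rotated])
qed

section \<open>The constant in the one-parameter formula\<close>

lemma damped_bernoulli_kernel:
  shows "(\<lambda>u. 1 / cosh (pi * (pi * w * exp (- u))) * bernoulli_kernel (exp u)) \<in> borel_measurable lborel"
    and "norm (1 / cosh (pi * (pi * w * exp (- u))) * bernoulli_kernel (exp u)) \<le> norm (bernoulli_kernel (exp u))"
proof -
  have "(\<lambda>u. 1 / cosh (pi * (pi * w * exp (- u)))) \<in> borel_measurable lborel"
    by (simp only: measurable_lborel2, intro borel_measurable_continuous_onI continuous_intros) auto
  then show "(\<lambda>u. 1 / cosh (pi * (pi * w * exp (- u))) * bernoulli_kernel (exp u)) \<in> borel_measurable lborel"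
    by (rule borel_measurable_times[OF _ borel_measurable_integrable[OF integrable_bernoulli_kernel_exp]])
  have "norm (1 / cosh (pi * (pi * w * exp (- u))) * bernoulli_kernel (exp u))
      = 1 / cosh (pi * (pi * w * exp (- u))) * norm (bernoulli_kernel (exp u))" by (simp add: abs_mult)
  also have "\<dots> \<le> 1 * norm (bernoulli_kernel (exp u))" by (intro mult_right_mono) (auto simp: cosh_real_ge_1)
  finally show "norm (1 / cosh (pi * (pi * w * exp (- u))) * bernoulli_kernel (exp u)) \<le> norm (bernoulli_kernel (exp u))" by simp
qed

text \<open>A primitive is (2 / pi) arctan(exp(pi e^x)).\<close>

lemma integral_exp_sech:
  shows "integrable lborel (\<lambda>x::real. exp x * (1 / cosh (pi * exp x)))"
    and "(\<integral>x. exp x * (1 / cosh (pi * exp x)) \<partial>lborel) = 1 / 2"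
proof -
  show i: "integrable lborel (\<lambda>x::real. exp x * (1 / cosh (pi * exp x)))"
  proof (rule Bochner_Integration.integrable_bound)
    show "integrable lborel (\<lambda>x::real. 2 * (exp x * exp (- pi * exp x)))"
      by (intro integrable_mult_right integral_exp_exp_minus) simp
    show "(\<lambda>x::real. exp x * (1 / cosh (pi * exp x))) \<in> borel_measurable lborel"
      by (simp only: measurable_lborel2, intro borel_measurable_continuous_onI continuous_intros) auto
    show "AE x in lborel. norm (exp (x::real) * (1 / cosh (pi * exp x))) \<le> norm (2 * (exp x * exp (- pi * exp x)))"
    proof (rule AE_I2)
      fix x :: real
      have "exp x * (1 / cosh (pi * exp x)) \<le> exp x * (2 * exp (- (pi * exp x)))"
        using sech_le[of "pi * exp x"] by (intro mult_left_mono) simp_all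
      then show "norm (exp (x::real) * (1 / cosh (pi * exp x))) \<le> norm (2 * (exp x * exp (- pi * exp x)))" by simp
    qed
  qed
  let ?F = "\<lambda>x::real. 2 / pi * arctan (exp (pi * exp x))"
  have d: "(?F has_vector_derivative exp x * (1 / cosh (pi * exp x))) (at x)" for x
  proof -
    define E where "E = exp (pi * exp x)"
    have E: "E > 0" by (simp add: E_def)
    have "1 / cosh (pi * exp x) = 2 * E / (1 + E\<^sup>2)"
    proof -
      have "cosh (pi * exp x) = (E + inverse E) / 2" by (simp add: cosh_field_def E_def exp_minus)
      also have "\<dots> = (1 + E\<^sup>2) / (2 * E)" using E by (simp add: field_simps power2_eq_square)
      finally show ?thesis by simp
    qed
    moreover have "(?F has_real_derivative 2 / pi * (inverse (1 + (exp (pi * exp x))\<^sup>2) * (exp (pi * exp x) * (pi * exp x)))) (at x)"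
      by (auto intro!: derivative_eq_intros)
    moreover have "2 / pi * (inverse (1 + E\<^sup>2) * (E * (pi * exp x))) = exp x * (2 * E / (1 + E\<^sup>2))"
      by (simp add: divide_inverse)
    ultimately show ?thesis
      unfolding E_def[symmetric] has_real_derivative_iff_has_vector_derivative[symmetric] by simp
  qed
  have c: "isCont (\<lambda>x::real. exp x * (1 / cosh (pi * exp x))) x" for x by (intro continuous_intros) auto
  have l: "(?F \<longlongrightarrow> 2 / pi * (pi / 4)) at_bot"
  proof -
    have "((\<lambda>x::real. pi * exp x) \<longlongrightarrow> pi * 0) at_bot" by (intro tendsto_mult tendsto_const exp_at_bot)
    from tendsto_mult[OF tendsto_const tendsto_arctan[OF tendsto_exp[OF this]]]
    have "(?F \<longlongrightarrow> 2 / pi * arctan (exp (pi * 0))) at_bot" .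
    then show ?thesis by (simp add: arctan_one)
  qed
  have u: "(?F \<longlongrightarrow> 2 / pi * (pi / 2)) at_top"
  proof -
    have "LIM x at_top. exp (pi * exp (x::real)) :> at_top" by real_asymp
    then show ?thesis by (intro tendsto_intros filterlim_compose[OF tendsto_arctan_at_top])
  qed
  show "(\<integral>x. exp x * (1 / cosh (pi * exp x)) \<partial>lborel) = 1 / 2"
    using integral_FTC_UNIV[OF d c i l u] by simp
qed

text \<open>The value of B'(0), by deriv_dirichlet_beta_0.\<close>

definition dirichlet_beta_deriv_0 :: real where
  "dirichlet_beta_deriv_0 = 1 / 2 * (\<integral>x. 1 / cosh (exp x) - exp (- exp x) \<partial>lborel)"

text \<open>Scaling the argument by pi is a translation for the difference as a whole; undoing it on the exponential alone
costs a Frullani integral.\<close>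

lemma integral_sech_pi_minus_exp:
  shows "integrable lborel (\<lambda>x::real. 1 / cosh (pi * exp x) - exp (- exp x))"
    and "(\<integral>x. 1 / cosh (pi * exp x) - exp (- exp x) \<partial>lborel) = 2 * dirichlet_beta_deriv_0 - ln pi"
proof -
  let ?d = "\<lambda>x::real. 1 / cosh (exp x) - exp (- exp x)"
  have sh: "exp (ln pi + 1 * x) = pi * exp x" for x by (simp add: exp_add)
  have i1: "integrable lborel (\<lambda>x. ?d (ln pi + 1 * x))"
    by (rule lborel_integrable_real_affine[OF integrable_sech_minus_exp]) simp
  have v1: "(\<integral>x. ?d (ln pi + 1 * x) \<partial>lborel) = 2 * dirichlet_beta_deriv_0"
    using lborel_integral_real_affine[of 1 ?d "ln pi"] by (simp add: dirichlet_beta_deriv_0_def)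
  have i2: "integrable lborel (\<lambda>x. exp (- pi * exp x) - exp (- 1 * exp x))"
    "(\<integral>x. exp (- pi * exp x) - exp (- 1 * exp x) \<partial>lborel) = ln 1 - ln pi"
    by (rule frullani_exp_exp; simp)+
  have eq: "1 / cosh (pi * exp x) - exp (- exp x) = ?d (ln pi + 1 * x) + (exp (- pi * exp x) - exp (- 1 * exp x))" for x
    unfolding sh by simp
  show "integrable lborel (\<lambda>x::real. 1 / cosh (pi * exp x) - exp (- exp x))"
    unfolding eq by (rule Bochner_Integration.integrable_add[OF i1 i2(1)])
  show "(\<integral>x. 1 / cosh (pi * exp x) - exp (- exp x) \<partial>lborel) = 2 * dirichlet_beta_deriv_0 - ln pi"
    unfolding eq Bochner_Integration.integral_add[OF i1 i2(1)] v1 i2(2) by simp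
qed

text \<open>The factor 1/(e^y - 1) with y = pi w e^(-x) is split into its remainder, 1/y and -e^(-y)/2. In the last
part, 1 / cosh(pi e^x) is compared with exp(-e^x), for which the integral is a value of K0.\<close>

lemma r2_K0_sum_decomposition:
  assumes w: "w > 0"
  shows "r2_K0_sum w = (\<integral>u. 1 / cosh (pi * (pi * w * exp (- u))) * bernoulli_kernel (exp u) \<partial>lborel) + 1 / (2 * pi * w)
    - K0_real (2 * sqrt (pi * w)) - 1 / 2 * (\<integral>x. (1 / cosh (pi * exp x) - exp (- exp x)) * exp (- (pi * w) * exp (- x)) \<partial>lborel)"
proof -
  let ?h = "\<lambda>x::real. 1 / cosh (pi * exp x)" and ?y = "\<lambda>x. pi * w * exp (- x)"
  let ?B = "\<lambda>u. 1 / cosh (pi * (pi * w * exp (- u))) * bernoulli_kernel (exp u)"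
  let ?D = "\<lambda>x. (1 / cosh (pi * exp x) - exp (- exp x)) * exp (- (pi * w) * exp (- x))"
  let ?K = "\<lambda>x. exp (- 1 * exp x - (pi * w) * exp (- x))"
  have pw: "pi * w > 0" using w by simp
  have iB: "integrable lborel ?B"
  proof (rule Bochner_Integration.integrable_bound[OF integrable_bernoulli_kernel_exp])
  qed (use damped_bernoulli_kernel in auto)
  have sh: "?B (ln (pi * w) + (-1) * x) = ?h x * bernoulli_kernel (?y x)" for x
  proof -
    have "exp (ln (pi * w) + (-1) * x) = ?y x" using pw by (simp only: exp_add exp_ln mult_minus1)
    moreover have "exp (- (ln (pi * w) + (-1) * x)) = exp x / (pi * w)"
    proof -
      have "- (ln (pi * w) + (-1) * x) = x - ln (pi * w)" by simp
      then show ?thesis using pw by (simp only: exp_diff exp_ln)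
    qed
    ultimately show ?thesis using w by simp
  qed
  have i1: "integrable lborel (\<lambda>x. ?h x * bernoulli_kernel (?y x))"
    using lborel_integrable_real_affine[OF iB, of "-1" "ln (pi * w)"] unfolding sh by simp
  have v1: "(\<integral>x. ?h x * bernoulli_kernel (?y x) \<partial>lborel) = integral\<^sup>L lborel ?B"
    using lborel_integral_real_affine[of "-1" ?B "ln (pi * w)"] unfolding sh by simp
  have iD: "integrable lborel ?D"
  proof (rule Bochner_Integration.integrable_bound[OF integral_sech_pi_minus_exp(1)])
    show "?D \<in> borel_measurable lborel"
      by (simp only: measurable_lborel2, intro borel_measurable_continuous_onI continuous_intros) auto
    show "AE x in lborel. norm (?D x) \<le> norm (1 / cosh (pi * exp x) - exp (- exp x))"
      using w by (intro AE_I2) (auto simp: abs_mult mult_left_le)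
  qed
  have iK: "integrable lborel ?K" by (rule K0_two_sided_integral(1)) (use pw in auto)
  have vK: "integral\<^sup>L lborel ?K = 2 * K0_real (2 * sqrt (pi * w))"
    using K0_real_two_sided[OF zero_less_one pw] by simp
  have eq: "?h x * (1 / (exp (pi * w * exp (- x)) - 1))
     = ?h x * bernoulli_kernel (?y x) + 1 / (pi * w) * (exp x * ?h x) - 1 / 2 * (?K x + ?D x)" for x
  proof -
    have b: "1 / (exp (?y x) - 1) = bernoulli_kernel (?y x) + 1 / ?y x - exp (- ?y x) / 2" by (simp add: bernoulli_kernel_def)
    have y: "1 / ?y x = 1 / (pi * w) * exp x" by (simp add: exp_minus divide_inverse)
    have k: "?K x = exp (- exp x) * exp (- ?y x)" by (simp add: exp_diff exp_minus divide_inverse)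
    show ?thesis unfolding b y k by (simp add: algebra_simps)
  qed
  have i2: "integrable lborel (\<lambda>x. 1 / (pi * w) * (exp x * ?h x))" by (intro integrable_mult_right integral_exp_sech)
  have i3: "integrable lborel (\<lambda>x. 1 / 2 * (?K x + ?D x))" by (intro integrable_mult_right Bochner_Integration.integrable_add iK iD)
  have i12: "integrable lborel (\<lambda>x. ?h x * bernoulli_kernel (?y x) + 1 / (pi * w) * (exp x * ?h x))" by (rule Bochner_Integration.integrable_add[OF i1 i2])
  have "r2_K0_sum w = (\<integral>x. ?h x * bernoulli_kernel (?y x) + 1 / (pi * w) * (exp x * ?h x) - 1 / 2 * (?K x + ?D x) \<partial>lborel)"
    unfolding r2_K0_sum_sech_form(2)[OF w] eq ..
  also have "\<dots> = integral\<^sup>L lborel ?B + 1 / (pi * w) * (1 / 2) - 1 / 2 * (2 * K0_real (2 * sqrt (pi * w)) + integral\<^sup>L lborel ?D)"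
    unfolding Bochner_Integration.integral_diff[OF i12 i3] Bochner_Integration.integral_add[OF i1 i2] v1
      integral_mult_right_zero integral_exp_sech(2) Bochner_Integration.integral_add[OF iK iD] vK ..
  finally show ?thesis by (simp add: algebra_simps)
qed

text \<open>The unknown constant is the limit, along w = 1/(j+1), of the decomposition above minus the singular terms. The
singular term 1/(2 pi w) occurs on both sides, and the logarithm (ln w)/2 comes from K0 at 2 sqrt(pi w).\<close>

theorem r2_K0_sum_formula:
  assumes w: "w > 0"
  shows "r2_K0_sum w = 1 / (2 * pi * w) + ln w / 2 + (euler_mascheroni + ln (pi / 2) / 2 - dirichlet_beta_deriv_0)
    + shift_sum w / (2 * pi)"
proof -
  obtain c where c: "\<And>w. w > 0 \<Longrightarrow> r2_K0_sum w = 1 / (2 * pi * w) + ln w / 2 + c + shift_sum w / (2 * pi)"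
    using r2_K0_sum_eq_up_to_constant by blast
  define v where "v j = 1 / real (Suc j)" for j
  have v: "v j > 0" for j by (simp add: v_def)
  have v0: "v \<longlonglongrightarrow> 0" unfolding v_def by real_asymp
  let ?C = "\<lambda>j. integral\<^sup>L lborel (\<lambda>u. 1 / cosh (pi * (pi * v j * exp (- u))) * bernoulli_kernel (exp u))"
  let ?D = "\<lambda>j. integral\<^sup>L lborel (\<lambda>x. (1 / cosh (pi * exp x) - exp (- exp x)) * exp (- (pi * v j) * exp (- x)))"
  let ?L = "\<lambda>j. K0_real (2 * sqrt (pi * v j)) + (ln (2 * sqrt (pi * v j) / 2) + euler_mascheroni)"
  have C: "?C \<longlonglongrightarrow> - ln (2 * pi) / 2"
    unfolding integral_bernoulli_kernel[symmetric]
  proof (rule integral_dominated_convergence[where w = "\<lambda>u. norm (bernoulli_kernel (exp u))"])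
    show "integrable lborel (\<lambda>u. norm (bernoulli_kernel (exp u)))" by (rule Bochner_Integration.integrable_norm[OF integrable_bernoulli_kernel_exp])
    show "(\<lambda>u. bernoulli_kernel (exp u)) \<in> borel_measurable lborel" by (rule borel_measurable_integrable[OF integrable_bernoulli_kernel_exp])
    show "(\<lambda>u. 1 / cosh (pi * (pi * v j * exp (- u))) * bernoulli_kernel (exp u)) \<in> borel_measurable lborel" for j by (rule damped_bernoulli_kernel)
    show "AE u in lborel. (\<lambda>j. 1 / cosh (pi * (pi * v j * exp (- u))) * bernoulli_kernel (exp u)) \<longlonglongrightarrow> bernoulli_kernel (exp u)"
    proof (rule AE_I2)
      fix u
      have "(\<lambda>j. 1 / cosh (pi * (pi * v j * exp (- u))) * bernoulli_kernel (exp u)) \<longlonglongrightarrow> 1 / cosh (pi * (pi * 0 * exp (- u))) * bernoulli_kernel (exp u)"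
        by (intro tendsto_intros v0) auto
      then show "(\<lambda>j. 1 / cosh (pi * (pi * v j * exp (- u))) * bernoulli_kernel (exp u)) \<longlonglongrightarrow> bernoulli_kernel (exp u)" by simp
    qed
    show "AE u in lborel. norm (1 / cosh (pi * (pi * v j * exp (- u))) * bernoulli_kernel (exp u)) \<le> norm (bernoulli_kernel (exp u))" for j
      by (intro AE_I2 damped_bernoulli_kernel)
  qed
  have D: "?D \<longlonglongrightarrow> 2 * dirichlet_beta_deriv_0 - ln pi"
    unfolding integral_sech_pi_minus_exp(2)[symmetric]
  proof (rule integral_dominated_convergence[where w = "\<lambda>x. norm (1 / cosh (pi * exp x) - exp (- exp x))"])
    show "integrable lborel (\<lambda>x::real. norm (1 / cosh (pi * exp x) - exp (- exp x)))" by (rule Bochner_Integration.integrable_norm[OF integral_sech_pi_minus_exp(1)])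
    show "(\<lambda>x::real. 1 / cosh (pi * exp x) - exp (- exp x)) \<in> borel_measurable lborel" by (rule borel_measurable_integrable[OF integral_sech_pi_minus_exp(1)])
    show "(\<lambda>x. (1 / cosh (pi * exp x) - exp (- exp x)) * exp (- (pi * v j) * exp (- x))) \<in> borel_measurable lborel" for j
      by (simp only: measurable_lborel2, intro borel_measurable_continuous_onI continuous_intros) auto
    show "AE x in lborel. (\<lambda>j. (1 / cosh (pi * exp x) - exp (- exp x)) * exp (- (pi * v j) * exp (- x))) \<longlonglongrightarrow> 1 / cosh (pi * exp x) - exp (- exp x)"
    proof (rule AE_I2)
      fix x :: real
      have "(\<lambda>j. (1 / cosh (pi * exp x) - exp (- exp x)) * exp (- (pi * v j) * exp (- x))) \<longlonglongrightarrow> (1 / cosh (pi * exp x) - exp (- exp x)) * exp (- (pi * 0) * exp (- x))"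
        by (intro tendsto_intros v0)
      then show "(\<lambda>j. (1 / cosh (pi * exp x) - exp (- exp x)) * exp (- (pi * v j) * exp (- x))) \<longlonglongrightarrow> 1 / cosh (pi * exp x) - exp (- exp x)" by simp
    qed
    show "AE x in lborel. norm ((1 / cosh (pi * exp x) - exp (- exp x)) * exp (- (pi * v j) * exp (- x))) \<le> norm (1 / cosh (pi * exp x) - exp (- exp x))" for j
      using v[of j] by (intro AE_I2) (auto simp: abs_mult mult_left_le)
  qed
  have L: "?L \<longlonglongrightarrow> 0"
  proof (rule Lim_null_comparison[where g = "\<lambda>j. sqrt (pi * v j)"])
    show "\<forall>\<^sub>F j in sequentially. norm (?L j) \<le> sqrt (pi * v j)"
    proof (rule always_eventually, rule allI)
      fix j
      have "2 * sqrt (pi * v j) > 0" using v[of j] by simp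
      from K0_log_asymptotic[OF this] show "norm (?L j) \<le> sqrt (pi * v j)"
        unfolding K0_eq_K0_real of_real_add[symmetric] norm_of_real by simp
    qed
    have "(\<lambda>j. sqrt (pi * v j)) \<longlonglongrightarrow> sqrt (pi * 0)" by (intro tendsto_intros v0)
    then show "(\<lambda>j. sqrt (pi * v j)) \<longlonglongrightarrow> 0" by simp
  qed
  have S: "(\<lambda>j. shift_sum (v j)) \<longlonglongrightarrow> 0"
  proof (rule Lim_null_comparison[where g = "\<lambda>j. v j * (\<Sum>n. real (r2 (Suc n)) / (real (Suc n))\<^sup>2)"])
    show "\<forall>\<^sub>F j in sequentially. norm (shift_sum (v j)) \<le> v j * (\<Sum>n. real (r2 (Suc n)) / (real (Suc n))\<^sup>2)"
      using abs_shift_sum_le[OF v] by (simp only: real_norm_def) simp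
    show "(\<lambda>j. v j * (\<Sum>n. real (r2 (Suc n)) / (real (Suc n))\<^sup>2)) \<longlonglongrightarrow> 0"
      using tendsto_mult_right[OF v0, of "\<Sum>n. real (r2 (Suc n)) / (real (Suc n))\<^sup>2"] by (simp only: mult_zero_left)
  qed
  \<comment> \<open>the two expressions for the sum, solved for the constant; the terms singular at 0 cancel\<close>
  have ceq: "c = ?C j - ?L j + euler_mascheroni + ln pi / 2 - 1 / 2 * ?D j - shift_sum (v j) / (2 * pi)" for j
  proof -
    have "ln (2 * sqrt (pi * v j) / 2) = ln pi / 2 + ln (v j) / 2" using v[of j]
      by (simp add: ln_sqrt ln_mult add_divide_distrib)
    then show ?thesis using c[OF v[of j]] r2_K0_sum_decomposition[OF v[of j]] by linarith
  qed
  have "(\<lambda>j. ?C j - ?L j + euler_mascheroni + ln pi / 2 - 1 / 2 * ?D j - shift_sum (v j) / (2 * pi))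
     \<longlonglongrightarrow> - ln (2 * pi) / 2 - 0 + euler_mascheroni + ln pi / 2 - 1 / 2 * (2 * dirichlet_beta_deriv_0 - ln pi) - 0 / (2 * pi)"
    by (intro tendsto_intros C D L S) auto
  then have "(\<lambda>j::nat. c) \<longlonglongrightarrow> - ln (2 * pi) / 2 - 0 + euler_mascheroni + ln pi / 2 - 1 / 2 * (2 * dirichlet_beta_deriv_0 - ln pi) - 0 / (2 * pi)"
    unfolding ceq[symmetric] .
  then have "c = - ln (2 * pi) / 2 - 0 + euler_mascheroni + ln pi / 2 - 1 / 2 * (2 * dirichlet_beta_deriv_0 - ln pi) - 0 / (2 * pi)"
    by (rule LIMSEQ_unique[OF tendsto_const])
  moreover have "ln (2 * pi) = ln 2 + ln pi" "ln (pi / 2) = ln pi - ln 2" by (simp_all add: ln_mult ln_div)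
  ultimately have "c = euler_mascheroni + ln (pi / 2) / 2 - dirichlet_beta_deriv_0" by (simp add: field_simps)
  then show ?thesis using c[OF w] by simp
qed

section \<open>The two-parameter formula for real parameters\<close>

lemma K0_real_antimono:
  assumes "0 < x" "x \<le> y"
  shows "K0_real y \<le> K0_real x"
proof -
  have i: "integrable lborel (\<lambda>t. exp (- z * cosh t))" if "z > 0" for z :: real
    using integrable_cosh_power_exp[OF that, of 0] by simp
  have "(\<integral>t. exp (- y * cosh t) \<partial>lborel) \<le> (\<integral>t. exp (- x * cosh t) \<partial>lborel)"
    by (rule integral_mono[OF i i]) (use assms in \<open>auto intro: mult_right_mono\<close>)
  then show ?thesis by (simp add: K0_real_def)
qed

lemma continuous_on_K0_real: "continuous_on {0<..} K0_real"
proof -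
  have "continuous_on {0<..} (\<lambda>x. Re (K0 (of_real x)))"
    by (intro continuous_on_Re continuous_on_compose2[OF holomorphic_on_imp_continuous_on[OF holomorphic_K0]] continuous_intros) auto
  then show ?thesis by (simp only: K0_eq_K0_real Re_complex_of_real)
qed

text \<open>The squared distance from (a+b)/2 to a point of the circle of radius |a-b|/2 around 0. It runs between
a^2 and b^2, and by circle_sq_dist_eq it is affine in a^2 and b^2, so that adding n to it amounts to adding
n to a^2 and to b^2.\<close>

definition circle_sq_dist :: "real \<Rightarrow> real \<Rightarrow> real \<Rightarrow> real" where
  "circle_sq_dist a b t = (cmod (of_real ((a + b) / 2) - of_real ((a - b) / 2) * circ t))\<^sup>2"

lemma circle_sq_dist_eq: "circle_sq_dist a b t = (a\<^sup>2 + b\<^sup>2) / 2 - (a\<^sup>2 - b\<^sup>2) / 2 * cos (2 * pi * t)"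
  unfolding circle_sq_dist_def norm_minus_circ by (simp add: field_simps power2_eq_square)

lemma continuous_circle_sq_dist: "continuous_on A (circle_sq_dist a b)"
  unfolding circle_sq_dist_eq by (intro continuous_intros)

lemma circle_sq_dist_bounds:
  assumes "a > 0" "b > 0"
  shows "(min a b)\<^sup>2 \<le> circle_sq_dist a b t" "circle_sq_dist a b t \<le> a\<^sup>2 + b\<^sup>2"
proof -
  define c where "c = cos (2 * pi * t)"
  have c: "-1 \<le> c" "c \<le> 1" by (auto simp: c_def)
  have e: "circle_sq_dist a b t = a\<^sup>2 * ((1 - c) / 2) + b\<^sup>2 * ((1 + c) / 2)"
    unfolding circle_sq_dist_eq c_def[symmetric] by (simp add: field_simps)
  have m: "(min a b)\<^sup>2 \<le> a\<^sup>2" "(min a b)\<^sup>2 \<le> b\<^sup>2" using assms by (auto intro!: power_mono)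
  have "(min a b)\<^sup>2 * ((1 - c) / 2) + (min a b)\<^sup>2 * ((1 + c) / 2) \<le> a\<^sup>2 * ((1 - c) / 2) + b\<^sup>2 * ((1 + c) / 2)"
    using c by (intro add_mono mult_right_mono m) auto
  then show "(min a b)\<^sup>2 \<le> circle_sq_dist a b t" unfolding e by (simp add: field_simps)
  have "a\<^sup>2 * ((1 - c) / 2) + b\<^sup>2 * ((1 + c) / 2) \<le> a\<^sup>2 * 1 + b\<^sup>2 * 1"
    using c by (intro add_mono mult_left_mono) auto
  then show "circle_sq_dist a b t \<le> a\<^sup>2 + b\<^sup>2" unfolding e by simp
qed

lemma circle_sq_dist_pos:
  assumes "a > 0" "b > 0"
  shows "circle_sq_dist a b t > 0"
  using circle_sq_dist_bounds(1)[OF assms] assms by (smt (verit) zero_less_power2 min_def)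

lemma abs_half_diff_less:
  assumes "a > 0" "b > 0"
  shows "\<bar>(a - b) / 2\<bar> < (a + b) / (2::real)"
  unfolding abs_less_iff using assms by (auto simp: field_simps)

lemma circle_mean_K0:
  assumes ab: "a > 0" "b > 0"
  shows "of_real (\<integral>t. K0_real (2 * pi * sqrt (real (Suc n) * circle_sq_dist a b t)) \<partial>unit_measure)
    = bessel_I 0 (of_real (pi * sqrt (real (Suc n)) * (a - b))) * K0 (of_real (pi * sqrt (real (Suc n)) * (a + b)))"
proof -
  define s where "s = pi * sqrt (real (Suc n))"
  have s: "s > 0" by (simp add: s_def)
  have d: "2 * pi * sqrt (real (Suc n) * circle_sq_dist a b t) = cmod (of_real (s * (a + b)) - of_real (s * (a - b)) * circ t)" for t
  proof -
    let ?z = "of_real ((a + b) / 2) - of_real ((a - b) / 2) * circ t"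
    have "of_real (s * (a + b)) - of_real (s * (a - b)) * circ t = of_real (2 * s) * ?z" by (simp add: field_simps)
    then have "cmod (of_real (s * (a + b)) - of_real (s * (a - b)) * circ t) = 2 * s * cmod ?z"
      using s by (simp only: norm_mult norm_of_real)
    also have "\<dots> = 2 * pi * sqrt (real (Suc n) * circle_sq_dist a b t)"
      unfolding circle_sq_dist_def s_def real_sqrt_mult by simp
    finally show ?thesis ..
  qed
  have "\<bar>s * (a - b)\<bar> < s * (a + b)" using s ab by (simp add: abs_mult)
  from bessel_I_0_mult_K0[OF this] show ?thesis
    unfolding d[symmetric] K0_eq_K0_real s_def[symmetric] integral_complex_of_real .
qed

lemma circle_mean_shift_term:
  assumes ab: "a > 0" "b > 0"
  shows "(\<integral>t. 1 / (real (Suc n) + circle_sq_dist a b t) - 1 / real (Suc n) \<partial>unit_measure)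
    = 1 / (sqrt (real (Suc n) + a\<^sup>2) * sqrt (real (Suc n) + b\<^sup>2)) - 1 / real (Suc n)"
proof -
  interpret prob_space unit_measure by (rule prob_space_unit_measure)
  define p q where "p = sqrt (real (Suc n) + a\<^sup>2)" and "q = sqrt (real (Suc n) + b\<^sup>2)"
  have pos: "real (Suc n) + a\<^sup>2 > 0" "real (Suc n) + b\<^sup>2 > 0" by (auto intro!: add_pos_nonneg)
  have pq: "p > 0" "q > 0" "p\<^sup>2 = real (Suc n) + a\<^sup>2" "q\<^sup>2 = real (Suc n) + b\<^sup>2" using pos by (auto simp: p_def q_def)
  have e: "real (Suc n) + circle_sq_dist a b t = circle_sq_dist p q t" for t
    unfolding circle_sq_dist_eq pq(3,4) by (simp add: field_simps)
  note m = circle_mean_inverse_square[OF abs_half_diff_less[OF pq(1,2)], folded circle_sq_dist_def]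
  have "((p + q) / 2)\<^sup>2 - ((p - q) / 2)\<^sup>2 = p * q" by (simp add: field_simps power2_eq_square)
  then have v: "(\<integral>t. 1 / circle_sq_dist p q t \<partial>unit_measure) = 1 / (p * q)" using m(2) by simp
  show ?thesis unfolding e p_def[symmetric] q_def[symmetric] v[symmetric]
    by (subst Bochner_Integration.integral_diff[OF m(1)]) (simp_all add: prob_space[unfolded space_unit_measure])
qed

text \<open>The one-parameter formula is integrated over the circle term by term. Both series are dominated uniformly in t
because the parameter stays in a compact interval of positive numbers.\<close>

theorem r2_I0_K0_sum_real:
  assumes ab: "a > 0" "b > 0"
  shows "(\<Sum>n. of_nat (r2 (Suc n)) * (bessel_I 0 (of_real (pi * sqrt (real (Suc n)) * (a - b))) * K0 (of_real (pi * sqrt (real (Suc n)) * (a + b)))))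
    = complex_of_real (1 / (2 * pi * (a * b)) + ln ((a + b) / 2) + (euler_mascheroni + ln (pi / 2) / 2 - dirichlet_beta_deriv_0)
      + 1 / (2 * pi) * (\<Sum>n. real (r2 (Suc n)) * (1 / (sqrt (real (Suc n) + a\<^sup>2) * sqrt (real (Suc n) + b\<^sup>2)) - 1 / real (Suc n))))"
proof -
  interpret prob_space unit_measure by (rule prob_space_unit_measure)
  let ?W = "circle_sq_dist a b"
  let ?C = "euler_mascheroni + ln (pi / 2) / 2 - dirichlet_beta_deriv_0"
  define m where "m = (min a b)\<^sup>2"
  have m: "m > 0" using ab by (auto simp: m_def min_def)
  note Wpos = circle_sq_dist_pos[OF ab] and Wb = circle_sq_dist_bounds[OF ab, folded m_def]
  let ?h = "\<lambda>n t. real (r2 (Suc n)) * K0_real (2 * pi * sqrt (real (Suc n) * ?W t))"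
  let ?g = "\<lambda>n t. real (r2 (Suc n)) * (1 / (real (Suc n) + ?W t) - 1 / real (Suc n))"
  have hm: "?h n \<in> borel_measurable borel" for n
  proof (rule borel_measurable_continuous_onI)
    show "continuous_on UNIV (?h n)"
      by (intro continuous_on_mult continuous_on_const continuous_on_compose2[OF continuous_on_K0_real]
          continuous_on_real_sqrt continuous_circle_sq_dist) (use Wpos in \<open>auto intro!: mult_pos_pos\<close>)
  qed
  have hb: "norm (?h n t) \<le> real (r2 (Suc n)) * K0_real (2 * pi * sqrt (real (Suc n) * m))" for n t
  proof -
    have "K0_real (2 * pi * sqrt (real (Suc n) * ?W t)) \<le> K0_real (2 * pi * sqrt (real (Suc n) * m))"
      using m Wb(1)[of t] by (intro K0_real_antimono mult_left_mono real_sqrt_le_mono mult_pos_pos) auto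
    then show ?thesis using K0_real_nonneg by (simp add: mult_left_mono)
  qed
  have gm: "?g n \<in> borel_measurable borel" for n
  proof (rule borel_measurable_continuous_onI)
    have "real (Suc n) + ?W t \<noteq> 0" for t using Wpos[of t] by linarith
    then show "continuous_on UNIV (?g n)"
      by (intro continuous_intros continuous_circle_sq_dist) auto
  qed
  have gb: "norm (?g n t) \<le> (a\<^sup>2 + b\<^sup>2) * (real (r2 (Suc n)) / (real (Suc n))\<^sup>2)" for n t
    unfolding real_norm_def by (rule order_trans[OF shift_term_bound[OF Wpos]]) (intro mult_right_mono Wb, simp)
  have S: "(\<integral>t. r2_K0_sum (?W t) \<partial>unit_measure) = (\<Sum>n. integral\<^sup>L unit_measure (?h n))"
    unfolding r2_K0_sum_def by (rule integral_unit_suminf(2)[OF hm hb summable_r2_K0_real[OF m]])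
  note G = integral_unit_suminf[OF gm gb summable_mult[OF summable_r2_inverse_square], folded shift_sum_def]
  note M1 = circle_mean_inverse_square[OF abs_half_diff_less[OF ab], folded circle_sq_dist_def]
  note M2 = circle_mean_ln[OF abs_half_diff_less[OF ab], folded circle_sq_dist_def]
  have f: "r2_K0_sum (?W t) = 1 / (2 * pi) * (1 / ?W t) + 1 / 2 * ln (?W t) + ?C + 1 / (2 * pi) * shift_sum (?W t)" for t
    unfolding r2_K0_sum_formula[OF Wpos] by simp
  have i1: "integrable unit_measure (\<lambda>t. 1 / (2 * pi) * (1 / ?W t) + 1 / 2 * ln (?W t))"
    by (intro Bochner_Integration.integrable_add integrable_mult_right M1 M2)
  have i2: "integrable unit_measure (\<lambda>t. 1 / (2 * pi) * (1 / ?W t) + 1 / 2 * ln (?W t) + ?C)"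
    by (intro Bochner_Integration.integrable_add i1) simp
  have i3: "integrable unit_measure (\<lambda>t. 1 / (2 * pi) * shift_sum (?W t))"
    by (intro integrable_mult_right G)
  have "(\<integral>t. r2_K0_sum (?W t) \<partial>unit_measure)
     = 1 / (2 * pi) * (1 / (((a + b) / 2)\<^sup>2 - ((a - b) / 2)\<^sup>2)) + 1 / 2 * (2 * ln ((a + b) / 2)) + ?C
       + 1 / (2 * pi) * (\<Sum>n. integral\<^sup>L unit_measure (?g n))"
    unfolding f Bochner_Integration.integral_add[OF i2 i3] G(2)[symmetric] M1(2)[symmetric] M2(2)[symmetric]
    using M1(1) M2(1) i1 by (simp only: Bochner_Integration.integral_add integrable_mult_right integral_mult_right_zero
        lebesgue_integral_const prob_space finite_measure.integrable_const[OF finite_measure_axioms] scaleR_one)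
  also have "((a + b) / 2)\<^sup>2 - ((a - b) / 2)\<^sup>2 = a * b" by (simp add: field_simps power2_eq_square)
  finally have R': "(\<integral>t. r2_K0_sum (?W t) \<partial>unit_measure)
     = 1 / (2 * pi) * (1 / (a * b)) + 1 / 2 * (2 * ln ((a + b) / 2)) + ?C
       + 1 / (2 * pi) * (\<Sum>n. integral\<^sup>L unit_measure (?g n))" .
  have gv: "integral\<^sup>L unit_measure (?g n) = real (r2 (Suc n)) * (1 / (sqrt (real (Suc n) + a\<^sup>2) * sqrt (real (Suc n) + b\<^sup>2)) - 1 / real (Suc n))" for n
    by (simp only: integral_mult_right_zero circle_mean_shift_term[OF ab])
  have R: "(\<integral>t. r2_K0_sum (?W t) \<partial>unit_measure) = 1 / (2 * pi * (a * b)) + ln ((a + b) / 2) + ?C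
      + 1 / (2 * pi) * (\<Sum>n. real (r2 (Suc n)) * (1 / (sqrt (real (Suc n) + a\<^sup>2) * sqrt (real (Suc n) + b\<^sup>2)) - 1 / real (Suc n)))"
    unfolding R' gv by simp
  have summand: "of_nat (r2 (Suc n)) * (bessel_I 0 (of_real (pi * sqrt (real (Suc n)) * (a - b))) * K0 (of_real (pi * sqrt (real (Suc n)) * (a + b))))
     = complex_of_real (integral\<^sup>L unit_measure (?h n))" for n
    unfolding circle_mean_K0[OF ab, symmetric] by (simp only: integral_mult_right_zero of_real_mult of_real_of_nat_eq)
  have "summable (\<lambda>n. integral\<^sup>L unit_measure (?h n))"
  proof (rule summable_comparison_test[OF _ summable_r2_K0_real[OF m]], intro exI allI impI)
    fix n
    have "norm (integral\<^sup>L unit_measure (?h n)) \<le> (\<integral>t. norm (?h n t) \<partial>unit_measure)" by (rule integral_norm_bound)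
    also have "\<dots> \<le> (\<integral>t. real (r2 (Suc n)) * K0_real (2 * pi * sqrt (real (Suc n) * m)) \<partial>unit_measure)"
      by (rule integral_mono[OF Bochner_Integration.integrable_norm[OF integrable_unit_measure_bounded[OF hm hb]] _ hb]) simp
    finally show "norm (integral\<^sup>L unit_measure (?h n)) \<le> real (r2 (Suc n)) * K0_real (2 * pi * sqrt (real (Suc n) * m))"
      by (simp add: prob_space[unfolded space_unit_measure] del: of_nat_Suc)
  qed
  then show ?thesis unfolding summand suminf_of_real[symmetric] S[symmetric] R[symmetric] by (simp only: suminf_of_real S)
qed

section \<open>Analytic continuation in the parameters\<close>

text \<open>In terms of the square roots a, b of the two parameters, so that the domain is the product of two right
half-planes.\<close>

definition bessel_term :: "complex \<Rightarrow> complex \<Rightarrow> nat \<Rightarrow> complex" where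
  "bessel_term a b n = of_nat (r2 n) * (bessel_I 0 (of_real (pi * sqrt (real n)) * (a - b)) * K0 (of_real (pi * sqrt (real n)) * (a + b)))"

definition root_term :: "complex \<Rightarrow> complex \<Rightarrow> nat \<Rightarrow> complex" where
  "root_term a b n = of_nat (r2 n) * (1 / (csqrt (of_nat n + a\<^sup>2) * csqrt (of_nat n + b\<^sup>2)) - 1 / of_nat n)"

text \<open>I0 grows at most like exp(pi sqrt n |Re a - Re b|) and K0 decays like exp(-pi sqrt n (Re a + Re b)); the
difference of the exponents is -2 pi sqrt n min(Re a, Re b).\<close>

lemma bessel_term_bound:
  assumes \<delta>: "\<delta> > 0"
  shows "\<exists>C\<ge>0. \<forall>a b n. Re a \<ge> \<delta> \<and> Re b \<ge> \<delta> \<longrightarrow>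
    norm (bessel_term a b (Suc n)) \<le> C * (real (r2 (Suc n)) * exp (- (2 * pi * \<delta>) * sqrt (real (Suc n))))"
proof -
  have "2 * pi * \<delta> > 0" using \<delta> by simp
  then obtain C where C: "C \<ge> 0" "\<And>z. Re z \<ge> 2 * pi * \<delta> \<Longrightarrow> norm (K0 z) \<le> C * exp (- Re z)" by (rule K0_bound) blast
  have "norm (bessel_term a b (Suc n)) \<le> C * (real (r2 (Suc n)) * exp (- (2 * pi * \<delta>) * sqrt (real (Suc n))))"
    if ab: "Re a \<ge> \<delta>" "Re b \<ge> \<delta>" for a b n
  proof -
    define s where "s = pi * sqrt (real (Suc n))"
    have s: "s \<ge> pi" by (simp add: s_def)
    then have s0: "s > 0" using pi_gt_zero by linarith
    have "pi * (2 * \<delta>) \<le> s * (Re a + Re b)" using s s0 \<delta> ab by (intro mult_mono) auto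
    then have K: "norm (K0 (of_real s * (a + b))) \<le> C * exp (- (s * (Re a + Re b)))"
      using C(2)[of "of_real s * (a + b)"] by (simp add: mult_ac)
    have I: "norm (bessel_I 0 (of_real s * (a - b))) \<le> exp (s * \<bar>Re a - Re b\<bar>)"
      using norm_bessel_I_0_le[of "of_real s * (a - b)"] s0 by (simp add: abs_mult)
    have "\<bar>Re a - Re b\<bar> - (Re a + Re b) \<le> - (2 * \<delta>)" using ab by (auto simp: abs_if)
    from mult_left_mono[OF this, of s] have e: "s * \<bar>Re a - Re b\<bar> + - (s * (Re a + Re b)) \<le> - (2 * pi * \<delta>) * sqrt (real (Suc n))"
      using s0 by (simp add: s_def algebra_simps)
    have "norm (bessel_I 0 (of_real s * (a - b)) * K0 (of_real s * (a + b))) \<le> exp (s * \<bar>Re a - Re b\<bar>) * (C * exp (- (s * (Re a + Re b))))"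
      unfolding norm_mult by (intro mult_mono I K) auto
    also have "\<dots> = C * exp (s * \<bar>Re a - Re b\<bar> + - (s * (Re a + Re b)))" by (simp only: exp_add) simp
    also have "\<dots> \<le> C * exp (- (2 * pi * \<delta>) * sqrt (real (Suc n)))" using e C(1) by (intro mult_left_mono) auto
    finally have "real (r2 (Suc n)) * norm (bessel_I 0 (of_real s * (a - b)) * K0 (of_real s * (a + b)))
       \<le> real (r2 (Suc n)) * (C * exp (- (2 * pi * \<delta>) * sqrt (real (Suc n))))" by (intro mult_left_mono) auto
    then show ?thesis unfolding bessel_term_def s_def[symmetric] norm_mult[of "of_nat _"] by (simp add: mult_ac)
  qed
  then show ?thesis using C(1) by blast
qed

text \<open>For n large against |a|^2, the square root of n + a^2 differs from sqrt n by at most |a|^2 / sqrt n, because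
the real part of a principal square root is nonnegative.\<close>

lemma root_term_bound:
  assumes R: "norm (a\<^sup>2) \<le> R" "norm (b\<^sup>2) \<le> R" and n: "real n \<ge> 2 * R" "n \<ge> 1"
  shows "norm (root_term a b n) \<le> 6 * R * (real (r2 n) / (real n)\<^sup>2)"
proof -
  define s u v where "s = sqrt (real n)" and "u = csqrt (of_nat n + a\<^sup>2)" and "v = csqrt (of_nat n + b\<^sup>2)"
  have s: "s > 0" "s\<^sup>2 = real n" using n by (auto simp: s_def)
  have R0: "R \<ge> 0" using R(1) norm_ge_zero order_trans by blast
  \<comment> \<open>the estimates for one square root, applied to z = a^2 and z = b^2\<close>
  have close: "norm (of_real s - csqrt (of_nat n + z)) \<le> R / s \<and> norm (csqrt (of_nat n + z)) \<le> 2 * s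
      \<and> norm (csqrt (of_nat n + z)) \<ge> s / sqrt 2" if z: "norm z \<le> R" for z
  proof -
    define w where "w = csqrt (of_nat n + z)"
    have w: "w\<^sup>2 = of_nat n + z" "Re w \<ge> 0" "norm w = sqrt (norm (of_nat n + z))"
      unfolding w_def by (rule power2_csqrt Re_csqrt norm_csqrt)+
    have "s \<le> Re (of_real s + w)" using w by simp
    also have "\<dots> \<le> norm (of_real s + w)" by (rule complex_Re_le_cmod)
    finally have sp: "s \<le> norm (of_real s + w)" .
    have "complex_of_real s ^ 2 = of_nat n" unfolding of_real_power[symmetric] s(2) by simp
    then have "(of_real s - w) * (of_real s + w) = - z" using w(1) by (simp add: algebra_simps power2_eq_square)
    then have "norm (of_real s - w) * norm (of_real s + w) = norm z" by (metis norm_minus_cancel norm_mult)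
    moreover have "norm (of_real s - w) * s \<le> norm (of_real s - w) * norm (of_real s + w)" by (intro mult_left_mono sp) simp
    ultimately have "norm (of_real s - w) * s \<le> R" using z by linarith
    then have 1: "norm (of_real s - w) \<le> R / s" using s by (simp add: pos_le_divide_eq)
    have "norm (of_nat n + z) \<le> real n + R" using norm_triangle_ineq[of "of_nat n" z] z by simp
    also have "\<dots> \<le> 4 * real n" using n R0 by linarith
    finally have "sqrt (norm (of_nat n + z)) \<le> sqrt (4 * real n)" by (rule real_sqrt_le_mono)
    then have 2: "norm w \<le> 2 * s" unfolding w(3) s_def by (simp add: real_sqrt_mult)
    have "real n - R \<le> norm (of_nat n + z)" using norm_diff_ineq[of "of_nat n" z] z by simp
    then have "real n / 2 \<le> norm (of_nat n + z)" using n by linarith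
    then have "sqrt (real n / 2) \<le> norm w" unfolding w(3) by (rule real_sqrt_le_mono)
    then have 3: "s / sqrt 2 \<le> norm w" by (simp add: s_def real_sqrt_divide)
    show ?thesis using 1 2 3 by (simp add: w_def)
  qed
  note u = close[OF R(1), folded u_def] and v = close[OF R(2), folded v_def]
  have "s / sqrt 2 * (s / sqrt 2) \<le> norm u * norm v" using u v s by (intro mult_mono) auto
  then have uv: "real n / 2 \<le> norm (u * v)" unfolding norm_mult s(2)[symmetric] by (simp add: power2_eq_square)
  have npos: "real n > 0" using n by simp
  then have nz: "u * v \<noteq> 0" "complex_of_nat n \<noteq> 0" using uv by auto
  have "of_nat n - u * v = of_real s * (of_real s - v) + v * (of_real s - u)"
  proof -
    have "complex_of_real (s * s) = of_nat n" using s(2) by (simp only: power2_eq_square of_real_of_nat_eq)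
    then have "complex_of_real s * of_real s = of_nat n" by (simp only: of_real_mult)
    then show ?thesis by (simp add: algebra_simps)
  qed
  then have "norm (of_nat n - u * v) \<le> s * norm (of_real s - v) + norm v * norm (of_real s - u)"
    using norm_triangle_ineq[of "of_real s * (of_real s - v)" "v * (of_real s - u)"] s by (simp add: norm_mult)
  also have "\<dots> \<le> s * (R / s) + 2 * s * (R / s)" using u v s by (intro add_mono mult_mono) auto
  also have "\<dots> = 3 * R" using s by simp
  finally have num: "norm (of_nat n - u * v) \<le> 3 * R" .
  have "1 / (u * v) - 1 / of_nat n = (of_nat n - u * v) / (u * v * of_nat n)" using nz by (simp add: field_simps)
  then have "norm (1 / (u * v) - 1 / of_nat n) = norm (of_nat n - u * v) / (norm (u * v) * real n)" by (simp add: norm_divide norm_mult)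
  also have "\<dots> \<le> 3 * R / (real n / 2 * real n)"
    using num uv npos R0 by (intro frac_le mult_right_mono) auto
  also have "\<dots> = 6 * R / (real n)\<^sup>2" by (simp add: power2_eq_square)
  finally have "real (r2 n) * norm (1 / (u * v) - 1 / of_nat n) \<le> real (r2 n) * (6 * R / (real n)\<^sup>2)" by (intro mult_left_mono) auto
  then show ?thesis unfolding root_term_def u_def[symmetric] v_def[symmetric] norm_mult[of "of_nat _"] by (simp add: mult_ac)
qed

lemma bessel_term_commute: "bessel_term a b n = bessel_term b a n"
  using bessel_I_0_minus[of "of_real (pi * sqrt (real n)) * (a - b)"] by (simp add: bessel_term_def add.commute algebra_simps)

lemma root_term_commute: "root_term a b n = root_term b a n"
  by (simp add: root_term_def mult.commute)

text \<open>The Weierstrass test on neighbourhoods of the points of an open set; the domination may fail for finitely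
many terms.\<close>

lemma holomorphic_suminf_locally_dominated:
  fixes f :: "nat \<Rightarrow> complex \<Rightarrow> complex"
  assumes S: "open S" and f: "\<And>n. f n holomorphic_on S"
    and M: "\<And>x. x \<in> S \<Longrightarrow> \<exists>d>0. \<exists>M. summable M \<and> (\<forall>\<^sub>F n in sequentially. \<forall>y\<in>ball x d \<inter> S. norm (f n y) \<le> M n)"
  shows "(\<lambda>x. \<Sum>n. f n x) holomorphic_on S" and "x \<in> S \<Longrightarrow> summable (\<lambda>n. f n x)"
proof -
  have fd: "f n field_differentiable (at x)" if "x \<in> S" for n x
    by (rule holomorphic_on_imp_differentiable_at[OF f S that])
  have dominated: "\<exists>d h. 0 < d \<and> summable h \<and> range h \<subseteq> \<real>\<^sub>\<ge>\<^sub>0 \<and> (\<forall>\<^sub>F n in sequentially. \<forall>y\<in>ball x d \<inter> S. cmod (f n y) \<le> cmod (h n))" if x: "x \<in> S" for x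
  proof -
    obtain d M where d: "d > 0" and M: "summable M" "\<forall>\<^sub>F n in sequentially. \<forall>y\<in>ball x d \<inter> S. norm (f n y) \<le> M n"
      using M[OF x] by blast
    have ev: "\<forall>\<^sub>F n in sequentially. norm (M n) = M n"
    proof (rule eventually_mono[OF M(2)])
      fix n assume "\<forall>y\<in>ball x d \<inter> S. norm (f n y) \<le> M n"
      then have "norm (f n x) \<le> M n" using x d by simp
      then show "norm (M n) = M n" using norm_ge_zero[of "f n x"] unfolding real_norm_def by linarith
    qed
    then have "summable (\<lambda>n. norm (M n)) \<longleftrightarrow> summable M" by (rule summable_cong)
    then have "summable (\<lambda>n. norm (M n))" using M(1) by blast
    then have "summable (\<lambda>n. complex_of_real (norm (M n)))" by (rule summable_of_real)
    moreover have "range (\<lambda>n. complex_of_real (norm (M n))) \<subseteq> \<real>\<^sub>\<ge>\<^sub>0" by auto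
    moreover have "\<forall>\<^sub>F n in sequentially. \<forall>y\<in>ball x d \<inter> S. cmod (f n y) \<le> cmod (complex_of_real (norm (M n)))"
      using M(2) by (rule eventually_mono) (auto intro: order_trans)
    ultimately show ?thesis using d by blast
  qed
  obtain g where g: "\<forall>x \<in> S. ((\<lambda>n. f n x) sums g x) \<and> g field_differentiable (at x)"
    using series_differentiable_comparison_complex[OF S fd dominated] by blast
  then have "g holomorphic_on S" by (auto simp: holomorphic_on_def intro: field_differentiable_at_within)
  then show "(\<lambda>x. \<Sum>n. f n x) holomorphic_on S"
    by (rule holomorphic_transform) (use g in \<open>auto simp: sums_iff\<close>)
  show "x \<in> S \<Longrightarrow> summable (\<lambda>n. f n x)" using g by (auto simp: sums_iff)
qed

text \<open>The neighbourhoods used for the Weierstrass test in the half-plane.\<close>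

lemma ball_half_Re:
  assumes "y \<in> ball x (Re x / 2)"
  shows "Re y \<ge> Re x / 2" "norm y \<le> norm x + Re x / 2"
proof -
  have d: "norm (x - y) < Re x / 2" using assms by (simp add: dist_norm)
  have "Re (x - y) \<le> norm (x - y)" by (rule complex_Re_le_cmod)
  then show "Re y \<ge> Re x / 2" using d by simp
  have "norm y \<le> norm x + norm (x - y)" using norm_triangle_sub[of y x] by (simp add: norm_minus_commute)
  then show "norm y \<le> norm x + Re x / 2" using d by linarith
qed

text \<open>A square of a number with positive real part is never a nonpositive real, and adding n does not change
the imaginary part; so the principal square root is holomorphic there.\<close>

lemma square_right_half_plane:
  assumes "Re a > 0"
  shows "of_nat n + a\<^sup>2 \<notin> \<real>\<^sub>\<le>\<^sub>0"
proof
  assume "of_nat n + a\<^sup>2 \<in> \<real>\<^sub>\<le>\<^sub>0"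
  then have "Re (of_nat n + a\<^sup>2) \<le> 0" "Im (of_nat n + a\<^sup>2) = 0" by (auto simp: complex_nonpos_Reals_iff)
  then have "real n + (Re a)\<^sup>2 - (Im a)\<^sup>2 \<le> 0" "Re a * Im a = 0" by (auto simp: Re_power2 Im_power2)
  moreover have "Im a = 0" using assms \<open>Re a * Im a = 0\<close> by simp
  moreover have "(Re a)\<^sup>2 > 0" using assms by simp
  ultimately show False by simp
qed

lemma holomorphic_bessel_series:
  assumes b: "Re b > 0"
  shows "(\<lambda>a. \<Sum>n. bessel_term a b (Suc n)) holomorphic_on {a. Re a > 0}"
    and "Re a > 0 \<Longrightarrow> summable (\<lambda>n. bessel_term a b (Suc n))"
proof -
  have h: "(\<lambda>a. bessel_term a b (Suc n)) holomorphic_on {a. Re a > 0}" for n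
  proof -
    have i: "bessel_I 0 \<circ> (\<lambda>a. of_real (pi * sqrt (real (Suc n))) * (a - b)) holomorphic_on {a. Re a > 0}"
      by (intro holomorphic_on_compose_gen[OF _ holomorphic_bessel_I_0] holomorphic_intros) auto
    have k: "K0 \<circ> (\<lambda>a. of_real (pi * sqrt (real (Suc n))) * (a + b)) holomorphic_on {a. Re a > 0}"
      by (intro holomorphic_on_compose_gen[OF _ holomorphic_K0] holomorphic_intros)
        (use b in \<open>auto simp del: of_nat_Suc intro!: mult_pos_pos add_pos_pos\<close>)
    show ?thesis unfolding bessel_term_def using i k unfolding o_def by (intro holomorphic_on_mult holomorphic_on_const)
  qed
  have dom: "\<exists>d>0. \<exists>M. summable M \<and> (\<forall>\<^sub>F n in sequentially. \<forall>y\<in>ball x d \<inter> {a. Re a > 0}. norm (bessel_term y b (Suc n)) \<le> M n)"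
    if x: "x \<in> {a. Re a > 0}" for x
  proof -
    define \<delta> where "\<delta> = min (Re x / 2) (Re b)"
    have \<delta>: "\<delta> > 0" using x b by (auto simp: \<delta>_def)
    obtain C where C: "\<And>a b n. Re a \<ge> \<delta> \<and> Re b \<ge> \<delta> \<Longrightarrow>
        norm (bessel_term a b (Suc n)) \<le> C * (real (r2 (Suc n)) * exp (- (2 * pi * \<delta>) * sqrt (real (Suc n))))"
      using bessel_term_bound[OF \<delta>] by blast
    have s: "summable (\<lambda>n. C * (real (r2 (Suc n)) * exp (- (2 * pi * \<delta>) * sqrt (real (Suc n)))))"
      by (intro summable_mult summable_r2_exp_sqrt) (use \<delta> in simp)
    have "norm (bessel_term y b (Suc n)) \<le> C * (real (r2 (Suc n)) * exp (- (2 * pi * \<delta>) * sqrt (real (Suc n))))"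
      if "y \<in> ball x (Re x / 2) \<inter> {a. Re a > 0}" for y n
      using ball_half_Re(1)[of y x] that by (intro C) (auto simp: \<delta>_def)
    then have "\<forall>\<^sub>F n in sequentially. \<forall>y\<in>ball x (Re x / 2) \<inter> {a. Re a > 0}.
        norm (bessel_term y b (Suc n)) \<le> C * (real (r2 (Suc n)) * exp (- (2 * pi * \<delta>) * sqrt (real (Suc n))))"
      by (intro always_eventually allI ballI)
    moreover have "Re x / 2 > 0" using x by simp
    ultimately show ?thesis using s by blast
  qed
  note H = holomorphic_suminf_locally_dominated[OF open_halfspace_Re_gt h dom]
  show "(\<lambda>a. \<Sum>n. bessel_term a b (Suc n)) holomorphic_on {a. Re a > 0}" by (rule H(1))
  show "Re a > 0 \<Longrightarrow> summable (\<lambda>n. bessel_term a b (Suc n))" using H(2)[of a] by simp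
qed

lemma holomorphic_root_series:
  assumes b: "Re b > 0"
  shows "(\<lambda>a. \<Sum>n. root_term a b (Suc n)) holomorphic_on {a. Re a > 0}"
    and "Re a > 0 \<Longrightarrow> summable (\<lambda>n. root_term a b (Suc n))"
proof -
  have nz: "csqrt (of_nat n + a\<^sup>2) \<noteq> 0" if "Re a > 0" for a n
    using square_right_half_plane[OF that, of n] by auto
  have h: "(\<lambda>a. root_term a b (Suc n)) holomorphic_on {a. Re a > 0}" for n
    unfolding root_term_def
    by (intro holomorphic_on_mult holomorphic_on_diff holomorphic_on_divide holomorphic_on_const holomorphic_on_csqrt'
        holomorphic_on_add holomorphic_on_power holomorphic_on_id[unfolded id_def])
      (use nz[OF b] nz square_right_half_plane in \<open>auto simp del: of_nat_Suc csqrt_eq_0\<close>)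
  have dom: "\<exists>d>0. \<exists>M. summable M \<and> (\<forall>\<^sub>F n in sequentially. \<forall>y\<in>ball x d \<inter> {a. Re a > 0}. norm (root_term y b (Suc n)) \<le> M n)"
    if x: "x \<in> {a. Re a > 0}" for x
  proof -
    define R where "R = (norm x + Re x / 2)\<^sup>2 + (norm b)\<^sup>2"
    have bnd: "norm (root_term y b (Suc n)) \<le> 6 * R * (real (r2 (Suc n)) / (real (Suc n))\<^sup>2)"
      if y: "y \<in> ball x (Re x / 2) \<inter> {a. Re a > 0}" and n: "n \<ge> nat \<lceil>2 * R\<rceil>" for y n
    proof (rule root_term_bound)
      have "(norm y)\<^sup>2 \<le> (norm x + Re x / 2)\<^sup>2" using ball_half_Re(2)[of y x] y by (intro power_mono) auto
      then show "norm (y\<^sup>2) \<le> R" by (simp add: R_def norm_power add_increasing2)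
      show "norm (b\<^sup>2) \<le> R" by (simp add: R_def norm_power)
      show "2 * R \<le> real (Suc n)" using n by linarith
    qed simp
    have s: "summable (\<lambda>n. 6 * R * (real (r2 (Suc n)) / (real (Suc n))\<^sup>2))"
      by (intro summable_mult summable_r2_inverse_square)
    show ?thesis
    proof (intro exI[of _ "Re x / 2"] conjI exI)
      show "\<forall>\<^sub>F n in sequentially. \<forall>y\<in>ball x (Re x / 2) \<inter> {a. Re a > 0}. norm (root_term y b (Suc n)) \<le> 6 * R * (real (r2 (Suc n)) / (real (Suc n))\<^sup>2)"
        using eventually_ge_at_top[of "nat \<lceil>2 * R\<rceil>"] by (rule eventually_mono) (use bnd in blast)
    qed (use s x in auto)
  qed
  note H = holomorphic_suminf_locally_dominated[OF open_halfspace_Re_gt h dom]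
  show "(\<lambda>a. \<Sum>n. root_term a b (Suc n)) holomorphic_on {a. Re a > 0}" by (rule H(1))
  show "Re a > 0 \<Longrightarrow> summable (\<lambda>n. root_term a b (Suc n))" using H(2)[of a] by simp
qed

definition bessel_side :: "complex \<Rightarrow> complex \<Rightarrow> complex" where
  "bessel_side a b = (\<Sum>n. bessel_term a b (Suc n))"

definition root_side :: "complex \<Rightarrow> complex \<Rightarrow> complex" where
  "root_side a b = 1 / (2 * of_real pi * (a * b)) + Ln ((a + b) / 2)
    + of_real (euler_mascheroni + ln (pi / 2) / 2 - dirichlet_beta_deriv_0)
    + 1 / (2 * of_real pi) * (\<Sum>n. root_term a b (Suc n))"

lemma sides_commute: "bessel_side a b = bessel_side b a" "root_side a b = root_side b a"
  by (simp_all only: bessel_side_def root_side_def bessel_term_commute[of a b] root_term_commute[of a b] mult.commute[of a b] add.commute[of a b])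

lemma holomorphic_bessel_side:
  assumes "Re b > 0"
  shows "(\<lambda>a. bessel_side a b) holomorphic_on {a. Re a > 0}"
  unfolding bessel_side_def by (rule holomorphic_bessel_series[OF assms])

lemma holomorphic_root_side:
  assumes b: "Re b > 0"
  shows "(\<lambda>a. root_side a b) holomorphic_on {a. Re a > 0}"
proof -
  have "(a + b) / 2 \<notin> \<real>\<^sub>\<le>\<^sub>0" if "Re a > 0" for a
    using that b by (auto simp: complex_nonpos_Reals_iff)
  moreover have "2 * of_real pi * (a * b) \<noteq> 0" if "Re a > 0" for a
    using that b by auto
  ultimately show ?thesis
    unfolding root_side_def
    by (intro holomorphic_on_add holomorphic_on_mult holomorphic_on_divide holomorphic_on_const holomorphic_on_Ln'
        holomorphic_root_series[OF b] holomorphic_on_id[unfolded id_def]) auto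
qed

lemma sides_eq_real:
  assumes ab: "a > 0" "b > 0"
  shows "bessel_side (of_real a) (of_real b) = root_side (of_real a) (of_real b)"
proof -
  let ?R = "\<lambda>n. real (r2 (Suc n)) * (1 / (sqrt (real (Suc n) + a\<^sup>2) * sqrt (real (Suc n) + b\<^sup>2)) - 1 / real (Suc n))"
  have root: "csqrt (of_nat n + (of_real x)\<^sup>2) = of_real (sqrt (real n + x\<^sup>2))" for n x
    by (subst of_real_sqrt) simp_all
  have R: "root_term (of_real a) (of_real b) (Suc n) = of_real (?R n)" for n
    unfolding root_term_def root by (simp del: of_nat_Suc)
  have "summable (\<lambda>n. root_term (of_real a) (of_real b) (Suc n))" by (rule holomorphic_root_series(2)) (use ab in auto)
  then have "summable (\<lambda>n. complex_of_real (?R n))" unfolding R .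
  then have "summable ?R" by (simp only: summable_complex_of_real)
  then have RS: "(\<Sum>n. root_term (of_real a) (of_real b) (Suc n)) = of_real (\<Sum>n. ?R n)"
    unfolding R by (rule suminf_of_real[symmetric])
  have L: "Ln ((of_real a + of_real b) / 2) = of_real (ln ((a + b) / 2))"
    using Ln_of_real[of "(a + b) / 2"] ab by simp
  have "bessel_side (of_real a) (of_real b) = complex_of_real (1 / (2 * pi * (a * b)) + ln ((a + b) / 2) + (euler_mascheroni + ln (pi / 2) / 2 - dirichlet_beta_deriv_0)
      + 1 / (2 * pi) * (\<Sum>n. ?R n))"
    using r2_I0_K0_sum_real[OF ab] unfolding bessel_side_def bessel_term_def by (simp only: of_real_mult of_real_diff of_real_add)
  also have "\<dots> = root_side (of_real a) (of_real b)"
    unfolding root_side_def RS L by simp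
  finally show ?thesis .
qed

text \<open>First a is continued from the positive reals for fixed real b, then b for fixed complex a. The symmetry
of both sides lets the same holomorphy statement serve both steps.\<close>

theorem sides_eq:
  assumes a: "Re a > 0" and b: "Re b > 0"
  shows "bessel_side a b = root_side a b"
proof -
  have real_b: "bessel_side z (of_real y) = root_side z (of_real y)" if "Re z > 0" "y > 0" for z y
    by (rule eq_on_right_half_plane[where f = "\<lambda>a. bessel_side a (of_real y)" and g = "\<lambda>a. root_side a (of_real y)",
          OF holomorphic_bessel_side holomorphic_root_side zero_less_one sides_eq_real that(1)]) (use that in auto)
  have "bessel_side b a = root_side b a"
    by (rule eq_on_right_half_plane[where f = "\<lambda>b. bessel_side b a" and g = "\<lambda>b. root_side b a",
          OF holomorphic_bessel_side[OF a] holomorphic_root_side[OF a] zero_less_one _ b])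
      (use real_b[OF a] in \<open>simp only: sides_commute[of _ a]\<close>)
  then show ?thesis by (simp only: sides_commute[of b a])
qed

lemma csqrt_of_nat_mult: "csqrt (of_nat n * z) = of_real (sqrt (real n)) * csqrt z"
proof (cases "n = 0")
  case False
  have "complex_of_real (sqrt (real n)) ^ 2 = of_nat n" by (simp only: of_real_power[symmetric] real_sqrt_pow2 of_nat_0_le_iff of_real_of_nat_eq)
  then show ?thesis
    using False csqrt_principal[of z] by (intro csqrt_unique) (auto simp: power_mult_distrib)
qed simp

text \<open>With a and b the principal square roots of the parameters, sqrt(n \<alpha>) = sqrt n a since n is a nonnegative
real, and \<alpha> = a^2, so the two series are those of the continued identity.\<close>

theorem theorem5p1:
  fixes \<alpha> \<beta> :: complex
  assumes "Re (csqrt \<alpha>) \<ge> Re (csqrt \<beta>)" and "Re (csqrt \<beta>) > 0"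
  shows
    "let S = (\<lambda>n::nat. of_nat (r2 n) *
           bessel_I 0 (of_real pi * (csqrt (of_nat n * \<alpha>) - csqrt (of_nat n * \<beta>))) *
           bessel_K 0 (of_real pi * (csqrt (of_nat n * \<alpha>) + csqrt (of_nat n * \<beta>))));
         T = (\<lambda>n::nat. of_nat (r2 n) *
           (1 / ((of_nat n + \<alpha>) powr (1 / 2) * (of_nat n + \<beta>) powr (1 / 2)) - 1 / of_nat n))
     in summable (\<lambda>n. S (Suc n)) \<and> summable (\<lambda>n. T (Suc n)) \<and>
        (\<Sum>n. S (Suc n)) =
          1 / (2 * of_real pi * (csqrt \<alpha> * csqrt \<beta>)) + euler_mascheroni
          + Ln ((csqrt \<alpha> + csqrt \<beta>) / 2) + 1 / 2 * of_real (ln (pi / 2))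
          - deriv dirichlet_beta 0
          + 1 / (2 * of_real pi) * (\<Sum>n. T (Suc n))"
proof -
  define a b where "a = csqrt \<alpha>" and "b = csqrt \<beta>"
  have ab: "Re a > 0" "Re b > 0" using assms by (auto simp: a_def b_def)
  have S: "of_nat (r2 (Suc n)) * bessel_I 0 (of_real pi * (csqrt (of_nat (Suc n) * \<alpha>) - csqrt (of_nat (Suc n) * \<beta>))) *
      bessel_K 0 (of_real pi * (csqrt (of_nat (Suc n) * \<alpha>) + csqrt (of_nat (Suc n) * \<beta>))) = bessel_term a b (Suc n)" for n
  proof -
    define s where "s = sqrt (real (Suc n))"
    have "s > 0" by (simp add: s_def)
    then have "Re (of_real pi * (of_real s * a + of_real s * b)) > 0" using ab by (simp add: add_pos_pos)
    note K = bessel_K_0_eq_K0[OF this]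
    show ?thesis
      unfolding csqrt_of_nat_mult a_def[symmetric] b_def[symmetric] s_def[symmetric] K bessel_term_def
      by (simp add: algebra_simps)
  qed
  have T: "of_nat (r2 (Suc n)) * (1 / ((of_nat (Suc n) + \<alpha>) powr (1 / 2) * (of_nat (Suc n) + \<beta>) powr (1 / 2)) - 1 / of_nat (Suc n))
      = root_term a b (Suc n)" for n
    unfolding root_term_def a_def b_def csqrt_conv_powr[symmetric] power2_csqrt ..
  have D: "euler_mascheroni + Ln ((a + b) / 2) + 1 / 2 * of_real (ln (pi / 2)) - deriv dirichlet_beta 0
      = Ln ((a + b) / 2) + of_real (euler_mascheroni + ln (pi / 2) / 2 - dirichlet_beta_deriv_0)"
    unfolding deriv_dirichlet_beta_0 dirichlet_beta_deriv_0_def[symmetric] by simp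
  have "(\<Sum>n. bessel_term a b (Suc n)) = 1 / (2 * of_real pi * (a * b)) + euler_mascheroni
          + Ln ((a + b) / 2) + 1 / 2 * of_real (ln (pi / 2)) - deriv dirichlet_beta 0
          + 1 / (2 * of_real pi) * (\<Sum>n. root_term a b (Suc n))"
    using sides_eq[OF ab] D unfolding bessel_side_def root_side_def by (simp add: algebra_simps)
  then show ?thesis
    unfolding Let_def S T a_def[symmetric] b_def[symmetric]
    using holomorphic_bessel_series(2)[OF ab(2,1)] holomorphic_root_series(2)[OF ab(2,1)] by blast
qed

end
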